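(* Let $m,\vec b,f$ satisfy the assumption in the context and let $\varrho_\infty^{(0)}$ be a given initial density. There is at most one weak solution $(\varrho,p)$ of the Hele-Shaw density equation with initial data $\varrho(\cdot,0)=\varrho_\infty^{(0)}$ in the regularity class $$L^\infty((0,T);L^1(\mathbb{R}^d)\cap L^\infty(\mathbb{R}^d))\times L^2([0,T];H^1(\mathbb{R}^d)\cap L^\infty(\mathbb{R}^d))$$ with compact support.
   Context: Fix $d\ge 1$, $T>0$, and let $Q_T=\mathbb{R}^d\times(0,T)$. The operators $\nabla$, $\nabla\cdot$ act in the space variables only. Assumption: $m,f:Q_T\to\mathbb{R}$ and $\vec b:Q_T\to\mathbb{R}^d$ are in $C^\infty(Q_T)$ with bounded derivatives of all orders (order zero included), and there is $\delta>0$ with $m(x,t)\ge\delta$. A pair $(\varrho,p)$ with $p\ge 0$ is a weak solution of the Hele-Shaw density equation $\partial_t\varrho=\nabla\cdot(m\nabla p+\varrho\vec b)+f\varrho$ with initial data $\varrho^{(0)}$ if for all $\varphi\in C_c^\infty(\mathbb{R}^d\times[0,T))$ $$-\int_{\mathbb{R}^d}\varphi(x,0)\varrho^{(0)}(x)\,dx-\iint_{Q_T}\varrho\,\partial_t\varphi=\iint_{Q_T}-\nabla\varphi\cdot(m\nabla p+\varrho\vec b)+f\varphi\varrho,$$ and $\varrho\le m$, $p(m-\varrho)=0$ a.e. in $Q_T$. "With compact support" means that $\varrho$ and $p$ vanish a.e. outside $K\times[0,T]$ for some compact $K\subset\mathbb{R}^d$. *)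

theory Defs
  imports "HOL-Analysis.Analysis" "HOL-Probability.Essential_Supremum"
begin

text \<open>Points of space-time are pairs \<open>(x, t)\<close>. All function spaces below consist of
  functions that represent classes modulo Lebesgue null sets.\<close>

definition cyl :: "real \<Rightarrow> ('a::euclidean_space \<times> real) set" where
  "cyl T = UNIV \<times> {0<..<T}"

definition slice :: "('a \<times> real \<Rightarrow> 'b) \<Rightarrow> real \<Rightarrow> 'a \<Rightarrow> 'b" where
  "slice u t = (\<lambda>x. u (x, t))"


section \<open>Smooth functions and test functions\<close>

fun iter_deriv :: "'a::euclidean_space list \<Rightarrow> ('a \<Rightarrow> 'b::real_normed_vector) \<Rightarrow> 'a \<Rightarrow> 'b" where
  "iter_deriv [] f = f"
| "iter_deriv (v # vs) f = (\<lambda>x. frechet_derivative (iter_deriv vs f) (at x) v)"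

text \<open>On an open set \<open>S\<close> this is the usual \<open>C\<^sup>\<infinity>(S)\<close>: iterated partial derivatives of all
  orders exist and are (differentiable, hence) continuous.\<close>

definition smooth_on :: "'a::euclidean_space set \<Rightarrow> ('a \<Rightarrow> 'b::real_normed_vector) \<Rightarrow> bool" where
  "smooth_on S f \<longleftrightarrow> (\<forall>vs \<in> lists Basis. \<forall>x\<in>S. iter_deriv vs f differentiable (at x))"

text \<open>The empty list of directions gives the bound on the function itself.\<close>

definition smooth_bounded_on :: "'a::euclidean_space set \<Rightarrow> ('a \<Rightarrow> 'b::real_normed_vector) \<Rightarrow> bool" where
  "smooth_bounded_on S f \<longleftrightarrow>
     smooth_on S f \<and> (\<forall>vs \<in> lists Basis. bounded (iter_deriv vs f ` S))"

text \<open>Elements of \<open>C\<^sub>c\<^sup>\<infinity>(U)\<close>, \<open>U\<close> open, extended by zero to the whole space. A test function on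
  the set \<open>\<real>\<^sup>d \<times> [0,T)\<close>, which need not vanish at time \<open>0\<close>, is as usual the restriction
  of a member of \<open>C\<^sub>c\<^sup>\<infinity>(\<real>\<^sup>d \<times> (-\<infinity>,T))\<close>.\<close>

definition test_function :: "'a::euclidean_space set \<Rightarrow> ('a \<Rightarrow> real) \<Rightarrow> bool" where
  "test_function U \<phi> \<longleftrightarrow>
     smooth_on UNIV \<phi> \<and> (\<exists>K. compact K \<and> K \<subseteq> U \<and> (\<forall>x. x \<notin> K \<longrightarrow> \<phi> x = 0))"

definition time_deriv :: "('a::euclidean_space \<times> real \<Rightarrow> real) \<Rightarrow> 'a \<times> real \<Rightarrow> real" where
  "time_deriv \<phi> z = frechet_derivative \<phi> (at z) (0, 1)"

definition space_grad :: "('a::euclidean_space \<times> real \<Rightarrow> real) \<Rightarrow> 'a \<times> real \<Rightarrow> 'a" where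
  "space_grad \<phi> z = (\<Sum>i\<in>Basis. frechet_derivative \<phi> (at z) (i, 0) *\<^sub>R i)"


section \<open>Weak gradients and function spaces\<close>

definition locally_integrable :: "('a::euclidean_space \<Rightarrow> 'b::euclidean_space) \<Rightarrow> bool" where
  "locally_integrable u \<longleftrightarrow> (\<forall>K. compact K \<longrightarrow> u absolutely_integrable_on K)"

definition has_weak_gradient :: "('a::euclidean_space \<Rightarrow> real) \<Rightarrow> ('a \<Rightarrow> 'a) \<Rightarrow> bool" where
  "has_weak_gradient u g \<longleftrightarrow>
     locally_integrable u \<and> locally_integrable g \<and>
     (\<forall>\<phi>. test_function UNIV \<phi> \<longrightarrow> (\<forall>i\<in>Basis.
        (LINT x|lebesgue. u x * frechet_derivative \<phi> (at x) i) =
        - (LINT x|lebesgue. (g x \<bullet> i) * \<phi> x)))"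

text \<open>\<open>G\<close> is the spatial gradient of \<open>p\<close> on the cylinder; it is determined
  up to null sets.\<close>

definition has_weak_space_gradient ::
    "real \<Rightarrow> ('a::euclidean_space \<times> real \<Rightarrow> real) \<Rightarrow> ('a \<times> real \<Rightarrow> 'a) \<Rightarrow> bool" where
  "has_weak_space_gradient T p G \<longleftrightarrow>
     G \<in> borel_measurable (lebesgue_on (cyl T)) \<and>
     (AE t in lebesgue_on {0<..<T}. has_weak_gradient (slice p t) (slice G t))"

definition L1_norm :: "('a::euclidean_space \<Rightarrow> 'b::real_normed_vector) \<Rightarrow> ennreal" where
  "L1_norm u = (\<integral>\<^sup>+x. ennreal (norm (u x)) \<partial>lebesgue)"

definition L2_norm_sq :: "('a::euclidean_space \<Rightarrow> 'b::real_normed_vector) \<Rightarrow> ennreal" where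
  "L2_norm_sq u = (\<integral>\<^sup>+x. ennreal ((norm (u x))\<^sup>2) \<partial>lebesgue)"

definition Linf_norm :: "('a::euclidean_space \<Rightarrow> 'b::real_normed_vector) \<Rightarrow> ennreal" where
  "Linf_norm u = esssup lebesgue (\<lambda>x. ennreal (norm (u x)))"

text \<open>\<open>L\<^sup>\<infinity>((0,T); L\<^sup>1(\<real>\<^sup>d) \<inter> L\<^sup>\<infinity>(\<real>\<^sup>d))\<close>. As usual for spaces over the non-separable
  \<open>L\<^sup>\<infinity>(\<real>\<^sup>d)\<close>, measurability in time is that of \<open>\<rho>\<close> as a function on the cylinder.\<close>

definition Linf_L1_Linf :: "real \<Rightarrow> ('a::euclidean_space \<times> real \<Rightarrow> real) set" where
  "Linf_L1_Linf T = {\<rho>.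
     \<rho> \<in> borel_measurable (lebesgue_on (cyl T)) \<and>
     esssup (lebesgue_on {0<..<T}) (\<lambda>t. L1_norm (slice \<rho> t) + Linf_norm (slice \<rho> t)) < \<infinity>}"

text \<open>\<open>L\<^sup>2([0,T]; H\<^sup>1(\<real>\<^sup>d) \<inter> L\<^sup>\<infinity>(\<real>\<^sup>d))\<close>, with the squared norm
  \<open>\<parallel>u\<parallel>\<^sup>2 + \<parallel>\<nabla>u\<parallel>\<^sup>2\<close> (both in \<open>L\<^sup>2\<close>) on \<open>H\<^sup>1\<close>.\<close>

definition L2_H1_Linf :: "real \<Rightarrow> ('a::euclidean_space \<times> real \<Rightarrow> real) set" where
  "L2_H1_Linf T = {p.
     p \<in> borel_measurable (lebesgue_on (cyl T)) \<and>
     (\<exists>G. has_weak_space_gradient T p G \<and>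
        (\<integral>\<^sup>+t. L2_norm_sq (slice p t) + L2_norm_sq (slice G t) + (Linf_norm (slice p t))\<^sup>2
           \<partial>lebesgue_on {0<..<T}) < \<infinity>)}"

definition compactly_supported_in_space ::
    "real \<Rightarrow> ('a::euclidean_space \<times> real \<Rightarrow> real) \<Rightarrow> bool" where
  "compactly_supported_in_space T u \<longleftrightarrow>
     (\<exists>K. compact K \<and> (AE z in lebesgue_on (cyl T). fst z \<notin> K \<longrightarrow> u z = 0))"


section \<open>Weak solutions of the Hele-Shaw density equation\<close>

text \<open>The integrability conditions say that the integrals in the weak formulation exist
  (the Bochner integral of a non-integrable function is \<open>0\<close> by convention).\<close>

definition hele_shaw_weak_solution ::
    "real \<Rightarrow> ('a::euclidean_space \<times> real \<Rightarrow> real) \<Rightarrow> ('a \<times> real \<Rightarrow> 'a) \<Rightarrow> ('a \<times> real \<Rightarrow> real) \<Rightarrow>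
     ('a \<Rightarrow> real) \<Rightarrow> ('a \<times> real \<Rightarrow> real) \<Rightarrow> ('a \<times> real \<Rightarrow> real) \<Rightarrow> bool" where
  "hele_shaw_weak_solution T m b f \<rho>0 \<rho> p \<longleftrightarrow>
     (AE z in lebesgue_on (cyl T). 0 \<le> p z \<and> \<rho> z \<le> m z \<and> p z * (m z - \<rho> z) = 0) \<and>
     (\<exists>G. has_weak_space_gradient T p G \<and>
       (\<forall>\<phi>. test_function (UNIV \<times> {..<T}) \<phi> \<longrightarrow>
          integrable lebesgue (\<lambda>x. \<phi> (x, 0) * \<rho>0 x) \<and>
          integrable (lebesgue_on (cyl T)) (\<lambda>z. \<rho> z * time_deriv \<phi> z) \<and>
          integrable (lebesgue_on (cyl T))
            (\<lambda>z. - (space_grad \<phi> z \<bullet> (m z *\<^sub>R G z + \<rho> z *\<^sub>R b z)) + f z * \<phi> z * \<rho> z) \<and>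
          - (LINT x|lebesgue. \<phi> (x, 0) * \<rho>0 x)
            - (LINT z|lebesgue_on (cyl T). \<rho> z * time_deriv \<phi> z) =
          (LINT z|lebesgue_on (cyl T).
             - (space_grad \<phi> z \<bullet> (m z *\<^sub>R G z + \<rho> z *\<^sub>R b z)) + f z * \<phi> z * \<rho> z)))"

end

theory Submission
  imports Defs
begin

text \<open>
  The difference \<open>(w, q)\<close> of two solutions satisfies
  \<open>\<integral> w (\<partial>\<^sub>t \<phi> - b \<bullet> \<nabla>\<phi> + f \<phi>) = \<integral> m \<nabla>q \<bullet> \<nabla>\<phi>\<close> and \<open>w q \<ge> 0\<close>. Instead of the degenerate
  parabolic dual problem, only the transport equation \<open>\<partial>\<^sub>t \<phi> - b \<bullet> \<nabla>\<phi> + f \<phi> = - S\<close> is solved, backwards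
  from \<open>\<phi> = 0\<close> at time \<open>T\<close>, with \<open>S\<close> a mollification of \<open>g = exp (- \<lambda> t) q\<close>. Then the left-hand side
  is about \<open>- \<integral> exp (- \<lambda> t) w q \<le> 0\<close>, whereas the energy \<open>Y = \<integral> exp (\<lambda> t) m |\<nabla>\<phi>|\<^sup>2\<close> satisfies
  \<open>Y \<le> \<integral> exp (\<lambda> t) m \<nabla>S \<bullet> \<nabla>\<phi> \<approx> \<integral> m \<nabla>q \<bullet> \<nabla>\<phi>\<close> for large \<open>\<lambda>\<close>. Hence \<open>Y \<rightarrow> 0\<close> as the
  mollification is removed, which by the Poincare inequality and the transport equation forces
  \<open>S \<rightarrow> 0\<close> weakly, so \<open>q = 0\<close>. With \<open>q = 0\<close> the same duality, now with \<open>S\<close> a mollification of \<open>w\<close>,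
  gives \<open>\<integral> w S = 0\<close> and so \<open>w = 0\<close>.
\<close>

section \<open>Mollification\<close>

text \<open>The obstacle is uniformity. Bounds on the mollified source and its derivatives may blow
  up as the mollification is removed, so every constant that survives the limit (the rate \<lambda>,
  the Poincare constant, the constants of the weak test) is fixed by the coefficients and the
  support radius alone. The transport equation is solved by an explicit averaging scheme instead of
  along characteristics: the coefficients are controlled only inside the cylinder, and averages with
  nonnegative weights yield both the C1 bounds with Lipschitz gradient and the energy estimate by
  elementary summation. The time step \<tau> is chosen last and may depend on the source, which
  makes the O(\<tau>) defect of the scheme harmless. The two exponentials match: \<lambda> makes exp
  (\<lambda> t) lose enough per backward step to absorb all O(\<tau>) losses, and since it depends
  on time only, exp (\<lambda> t) times the spatial gradient of g is the spatial gradient of q, the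
  one that occurs in the weak equation.\<close>

fun psi :: "nat \<Rightarrow> real \<Rightarrow> real" where
  "psi n s = (if s > 0 then (1 / s) ^ n * exp (- 1 / s) else 0)"

declare psi.simps [simp del]

text \<open>The exponential beats every power of \<open>1 / s\<close>; this limit is what glues the
  two branches of \<open>psi n\<close> together at 0.\<close>

lemma psi_tendsto_0: "(psi n \<longlongrightarrow> 0) (at 0)"
proof -
  have "((\<lambda>x::real. x ^ n / exp x) \<longlongrightarrow> 0) at_top"
    by (rule tendsto_power_div_exp_0)
  then have "((\<lambda>s::real. inverse s ^ n / exp (inverse s)) \<longlongrightarrow> 0) (at_right 0)"
    by (rule filterlim_compose) (rule filterlim_inverse_at_top_right)
  then have right: "(psi n \<longlongrightarrow> 0) (at_right 0)"
    by (rule Lim_transform_eventually)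
      (auto simp: eventually_at_filter psi.simps field_simps exp_minus)
  have "eventually (\<lambda>s. 0 = psi n s) (at_left 0)"
    by (auto simp: eventually_at_filter psi.simps)
  then have "(psi n \<longlongrightarrow> 0) (at_left 0)"
    by (rule Lim_transform_eventually[OF tendsto_const])
  with right show ?thesis
    by (simp add: filterlim_split_at)
qed

text \<open>The powers of \<open>1 / s\<close> belong to the family because differentiating
  \<open>exp (- 1 / s)\<close> produces them; with them the span of the family is closed under
  differentiation.\<close>

lemma DERIV_psi: "DERIV (psi n) s :> - real n * psi (Suc n) s + psi (Suc (Suc n)) s"
proof -
  consider "s < 0" | "s = 0" | "s > 0" by linarith
  then show ?thesis
  proof cases
    case 1
    have "DERIV (psi n) s :> 0"
      by (rule has_field_derivative_transform_within_open[of "\<lambda>_. 0" _ _ "{..<0}"])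
        (use 1 in \<open>auto simp: psi.simps\<close>)
    with 1 show ?thesis by (simp add: psi.simps)
  next
    case 2
    \<comment> \<open>At the junction the difference quotient of \<open>psi n\<close> is
      \<open>psi (Suc n)\<close> itself, so the derivative is the limit 0 of
      \<open>psi_tendsto_0\<close>.\<close>
    have "(\<lambda>h. (psi n (0 + h) - psi n 0) / h) = psi (Suc n)"
      by (rule ext) (auto simp: psi.simps)
    with psi_tendsto_0[of "Suc n"] 2 show ?thesis
      by (simp add: DERIV_def psi.simps)
  next
    case 3
    have "DERIV (\<lambda>s. (1 / s) ^ n * exp (- 1 / s)) s :>
        - real n * psi (Suc n) s + psi (Suc (Suc n)) s"
      using 3 by (auto intro!: derivative_eq_intros simp: psi.simps field_simps power2_eq_square)
        (cases n; simp add: field_simps)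
    then show ?thesis
      by (rule has_field_derivative_transform_within_open[of _ _ _ "{0<..}"])
        (use 3 in \<open>auto simp: psi.simps\<close>)
  qed
qed

text \<open>\<open>smooth_on\<close> quantifies over iterated derivatives, so smoothness is proved
  for a whole class that directional differentiation maps to itself. Inner products with fixed
  vectors are included because the chain rule for \<open>psi\<close> brings them out.\<close>

inductive bump_class :: "'a::euclidean_space \<Rightarrow> real \<Rightarrow> ('a \<Rightarrow> real) \<Rightarrow> bool" for c r where
  const: "bump_class c r (\<lambda>x. a)"
| inner: "bump_class c r (\<lambda>x. x \<bullet> v)"
| psi: "bump_class c r (\<lambda>x. psi n (r\<^sup>2 - (x - c) \<bullet> (x - c)))"
| add: "bump_class c r f \<Longrightarrow> bump_class c r g \<Longrightarrow> bump_class c r (\<lambda>x. f x + g x)"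
| mult: "bump_class c r f \<Longrightarrow> bump_class c r g \<Longrightarrow> bump_class c r (\<lambda>x. f x * g x)"

lemma bump_class_derivative:
  assumes "bump_class c r f"
  shows "\<exists>f'. (\<forall>x. (f has_derivative f' x) (at x)) \<and> (\<forall>v. bump_class c r (\<lambda>x. f' x v))"
  using assms
proof induction
  case (const a)
  show ?case
    by (rule exI[of _ "\<lambda>_ _. 0"]) (auto intro: bump_class.const)
next
  case (inner v)
  show ?case
    by (rule exI[of _ "\<lambda>_ h. h \<bullet> v"]) (auto intro!: derivative_eq_intros bump_class.const)
next
  case (psi n)
  define P where "P = (\<lambda>x::'a. - real n * psi (Suc n) (r\<^sup>2 - (x - c) \<bullet> (x - c)) +
    psi (Suc (Suc n)) (r\<^sup>2 - (x - c) \<bullet> (x - c)))"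
  have P: "bump_class c r P"
    unfolding P_def by (intro bump_class.add bump_class.mult bump_class.const bump_class.psi)
  show ?case
  proof (rule exI[of _ "\<lambda>x h. P x * (- 2 * (x \<bullet> h + - (c \<bullet> h)))"], intro conjI allI)
    fix x :: 'a
    have "((\<lambda>x. r\<^sup>2 - (x - c) \<bullet> (x - c)) has_derivative (\<lambda>h. - 2 * (x \<bullet> h + - (c \<bullet> h)))) (at x)"
      by (auto intro!: derivative_eq_intros simp: fun_eq_iff inner_diff_left inner_diff_right inner_commute)
    from has_derivative_compose[OF this DERIV_psi[of n, THEN has_field_derivative_imp_has_derivative]]
    show "((\<lambda>x. psi n (r\<^sup>2 - (x - c) \<bullet> (x - c))) has_derivative
        (\<lambda>h. P x * (- 2 * (x \<bullet> h + - (c \<bullet> h))))) (at x)"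
      by (simp add: P_def)
  next
    fix v :: 'a
    show "bump_class c r (\<lambda>x. P x * (- 2 * (x \<bullet> v + - (c \<bullet> v))))"
      by (intro P bump_class.add bump_class.mult bump_class.const bump_class.inner)
  qed
next
  case (add f g)
  then obtain f' g' where
    "\<forall>x. (f has_derivative f' x) (at x)" "\<forall>v. bump_class c r (\<lambda>x. f' x v)"
    "\<forall>x. (g has_derivative g' x) (at x)" "\<forall>v. bump_class c r (\<lambda>x. g' x v)" by auto
  then show ?case
    by (intro exI[of _ "\<lambda>x h. f' x h + g' x h"])
      (auto intro!: has_derivative_add bump_class.add)
next
  case (mult f g)
  then obtain f' g' where
    "\<forall>x. (f has_derivative f' x) (at x)" "\<forall>v. bump_class c r (\<lambda>x. f' x v)"
    "\<forall>x. (g has_derivative g' x) (at x)" "\<forall>v. bump_class c r (\<lambda>x. g' x v)" by auto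
  with mult show ?case
    by (intro exI[of _ "\<lambda>x h. f x * g' x h + f' x h * g x"])
      (auto intro!: has_derivative_mult bump_class.add bump_class.mult)
qed

lemma bump_class_smooth:
  assumes "bump_class c r f"
  shows "smooth_on UNIV f"
proof -
  have "bump_class c r (iter_deriv vs f)" for vs
  proof (induction vs)
    case (Cons v vs)
    then obtain f' where f': "\<And>x. (iter_deriv vs f has_derivative f' x) (at x)"
      "\<And>v. bump_class c r (\<lambda>x. f' x v)"
      using bump_class_derivative by blast
    have "frechet_derivative (iter_deriv vs f) (at x) = f' x" for x
      using frechet_derivative_at[OF f'(1)] by simp
    with f'(2) show ?case by simp
  qed (simp add: assms)
  then show ?thesis
    unfolding smooth_on_def differentiable_def using bump_class_derivative by blast
qed

lemma smooth_imp_continuous: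
  assumes "smooth_on UNIV f" "vs \<in> lists Basis"
  shows "continuous_on UNIV (iter_deriv vs f)"
  using assms by (auto simp: smooth_on_def intro!: continuous_at_imp_continuous_on
      differentiable_imp_continuous_within)

lemma continuous_compact_support_integrable:
  fixes f :: "'a::euclidean_space \<Rightarrow> 'b::euclidean_space"
  assumes "continuous_on UNIV f" "compact K" "\<And>x. x \<notin> K \<Longrightarrow> f x = 0"
  shows "integrable lborel f"
proof -
  have "set_integrable lborel K f"
    unfolding set_integrable_def
    by (intro borel_integrable_compact assms continuous_on_subset[OF assms(1)]) auto
  moreover have "(\<lambda>x. indicator K x *\<^sub>R f x) = f"
    using assms(3) by (auto simp: indicator_def fun_eq_iff)
  ultimately show ?thesis by (simp add: set_integrable_def)
qed

text \<open>The centre stays free because the kernels used for the source sit at a slightly negative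
  time rather than at the origin.\<close>

lemma smooth_mollifier:
  fixes c :: "'a::euclidean_space"
  assumes "r > 0"
  obtains \<eta> :: "'a \<Rightarrow> real" where "smooth_on UNIV \<eta>" "\<And>x. 0 \<le> \<eta> x" "\<And>x. x \<notin> ball c r \<Longrightarrow> \<eta> x = 0"
    "integrable lborel \<eta>" "(LINT x|lborel. \<eta> x) = 1"
proof -
  define \<beta> where "\<beta> = (\<lambda>x. psi 0 (r\<^sup>2 - (x - c) \<bullet> (x - c)))"
  have sm: "bump_class c r \<beta>"
    unfolding \<beta>_def by (rule bump_class.psi)
  have nn: "0 \<le> \<beta> x" for x by (simp add: \<beta>_def psi.simps)
  have pos: "\<beta> x > 0 \<longleftrightarrow> x \<in> ball c r" for x
  proof -
    have "(x - c) \<bullet> (x - c) < r\<^sup>2 \<longleftrightarrow> norm (x - c) < r"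
      using assms power2_less_imp_less[of "norm (x - c)" r] power_strict_mono[of "norm (x - c)" r 2]
      by (auto simp: power2_norm_eq_inner)
    then show ?thesis
      by (simp add: \<beta>_def psi.simps dist_norm norm_minus_commute)
  qed
  then have z: "\<beta> x = 0" if "x \<notin> ball c r" for x
    using that nn[of x] by force
  have cont: "continuous_on UNIV \<beta>"
    using smooth_imp_continuous[OF bump_class_smooth[OF sm], of "[]"] by simp
  have int: "integrable lborel \<beta>"
    by (rule continuous_compact_support_integrable[OF cont compact_cball[of c r]])
      (use z in force)
  have "(LINT x|lborel. \<beta> x) \<noteq> 0"
  proof
    assume "(LINT x|lborel. \<beta> x) = 0"
    then have "AE x in lborel. \<beta> x = 0"
      using integral_nonneg_eq_0_iff_AE[OF int] nn by simp
    then have "AE x in lborel. x \<notin> ball c r"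
      by eventually_elim (use pos in force)
    then have "emeasure lborel (ball c r) = 0"
      by (subst (asm) AE_iff_measurable[of "ball c r"]) auto
    then show False
      using content_ball_pos[OF assms, of c] by (simp add: measure_def)
  qed
  define I where "I = (LINT x|lborel. \<beta> x)"
  have I: "I > 0"
    using \<open>(LINT x|lborel. \<beta> x) \<noteq> 0\<close> Bochner_Integration.integral_nonneg[of lborel \<beta>] nn by (simp add: I_def less_le)
  have "bump_class c r (\<lambda>x. 1 / I * \<beta> x)"
    by (intro bump_class.mult bump_class.const sm)
  then show thesis
    by (intro that[of "\<lambda>x. 1 / I * \<beta> x"] bump_class_smooth)
      (use I nn z int in \<open>auto simp: I_def\<close>)
qed

section \<open>Derivatives of convolutions\<close>

definition convol :: "('a::euclidean_space \<Rightarrow> real) \<Rightarrow> ('a \<Rightarrow> 'b::{banach,second_countable_topology}) \<Rightarrow> 'a \<Rightarrow> 'b" where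
  "convol u k x = (LINT y|lborel. u y *\<^sub>R k (x - y))"

lemma compact_support_bounded:
  fixes f :: "'a::euclidean_space \<Rightarrow> 'b::euclidean_space"
  assumes "continuous_on UNIV f" "compact K" "\<And>x. x \<notin> K \<Longrightarrow> f x = 0"
  obtains B where "B > 0" "\<And>x. norm (f x) \<le> B"
proof -
  have "bounded (f ` K)"
    by (intro compact_imp_bounded compact_continuous_image assms(2) continuous_on_subset[OF assms(1)]) simp
  then obtain B where B: "B > 0" "\<And>x. x \<in> K \<Longrightarrow> norm (f x) \<le> B"
    by (auto simp: bounded_pos)
  have "norm (f x) \<le> B" for x
    using B assms(3)[of x] by (cases "x \<in> K") auto
  with B(1) show thesis by (rule that)
qed

lemma compact_support_uniformly_continuous:
  fixes f :: "'a::euclidean_space \<Rightarrow> 'b::euclidean_space"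
  assumes "continuous_on UNIV f" "compact K" "\<And>x. x \<notin> K \<Longrightarrow> f x = 0" "e > 0"
  obtains d where "d > 0" "\<And>x y. norm (x - y) < d \<Longrightarrow> norm (f x - f y) < e"
proof -
  obtain r where r: "K \<subseteq> cball 0 r"
    using compact_imp_bounded[OF assms(2)] by (auto simp: bounded_iff subset_iff)
  have "uniformly_continuous_on (cball 0 (r + 1)) f"
    using assms(1) by (intro compact_uniformly_continuous) (auto intro: continuous_on_subset)
  then obtain d where d: "d > 0"
    "\<And>x y. x \<in> cball 0 (r + 1) \<Longrightarrow> y \<in> cball 0 (r + 1) \<Longrightarrow> dist y x < d \<Longrightarrow> dist (f y) (f x) < e"
    using assms(4) by (auto simp: uniformly_continuous_on_def)
  show thesis
  proof (rule that[of "min d 1"])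
    fix x y :: 'a
    assume xy: "norm (x - y) < min d 1"
    show "norm (f x - f y) < e"
    proof (cases "norm x \<le> r + 1 \<and> norm y \<le> r + 1")
      case True
      with d(2)[of y x] xy show ?thesis by (simp add: dist_norm)
    next
      case False
      with xy norm_triangle_ineq2[of x y] norm_triangle_ineq2[of y x]
      have "norm x > r" "norm y > r" by (auto simp: norm_minus_commute)
      with r assms(3) have "f x = 0" "f y = 0" by force+
      then show ?thesis using assms(4) by simp
    qed
  qed (use d in auto)
qed

lemma convol_integrable:
  fixes k :: "'a::euclidean_space \<Rightarrow> 'b::euclidean_space"
  assumes "integrable lborel u" "continuous_on UNIV k" "\<And>x. norm (k x) \<le> B"
  shows "integrable lborel (\<lambda>y. u y *\<^sub>R k (x - y))"
proof (rule Bochner_Integration.integrable_bound)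
  show "integrable lborel (\<lambda>y. B * norm (u y))"
    using assms(1) by auto
  have [measurable]: "u \<in> borel_measurable borel"
    using borel_measurable_integrable[OF assms(1)] by simp
  have "(\<lambda>y. k (x - y)) \<in> borel_measurable borel"
    by (intro borel_measurable_continuous_onI continuous_on_compose2[OF assms(2)]) (auto intro!: continuous_intros)
  then show "(\<lambda>y. u y *\<^sub>R k (x - y)) \<in> borel_measurable lborel" by simp
  show "AE y in lborel. norm (u y *\<^sub>R k (x - y)) \<le> norm (B * norm (u y))"
  proof (rule AE_I2)
    fix y
    have "norm (u y *\<^sub>R k (x - y)) = norm (u y) * norm (k (x - y))" by simp
    also have "\<dots> \<le> norm (u y) * B"
      using assms(3) by (intro mult_left_mono) auto
    also have "\<dots> \<le> norm (B * norm (u y))"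
      by (simp add: mult.commute)
    finally show "norm (u y *\<^sub>R k (x - y)) \<le> norm (B * norm (u y))" .
  qed
qed

text \<open>A first-order expansion whose error is uniform in \<open>x\<close>: the mean value bound
  along a segment, fed with the modulus of continuity of the gradient. It is what allows
  differentiation under the convolution integral.\<close>

lemma GDERIV_uniform:
  fixes k :: "'a::euclidean_space \<Rightarrow> real"
  assumes k: "\<And>x. GDERIV k x :> D x" and D: "\<And>x y. norm (x - y) < d \<Longrightarrow> norm (D x - D y) < e"
    and h: "norm h < d"
  shows "\<bar>k (x + h) - k x - h \<bullet> D x\<bar> \<le> e * norm h"
proof -
  have "norm (k (x + h) - k x - (\<lambda>h. h \<bullet> D x) ((x + h) - x)) \<le> norm ((x + h) - x) * e"
  proof (rule differentiable_bound_linearization[where S = "closed_segment x (x + h)" and f' = "\<lambda>z h. h \<bullet> D z"])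
    fix z assume z: "z \<in> closed_segment x (x + h)"
    show "(k has_derivative (\<lambda>h. h \<bullet> D z)) (at z within closed_segment x (x + h))"
      using k[of z] by (auto simp: gderiv_def intro: has_derivative_at_withinI)
    have "norm (z - x) \<le> norm h"
      using segment_bound(1)[OF z] by simp
    then have e: "norm (D z - D x) \<le> e"
      using D[of z x] h by simp
    have "onorm (\<lambda>v. v \<bullet> (D z - D x)) \<le> e"
    proof (rule onorm_bound)
      show "0 \<le> e" using e norm_ge_zero order_trans by blast
      fix v
      have "norm (v \<bullet> (D z - D x)) \<le> norm v * norm (D z - D x)"
        by (simp add: Cauchy_Schwarz_ineq2)
      also have "\<dots> \<le> norm v * e" using e by (rule mult_left_mono) simp
      finally show "norm (v \<bullet> (D z - D x)) \<le> e * norm v" by (simp add: mult.commute)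
    qed
    then show "onorm ((\<lambda>v. v \<bullet> D z) - (\<lambda>v. v \<bullet> D x)) \<le> e"
      by (simp add: fun_diff_def inner_diff_right)
  qed (auto simp: closed_segment_def algebra_simps)
  then show ?thesis by (simp add: mult.commute)
qed

lemma GDERIV_convol:
  fixes u k :: "'a::euclidean_space \<Rightarrow> real"
  assumes u: "integrable lborel u" and k: "\<And>x. GDERIV k x :> D x" and D: "continuous_on UNIV D"
    and K: "compact K" "\<And>x. x \<notin> K \<Longrightarrow> k x = 0" "\<And>x. x \<notin> K \<Longrightarrow> D x = 0"
  shows "GDERIV (convol u k) x :> convol u D x"
proof -
  have contk: "continuous_on UNIV k"
    using k by (auto intro!: continuous_at_imp_continuous_on has_derivative_continuous simp: gderiv_def)
  obtain Bk where Bk: "\<And>x. norm (k x) \<le> Bk"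
    using compact_support_bounded[OF contk K(1,2)] by metis
  obtain BD where BD: "\<And>x. norm (D x) \<le> BD"
    using compact_support_bounded[OF D K(1,3)] by metis
  have ik: "integrable lborel (\<lambda>y. u y *\<^sub>R k (z - y))" for z
    by (rule convol_integrable[OF u contk Bk])
  have iD: "integrable lborel (\<lambda>y. u y *\<^sub>R D (z - y))" for z
    by (rule convol_integrable[OF u D BD])
  define U where "U = (LINT y|lborel. \<bar>u y\<bar>)"
  have U: "U \<ge> 0" by (simp add: U_def)
  show ?thesis
    unfolding gderiv_def has_derivative_at_alt
  proof (intro conjI allI impI bounded_linear_inner_left)
    fix e :: real assume "e > 0"
    \<comment> \<open>\<open>U\<close> is the L1 norm of \<open>u\<close>, against which the uniform
      remainder gets integrated; the summand 1 keeps the quotient meaningful for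
      \<open>U = 0\<close>.\<close>
    then have "e / (U + 1) > 0" using U by simp
    then obtain d where d: "d > 0" "\<And>x y. norm (x - y) < d \<Longrightarrow> norm (D x - D y) < e / (U + 1)"
      using compact_support_uniformly_continuous[OF D K(1,3)] by metis
    show "\<exists>d>0. \<forall>y. norm (y - x) < d \<longrightarrow>
        norm (convol u k y - convol u k x - (y - x) \<bullet> convol u D x) \<le> e * norm (y - x)"
    proof (intro exI conjI allI impI)
      fix z assume z: "norm (z - x) < d"
      define h where "h = z - x"
      have "convol u k z - convol u k x - h \<bullet> convol u D x =
          (LINT y|lborel. u y * k (z - y) - u y * k (x - y) - h \<bullet> (u y *\<^sub>R D (x - y)))"
      proof -
        have 1: "(LINT y|lborel. h \<bullet> (u y *\<^sub>R D (x - y))) = h \<bullet> convol u D x"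
          unfolding convol_def by (rule integral_inner_right) (rule iD)
        have 2: "integrable lborel (\<lambda>y. h \<bullet> (u y *\<^sub>R D (x - y)))"
          by (rule integrable_inner_right) (rule iD)
        note ik' = ik[unfolded real_scaleR_def]
        show ?thesis
          by (simp only: Bochner_Integration.integral_diff[OF Bochner_Integration.integrable_diff[OF ik' ik'] 2]
              Bochner_Integration.integral_diff[OF ik' ik'] 1) (simp add: convol_def)
      qed
      also have "norm \<dots> \<le> (LINT y|lborel. \<bar>u y\<bar> * (e / (U + 1) * norm h))"
      proof (rule Bochner_Integration.integral_norm_bound_integral)
        show "integrable lborel (\<lambda>y. u y * k (z - y) - u y * k (x - y) - h \<bullet> (u y *\<^sub>R D (x - y)))"
          using ik[of z] ik[of x] iD[of x] by (intro Bochner_Integration.integrable_diff integrable_inner_right) auto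
        show "integrable lborel (\<lambda>y. \<bar>u y\<bar> * (e / (U + 1) * norm h))"
          using u by (intro integrable_mult_left) auto
        fix y
        have "\<bar>k (x - y + h) - k (x - y) - h \<bullet> D (x - y)\<bar> \<le> e / (U + 1) * norm h"
          using GDERIV_uniform[OF k d(2)] z unfolding h_def by blast
        then have "\<bar>u y\<bar> * \<bar>k (z - y) - k (x - y) - h \<bullet> D (x - y)\<bar> \<le> \<bar>u y\<bar> * (e / (U + 1) * norm h)"
          by (intro mult_left_mono) (auto simp: h_def algebra_simps)
        then show "norm (u y * k (z - y) - u y * k (x - y) - h \<bullet> (u y *\<^sub>R D (x - y)))
            \<le> \<bar>u y\<bar> * (e / (U + 1) * norm h)"
          by (simp add: abs_mult[symmetric] right_diff_distrib)
      qed
      also have "\<dots> = U * (e / (U + 1) * norm h)" by (simp add: U_def)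
      also have "\<dots> = U / (U + 1) * (e * norm h)" by simp
      also have "\<dots> \<le> 1 * (e * norm h)"
        using U \<open>e > 0\<close> by (intro mult_right_mono) auto
      finally show "norm (convol u k z - convol u k x - (z - x) \<bullet> convol u D x) \<le> e * norm (z - x)"
        by (simp add: h_def)
    qed (use d in auto)
  qed
qed

lemma smooth_GDERIV:
  assumes "smooth_on UNIV \<eta>" "vs \<in> lists Basis"
  shows "GDERIV (iter_deriv vs \<eta>) x :> (\<Sum>i\<in>Basis. iter_deriv (i # vs) \<eta> x *\<^sub>R i)"
proof -
  define L where "L = frechet_derivative (iter_deriv vs \<eta>) (at x)"
  have d: "(iter_deriv vs \<eta> has_derivative L) (at x)"
    unfolding L_def using assms frechet_derivative_works by (auto simp: smooth_on_def)
  then have L: "linear L" by (rule has_derivative_linear)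
  have "L h = h \<bullet> (\<Sum>i\<in>Basis. L i *\<^sub>R i)" for h
  proof -
    have "L h = L (\<Sum>i\<in>Basis. (h \<bullet> i) *\<^sub>R i)"
      using euclidean_representation[of h] by (rule arg_cong[OF sym])
    also have "\<dots> = (\<Sum>i\<in>Basis. (h \<bullet> i) * L i)"
      unfolding linear_sum[OF L] linear_cmul[OF L] real_scaleR_def ..
    also have "\<dots> = h \<bullet> (\<Sum>i\<in>Basis. L i *\<^sub>R i)"
      unfolding inner_sum_right by (rule sum.cong) auto
    finally show ?thesis .
  qed
  then have "L = (\<lambda>h. h \<bullet> (\<Sum>i\<in>Basis. L i *\<^sub>R i))" by (rule ext)
  with d have "(iter_deriv vs \<eta> has_derivative (\<lambda>h. h \<bullet> (\<Sum>i\<in>Basis. L i *\<^sub>R i))) (at x)"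
    by (rule back_subst[where P = "\<lambda>L. (iter_deriv vs \<eta> has_derivative L) (at x)"])
  then show ?thesis unfolding gderiv_def iter_deriv.simps(2) L_def .
qed

lemma iter_deriv_support:
  assumes "closed K" "\<And>x. x \<notin> K \<Longrightarrow> \<eta> x = 0" "x \<notin> K"
  shows "iter_deriv vs \<eta> x = 0"
  using assms(3)
proof (induction vs arbitrary: x)
  case (Cons v vs)
  have "((\<lambda>_. 0) has_derivative (\<lambda>_. 0)) (at x)" by simp
  then have "(iter_deriv vs \<eta> has_derivative (\<lambda>_. 0)) (at x)"
    by (rule has_derivative_transform_within_open[where s = "- K"]) (use assms Cons in auto)
  then show ?case by (simp add: frechet_derivative_at[symmetric])
qed (simp add: assms(2))

text \<open>All derivatives fall on the kernel. The induction over the list of directions moves one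
  directional derivative at a time under the integral, reading it off the gradient of the previous
  stage.\<close>

lemma iter_deriv_convol:
  assumes u: "integrable lborel u" and \<eta>: "smooth_on UNIV \<eta>" "compact K" "\<And>x. x \<notin> K \<Longrightarrow> \<eta> x = 0"
    and vs: "vs \<in> lists Basis"
  shows "iter_deriv vs (convol u \<eta>) = convol u (iter_deriv vs \<eta>)"
    and "GDERIV (iter_deriv vs (convol u \<eta>)) x :>
      convol u (\<lambda>x. \<Sum>i\<in>Basis. iter_deriv (i # vs) \<eta> x *\<^sub>R i) x"
proof -
  have supp: "iter_deriv vs \<eta> x = 0" if "x \<notin> K" for vs x
    using iter_deriv_support[of K \<eta>] \<eta> that compact_imp_closed by blast
  have cont: "continuous_on UNIV (\<lambda>x. \<Sum>i\<in>Basis. iter_deriv (i # vs) \<eta> x *\<^sub>R i)"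
    if "vs \<in> lists Basis" for vs
    using that by (intro continuous_intros smooth_imp_continuous[OF \<eta>(1)]) auto
  have G: "GDERIV (convol u (iter_deriv vs \<eta>)) x :>
      convol u (\<lambda>x. \<Sum>i\<in>Basis. iter_deriv (i # vs) \<eta> x *\<^sub>R i) x" if "vs \<in> lists Basis" for vs x
    by (rule GDERIV_convol[OF u smooth_GDERIV[OF \<eta>(1) that] cont[OF that] \<eta>(2)])
      (simp_all add: supp del: iter_deriv.simps)
  show *: "iter_deriv vs (convol u \<eta>) = convol u (iter_deriv vs \<eta>)"
    using vs
  proof (induction vs)
    case (Cons v vs)
    then have vs: "vs \<in> lists Basis" and v: "v \<in> Basis" by auto
    show ?case
    proof
      fix x
      have c: "continuous_on UNIV (iter_deriv (i # vs) \<eta>)" if "i \<in> Basis" for i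
        using smooth_imp_continuous[OF \<eta>(1)] vs that by (meson Cons_in_lists_iff)
      obtain C where "C > 0" "\<And>x. norm (\<Sum>i\<in>Basis. iter_deriv (i # vs) \<eta> x *\<^sub>R i) \<le> C"
        by (rule compact_support_bounded[OF cont[OF vs] \<eta>(2)])
          (auto simp add: supp simp del: iter_deriv.simps)
      from convol_integrable[OF u cont[OF vs] this(2)]
      have i: "integrable lborel (\<lambda>y. u y *\<^sub>R (\<Sum>i\<in>Basis. iter_deriv (i # vs) \<eta> (x - y) *\<^sub>R i))" .
      have vsum: "v \<bullet> (\<Sum>i\<in>Basis. g i *\<^sub>R i) = g v" for g :: "'a \<Rightarrow> real"
        unfolding inner_commute[of v] by (rule inner_sum_left_Basis[OF v])
      have "iter_deriv (v # vs) (convol u \<eta>) x = v \<bullet> convol u (\<lambda>x. \<Sum>i\<in>Basis. iter_deriv (i # vs) \<eta> x *\<^sub>R i) x"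
        unfolding iter_deriv.simps(2)[of v vs "convol u \<eta>"] Cons.IH
        by (rule fun_cong[OF frechet_derivative_at[OF G[OF vs, of x, unfolded gderiv_def], symmetric]])
      also have "\<dots> = (LINT y|lborel. v \<bullet> (u y *\<^sub>R (\<Sum>i\<in>Basis. iter_deriv (i # vs) \<eta> (x - y) *\<^sub>R i)))"
        unfolding convol_def by (rule integral_inner_right[symmetric]) (rule i)
      also have "\<dots> = (LINT y|lborel. u y * iter_deriv (v # vs) \<eta> (x - y))"
        unfolding inner_scaleR_right vsum ..
      finally show "iter_deriv (v # vs) (convol u \<eta>) x = convol u (iter_deriv (v # vs) \<eta>) x"
        unfolding convol_def by (simp del: iter_deriv.simps)
    qed
  qed simp
  show "GDERIV (iter_deriv vs (convol u \<eta>)) x :>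
      convol u (\<lambda>x. \<Sum>i\<in>Basis. iter_deriv (i # vs) \<eta> x *\<^sub>R i) x"
    unfolding * by (rule G[OF vs])
qed

lemma smooth_convol:
  fixes u \<eta> :: "'a::euclidean_space \<Rightarrow> real"
  assumes "integrable lborel u" and "smooth_on UNIV \<eta>" "compact K" "\<And>x. x \<notin> K \<Longrightarrow> \<eta> x = 0"
  shows "smooth_on UNIV (convol u \<eta>)"
  using iter_deriv_convol(2)[OF assms] unfolding smooth_on_def gderiv_def differentiable_def by blast

lemma lborel_integral_reflect:
  fixes F :: "'a::euclidean_space \<Rightarrow> 'b::{banach,second_countable_topology}"
  assumes "F \<in> borel_measurable borel"
  shows "(LINT y|lborel. F (x - y)) = (LINT y|lborel. F y)"
proof -
  have "lborel = distr lborel borel (\<lambda>y::'a. x + (-1) *\<^sub>R y)"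
    using lborel_affine[of "-1" x] by (simp add: density_1)
  then have "(LINT y|lborel. F y) = (LINT y|distr lborel borel (\<lambda>y. x + (-1) *\<^sub>R y). F y)"
    by simp
  also have "\<dots> = (LINT y|lborel. F (x - y))"
    using assms by (simp add: integral_distr)
  finally show ?thesis ..
qed

lemma convol_commute:
  fixes u k :: "'a::euclidean_space \<Rightarrow> real"
  assumes [measurable]: "u \<in> borel_measurable borel" "k \<in> borel_measurable borel"
  shows "convol u k x = convol k u x"
  using lborel_integral_reflect[of "\<lambda>y. u (x - y) * k y" x]
  by (simp add: convol_def mult.commute)

lemma convol_mollifier_close:
  fixes k :: "'a::euclidean_space \<Rightarrow> 'b::euclidean_space"
  assumes \<eta>: "\<And>x. 0 \<le> \<eta> x" "\<And>x. x \<notin> ball 0 d \<Longrightarrow> \<eta> x = 0" "integrable lborel \<eta>" "(LINT x|lborel. \<eta> x) = 1"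
    and k: "continuous_on UNIV k" "\<And>x. norm (k x) \<le> B"
    and e: "\<And>y. norm y < d \<Longrightarrow> norm (k (x - y) - k x) \<le> e"
  shows "norm (convol \<eta> k x - k x) \<le> e"
proof -
  have i: "integrable lborel (\<lambda>y. \<eta> y *\<^sub>R k (x - y))"
    by (rule convol_integrable[OF \<eta>(3) k])
  have "convol \<eta> k x - k x = (LINT y|lborel. \<eta> y *\<^sub>R k (x - y)) - (LINT y|lborel. \<eta> y *\<^sub>R k x)"
    using \<eta>(3,4) by (simp add: convol_def)
  also have "\<dots> = (LINT y|lborel. \<eta> y *\<^sub>R k (x - y) - \<eta> y *\<^sub>R k x)"
    using i \<eta>(3) by (intro Bochner_Integration.integral_diff[symmetric]) auto
  also have "norm \<dots> \<le> (LINT y|lborel. \<eta> y * e)"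
  proof (rule Bochner_Integration.integral_norm_bound_integral)
    show "integrable lborel (\<lambda>y. \<eta> y *\<^sub>R k (x - y) - \<eta> y *\<^sub>R k x)"
      using i \<eta>(3) by (intro Bochner_Integration.integrable_diff) auto
    show "integrable lborel (\<lambda>y. \<eta> y * e)" using \<eta>(3) by simp
    fix y
    show "norm (\<eta> y *\<^sub>R k (x - y) - \<eta> y *\<^sub>R k x) \<le> \<eta> y * e"
    proof (cases "y \<in> ball 0 d")
      case True
      then have "\<eta> y * norm (k (x - y) - k x) \<le> \<eta> y * e"
        using e[of y] \<eta>(1) by (intro mult_left_mono) auto
      then show ?thesis using \<eta>(1) by (simp add: scaleR_diff_right[symmetric])
    qed (simp add: \<eta>(2))
  qed
  finally show ?thesis using \<eta>(4) by simp
qed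

section \<open>Smooth approximation of C1 test functions\<close>

definition C1_close :: "'a::euclidean_space set \<Rightarrow> 'a set \<Rightarrow> ('a \<Rightarrow> real) \<Rightarrow> ('a \<Rightarrow> 'a) \<Rightarrow> real \<Rightarrow>
    ('a \<Rightarrow> real) \<Rightarrow> ('a \<Rightarrow> 'a) \<Rightarrow> bool" where
  "C1_close U K \<phi> D e \<psi> D' \<longleftrightarrow> test_function U \<psi> \<and> continuous_on UNIV D' \<and>
    (\<forall>x. GDERIV \<psi> x :> D' x \<and> \<bar>\<psi> x - \<phi> x\<bar> \<le> e \<and> norm (D' x - D x) \<le> e \<and>
      (x \<notin> K \<longrightarrow> \<psi> x = 0 \<and> D' x = 0))"

text \<open>The weak formulation is available for smooth test functions only, whereas the dual
  solutions are merely C1. The compact set \<open>K'\<close> is chosen before \<open>e\<close>, so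
  that a sequence of approximations has a common support and dominated convergence applies.\<close>

lemma C1_smooth_approx:
  fixes \<phi> :: "'a::euclidean_space \<Rightarrow> real"
  assumes \<phi>: "\<And>x. GDERIV \<phi> x :> D x" "continuous_on UNIV D"
    and K: "compact K" "\<And>x. x \<notin> K \<Longrightarrow> \<phi> x = 0" "K \<subseteq> U" "open U"
  shows "\<exists>K'. compact K' \<and> K' \<subseteq> U \<and> (\<forall>e>0. \<exists>\<psi> D'. C1_close U K' \<phi> D e \<psi> D')"
proof -
  have cont: "continuous_on UNIV \<phi>"
    using \<phi>(1) by (auto intro!: continuous_at_imp_continuous_on has_derivative_continuous simp: gderiv_def)
  have D0: "D x = 0" if "x \<notin> K" for x
  proof -
    have "GDERIV \<phi> x :> 0"
      unfolding gderiv_def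
      by (rule has_derivative_transform_within_open[where s = "- K" and f = "\<lambda>_. 0"])
        (use that K compact_imp_closed in auto)
    then have "(\<lambda>h. h \<bullet> D x) = (\<lambda>h. h \<bullet> 0)"
      using has_derivative_unique \<phi>(1)[of x] unfolding gderiv_def by blast
    then show ?thesis by (metis inner_eq_zero_iff inner_zero_right)
  qed
  obtain r where r: "r > 0" "(\<Union>x\<in>K. cball x r) \<subseteq> U"
    using compact_subset_open_imp_cball_epsilon_subset[OF K(1,4,3)] by auto
  define K' where "K' = {x + y | x y. x \<in> K \<and> y \<in> cball 0 r}"
  have K': "compact K'" "K' \<subseteq> U"
  proof -
    show "compact K'" unfolding K'_def by (rule compact_sums[OF K(1) compact_cball])
    show "K' \<subseteq> U" using r(2) by (force simp: K'_def dist_norm)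
  qed
  have "\<exists>\<psi> D'. C1_close U K' \<phi> D e \<psi> D'" if e: "e > 0" for e
  proof -
    obtain d1 where d1: "d1 > 0" "\<And>x y. norm (x - y) < d1 \<Longrightarrow> norm (\<phi> x - \<phi> y) < e"
      using compact_support_uniformly_continuous[OF cont K(1,2) e] by metis
    obtain d2 where d2: "d2 > 0" "\<And>x y. norm (x - y) < d2 \<Longrightarrow> norm (D x - D y) < e"
      using compact_support_uniformly_continuous[OF \<phi>(2) K(1) D0 e] by metis
    \<comment> \<open>Radius at most \<open>r\<close> keeps the support inside \<open>K'\<close>;
      \<open>d1\<close> and \<open>d2\<close> give accuracy \<open>e\<close> for the function and
      for its gradient.\<close>
    define d where "d = min r (min d1 d2)"
    have "d > 0" using r d1 d2 by (simp add: d_def)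
    then obtain \<eta> :: "'a \<Rightarrow> real" where \<eta>: "smooth_on UNIV \<eta>" "\<And>x. 0 \<le> \<eta> x" "\<And>x. x \<notin> ball 0 d \<Longrightarrow> \<eta> x = 0"
      "integrable lborel \<eta>" "(LINT x|lborel. \<eta> x) = 1"
      by (rule smooth_mollifier[of d 0]) blast
    obtain B1 where B1: "\<And>x. norm (\<phi> x) \<le> B1"
      using compact_support_bounded[OF cont K(1,2)] by metis
    obtain B2 where B2: "\<And>x. norm (D x) \<le> B2"
      using compact_support_bounded[OF \<phi>(2) K(1) D0] by metis
    have [measurable]: "\<phi> \<in> borel_measurable borel" "\<eta> \<in> borel_measurable borel"
      using borel_measurable_integrable[OF \<eta>(4)] borel_measurable_continuous_onI[OF cont] by auto
    have eq: "convol \<phi> \<eta> = convol \<eta> \<phi>"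
      by (rule ext) (simp add: convol_commute)
    have i\<phi>: "integrable lborel \<phi>"
      by (rule continuous_compact_support_integrable[OF cont K(1,2)])
    have smooth: "smooth_on UNIV (convol \<phi> \<eta>)"
      by (rule smooth_convol[OF i\<phi> \<eta>(1) compact_cball[of 0 d]]) (use \<eta>(3) in force)
    have G: "GDERIV (convol \<phi> \<eta>) x :> convol \<eta> D x" for x
      unfolding eq by (rule GDERIV_convol[OF \<eta>(4) \<phi>(1,2) K(1,2) D0])
    have Dc: "continuous_on UNIV (convol \<eta> D)"
    proof -
      \<comment> \<open>Continuity of the averaged gradient is inherited: its components are partial
        derivatives of the smooth function \<open>convol \<phi> \<eta>\<close>.\<close>
      have *: "convol \<eta> D = (\<lambda>x. \<Sum>i\<in>Basis. (iter_deriv [i] (convol \<phi> \<eta>) x) *\<^sub>R i)"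
      proof
        fix x
        have "iter_deriv [i] (convol \<phi> \<eta>) x = convol \<eta> D x \<bullet> i" for i
          using frechet_derivative_at[OF G[of x, unfolded gderiv_def]]
          by (metis inner_commute iter_deriv.simps(1,2))
        then show "convol \<eta> D x = (\<Sum>i\<in>Basis. (iter_deriv [i] (convol \<phi> \<eta>) x) *\<^sub>R i)"
          by (simp only: euclidean_representation)
      qed
      show ?thesis
        unfolding * by (intro continuous_intros smooth_imp_continuous[OF smooth]) auto
    qed
    have supp: "convol \<phi> \<eta> x = 0 \<and> convol \<eta> D x = 0" if "x \<notin> K'" for x
    proof -
      have "\<eta> y *\<^sub>R k (x - y) = 0" if k: "\<And>x. x \<notin> K \<Longrightarrow> k x = 0" for k :: "'a \<Rightarrow> 'c::real_vector" and y
      proof (cases "y \<in> cball 0 r")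
        case True
        have "x - y \<notin> K"
          using \<open>x \<notin> K'\<close> True by (auto simp: K'_def)
        then show ?thesis using k by simp
      next
        case False
        then have "y \<notin> ball 0 d" by (auto simp: d_def)
        then show ?thesis using \<eta>(3) by simp
      qed
      then have "(\<lambda>y. \<eta> y *\<^sub>R \<phi> (x - y)) = (\<lambda>_. 0)" "(\<lambda>y. \<eta> y *\<^sub>R D (x - y)) = (\<lambda>_. 0)"
        using K(2) D0 by blast+
      then show ?thesis
        unfolding eq convol_def by simp
    qed
    have c1: "norm (convol \<phi> \<eta> x - \<phi> x) \<le> e" for x
      unfolding eq
    proof (rule convol_mollifier_close[OF \<eta>(2,3,4,5) cont B1])
      fix y :: 'a assume "norm y < d"
      then show "norm (\<phi> (x - y) - \<phi> x) \<le> e"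
        using d1(2)[of "x - y" x] by (simp add: d_def)
    qed
    have c2: "norm (convol \<eta> D x - D x) \<le> e" for x
    proof (rule convol_mollifier_close[OF \<eta>(2,3,4,5) \<phi>(2) B2])
      fix y :: 'a assume "norm y < d"
      then show "norm (D (x - y) - D x) \<le> e"
        using d2(2)[of "x - y" x] by (simp add: d_def)
    qed
    have "test_function U (convol \<phi> \<eta>)"
      unfolding test_function_def using smooth K' supp by blast
    then show ?thesis
      unfolding C1_close_def using Dc G c1 c2 supp by (intro exI[of _ "convol \<phi> \<eta>"] exI[of _ "convol \<eta> D"]) auto
  qed
  with K' show ?thesis by blast
qed

section \<open>Translation and mollification in L2\<close>

lemma lborel_translate:
  fixes F :: "'a::euclidean_space \<Rightarrow> 'b::{banach,second_countable_topology}"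
  assumes [measurable]: "F \<in> borel_measurable borel"
  shows "(LINT y|lborel. F (y + a)) = (LINT y|lborel. F y)"
    and "integrable lborel (\<lambda>y. F (y + a)) \<longleftrightarrow> integrable lborel F"
proof -
  have *: "lborel = distr lborel borel (\<lambda>y. y + a)"
    using lborel_distr_plus[of a] by (simp add: add.commute[of a, abs_def] ext[of "(+) a" "\<lambda>y. y + a"])
  show "(LINT y|lborel. F (y + a)) = (LINT y|lborel. F y)"
    by (subst (2) *) (simp add: integral_distr)
  show "integrable lborel (\<lambda>y. F (y + a)) \<longleftrightarrow> integrable lborel F"
    by (subst (2) *) (simp add: integrable_distr_eq)
qed

text \<open>Truncation in height and space reduces to a bounded function with bounded support. For
  it there are continuous approximations converging almost everywhere, and clipping and cutting
  these off again makes dominated convergence applicable.\<close>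

lemma L2_continuous_approx:
  fixes u :: "'a::euclidean_space \<Rightarrow> real"
  assumes [measurable]: "u \<in> borel_measurable borel" and u2: "integrable lborel (\<lambda>x. (u x)\<^sup>2)" and e: "e > 0"
  obtains v K where "continuous_on UNIV v" "compact K" "\<And>x. x \<notin> K \<Longrightarrow> v x = 0"
    "(LINT x|lborel. (u x - v x)\<^sup>2) < e"
proof -
  define cl where "cl = (\<lambda>n::real. \<lambda>s::real. max (- n) (min n s))"
  define U where "U = (\<lambda>n::nat. \<lambda>x. cl (real n) (u x) * indicator (cball 0 (real n)) x)"
  have cl_le: "\<bar>cl n s\<bar> \<le> n" if "n \<ge> 0" for n s using that by (auto simp: cl_def)
  have [measurable]: "U n \<in> borel_measurable borel" for n unfolding U_def cl_def
    by (intro borel_measurable_times borel_measurable_max borel_measurable_min borel_measurable_const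
        borel_measurable_indicator) auto
  have "(\<lambda>n. LINT x|lborel. (u x - U n x)\<^sup>2) \<longlonglongrightarrow> (LINT x::'a|lborel. 0)"
  proof (rule integral_dominated_convergence[where w = "\<lambda>x. (u x)\<^sup>2"])
    show "AE x in lborel. (\<lambda>n. (u x - U n x)\<^sup>2) \<longlonglongrightarrow> 0"
    proof (rule AE_I2)
      fix x
      have "eventually (\<lambda>n. real n \<ge> max (norm x) \<bar>u x\<bar>) sequentially"
        using filterlim_real_sequentially unfolding filterlim_at_top by blast
      then have "eventually (\<lambda>n. 0 = (u x - U n x)\<^sup>2) sequentially"
        by eventually_elim (auto simp: U_def cl_def)
      then show "(\<lambda>n. (u x - U n x)\<^sup>2) \<longlonglongrightarrow> 0"
        by (rule Lim_transform_eventually[OF tendsto_const])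
    qed
    show "AE x in lborel. norm ((u x - U n x)\<^sup>2) \<le> (u x)\<^sup>2" for n
    proof (rule AE_I2)
      fix x
      have "\<bar>u x - U n x\<bar> \<le> \<bar>u x\<bar>"
        by (auto simp: U_def cl_def indicator_def)
      then show "norm ((u x - U n x)\<^sup>2) \<le> (u x)\<^sup>2"
        by (simp add: abs_le_square_iff)
    qed
  qed (use u2 in auto)
  then have "eventually (\<lambda>n. (LINT x|lborel. (u x - U n x)\<^sup>2) < e / 4) sequentially"
    using e by (intro order_tendstoD) auto
  then obtain n where n: "(LINT x|lborel. (u x - U n x)\<^sup>2) < e / 4"
    by (auto simp: eventually_sequentially)
  have "U n measurable_on UNIV"
    by (rule lebesgue_measurable_imp_measurable_on) (auto intro: measurable_completion)
  then obtain N g where N: "negligible N" and g: "\<And>k. continuous_on UNIV (g k)"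
    and lim: "\<And>x. x \<notin> N \<Longrightarrow> (\<lambda>k. g k x) \<longlonglongrightarrow> U n x"
    by (auto simp: measurable_on_def)
  \<comment> \<open>Equal to 1 on the ball that carries \<open>U n\<close>, so multiplying by it
    does not disturb the limit.\<close>
  define \<rho> where "\<rho> = (\<lambda>x::'a. max 0 (min 1 (real n + 1 - norm x)))"
  define h where "h = (\<lambda>k x. cl (real n) (g k x) * \<rho> x)"
  have hc: "continuous_on UNIV (h k)" for k
    unfolding h_def \<rho>_def cl_def using g[of k] by (intro continuous_intros) auto
  then have [measurable]: "h k \<in> borel_measurable borel" for k
    by (rule borel_measurable_continuous_onI)
  have h0: "h k x = 0" if "x \<notin> cball 0 (real n + 1)" for k x
    using that by (auto simp: h_def \<rho>_def)
  have U0: "U n x = 0" if "x \<notin> cball 0 (real n + 1)" for x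
    using that by (auto simp: U_def)
  have hb: "\<bar>h k x\<bar> \<le> real n" "\<bar>U n x\<bar> \<le> real n" for k x
    using mult_mono[of "\<bar>cl (real n) (g k x)\<bar>" "real n" "\<bar>\<rho> x\<bar>" 1] cl_le[of "real n"]
    by (auto simp: h_def U_def \<rho>_def abs_mult indicator_def)
  have ic: "integrable lborel (\<lambda>x. indicator (cball 0 (real n + 1)) x * (2 * real n)\<^sup>2 :: real)" for n
    by (intro integrable_mult_left integrable_real_indicator emeasure_lborel_cball_finite) auto
  have bound: "norm ((U n x - h k x)\<^sup>2) \<le> indicator (cball 0 (real n + 1)) x * (2 * real n)\<^sup>2" for k x
  proof (cases "x \<in> cball 0 (real n + 1)")
    case True
    have "\<bar>U n x - h k x\<bar> \<le> \<bar>2 * real n\<bar>"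
      using hb(1)[of k x] hb(2)[of x] by linarith
    then show ?thesis using True by (simp only: abs_le_square_iff) simp
  qed (simp add: h0 U0)
  have "(\<lambda>k. LINT x|lborel. (U n x - h k x)\<^sup>2) \<longlonglongrightarrow> (LINT x::'a|lborel. 0)"
  proof (rule integral_dominated_convergence[where w = "\<lambda>x. indicator (cball 0 (real n + 1)) x * (2 * real n)\<^sup>2"])
    have "AE x in lebesgue. x \<notin> N"
      using N by (simp add: negligible_iff_null_sets AE_not_in)
    then have "AE x in lborel. x \<notin> N" by (simp add: AE_completion_iff)
    then show "AE x in lborel. (\<lambda>k. (U n x - h k x)\<^sup>2) \<longlonglongrightarrow> 0"
    proof eventually_elim
      case (elim x)
      have "(\<lambda>k. h k x) \<longlonglongrightarrow> cl (real n) (U n x) * \<rho> x"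
        unfolding h_def cl_def by (intro tendsto_intros lim[OF elim])
      also have "cl (real n) (U n x) * \<rho> x = U n x"
        by (auto simp: U_def cl_def \<rho>_def indicator_def)
      finally have "(\<lambda>k. (U n x - h k x)\<^sup>2) \<longlonglongrightarrow> (U n x - U n x)\<^sup>2"
        by (intro tendsto_intros)
      then show ?case by simp
    qed
  qed (use ic bound in auto)
  then have "eventually (\<lambda>k. (LINT x|lborel. (U n x - h k x)\<^sup>2) < e / 4) sequentially"
    using e by (intro order_tendstoD) auto
  then obtain k where k: "(LINT x|lborel. (U n x - h k x)\<^sup>2) < e / 4"
    by (auto simp: eventually_sequentially)
  have i1: "integrable lborel (\<lambda>x. (u x - U n x)\<^sup>2)"
  proof (rule Bochner_Integration.integrable_bound[OF u2])
    show "AE x in lborel. norm ((u x - U n x)\<^sup>2) \<le> norm ((u x)\<^sup>2)"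
    proof (rule AE_I2)
      fix x
      have "\<bar>u x - U n x\<bar> \<le> \<bar>u x\<bar>"
        by (auto simp: U_def cl_def indicator_def)
      then show "norm ((u x - U n x)\<^sup>2) \<le> norm ((u x)\<^sup>2)"
        by (simp add: abs_le_square_iff)
    qed
  qed auto
  have i2: "integrable lborel (\<lambda>x. (U n x - h k x)\<^sup>2)"
    by (rule Bochner_Integration.integrable_bound[OF ic[of n]])
      (use bound[of _ k] in \<open>auto intro!: AE_I2\<close>)
  have "(LINT x|lborel. (u x - h k x)\<^sup>2) \<le> (LINT x|lborel. 2 * (u x - U n x)\<^sup>2 + 2 * (U n x - h k x)\<^sup>2)"
  proof (rule integral_mono')
    show "integrable lborel (\<lambda>x. 2 * (u x - U n x)\<^sup>2 + 2 * (U n x - h k x)\<^sup>2)"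
      using i1 i2 by auto
    fix x
    have "(a + b)\<^sup>2 \<le> 2 * a\<^sup>2 + 2 * b\<^sup>2" for a b :: real
      using zero_le_power2[of "a - b"] by (simp add: power2_eq_square algebra_simps)
    from this[of "u x - U n x" "U n x - h k x"]
    show "(u x - h k x)\<^sup>2 \<le> 2 * (u x - U n x)\<^sup>2 + 2 * (U n x - h k x)\<^sup>2" by simp
  qed auto
  also have "\<dots> = 2 * (LINT x|lborel. (u x - U n x)\<^sup>2) + 2 * (LINT x|lborel. (U n x - h k x)\<^sup>2)"
    using i1 i2 by simp
  also have "\<dots> < e" using n k by linarith
  finally have "(LINT x|lborel. (u x - h k x)\<^sup>2) < e" .
  then show thesis
    by (intro that[of "h k" "cball 0 (real n + 1)"] hc h0 compact_cball)
qed

lemma power2_sum_le: "(a + b)\<^sup>2 \<le> 2 * a\<^sup>2 + 2 * (b::real)\<^sup>2"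
  using zero_le_power2[of "a - b"] by (simp add: power2_eq_square algebra_simps)

lemma L2_translation_continuous:
  fixes u :: "'a::euclidean_space \<Rightarrow> real"
  assumes [measurable]: "u \<in> borel_measurable borel" and u2: "integrable lborel (\<lambda>x. (u x)\<^sup>2)" and e: "e > 0"
  obtains d where "d > 0"
    "\<And>y. norm y < d \<Longrightarrow> integrable lborel (\<lambda>x. (u (x - y) - u x)\<^sup>2) \<and>
      (LINT x|lborel. (u (x - y) - u x)\<^sup>2) \<le> e"
proof -
  \<comment> \<open>The triangle inequality for three squares costs a factor of at most 4 on each
    term, and three terms of size \<open>4 * (e / 12)\<close> add up to \<open>e\<close>.\<close>
  obtain v K where v: "continuous_on UNIV v" and K: "compact K" "\<And>x. x \<notin> K \<Longrightarrow> v x = 0"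
    and uv: "(LINT x|lborel. (u x - v x)\<^sup>2) < e / 12"
    using L2_continuous_approx[OF assms(1,2), of "e / 12"] e by auto
  have [measurable]: "v \<in> borel_measurable borel"
    by (rule borel_measurable_continuous_onI[OF v])
  obtain r where r: "r > 0" "K \<subseteq> cball 0 r"
    using compact_imp_bounded[OF K(1)] by (auto simp: bounded_pos subset_iff)
  have iv2: "integrable lborel (\<lambda>x. (v x)\<^sup>2)"
    by (rule continuous_compact_support_integrable[OF _ K(1)]) (use K(2) v in \<open>auto intro!: continuous_intros\<close>)
  have iuv: "integrable lborel (\<lambda>x. (u x - v x)\<^sup>2)"
  proof (rule Bochner_Integration.integrable_bound)
    show "integrable lborel (\<lambda>x. 2 * (u x)\<^sup>2 + 2 * (v x)\<^sup>2)" using u2 iv2 by auto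
    show "AE x in lborel. norm ((u x - v x)\<^sup>2) \<le> norm (2 * (u x)\<^sup>2 + 2 * (v x)\<^sup>2)"
      using power2_sum_le[of _ "- v _"] by (intro AE_I2) simp
  qed auto
  define V where "V = measure lborel (cball (0::'a) (r + 1))"
  \<comment> \<open>Closeness \<open>e1\<close> on a ball of volume \<open>V\<close> contributes at
    most \<open>V * e1\<^sup>2\<close>, which this choice keeps below \<open>e / 12\<close>.\<close>
  define e1 where "e1 = sqrt (e / (12 * (V + 1)))"
  have V: "V \<ge> 0" by (simp add: V_def)
  have e1: "e1 > 0" using e V by (simp add: e1_def)
  obtain d where d: "d > 0" "\<And>x y. norm (x - y) < d \<Longrightarrow> norm (v x - v y) < e1"
    using compact_support_uniformly_continuous[OF v K e1] by metis
  show thesis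
  proof (rule that[of "min d 1"])
    show "min d 1 > 0" using d by simp
    fix y :: 'a assume y: "norm y < min d 1"
    have ic: "integrable lborel (\<lambda>x. indicator (cball (0::'a) (r + 1)) x * e1\<^sup>2 :: real)"
      by (intro integrable_mult_left integrable_real_indicator emeasure_lborel_cball_finite) auto
    have vb: "(v (x - y) - v x)\<^sup>2 \<le> indicator (cball (0::'a) (r + 1)) x * e1\<^sup>2" for x
    proof (cases "x \<in> cball 0 (r + 1)")
      case True
      have "\<bar>v (x - y) - v x\<bar> \<le> \<bar>e1\<bar>" using d(2)[of "x - y" x] y e1 by simp
      then show ?thesis using True by (simp only: abs_le_square_iff) simp
    next
      case False
      then have "x \<notin> K" "x - y \<notin> K"
        using r(2) y norm_triangle_ineq2[of x y] by (force simp: subset_iff)+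
      then show ?thesis using K(2) by simp
    qed
    have iv: "integrable lborel (\<lambda>x. (v (x - y) - v x)\<^sup>2)"
      by (rule Bochner_Integration.integrable_bound[OF ic]) (use vb in \<open>auto intro!: AE_I2\<close>)
    have iuvy: "integrable lborel (\<lambda>x. (u (x - y) - v (x - y))\<^sup>2)"
      and uvy: "(LINT x|lborel. (u (x - y) - v (x - y))\<^sup>2) < e / 12"
      using lborel_translate[of "\<lambda>x. (u x - v x)\<^sup>2" "- y"] iuv uv by auto
    have i: "integrable lborel (\<lambda>x. 4 * (u (x - y) - v (x - y))\<^sup>2 + 4 * (v (x - y) - v x)\<^sup>2 + 4 * (u x - v x)\<^sup>2)"
      using iv iuvy iuv by auto
    have le: "(u (x - y) - u x)\<^sup>2 \<le> 4 * (u (x - y) - v (x - y))\<^sup>2 + 4 * (v (x - y) - v x)\<^sup>2 + 4 * (u x - v x)\<^sup>2" for x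
      using power2_sum_le[of "u (x - y) - v (x - y)" "v (x - y) - u x"]
        power2_sum_le[of "v (x - y) - v x" "v x - u x"]
        zero_le_power2[of "u (x - y) - v (x - y)"]
      unfolding power2_commute[of "v x" "u x"] diff_add_cancel add_diff_eq by linarith
    have "(LINT x|lborel. (v (x - y) - v x)\<^sup>2) \<le> (LINT x|lborel. indicator (cball (0::'a) (r + 1)) x * e1\<^sup>2)"
      by (rule integral_mono[OF iv ic vb])
    also have "\<dots> = V * e1\<^sup>2" by (simp add: V_def)
    also have "\<dots> \<le> (V + 1) * e1\<^sup>2" by (intro mult_right_mono) auto
    also have "\<dots> = e / 12" using e V by (simp add: e1_def field_simps)
    finally have v12: "(LINT x|lborel. (v (x - y) - v x)\<^sup>2) \<le> e / 12" .
    have "integrable lborel (\<lambda>x. (u (x - y) - u x)\<^sup>2)"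
      by (rule Bochner_Integration.integrable_bound[OF i]) (use le in \<open>auto intro!: AE_I2 intro: order.trans\<close>)
    moreover have "(LINT x|lborel. (u (x - y) - u x)\<^sup>2) \<le>
        (LINT x|lborel. 4 * (u (x - y) - v (x - y))\<^sup>2 + 4 * (v (x - y) - v x)\<^sup>2 + 4 * (u x - v x)\<^sup>2)"
      by (rule integral_mono'[OF i le]) auto
    moreover have "\<dots> = 4 * (LINT x|lborel. (u (x - y) - v (x - y))\<^sup>2) + 4 * (LINT x|lborel. (v (x - y) - v x)\<^sup>2)
        + 4 * (LINT x|lborel. (u x - v x)\<^sup>2)"
      using iv iuvy iuv by simp
    ultimately show "integrable lborel (\<lambda>x. (u (x - y) - u x)\<^sup>2) \<and>
      (LINT x|lborel. (u (x - y) - u x)\<^sup>2) \<le> e"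
      using v12 uvy uv by simp
  qed
qed

text \<open>Nonnegativity of the variance of \<open>a\<close> about its mean \<open>A\<close> with
  respect to the probability density \<eta>.\<close>

lemma weighted_Jensen_square:
  fixes \<eta> a :: "'a::euclidean_space \<Rightarrow> real"
  assumes \<eta>: "\<And>x. 0 \<le> \<eta> x" "integrable lborel \<eta>" "(LINT x|lborel. \<eta> x) = 1"
    and a: "integrable lborel (\<lambda>y. \<eta> y * (a y)\<^sup>2)" and [measurable]: "a \<in> borel_measurable borel"
  shows "integrable lborel (\<lambda>y. \<eta> y * a y)"
    and "(LINT y|lborel. \<eta> y * a y)\<^sup>2 \<le> (LINT y|lborel. \<eta> y * (a y)\<^sup>2)"
proof -
  have [measurable]: "\<eta> \<in> borel_measurable borel"
    using borel_measurable_integrable[OF \<eta>(2)] by simp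
  show i: "integrable lborel (\<lambda>y. \<eta> y * a y)"
  proof (rule Bochner_Integration.integrable_bound)
    show "integrable lborel (\<lambda>y. \<eta> y + \<eta> y * (a y)\<^sup>2)" using \<eta>(2) a by auto
    show "AE y in lborel. norm (\<eta> y * a y) \<le> norm (\<eta> y + \<eta> y * (a y)\<^sup>2)"
    proof (rule AE_I2)
      fix y
      have "\<bar>a y\<bar> \<le> 1 + (a y)\<^sup>2"
        using zero_le_power2[of "\<bar>a y\<bar> - 1"] by (simp add: power2_eq_square algebra_simps abs_mult_self_eq)
      then have "\<eta> y * \<bar>a y\<bar> \<le> \<eta> y * (1 + (a y)\<^sup>2)" using \<eta>(1) by (rule mult_left_mono)
      then show "norm (\<eta> y * a y) \<le> norm (\<eta> y + \<eta> y * (a y)\<^sup>2)"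
        using \<eta>(1)[of y] by (simp add: abs_mult algebra_simps)
    qed
  qed auto
  define A where "A = (LINT y|lborel. \<eta> y * a y)"
  have "0 \<le> (LINT y|lborel. \<eta> y * (a y - A)\<^sup>2)" using \<eta>(1) by simp
  also have "\<dots> = (LINT y|lborel. \<eta> y * (a y)\<^sup>2 - 2 * A * (\<eta> y * a y) + A\<^sup>2 * \<eta> y)"
    by (intro Bochner_Integration.integral_cong) (auto simp: power2_eq_square algebra_simps)
  also have "\<dots> = (LINT y|lborel. \<eta> y * (a y)\<^sup>2) - 2 * A * A + A\<^sup>2 * 1"
    using a i \<eta> by (simp add: A_def)
  finally show "(LINT y|lborel. \<eta> y * a y)\<^sup>2 \<le> (LINT y|lborel. \<eta> y * (a y)\<^sup>2)"
    by (simp add: A_def power2_eq_square)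
qed

text \<open>The mollification error is an average of translation errors, so Jensen and Tonelli bound
  it by the worst translation. The radius \<open>d\<close> serves every normalised nonnegative
  kernel supported in the ball, in particular the off-centre ones used later.\<close>

lemma L2_mollify:
  fixes u :: "'a::euclidean_space \<Rightarrow> real"
  assumes [measurable]: "u \<in> borel_measurable borel" and u2: "integrable lborel (\<lambda>x. (u x)\<^sup>2)" and e: "e > 0"
  obtains d where "d > 0"
    "\<And>\<eta>. (\<And>x. 0 \<le> \<eta> x) \<Longrightarrow> (\<And>x. x \<notin> ball 0 d \<Longrightarrow> \<eta> x = 0) \<Longrightarrow> integrable lborel \<eta> \<Longrightarrow>
      (LINT x|lborel. \<eta> x) = 1 \<Longrightarrow>
      integrable lborel (\<lambda>x. (convol u \<eta> x - u x)\<^sup>2) \<and> (LINT x|lborel. (convol u \<eta> x - u x)\<^sup>2) \<le> e"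
proof -
  obtain d where d: "d > 0"
    "\<And>y. norm y < d \<Longrightarrow> integrable lborel (\<lambda>x. (u (x - y) - u x)\<^sup>2) \<and>
      (LINT x|lborel. (u (x - y) - u x)\<^sup>2) \<le> e"
    by (rule L2_translation_continuous[OF assms]) blast
  show thesis
  proof (rule that[OF d(1)])
    fix \<eta> :: "'a \<Rightarrow> real"
    assume \<eta>: "\<And>x. 0 \<le> \<eta> x" "\<And>x. x \<notin> ball 0 d \<Longrightarrow> \<eta> x = 0" "integrable lborel \<eta>"
      "(LINT x|lborel. \<eta> x) = 1"
    have [measurable]: "\<eta> \<in> borel_measurable borel"
      using borel_measurable_integrable[OF \<eta>(3)] by simp
    have [measurable]: "convol u \<eta> \<in> borel_measurable borel"
    proof -
      have "(\<lambda>x. LINT y|lborel. u y *\<^sub>R \<eta> (x - y)) \<in> borel_measurable borel"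
        by measurable
      then show ?thesis by (simp add: convol_def[abs_def])
    qed
    have pw: "ennreal ((convol u \<eta> x - u x)\<^sup>2) \<le> (\<integral>\<^sup>+y. ennreal (\<eta> y * (u (x - y) - u x)\<^sup>2) \<partial>lborel)" for x
    proof (cases "(\<integral>\<^sup>+y. ennreal (\<eta> y * (u (x - y) - u x)\<^sup>2) \<partial>lborel) = \<infinity>")
      case False
      have ia: "integrable lborel (\<lambda>y. \<eta> y * (u (x - y) - u x)\<^sup>2)"
        using False \<eta>(1) by (intro integrableI_nonneg) (auto simp: less_top)
      note J = weighted_Jensen_square[OF \<eta>(1,3,4) ia]
      have "convol u \<eta> x = (LINT y|lborel. \<eta> y * (u (x - y) - u x) + \<eta> y * u x)"
        by (simp add: convol_commute) (simp add: convol_def algebra_simps)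
      also have "\<dots> = (LINT y|lborel. \<eta> y * (u (x - y) - u x)) + u x"
        using J(1) \<eta>(3,4) by (subst Bochner_Integration.integral_add) auto
      finally have "(convol u \<eta> x - u x)\<^sup>2 \<le> (LINT y|lborel. \<eta> y * (u (x - y) - u x)\<^sup>2)"
        using J(2) by simp
      then have "ennreal ((convol u \<eta> x - u x)\<^sup>2) \<le> ennreal (LINT y|lborel. \<eta> y * (u (x - y) - u x)\<^sup>2)"
        by (rule ennreal_leI)
      also have "\<dots> = (\<integral>\<^sup>+y. ennreal (\<eta> y * (u (x - y) - u x)\<^sup>2) \<partial>lborel)"
        using nn_integral_eq_integral[OF ia] \<eta>(1) by simp
      finally show ?thesis .
    qed simp
    have "(\<integral>\<^sup>+x. ennreal ((convol u \<eta> x - u x)\<^sup>2) \<partial>lborel) \<le>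
        (\<integral>\<^sup>+x. \<integral>\<^sup>+y. ennreal (\<eta> y * (u (x - y) - u x)\<^sup>2) \<partial>lborel \<partial>lborel)"
      by (rule nn_integral_mono) (rule pw)
    also have "\<dots> = (\<integral>\<^sup>+y. \<integral>\<^sup>+x. ennreal (\<eta> y * (u (x - y) - u x)\<^sup>2) \<partial>lborel \<partial>lborel)"
      by (rule lborel_pair.Fubini'[symmetric]) measurable
    also have "\<dots> \<le> (\<integral>\<^sup>+y. ennreal (\<eta> y) * ennreal e \<partial>lborel)"
    proof (rule nn_integral_mono)
      fix y :: 'a
      have "(\<integral>\<^sup>+x. ennreal (\<eta> y * (u (x - y) - u x)\<^sup>2) \<partial>lborel) =
          ennreal (\<eta> y) * (\<integral>\<^sup>+x. ennreal ((u (x - y) - u x)\<^sup>2) \<partial>lborel)"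
        using \<eta>(1) by (subst nn_integral_cmult[symmetric]) (auto simp: ennreal_mult')
      also have "\<dots> \<le> ennreal (\<eta> y) * ennreal e"
      proof (cases "norm y < d")
        case True
        then show ?thesis
          using d(2)[of y] by (intro mult_left_mono) (auto simp: nn_integral_eq_integral intro: ennreal_leI)
      qed (simp add: \<eta>(2))
      finally show "(\<integral>\<^sup>+x. ennreal (\<eta> y * (u (x - y) - u x)\<^sup>2) \<partial>lborel) \<le> ennreal (\<eta> y) * ennreal e" .
    qed
    also have "\<dots> = ennreal e"
      using \<eta> by (subst nn_integral_multc) (auto simp: nn_integral_eq_integral)
    finally have fin: "(\<integral>\<^sup>+x. ennreal ((convol u \<eta> x - u x)\<^sup>2) \<partial>lborel) \<le> ennreal e" .
    have i: "integrable lborel (\<lambda>x. (convol u \<eta> x - u x)\<^sup>2)"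
      using le_less_trans[OF fin ennreal_less_top] by (intro integrableI_nonneg) auto
    have "ennreal (LINT x|lborel. (convol u \<eta> x - u x)\<^sup>2) \<le> ennreal e"
      using fin nn_integral_eq_integral[OF i] by simp
    then show "integrable lborel (\<lambda>x. (convol u \<eta> x - u x)\<^sup>2) \<and>
        (LINT x|lborel. (convol u \<eta> x - u x)\<^sup>2) \<le> e"
      using i e by (simp add: ennreal_le_iff)
  qed
qed

section \<open>A discrete backward transport equation\<close>

lemma GDERIV_Lipschitz:
  fixes \<phi> :: "'a::euclidean_space \<Rightarrow> real"
  assumes "convex W" "\<And>z. z \<in> W \<Longrightarrow> GDERIV \<phi> z :> D z" "\<And>z. z \<in> W \<Longrightarrow> norm (D z) \<le> M"
    and "x \<in> W" "y \<in> W"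
  shows "\<bar>\<phi> x - \<phi> y\<bar> \<le> M * norm (x - y)"
proof -
  have M: "M \<ge> 0" using assms(3)[OF assms(4)] norm_ge_zero order_trans by blast
  have "norm (\<phi> x - \<phi> y) \<le> M * norm (x - y)"
  proof (rule differentiable_bound[OF assms(1) _ _ assms(4,5), where f' = "\<lambda>z h. h \<bullet> D z"])
    fix z assume z: "z \<in> W"
    show "(\<phi> has_derivative (\<lambda>h. h \<bullet> D z)) (at z within W)"
      using assms(2)[OF z] by (auto simp: gderiv_def intro: has_derivative_at_withinI)
    show "onorm (\<lambda>h. h \<bullet> D z) \<le> M"
    proof (rule onorm_bound[OF M])
      fix h
      have "norm (h \<bullet> D z) \<le> norm h * norm (D z)" by (simp add: Cauchy_Schwarz_ineq2)
      also have "\<dots> \<le> norm h * M" using assms(3)[OF z] by (rule mult_left_mono) simp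
      finally show "norm (h \<bullet> D z) \<le> M * norm h" by (simp add: mult.commute)
    qed
  qed
  then show ?thesis by simp
qed

text \<open>The tangent plane at \<open>x\<close> is subtracted and the Lipschitz bound applied
  along the segment, where the remaining gradient is at most \<open>M * norm h\<close>.\<close>

lemma GDERIV_linearization:
  fixes \<phi> :: "'a::euclidean_space \<Rightarrow> real"
  assumes "convex W" "\<And>z. z \<in> W \<Longrightarrow> GDERIV \<phi> z :> D z"
    and "\<And>z z'. z \<in> W \<Longrightarrow> z' \<in> W \<Longrightarrow> norm (D z - D z') \<le> M * norm (z - z')"
    and "x \<in> W" "x + h \<in> W" "M \<ge> 0"
  shows "\<bar>\<phi> (x + h) - \<phi> x - h \<bullet> D x\<bar> \<le> M * (norm h)\<^sup>2"
proof -
  define g where "g = (\<lambda>y. \<phi> y - y \<bullet> D x)"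
  define V where "V = closed_segment x (x + h)"
  have VW: "V \<subseteq> W" unfolding V_def using assms(1,4,5) by (rule closed_segment_subset[rotated 2])
  have "\<bar>g (x + h) - g x\<bar> \<le> (M * norm h) * norm (x + h - x)"
  proof (rule GDERIV_Lipschitz[where W = V and D = "\<lambda>z. D z - D x"])
    show "convex V" "x + h \<in> V" "x \<in> V" by (auto simp: V_def)
    fix z assume z: "z \<in> V"
    have "GDERIV \<phi> z :> D z" using assms(2) z VW by blast
    then show "GDERIV g z :> D z - D x"
      unfolding g_def gderiv_def by (auto intro!: derivative_eq_intros simp: inner_diff_right)
    have "norm (D z - D x) \<le> M * norm (z - x)" using assms(3) z VW assms(4) by blast
    also have "\<dots> \<le> M * norm h"
      using segment_bound(1)[of z x "x + h"] z assms(6) by (intro mult_left_mono) (auto simp: V_def)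
    finally show "norm (D z - D x) \<le> M * norm h" .
  qed
  then show ?thesis by (simp add: g_def inner_add_left power2_eq_square algebra_simps)
qed

text \<open>Summing over the two signs turns the odd part \<open>p\<close> into a difference of
  \<open>a\<close> across a pair. The odd part of the differentiated weights does not shrink with
  the time step; the total is O(\<tau>), as stability requires, only because \<open>a\<close> varies
  by O(\<tau>) across a pair. The product is abstract so that both argument orders of scaling are
  covered.\<close>

lemma signed_pair_sum_bound:
  fixes pr :: "'x::real_normed_vector \<Rightarrow> 'y::real_normed_vector \<Rightarrow> 'z::real_normed_vector"
    and a :: "'i \<times> real \<Rightarrow> 'x" and p :: "'i \<Rightarrow> 'y"
  assumes pr: "bounded_bilinear pr" and pr1: "\<And>x y. norm (pr x y) \<le> norm x * norm y"
    and I: "finite I"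
    and p: "\<And>i. i \<in> I \<Longrightarrow> norm (p i) \<le> P" and q: "norm q \<le> Q"
    and a1: "\<And>i. i \<in> I \<Longrightarrow> norm (a (i, 1) - a (i, -1)) \<le> A1"
    and a0: "\<And>j. j \<in> I \<times> {1, -1} \<Longrightarrow> norm (a j) \<le> A0" and nn: "0 \<le> A0" "0 \<le> A1"
  shows "norm (\<Sum>j\<in>I \<times> {1, -1}. pr (a j) (snd j *\<^sub>R p (fst j) + q)) \<le> real (card I) * (A1 * P + 2 * A0 * Q)"
proof -
  interpret bounded_bilinear pr by (rule pr)
  have "(\<Sum>j\<in>I \<times> {1, -1}. pr (a j) (snd j *\<^sub>R p (fst j) + q)) =
      (\<Sum>i\<in>I. \<Sum>s\<in>{1, -1}. pr (a (i, s)) (s *\<^sub>R p i + q))"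
    by (subst sum.cartesian_product) (auto intro!: sum.cong)
  also have "\<dots> = (\<Sum>i\<in>I. pr (a (i, 1) - a (i, -1)) (p i) + (pr (a (i, 1)) q + pr (a (i, -1)) q))"
    by (intro sum.cong refl) (simp add: add_right diff_left minus_right algebra_simps)
  also have "norm \<dots> \<le> (\<Sum>i\<in>I. (A1 * P + 2 * A0 * Q :: real))"
  proof (intro sum_norm_le)
    fix i assume i: "i \<in> I"
    have "norm (pr (a (i, 1) - a (i, -1)) (p i)) \<le> A1 * P"
      by (rule order.trans[OF pr1 mult_mono[OF a1[OF i] p[OF i] nn(2) norm_ge_zero]])
    moreover have s: "norm (pr (a (i, s)) q) \<le> A0 * Q" if "s \<in> {1, -1}" for s
      by (rule order.trans[OF pr1 mult_mono[OF a0 q nn(1) norm_ge_zero]]) (use i that in auto)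
    moreover note s[of 1, simplified] s[of "-1", simplified]
    ultimately show "norm (pr (a (i, 1) - a (i, -1)) (p i) + (pr (a (i, 1)) q + pr (a (i, -1)) q))
        \<le> A1 * P + 2 * A0 * Q"
      using norm_triangle_ineq[of "pr (a (i, 1) - a (i, -1)) (p i)" "pr (a (i, 1)) q + pr (a (i, -1)) q"]
        norm_triangle_ineq[of "pr (a (i, 1)) q" "pr (a (i, -1)) q"] by linarith
  qed
  finally show ?thesis by simp
qed

section \<open>The space-time cylinder and the weights of the scheme\<close>

lemma cyl_iff: "z \<in> cyl T \<longleftrightarrow> 0 < snd z \<and> snd z < T"
  by (cases z) (auto simp: cyl_def)

lemma convex_cyl: "convex (cyl T)"
  unfolding cyl_def by (intro convex_Times) auto

lemma open_cyl: "open (cyl T)"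
  unfolding cyl_def by (intro open_Times) auto

text \<open>All bounds are required inside the cylinder only, since nothing is known about the
  coefficients elsewhere. One constant \<open>B\<close> serves for sizes, first derivatives and the
  Lipschitz constants of these; \<open>1 \<le> B\<close> bounds \<kappa> away from 0.\<close>

locale transport_coeffs =
  fixes T B :: real and b :: "'a::euclidean_space \<times> real \<Rightarrow> 'a" and f :: "'a \<times> real \<Rightarrow> real"
    and Db :: "'a \<Rightarrow> 'a \<times> real \<Rightarrow> 'a \<times> real" and Df :: "'a \<times> real \<Rightarrow> 'a \<times> real"
  assumes T: "0 < T" and B: "1 \<le> B"
    and b_deriv: "\<And>i z. i \<in> Basis \<Longrightarrow> z \<in> cyl T \<Longrightarrow> GDERIV (\<lambda>z. b z \<bullet> i) z :> Db i z"
    and b_bound: "\<And>i z. i \<in> Basis \<Longrightarrow> z \<in> cyl T \<Longrightarrow> \<bar>b z \<bullet> i\<bar> \<le> B"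
    and Db_bound: "\<And>i z. i \<in> Basis \<Longrightarrow> z \<in> cyl T \<Longrightarrow> norm (Db i z) \<le> B"
    and Db_lip: "\<And>i z z'. i \<in> Basis \<Longrightarrow> z \<in> cyl T \<Longrightarrow> z' \<in> cyl T \<Longrightarrow>
      norm (Db i z - Db i z') \<le> B * norm (z - z')"
    and f_deriv: "\<And>z. z \<in> cyl T \<Longrightarrow> GDERIV f z :> Df z"
    and f_bound: "\<And>z. z \<in> cyl T \<Longrightarrow> \<bar>f z\<bar> \<le> B"
    and Df_bound: "\<And>z. z \<in> cyl T \<Longrightarrow> norm (Df z) \<le> B"
    and Df_lip: "\<And>z z'. z \<in> cyl T \<Longrightarrow> z' \<in> cyl T \<Longrightarrow> norm (Df z - Df z') \<le> B * norm (z - z')"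
begin

definition dd :: real where "dd = real DIM('a)"
definition \<kappa> :: real where "\<kappa> = 2 * dd * B"
definition idx :: "('a \<times> real) set" where "idx = Basis \<times> {1, -1}"
text \<open>Averaging \<open>\<phi>\<close> over the points \<open>z + vv \<tau> j\<close> with the weights \<open>cc \<tau> j\<close>, nonnegative by the choice of
  \<open>\<kappa>\<close>, gives \<open>\<phi> + \<tau> (\<partial>\<^sub>t \<phi> - b \<bullet> \<nabla>\<phi> + f \<phi>)\<close> up to \<open>O(\<tau>\<^sup>2)\<close> (a Lax-Friedrichs scheme).\<close>

definition vv :: "real \<Rightarrow> 'a \<times> real \<Rightarrow> 'a \<times> real" where
  "vv \<tau> j = ((snd j * \<kappa> * \<tau>) *\<^sub>R fst j, \<tau>)"
definition cc :: "real \<Rightarrow> 'a \<times> real \<Rightarrow> 'a \<times> real \<Rightarrow> real" where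
  "cc \<tau> j z = 1 / (2 * dd) + (snd j * (- (b z \<bullet> fst j) / (2 * \<kappa>)) + \<tau> * f z / (2 * dd))"
definition Dcc :: "real \<Rightarrow> 'a \<times> real \<Rightarrow> 'a \<times> real \<Rightarrow> 'a \<times> real" where
  "Dcc \<tau> j z = snd j *\<^sub>R ((- 1 / (2 * \<kappa>)) *\<^sub>R Db (fst j) z) + (\<tau> / (2 * dd)) *\<^sub>R Df z"

lemma dd: "1 \<le> dd" by (simp add: dd_def Suc_leI)

lemma \<kappa>: "2 \<le> \<kappa>"
  using mult_mono[OF dd B] dd B by (simp add: \<kappa>_def)

lemma idx: "finite idx" "card (Basis :: 'a set) = dd" "card idx = 2 * dd"
  by (auto simp: idx_def dd_def card_cartesian_product)

lemma b_lip: "i \<in> Basis \<Longrightarrow> z \<in> cyl T \<Longrightarrow> z' \<in> cyl T \<Longrightarrow> \<bar>b z \<bullet> i - b z' \<bullet> i\<bar> \<le> B * norm (z - z')"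
  by (rule GDERIV_Lipschitz[OF convex_cyl, where D = "Db i"]) (auto intro: b_deriv Db_bound)

lemma f_lip: "z \<in> cyl T \<Longrightarrow> z' \<in> cyl T \<Longrightarrow> \<bar>f z - f z'\<bar> \<le> B * norm (z - z')"
  by (rule GDERIV_Lipschitz[OF convex_cyl, where D = "Df"]) (auto intro: f_deriv Df_bound)

lemma cc_deriv:
  assumes "j \<in> idx" "z \<in> cyl T"
  shows "GDERIV (cc \<tau> j) z :> Dcc \<tau> j z"
proof -
  have 1: "((\<lambda>z. b z \<bullet> fst j) has_derivative (\<lambda>h. h \<bullet> Db (fst j) z)) (at z)"
    using b_deriv[of "fst j" z] assms by (auto simp: gderiv_def idx_def)
  have 2: "(f has_derivative (\<lambda>h. h \<bullet> Df z)) (at z)"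
    using f_deriv[of z] assms by (auto simp: gderiv_def)
  have "cc \<tau> j = (\<lambda>z. 1 / (2 * dd) + ((- snd j / (2 * \<kappa>)) * (b z \<bullet> fst j) + (\<tau> / (2 * dd)) * f z))"
    by (simp add: cc_def[abs_def])
  moreover have "((\<lambda>z. 1 / (2 * dd) + ((- snd j / (2 * \<kappa>)) * (b z \<bullet> fst j) + (\<tau> / (2 * dd)) * f z)) has_derivative
      (\<lambda>h. 0 + ((- snd j / (2 * \<kappa>)) * (h \<bullet> Db (fst j) z) + (\<tau> / (2 * dd)) * (h \<bullet> Df z)))) (at z)"
    by (intro has_derivative_add has_derivative_const has_derivative_mult_right 1 2)
  ultimately show ?thesis
    unfolding gderiv_def Dcc_def by (simp add: inner_add_right inner_diff_right)
qed

text \<open>A CFL condition. Half of the base weight \<open>1 / (2 * dd)\<close> absorbs the drift,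
  whose share is at most \<open>1 / (4 * dd)\<close> because \<open>\<kappa> = 2 * dd * B\<close>;
  the other half absorbs the term with \<open>f\<close>, because
  \<open>\<tau> * B \<le> 1 / 2\<close>.\<close>

lemma cc_nonneg:
  assumes "j \<in> idx" "z \<in> cyl T" "0 \<le> \<tau>" "\<tau> * B \<le> 1 / 2"
  shows "0 \<le> cc \<tau> j z"
proof -
  have "\<bar>snd j * (- (b z \<bullet> fst j) / (2 * \<kappa>))\<bar> \<le> B / (2 * \<kappa>)"
    using assms b_bound[of "fst j" z] \<kappa> by (auto simp: idx_def abs_mult divide_right_mono)
  also have "\<dots> = 1 / (4 * dd)" using dd B by (simp add: \<kappa>_def)
  finally have 1: "- 1 / (4 * dd) \<le> snd j * (- (b z \<bullet> fst j) / (2 * \<kappa>))" by linarith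
  have "\<bar>\<tau> * f z\<bar> \<le> \<tau> * B"
    using f_bound[OF assms(2)] assms(3) by (simp add: abs_mult mult_left_mono)
  then have "- (1 / 2) \<le> \<tau> * f z" using assms(4) by linarith
  then have 2: "- (1 / 2) / (2 * dd) \<le> \<tau> * f z / (2 * dd)"
    using dd by (intro divide_right_mono) auto
  have "1 / (2 * dd) = 1 / (4 * dd) + 1 / 2 / (2 * dd)" using dd by (simp add: field_simps)
  with 1 2 show ?thesis by (simp add: cc_def)
qed

lemma idx_sum: "(\<Sum>j\<in>idx. F j) = (\<Sum>i\<in>Basis. F (i, 1) + F (i, -1))" for F :: "_ \<Rightarrow> 'c::comm_monoid_add"
  unfolding idx_def by (subst sum.cartesian_product[symmetric, of "\<lambda>i s. F (i, s)", simplified]) (auto intro!: sum.cong)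

lemma cc_sum: "(\<Sum>j\<in>idx. cc \<tau> j z) = 1 + \<tau> * f z"
proof -
  have "cc \<tau> (i, 1) z + cc \<tau> (i, -1) z = (1 + \<tau> * f z) / dd" for i
    using dd by (simp add: cc_def field_simps)
  then show ?thesis
    unfolding idx_sum using dd by (simp add: idx(2))
qed

text \<open>The mean displacement is \<tau> times the transport direction \<open>(- b z, 1)\<close>,
  up to the extra \<open>\<tau> * f z\<close> in the time slot. The latter arises because every
  displacement advances time by \<tau> while the weights sum to \<open>1 + \<tau> * f z\<close>; it
  costs O(\<tau>) in \<open>scheme_consistent\<close>.\<close>

lemma cc_moment: "(\<Sum>j\<in>idx. cc \<tau> j z *\<^sub>R vv \<tau> j) = \<tau> *\<^sub>R (- b z, 1 + \<tau> * f z)"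
proof -
  have 1: "(\<Sum>j\<in>idx. cc \<tau> j z *\<^sub>R (snd j * \<kappa> * \<tau>) *\<^sub>R fst j) = (\<Sum>i\<in>Basis. (- \<tau> * (b z \<bullet> i)) *\<^sub>R i)"
    unfolding idx_sum
  proof (intro sum.cong refl)
    fix i :: 'a
    have "cc \<tau> (i, 1) z * \<kappa> * \<tau> - cc \<tau> (i, -1) z * \<kappa> * \<tau> = - \<tau> * (b z \<bullet> i)"
      using \<kappa> by (simp add: cc_def field_simps)
    then show "cc \<tau> (i, 1) z *\<^sub>R (snd (i, 1::real) * \<kappa> * \<tau>) *\<^sub>R fst (i, 1::real) +
        cc \<tau> (i, - 1) z *\<^sub>R (snd (i, - 1::real) * \<kappa> * \<tau>) *\<^sub>R fst (i, -1::real) = (- \<tau> * (b z \<bullet> i)) *\<^sub>R i"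
      by (simp add: scaleR_diff_left[symmetric] mult.assoc)
  qed
  have "(\<Sum>i\<in>Basis. (- \<tau> * (b z \<bullet> i)) *\<^sub>R i) = - \<tau> *\<^sub>R (\<Sum>i\<in>Basis. (b z \<bullet> i) *\<^sub>R i)"
    by (simp add: scaleR_sum_right sum_negf)
  then have 2: "(\<Sum>i\<in>Basis. (- \<tau> * (b z \<bullet> i)) *\<^sub>R i) = - \<tau> *\<^sub>R b z"
    by (simp only: euclidean_representation)
  have 3: "(\<Sum>j\<in>idx. cc \<tau> j z * \<tau>) = (1 + \<tau> * f z) * \<tau>"
    by (simp only: sum_distrib_right[symmetric] cc_sum)
  show ?thesis
    using 1 2 3 by (simp add: prod_eq_iff fst_sum snd_sum vv_def mult.commute)
qed

end

text \<open>The source dies a time \<epsilon> before \<open>T\<close>, and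
  \<open>\<tau> < \<epsilon>\<close>. Hence the step is switched off, at time
  \<open>T - \<tau>\<close>, where everything is zero already, and the switch creates no jump in
  value or gradient.\<close>

locale scheme = transport_coeffs T B b f Db Df
  for T B :: real and b :: "'a::euclidean_space \<times> real \<Rightarrow> 'a" and f :: "'a \<times> real \<Rightarrow> real"
    and Db :: "'a \<Rightarrow> 'a \<times> real \<Rightarrow> 'a \<times> real" and Df :: "'a \<times> real \<Rightarrow> 'a \<times> real" +
  fixes \<tau> \<epsilon> s R :: real and S :: "'a \<times> real \<Rightarrow> real" and DS :: "'a \<times> real \<Rightarrow> 'a \<times> real"
  assumes \<tau>: "0 < \<tau>" "\<tau> < \<epsilon>" "\<tau> \<le> 1" "\<tau> * B \<le> 1 / 2"
    and S_deriv: "\<And>z. GDERIV S z :> DS z"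
    and S_bound: "\<And>z. \<bar>S z\<bar> \<le> s" "\<And>z. norm (DS z) \<le> s"
    and DS_lip: "\<And>z z'. norm (DS z - DS z') \<le> s * norm (z - z')"
    and S_late: "\<And>z. T - \<epsilon> \<le> snd z \<Longrightarrow> S z = 0 \<and> DS z = 0"
    and S_far: "\<And>z. R < norm (fst z) \<Longrightarrow> S z = 0 \<and> DS z = 0"
begin

text \<open>The coefficients are read one time step later, at \<open>sh z\<close>, which lies in the
  cylinder for all times between \<open>- \<tau>\<close> and \<open>T - \<tau>\<close>. The scheme
  thus runs below time 0 without extending the coefficients, and its solution is C1 across time 0,
  as a test function has to be.\<close>

definition sh :: "'a \<times> real \<Rightarrow> 'a \<times> real" where "sh z = z + (0, \<tau>)"
definition \<Omega> :: "('a \<times> real) set" where "\<Omega> = {z. - \<tau> < snd z}"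
definition step :: "('a \<times> real \<Rightarrow> real) \<Rightarrow> 'a \<times> real \<Rightarrow> real" where
  "step \<phi> z = (if snd z + \<tau> < T then (\<Sum>j\<in>idx. cc \<tau> j (sh z) * \<phi> (z + vv \<tau> j)) + \<tau> * S z else 0)"
definition stepD :: "('a \<times> real \<Rightarrow> real) \<Rightarrow> ('a \<times> real \<Rightarrow> 'a \<times> real) \<Rightarrow> 'a \<times> real \<Rightarrow> 'a \<times> real" where
  "stepD \<phi> D z = (if snd z + \<tau> < T then
     (\<Sum>j\<in>idx. cc \<tau> j (sh z) *\<^sub>R D (z + vv \<tau> j) + \<phi> (z + vv \<tau> j) *\<^sub>R Dcc \<tau> j (sh z)) + \<tau> *\<^sub>R DS z else 0)"

lemma s: "0 \<le> s" using S_bound(1)[of 0] by linarith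

lemma sh_cyl: "z \<in> \<Omega> \<Longrightarrow> snd z + \<tau> < T \<Longrightarrow> sh z \<in> cyl T"
  by (auto simp: \<Omega>_def sh_def cyl_iff)

lemma vv_\<Omega>: "z \<in> \<Omega> \<Longrightarrow> z + vv \<tau> j \<in> \<Omega>"
  using \<tau> by (auto simp: \<Omega>_def vv_def)

lemma snd_vv: "snd (vv \<tau> j) = \<tau>" by (simp add: vv_def)

lemma norm_fst_vv: "j \<in> idx \<Longrightarrow> norm (fst (vv \<tau> j)) = \<kappa> * \<tau>"
  using \<tau> \<kappa> by (auto simp: vv_def idx_def)

lemma norm_vv: "j \<in> idx \<Longrightarrow> norm (vv \<tau> j) \<le> (\<kappa> + 1) * \<tau>"
proof -
  assume j: "j \<in> idx"
  have "norm (fst (vv \<tau> j), snd (vv \<tau> j)) \<le> norm (fst (vv \<tau> j)) + norm (snd (vv \<tau> j))"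
    by (rule norm_Pair_le)
  also have "\<dots> = (\<kappa> + 1) * \<tau>"
    unfolding norm_fst_vv[OF j] snd_vv using \<tau> by (simp add: algebra_simps)
  finally show ?thesis by simp
qed

lemma vv_diff: "i \<in> Basis \<Longrightarrow> norm (vv \<tau> (i, 1) - vv \<tau> (i, -1)) = 2 * \<kappa> * \<tau>"
proof -
  assume i: "i \<in> Basis"
  have "vv \<tau> (i, 1) - vv \<tau> (i, -1) = ((2 * \<kappa> * \<tau>) *\<^sub>R i, 0)"
    by (simp add: vv_def scaleR_left_distrib[symmetric])
  then show ?thesis using \<tau> \<kappa> i by (simp add: norm_Pair)
qed

lemma convex_\<Omega>: "convex \<Omega>"
proof -
  have "\<Omega> = UNIV \<times> {- \<tau> <..}" by (auto simp: \<Omega>_def)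
  then show ?thesis by (simp add: convex_Times)
qed

lemma open_\<Omega>: "open \<Omega>"
proof -
  have "\<Omega> = UNIV \<times> {- \<tau> <..}" by (auto simp: \<Omega>_def)
  then show ?thesis by (simp add: open_Times)
qed

text \<open>Stability: the weights are nonnegative with sum \<open>1 + \<tau> * f z\<close>, so
  averaging enlarges a bound by at most the factor \<open>1 + \<tau> * B\<close> per step.\<close>

lemma sum_cc_bound:
  fixes g :: "'a \<times> real \<Rightarrow> 'c::real_normed_vector"
  assumes "z \<in> cyl T" "\<And>j. j \<in> idx \<Longrightarrow> norm (g j) \<le> M" "0 \<le> M"
  shows "norm (\<Sum>j\<in>idx. cc \<tau> j z *\<^sub>R g j) \<le> (1 + \<tau> * B) * M"
proof -
  have nn: "0 \<le> cc \<tau> j z" if "j \<in> idx" for j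
    using cc_nonneg[OF that assms(1)] \<tau> by simp
  have "norm (\<Sum>j\<in>idx. cc \<tau> j z *\<^sub>R g j) \<le> (\<Sum>j\<in>idx. cc \<tau> j z * M)"
    using nn assms(2) by (intro sum_norm_le) (auto intro: mult_left_mono)
  also have "\<dots> = (1 + \<tau> * f z) * M" by (simp only: sum_distrib_right[symmetric] cc_sum)
  also have "\<dots> \<le> (1 + \<tau> * B) * M"
    using f_bound[OF assms(1)] \<tau> assms(3) by (intro mult_right_mono add_left_mono mult_left_mono) auto
  finally show ?thesis .
qed

text \<open>The pair distance \<open>2 * \<kappa> * \<tau>\<close> cancels the
  \<open>1 / (2 * \<kappa>)\<close> in \<open>Dcc\<close>. In the applications \<open>A1\<close> is
  a Lipschitz constant of the averaged quantity and \<open>A0\<close> a bound for its size.\<close>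

lemma sum_Dcc_bound:
  fixes a :: "'a \<times> real \<Rightarrow> real"
  assumes z: "z \<in> cyl T" and a1: "\<And>i. i \<in> Basis \<Longrightarrow> \<bar>a (i, 1) - a (i, -1)\<bar> \<le> 2 * \<kappa> * \<tau> * A1"
    and a0: "\<And>j. j \<in> idx \<Longrightarrow> \<bar>a j\<bar> \<le> A0" and nn: "0 \<le> A0" "0 \<le> A1"
  shows "norm (\<Sum>j\<in>idx. a j *\<^sub>R Dcc \<tau> j z) \<le> \<tau> * B * (dd * A1 + A0)"
proof -
  have "norm (\<Sum>j\<in>idx. a j *\<^sub>R Dcc \<tau> j z) \<le>
      real (card (Basis :: 'a set)) * ((2 * \<kappa> * \<tau> * A1) * (B / (2 * \<kappa>)) + 2 * A0 * (\<tau> / (2 * dd) * B))"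
    unfolding Dcc_def idx_def
  proof (rule signed_pair_sum_bound[OF bounded_bilinear_scaleR])
    show "norm ((- 1 / (2 * \<kappa>)) *\<^sub>R Db i z) \<le> B / (2 * \<kappa>)" if "i \<in> Basis" for i
      using Db_bound[OF that z] \<kappa> by (simp add: divide_right_mono)
    show "norm ((\<tau> / (2 * dd)) *\<^sub>R Df z) \<le> \<tau> / (2 * dd) * B"
      using Df_bound[OF z] dd \<tau> by (auto intro!: divide_right_mono mult_left_mono)
    show "0 \<le> 2 * \<kappa> * \<tau> * A1" using \<kappa> \<tau> nn by simp
  qed (use a1 a0 nn in \<open>auto simp: idx_def\<close>)
  also have "\<dots> = \<tau> * B * (dd * A1 + A0)"
    using \<kappa> dd by (simp add: dd_def field_simps)
  finally show ?thesis .
qed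

lemma sum_cc_diff_bound:
  fixes a :: "'a \<times> real \<Rightarrow> 'c::real_normed_vector"
  assumes z: "z \<in> cyl T" "z' \<in> cyl T" and a1: "\<And>i. i \<in> Basis \<Longrightarrow> norm (a (i, 1) - a (i, -1)) \<le> 2 * \<kappa> * \<tau> * A1"
    and a0: "\<And>j. j \<in> idx \<Longrightarrow> norm (a j) \<le> A0" and nn: "0 \<le> A0" "0 \<le> A1"
  shows "norm (\<Sum>j\<in>idx. (cc \<tau> j z - cc \<tau> j z') *\<^sub>R a j) \<le> \<tau> * B * (dd * A1 + A0) * norm (z - z')"
proof -
  have eq: "cc \<tau> j z - cc \<tau> j z' = snd j *\<^sub>R (- (b z \<bullet> fst j - b z' \<bullet> fst j) / (2 * \<kappa>)) + \<tau> / (2 * dd) * (f z - f z')" for j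
    using \<kappa> dd by (simp add: cc_def field_simps)
  have "norm (\<Sum>j\<in>idx. (cc \<tau> j z - cc \<tau> j z') *\<^sub>R a j) \<le>
      real (card (Basis :: 'a set)) * ((2 * \<kappa> * \<tau> * A1) * (B * norm (z - z') / (2 * \<kappa>)) + 2 * A0 * (\<tau> / (2 * dd) * (B * norm (z - z'))))"
    unfolding eq idx_def
  proof (rule signed_pair_sum_bound[where pr = "\<lambda>x y. y *\<^sub>R x"])
    show "bounded_bilinear (\<lambda>x y. y *\<^sub>R x :: 'c)"
      by (rule bounded_bilinear.flip[OF bounded_bilinear_scaleR])
    show "norm (- (b z \<bullet> i - b z' \<bullet> i) / (2 * \<kappa>)) \<le> B * norm (z - z') / (2 * \<kappa>)" if "i \<in> Basis" for i
      using b_lip[OF that z] \<kappa> by (simp add: divide_right_mono)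
    show "norm (\<tau> / (2 * dd) * (f z - f z')) \<le> \<tau> / (2 * dd) * (B * norm (z - z'))"
      using f_lip[OF z] dd \<tau> by (auto simp: abs_mult intro!: divide_right_mono mult_left_mono)
    show "0 \<le> 2 * \<kappa> * \<tau> * A1" using \<kappa> \<tau> nn by simp
  qed (use a1 a0 nn in \<open>auto simp: idx_def\<close>)
  also have "\<dots> = \<tau> * B * (dd * A1 + A0) * norm (z - z')"
    using \<kappa> dd by (simp add: dd_def field_simps)
  finally show ?thesis .
qed

lemma sum_Dcc_diff_bound:
  fixes a :: "'a \<times> real \<Rightarrow> real"
  assumes z: "z \<in> cyl T" "z' \<in> cyl T" and a1: "\<And>i. i \<in> Basis \<Longrightarrow> \<bar>a (i, 1) - a (i, -1)\<bar> \<le> 2 * \<kappa> * \<tau> * A1"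
    and a0: "\<And>j. j \<in> idx \<Longrightarrow> \<bar>a j\<bar> \<le> A0" and nn: "0 \<le> A0" "0 \<le> A1"
  shows "norm (\<Sum>j\<in>idx. a j *\<^sub>R (Dcc \<tau> j z - Dcc \<tau> j z')) \<le> \<tau> * B * (dd * A1 + A0) * norm (z - z')"
proof -
  have eq: "Dcc \<tau> j z - Dcc \<tau> j z' = snd j *\<^sub>R ((- 1 / (2 * \<kappa>)) *\<^sub>R (Db (fst j) z - Db (fst j) z')) + (\<tau> / (2 * dd)) *\<^sub>R (Df z - Df z')" for j
    by (simp add: Dcc_def scaleR_diff_right)
  have "norm (\<Sum>j\<in>idx. a j *\<^sub>R (Dcc \<tau> j z - Dcc \<tau> j z')) \<le>
      real (card (Basis :: 'a set)) * ((2 * \<kappa> * \<tau> * A1) * (B * norm (z - z') / (2 * \<kappa>)) + 2 * A0 * (\<tau> / (2 * dd) * (B * norm (z - z'))))"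
    unfolding eq idx_def
  proof (rule signed_pair_sum_bound[OF bounded_bilinear_scaleR])
    show "norm ((- 1 / (2 * \<kappa>)) *\<^sub>R (Db i z - Db i z')) \<le> B * norm (z - z') / (2 * \<kappa>)" if "i \<in> Basis" for i
      using Db_lip[OF that z] \<kappa> by (simp add: divide_right_mono)
    show "norm ((\<tau> / (2 * dd)) *\<^sub>R (Df z - Df z')) \<le> \<tau> / (2 * dd) * (B * norm (z - z'))"
      using Df_lip[OF z] dd \<tau> by (auto intro!: divide_right_mono mult_left_mono)
    show "0 \<le> 2 * \<kappa> * \<tau> * A1" using \<kappa> \<tau> nn by simp
  qed (use a1 a0 nn in \<open>auto simp: idx_def\<close>)
  also have "\<dots> = \<tau> * B * (dd * A1 + A0) * norm (z - z')"
    using \<kappa> dd by (simp add: dd_def field_simps)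
  finally show ?thesis .
qed

text \<open>One constant for the values, the gradient and the Lipschitz constant of the gradient, so
  that a single recursion controls all three. The Lipschitz gradient is carried along because the
  consistency of the scheme rests on a second-order remainder.\<close>

definition inv :: "real \<Rightarrow> ('a \<times> real \<Rightarrow> real) \<Rightarrow> ('a \<times> real \<Rightarrow> 'a \<times> real) \<Rightarrow> bool" where
  "inv M \<phi> D \<longleftrightarrow> 0 \<le> M \<and> (\<forall>z\<in>\<Omega>. GDERIV \<phi> z :> D z) \<and> (\<forall>z\<in>\<Omega>. \<bar>\<phi> z\<bar> \<le> M \<and> norm (D z) \<le> M) \<and>
     (\<forall>z\<in>\<Omega>. \<forall>z'\<in>\<Omega>. norm (D z - D z') \<le> M * norm (z - z')) \<and>
     (\<forall>z. T - \<epsilon> \<le> snd z \<longrightarrow> \<phi> z = 0 \<and> D z = 0)"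

lemma step_late:
  assumes "inv M \<phi> D" "T - \<epsilon> \<le> snd z"
  shows "step \<phi> z = 0 \<and> stepD \<phi> D z = 0"
proof -
  have "T - \<epsilon> \<le> snd (z + vv \<tau> j)" for j
    using assms(2) \<tau>(1) by (simp add: snd_vv)
  then have "\<phi> (z + vv \<tau> j) = 0 \<and> D (z + vv \<tau> j) = 0" for j
    using assms(1) unfolding inv_def by blast
  then show ?thesis
    using S_late[OF assms(2)] by (simp add: step_def stepD_def)
qed

lemma step_deriv:
  assumes inv: "inv M \<phi> D" and z: "z \<in> \<Omega>"
  shows "GDERIV (step \<phi>) z :> stepD \<phi> D z"
proof (cases "snd z + \<tau> < T")
  case True
  have op: "open {z::'a \<times> real. snd z + \<tau> < T}"
    by (intro open_Collect_less continuous_intros)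
  have "((\<lambda>z. (\<Sum>j\<in>idx. cc \<tau> j (sh z) * \<phi> (z + vv \<tau> j)) + \<tau> * S z) has_derivative
      (\<lambda>h. (\<Sum>j\<in>idx. cc \<tau> j (sh z) * (h \<bullet> D (z + vv \<tau> j)) + (h \<bullet> Dcc \<tau> j (sh z)) * \<phi> (z + vv \<tau> j)) + \<tau> * (h \<bullet> DS z))) (at z)"
  proof (intro has_derivative_add has_derivative_sum has_derivative_mult has_derivative_mult_right)
    fix j assume j: "j \<in> idx"
    have 1: "((\<lambda>z. z + vv \<tau> j) has_derivative (\<lambda>h. h)) (at z)"
      and 2: "(sh has_derivative (\<lambda>h. h)) (at z)"
      unfolding sh_def by (auto intro!: derivative_eq_intros)
    show "((\<lambda>z. \<phi> (z + vv \<tau> j)) has_derivative (\<lambda>h. h \<bullet> D (z + vv \<tau> j))) (at z)"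
      using has_derivative_compose[OF 1, of \<phi> "\<lambda>h. h \<bullet> D (z + vv \<tau> j)"] inv vv_\<Omega>[OF z]
      by (simp add: inv_def gderiv_def)
    show "((\<lambda>z. cc \<tau> j (sh z)) has_derivative (\<lambda>h. h \<bullet> Dcc \<tau> j (sh z))) (at z)"
      using has_derivative_compose[OF 2, of "cc \<tau> j" "\<lambda>h. h \<bullet> Dcc \<tau> j (sh z)"]
        cc_deriv[OF j sh_cyl[OF z True]] by (simp add: gderiv_def)
  next
    show "(S has_derivative (\<lambda>h. h \<bullet> DS z)) (at z)"
      using S_deriv by (simp add: gderiv_def)
  qed
  then have "(step \<phi> has_derivative
      (\<lambda>h. (\<Sum>j\<in>idx. cc \<tau> j (sh z) * (h \<bullet> D (z + vv \<tau> j)) + (h \<bullet> Dcc \<tau> j (sh z)) * \<phi> (z + vv \<tau> j)) + \<tau> * (h \<bullet> DS z))) (at z)"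
    by (rule has_derivative_transform_within_open[OF _ op]) (use True in \<open>auto simp: step_def\<close>)
  then show ?thesis
    using True by (simp add: gderiv_def stepD_def inner_add_right inner_sum_right mult.commute)
next
  case False
  \<comment> \<open>Since \<open>\<tau> < \<epsilon>\<close>, a point at or past
    \<open>T - \<tau>\<close> has this open set as a neighbourhood, and \<open>step \<phi>\<close>
    vanishes on all of it.\<close>
  have op: "open {z::'a \<times> real. T - \<epsilon> < snd z}"
    by (intro open_Collect_less continuous_intros)
  have "(step \<phi> has_derivative (\<lambda>h. 0)) (at z)"
    by (rule has_derivative_transform_within_open[OF has_derivative_const[of 0] op])
      (use False \<tau> step_late[OF inv] in auto)
  then show ?thesis using False by (simp add: gderiv_def stepD_def)
qed

lemma inv_lip:
  assumes "inv M \<phi> D" "z \<in> \<Omega>" "z' \<in> \<Omega>"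
  shows "\<bar>\<phi> z - \<phi> z'\<bar> \<le> M * norm (z - z')"
  by (rule GDERIV_Lipschitz[OF convex_\<Omega>, where D = D]) (use assms in \<open>auto simp: inv_def\<close>)

lemma step_bound:
  assumes inv: "inv M \<phi> D" and z: "z \<in> \<Omega>"
  shows "\<bar>step \<phi> z\<bar> \<le> (1 + \<tau> * B) * M + \<tau> * s"
    and "norm (stepD \<phi> D z) \<le> (1 + \<tau> * B) * M + \<tau> * B * (dd * M + M) + \<tau> * s"
proof -
  have M: "0 \<le> M" using inv by (simp add: inv_def)
  have b: "\<bar>\<phi> z\<bar> \<le> M" "norm (D z) \<le> M" if "z \<in> \<Omega>" for z
    using inv that by (auto simp: inv_def)
  show "\<bar>step \<phi> z\<bar> \<le> (1 + \<tau> * B) * M + \<tau> * s"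
  proof (cases "snd z + \<tau> < T")
    case True
    have "norm (\<Sum>j\<in>idx. cc \<tau> j (sh z) *\<^sub>R \<phi> (z + vv \<tau> j)) \<le> (1 + \<tau> * B) * M"
      by (rule sum_cc_bound[OF sh_cyl[OF z True] _ M]) (simp add: b vv_\<Omega>[OF z])
    moreover have "\<bar>\<tau> * S z\<bar> \<le> \<tau> * s" using S_bound(1)[of z] \<tau> by (simp add: abs_mult)
    ultimately show ?thesis using True by (simp add: step_def)
  qed (use M s \<tau> B in \<open>simp add: step_def\<close>)
  show "norm (stepD \<phi> D z) \<le> (1 + \<tau> * B) * M + \<tau> * B * (dd * M + M) + \<tau> * s"
  proof (cases "snd z + \<tau> < T")
    case True
    have 1: "norm (\<Sum>j\<in>idx. cc \<tau> j (sh z) *\<^sub>R D (z + vv \<tau> j)) \<le> (1 + \<tau> * B) * M"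
      by (rule sum_cc_bound[OF sh_cyl[OF z True] _ M]) (simp add: b vv_\<Omega>[OF z])
    have 2: "norm (\<Sum>j\<in>idx. \<phi> (z + vv \<tau> j) *\<^sub>R Dcc \<tau> j (sh z)) \<le> \<tau> * B * (dd * M + M)"
    proof (rule sum_Dcc_bound[OF sh_cyl[OF z True] _ _ M M])
      fix i :: 'a assume "i \<in> Basis"
      then show "\<bar>\<phi> (z + vv \<tau> (i, 1)) - \<phi> (z + vv \<tau> (i, - 1))\<bar> \<le> 2 * \<kappa> * \<tau> * M"
        using inv_lip[OF inv vv_\<Omega>[OF z] vv_\<Omega>[OF z], of "(i, 1)" "(i, -1)"] vv_diff[of i] by (simp add: mult.commute)
    qed (simp add: b vv_\<Omega>[OF z])
    have 3: "norm (\<tau> *\<^sub>R DS z) \<le> \<tau> * s" using S_bound(2)[of z] \<tau> by simp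
    have "norm (stepD \<phi> D z) \<le> norm (\<Sum>j\<in>idx. cc \<tau> j (sh z) *\<^sub>R D (z + vv \<tau> j)) +
        norm (\<Sum>j\<in>idx. \<phi> (z + vv \<tau> j) *\<^sub>R Dcc \<tau> j (sh z)) + norm (\<tau> *\<^sub>R DS z)"
      using True unfolding stepD_def sum.distrib
      by (auto intro: norm_triangle_mono norm_triangle_ineq order.refl)
    with 1 2 3 show ?thesis by linarith
  qed (use M s \<tau> B dd in \<open>simp add: stepD_def\<close>)
qed

text \<open>The difference is telescoped into terms in which a single factor varies between
  \<open>z\<close> and \<open>z'\<close>. Three of them contain derivatives or differences of the
  weights and are O(\<tau>) by cancellation within pairs; the plain average contributes the factor
  \<open>1 + \<tau> * B\<close>.\<close>

lemma stepD_lip_early: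
  assumes inv: "inv M \<phi> D" and z: "z \<in> \<Omega>" "z' \<in> \<Omega>" and t: "snd z + \<tau> < T" "snd z' + \<tau> < T"
  shows "norm (stepD \<phi> D z - stepD \<phi> D z') \<le>
    ((1 + \<tau> * B) * M + 3 * (\<tau> * B * (dd * M + M)) + \<tau> * s) * norm (z - z')"
proof -
  have M: "0 \<le> M" using inv by (simp add: inv_def)
  have b: "\<bar>\<phi> z\<bar> \<le> M" "norm (D z) \<le> M" if "z \<in> \<Omega>" for z
    using inv that by (auto simp: inv_def)
  have D: "norm (D z - D z') \<le> M * norm (z - z')" if "z \<in> \<Omega>" "z' \<in> \<Omega>" for z z'
    using inv that by (auto simp: inv_def)
  define r where "r = norm (z - z')"
  have r: "norm (sh z - sh z') = r" by (simp add: sh_def r_def)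
  note cyl = sh_cyl[OF z(1) t(1)] sh_cyl[OF z(2) t(2)]
  have 1: "norm (\<Sum>j\<in>idx. cc \<tau> j (sh z) *\<^sub>R (D (z + vv \<tau> j) - D (z' + vv \<tau> j))) \<le> (1 + \<tau> * B) * (M * r)"
  proof (rule sum_cc_bound[OF cyl(1)])
    fix j show "norm (D (z + vv \<tau> j) - D (z' + vv \<tau> j)) \<le> M * r"
      using D[OF vv_\<Omega>[OF z(1)] vv_\<Omega>[OF z(2)], of j j] by (simp add: r_def)
  qed (simp add: M r_def)
  have 2: "norm (\<Sum>j\<in>idx. (cc \<tau> j (sh z) - cc \<tau> j (sh z')) *\<^sub>R D (z' + vv \<tau> j)) \<le> \<tau> * B * (dd * M + M) * r"
    unfolding r[symmetric]
  proof (rule sum_cc_diff_bound[OF cyl _ _ M M])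
    fix i :: 'a assume "i \<in> Basis"
    then show "norm (D (z' + vv \<tau> (i, 1)) - D (z' + vv \<tau> (i, - 1))) \<le> 2 * \<kappa> * \<tau> * M"
      using D[OF vv_\<Omega>[OF z(2)] vv_\<Omega>[OF z(2)], of "(i, 1)" "(i, -1)"] vv_diff[of i] by (simp add: mult.commute)
  qed (simp add: b vv_\<Omega>[OF z(2)])
  have 3: "norm (\<Sum>j\<in>idx. (\<phi> (z + vv \<tau> j) - \<phi> (z' + vv \<tau> j)) *\<^sub>R Dcc \<tau> j (sh z)) \<le> \<tau> * B * (dd * (M * r) + M * r)"
  proof (rule sum_Dcc_bound[OF cyl(1)])
    fix i :: 'a assume i: "i \<in> Basis"
    \<comment> \<open>A mixed second difference of \<phi>. The gradient of \<open>g\<close> is a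
      difference of \<open>D\<close> at points a distance \<open>r\<close> apart, hence at most
      \<open>M * r\<close>; multiplied by the pair distance it is small in both respects.\<close>
    define g where "g = (\<lambda>x. \<phi> (z + x) - \<phi> (z' + x))"
    define W where "W = closed_segment (vv \<tau> (i, 1)) (vv \<tau> (i, -1))"
    have W: "z + x \<in> \<Omega>" "z' + x \<in> \<Omega>" if xW: "x \<in> W" for x
    proof -
      obtain u where "x = (1 - u) *\<^sub>R vv \<tau> (i, 1) + u *\<^sub>R vv \<tau> (i, -1)"
        using xW unfolding W_def in_segment by blast
      from arg_cong[OF this, of snd] have "snd x = \<tau>" by (simp add: snd_vv left_diff_distrib)
      then show "z + x \<in> \<Omega>" "z' + x \<in> \<Omega>" using z \<tau> by (auto simp: \<Omega>_def)
    qed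
    have "\<bar>g (vv \<tau> (i, 1)) - g (vv \<tau> (i, -1))\<bar> \<le> (M * r) * norm (vv \<tau> (i, 1) - vv \<tau> (i, -1))"
    proof (rule GDERIV_Lipschitz[where W = W and D = "\<lambda>x. D (z + x) - D (z' + x)"])
      show "convex W" "vv \<tau> (i, 1) \<in> W" "vv \<tau> (i, -1) \<in> W" by (auto simp: W_def)
      fix x assume x: "x \<in> W"
      have c: "((\<lambda>x. \<phi> (y + x)) has_derivative (\<lambda>h. h \<bullet> D (y + x))) (at x)" if "y + x \<in> \<Omega>" for y
      proof -
        have "((\<lambda>x. y + x) has_derivative (\<lambda>h. h)) (at x)" by (auto intro!: derivative_eq_intros)
        then show ?thesis
          using has_derivative_compose[of "\<lambda>x. y + x" "\<lambda>h. h" x UNIV \<phi> "\<lambda>h. h \<bullet> D (y + x)"] inv that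
          by (simp add: inv_def gderiv_def)
      qed
      show "GDERIV g x :> D (z + x) - D (z' + x)"
        unfolding g_def gderiv_def inner_diff_right by (intro has_derivative_diff c W x)
      show "norm (D (z + x) - D (z' + x)) \<le> M * r"
        using D[OF W[OF x]] by (simp add: r_def)
    qed
    then show "\<bar>\<phi> (z + vv \<tau> (i, 1)) - \<phi> (z' + vv \<tau> (i, 1)) - (\<phi> (z + vv \<tau> (i, - 1)) - \<phi> (z' + vv \<tau> (i, - 1)))\<bar>
        \<le> 2 * \<kappa> * \<tau> * (M * r)"
      using vv_diff[OF i] by (simp add: g_def mult.commute)
  next
    fix j show "\<bar>\<phi> (z + vv \<tau> j) - \<phi> (z' + vv \<tau> j)\<bar> \<le> M * r"
      using inv_lip[OF inv vv_\<Omega>[OF z(1)] vv_\<Omega>[OF z(2)], of j j] by (simp add: r_def)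
  qed (simp_all add: M r_def)
  have 4: "norm (\<Sum>j\<in>idx. \<phi> (z' + vv \<tau> j) *\<^sub>R (Dcc \<tau> j (sh z) - Dcc \<tau> j (sh z'))) \<le> \<tau> * B * (dd * M + M) * r"
    unfolding r[symmetric]
  proof (rule sum_Dcc_diff_bound[OF cyl _ _ M M])
    fix i :: 'a assume "i \<in> Basis"
    then show "\<bar>\<phi> (z' + vv \<tau> (i, 1)) - \<phi> (z' + vv \<tau> (i, - 1))\<bar> \<le> 2 * \<kappa> * \<tau> * M"
      using inv_lip[OF inv vv_\<Omega>[OF z(2)] vv_\<Omega>[OF z(2)], of "(i, 1)" "(i, -1)"] vv_diff[of i] by (simp add: mult.commute)
  qed (simp add: b vv_\<Omega>[OF z(2)])
  have 5: "norm (\<tau> *\<^sub>R (DS z - DS z')) \<le> \<tau> * (s * r)"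
    using DS_lip[of z z'] \<tau> by (simp add: r_def)
  have "stepD \<phi> D z - stepD \<phi> D z' =
      (\<Sum>j\<in>idx. cc \<tau> j (sh z) *\<^sub>R (D (z + vv \<tau> j) - D (z' + vv \<tau> j))) +
      (\<Sum>j\<in>idx. (cc \<tau> j (sh z) - cc \<tau> j (sh z')) *\<^sub>R D (z' + vv \<tau> j)) +
      (\<Sum>j\<in>idx. (\<phi> (z + vv \<tau> j) - \<phi> (z' + vv \<tau> j)) *\<^sub>R Dcc \<tau> j (sh z)) +
      (\<Sum>j\<in>idx. \<phi> (z' + vv \<tau> j) *\<^sub>R (Dcc \<tau> j (sh z) - Dcc \<tau> j (sh z'))) +
      \<tau> *\<^sub>R (DS z - DS z')" (is "_ = ?X")
    using t by (simp add: stepD_def sum.distrib sum_subtractf scaleR_diff_left scaleR_diff_right algebra_simps)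
  moreover have "norm ?X \<le> (1 + \<tau> * B) * (M * r) + \<tau> * B * (dd * M + M) * r + \<tau> * B * (dd * (M * r) + M * r) +
      \<tau> * B * (dd * M + M) * r + \<tau> * (s * r)"
    by (rule norm_triangle_mono[OF norm_triangle_mono[OF norm_triangle_mono[OF norm_triangle_mono[OF 1 2] 3] 4] 5])
  ultimately have "norm (stepD \<phi> D z - stepD \<phi> D z') \<le>
      (1 + \<tau> * B) * (M * r) + \<tau> * B * (dd * M + M) * r + \<tau> * B * (dd * (M * r) + M * r) +
      \<tau> * B * (dd * M + M) * r + \<tau> * (s * r)"
    by (simp only:)
  then show ?thesis unfolding r_def[symmetric]
    by (rule ord_le_eq_trans) algebra
qed

text \<open>One \<open>B\<close> from the growth of the average and three times
  \<open>B * (dd + 1)\<close> from derivatives and differences of the weights, rounded up.\<close>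

definition CC :: real where "CC = 4 * B * (dd + 1)"

lemma inv_step:
  assumes inv: "inv M \<phi> D"
  shows "inv ((1 + CC * \<tau>) * M + \<tau> * s) (step \<phi>) (stepD \<phi> D)"
proof -
  have M: "0 \<le> M" using inv by (simp add: inv_def)
  define M' where "M' = (1 + CC * \<tau>) * M + \<tau> * s"
  have M'eq: "M' = (1 + \<tau> * B) * M + 3 * (\<tau> * B * (dd * M + M)) + \<tau> * s + \<tau> * B * dd * M"
    by (simp add: M'_def CC_def algebra_simps)
  have nn: "0 \<le> \<tau> * B * dd * M" "0 \<le> \<tau> * B * (dd * M + M)" "0 \<le> \<tau> * s" "0 \<le> (1 + \<tau> * B) * M"
    using M \<tau> B dd s by auto
  have M': "0 \<le> M'" using nn unfolding M'eq by linarith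
  have early: "norm (stepD \<phi> D z - stepD \<phi> D z') \<le> M' * norm (z - z')"
    if "z \<in> \<Omega>" "z' \<in> \<Omega>" "snd z + \<tau> < T" "snd z' + \<tau> < T" for z z'
    by (rule order.trans[OF stepD_lip_early[OF inv that] mult_right_mono]) (use nn M'eq in auto)
  have mixed: "norm (stepD \<phi> D z - stepD \<phi> D z') \<le> M' * norm (z - z')"
    if z: "z \<in> \<Omega>" "z' \<in> \<Omega>" "snd z + \<tau> < T" "T \<le> snd z' + \<tau>" for z z'
  proof (cases "T - \<epsilon> \<le> snd z")
    case True
    then have "stepD \<phi> D z = 0" "stepD \<phi> D z' = 0"
      using step_late[OF inv, of z] step_late[OF inv, of z'] z \<tau> by auto
    then show ?thesis using M' by simp
  next
    case False
    \<comment> \<open>\<theta> picks the point of the segment at time \<open>T - \<epsilon>\<close>.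
      The differentiated step is zero there and at \<open>z'\<close>, so the estimate for early
      points applies to the first part of the segment alone.\<close>
    define \<theta> where "\<theta> = (T - \<epsilon> - snd z) / (snd z' - snd z)"
    define y where "y = z + \<theta> *\<^sub>R (z' - z)"
    have \<theta>: "0 \<le> \<theta>" "\<theta> \<le> 1" using False z \<tau> by (auto simp: \<theta>_def field_simps)
    have ys: "snd y = T - \<epsilon>" using False z \<tau> by (simp add: y_def \<theta>_def)
    have y: "y \<in> \<Omega>" using ys False z by (auto simp: \<Omega>_def)
    have "norm (stepD \<phi> D z - stepD \<phi> D y) \<le> M' * norm (z - y)"
      by (rule early) (use ys y z \<tau> in auto)
    moreover have "stepD \<phi> D y = 0" "stepD \<phi> D z' = 0"
      using step_late[OF inv, of y] step_late[OF inv, of z'] z \<tau> ys by auto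
    moreover have "norm (z - y) \<le> norm (z - z')"
    proof -
      have "norm (z - y) = \<theta> * norm (z - z')" using \<theta> by (simp add: y_def norm_minus_commute)
      also have "\<dots> \<le> 1 * norm (z - z')" using \<theta> by (intro mult_right_mono) auto
      finally show ?thesis by simp
    qed
    ultimately show ?thesis using M' by (auto intro: order.trans mult_left_mono)
  qed
  have lip: "norm (stepD \<phi> D z - stepD \<phi> D z') \<le> M' * norm (z - z')" if z: "z \<in> \<Omega>" "z' \<in> \<Omega>" for z z'
  proof -
    consider "snd z + \<tau> < T" "snd z' + \<tau> < T" | "snd z + \<tau> < T" "T \<le> snd z' + \<tau>"
      | "snd z' + \<tau> < T" "T \<le> snd z + \<tau>" | "T \<le> snd z + \<tau>" "T \<le> snd z' + \<tau>" by linarith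
    then show ?thesis
    proof cases
      case 3
      show ?thesis using mixed[OF z(2,1) 3] by (simp add: norm_minus_commute)
    next
      case 4
      then have "stepD \<phi> D z = 0" "stepD \<phi> D z' = 0" by (auto simp: stepD_def)
      then show ?thesis using M' by simp
    qed (use early mixed z in auto)
  qed
  have b: "\<bar>step \<phi> z\<bar> \<le> M'" "norm (stepD \<phi> D z) \<le> M'" if z: "z \<in> \<Omega>" for z
    using step_bound[OF inv z] nn unfolding M'eq by linarith+
  show ?thesis
    using M' lip b step_deriv[OF inv] step_late[OF inv] unfolding inv_def M'_def[symmetric] by blast
qed

end

section \<open>Iterating the step to a fixed point, and consistency\<close>

context scheme
begin

primrec it :: "nat \<Rightarrow> 'a \<times> real \<Rightarrow> real" where
  "it 0 = (\<lambda>_. 0)"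
| "it (Suc n) = step (it n)"

primrec itD :: "nat \<Rightarrow> 'a \<times> real \<Rightarrow> 'a \<times> real" where
  "itD 0 = (\<lambda>_. 0)"
| "itD (Suc n) = stepD (it n) (itD n)"

lemma inv_mono: "inv M \<phi> D \<Longrightarrow> M \<le> M' \<Longrightarrow> inv M' \<phi> D"
  unfolding inv_def by (meson mult_right_mono norm_ge_zero order_trans)

lemma CC: "0 \<le> CC" using B dd by (simp add: CC_def)

text \<open>Discrete Gronwall: each of the \<open>n\<close> source contributions
  \<open>\<tau> * s\<close> is amplified by at most \<open>n\<close> factors
  \<open>1 + CC * \<tau>\<close>.\<close>

lemma inv_it: "inv ((1 + CC * \<tau>) ^ n * (real n * \<tau> * s)) (it n) (itD n)"
proof (induction n)
  case 0
  show ?case by (auto simp: inv_def gderiv_def)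
next
  case (Suc n)
  define q where "q = 1 + CC * \<tau>"
  have q: "1 \<le> q ^ Suc n" using CC \<tau> by (intro one_le_power) (simp add: q_def)
  have "q * (q ^ n * (real n * \<tau> * s)) + 1 * (\<tau> * s) \<le> q * (q ^ n * (real n * \<tau> * s)) + q ^ Suc n * (\<tau> * s)"
    using q \<tau> s by (intro add_left_mono mult_right_mono) auto
  also have "\<dots> = q ^ Suc n * (real (Suc n) * \<tau> * s)"
    by (simp add: algebra_simps)
  finally have "q * (q ^ n * (real n * \<tau> * s)) + \<tau> * s \<le> q ^ Suc n * (real (Suc n) * \<tau> * s)"
    by simp
  with inv_step[OF Suc] show ?case
    unfolding q_def[symmetric] it.simps itD.simps by (rule inv_mono)
qed

text \<open>The step reads its argument only at times later by \<tau>, so after \<open>n\<close>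
  iterations the values from time \<open>T - n * \<tau>\<close> on are final. A fixed point on
  \<Omega> is therefore reached after finitely many iterations, without any limit.\<close>

lemma it_stable: "T - real n * \<tau> \<le> snd z \<Longrightarrow> it (Suc n) z = it n z \<and> itD (Suc n) z = itD n z"
proof (induction n arbitrary: z)
  case 0
  then show ?case using \<tau> by (simp add: step_def stepD_def)
next
  case (Suc n)
  have "T - real n * \<tau> \<le> snd (z + vv \<tau> j)" for j
    using Suc.prems by (simp add: snd_vv algebra_simps)
  from Suc.IH[OF this]
  have "it (Suc n) (z + vv \<tau> j) = it n (z + vv \<tau> j)" "itD (Suc n) (z + vv \<tau> j) = itD n (z + vv \<tau> j)" for j
    by auto
  then show ?case
    unfolding it.simps(2)[of "Suc n"] itD.simps(2)[of "Suc n"] it.simps(2)[of n] itD.simps(2)[of n]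
    by (simp add: step_def[of "step (it n)"] step_def[of "it n" z] stepD_def[of "step (it n)"] stepD_def[of "it n" "itD n" z])
qed

text \<open>Finite speed of propagation \<kappa>: one step displaces points by
  \<open>\<kappa> * \<tau>\<close> in space.\<close>

lemma it_far: "R + \<kappa> * (real n * \<tau>) < norm (fst z) \<Longrightarrow> it n z = 0 \<and> itD n z = 0"
proof (induction n arbitrary: z)
  case (Suc n)
  have "it n (z + vv \<tau> j) = 0 \<and> itD n (z + vv \<tau> j) = 0" if j: "j \<in> idx" for j
  proof (rule Suc.IH)
    have "norm (fst z) \<le> norm (fst (z + vv \<tau> j)) + norm (fst (vv \<tau> j))"
      using norm_triangle_ineq4[of "fst (z + vv \<tau> j)" "fst (vv \<tau> j)"] by simp
    then show "R + \<kappa> * (real n * \<tau>) < norm (fst (z + vv \<tau> j))"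
      using Suc.prems norm_fst_vv[OF j] by (simp add: algebra_simps)
  qed
  moreover have "0 \<le> \<kappa> * (real (Suc n) * \<tau>)" using \<kappa> \<tau> by simp
  with Suc.prems have "R < norm (fst z)" by linarith
  then have "S z = 0 \<and> DS z = 0" by (rule S_far)
  ultimately show ?case by (simp add: step_def stepD_def)
qed simp

text \<open>Independent of \<tau>, because the number of iterations times \<tau> stays below
  \<open>T + 2\<close>.\<close>

definition MM :: real where "MM = exp (CC * (T + 2)) * ((T + 2) * s)"

lemma scheme_solution:
  obtains \<phi> D where "inv MM \<phi> D" "\<And>z. z \<in> \<Omega> \<Longrightarrow> \<phi> z = step \<phi> z" "\<And>z. z \<in> \<Omega> \<Longrightarrow> D z = stepD \<phi> D z"
    "\<And>z. R + \<kappa> * (T + 2) < norm (fst z) \<Longrightarrow> \<phi> z = 0 \<and> D z = 0"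
proof -
  \<comment> \<open>The extra iteration gives \<open>T + \<tau> \<le> N * \<tau>\<close>, which
    covers \<Omega> down to time \<open>- \<tau>\<close>; the upper bound \<open>T + 2\<close> uses
    \<open>\<tau> \<le> 1\<close>.\<close>
  define N where "N = Suc (nat \<lceil>T / \<tau>\<rceil>)"
  have "T / \<tau> \<le> real (nat \<lceil>T / \<tau>\<rceil>)" "real (nat \<lceil>T / \<tau>\<rceil>) \<le> T / \<tau> + 1"
    using T \<tau>(1) by (auto simp: of_nat_ceiling ceiling_correct le_nat_iff)
  then have "T \<le> real (nat \<lceil>T / \<tau>\<rceil>) * \<tau>" "real (nat \<lceil>T / \<tau>\<rceil>) * \<tau> \<le> T + \<tau>"
    using \<tau>(1) by (auto simp: field_simps)
  then have N: "T + \<tau> \<le> real N * \<tau>" "real N * \<tau> \<le> T + 2"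
    using \<tau> by (auto simp: N_def algebra_simps)
  have "(1 + CC * \<tau>) ^ N \<le> exp (CC * \<tau>) ^ N"
    using CC \<tau> by (intro power_mono exp_ge_add_one_self) auto
  also have "\<dots> = exp (CC * (real N * \<tau>))" by (simp add: exp_of_nat_mult[symmetric] algebra_simps)
  also have "\<dots> \<le> exp (CC * (T + 2))" using CC N by (auto intro: mult_left_mono)
  finally have "(1 + CC * \<tau>) ^ N * (real N * \<tau> * s) \<le> MM"
    unfolding MM_def using N s T \<tau> by (intro mult_mono mult_right_mono) auto
  with inv_it[of N] have 1: "inv MM (it N) (itD N)" by (rule inv_mono)
  have "T - real N * \<tau> \<le> snd z" if "z \<in> \<Omega>" for z
    using that N by (simp add: \<Omega>_def)
  from it_stable[OF this] have 2: "it N z = step (it N) z" "itD N z = stepD (it N) (itD N) z" if "z \<in> \<Omega>" for z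
    using that by auto
  have 3: "it N z = 0 \<and> itD N z = 0" if "R + \<kappa> * (T + 2) < norm (fst z)" for z
  proof (rule it_far)
    have "\<kappa> * (real N * \<tau>) \<le> \<kappa> * (T + 2)" using N \<kappa> by (intro mult_left_mono) auto
    then show "R + \<kappa> * (real N * \<tau>) < norm (fst z)" using that by linarith
  qed
  show thesis by (rule that[OF 1 2 3])
qed

text \<open>The zeroth and first moments of the weights reproduce the transport operator, and a
  Taylor remainder \<open>M * ((\<kappa> + 1) * \<tau>)\<^sup>2\<close> per node is left, which
  still yields O(\<tau>) after division by \<tau>. In the constant,
  \<open>2 * (\<kappa> + 1)\<^sup>2\<close> is this remainder, \<open>dd * B\<close> comes from
  reading \<open>b\<close> at \<open>sh z\<close>, and \<open>2 * B\<close> from reading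
  \<open>f\<close> there and from the surplus in the time moment.\<close>

lemma scheme_consistent:
  assumes inv: "inv M \<phi> D" and fix_eq: "\<phi> z = step \<phi> z" and z: "z \<in> cyl T"
  shows "\<bar>snd (D z) - b z \<bullet> fst (D z) + f z * \<phi> z + S z\<bar> \<le> \<tau> * (M * (2 * B + dd * B + 2 * (\<kappa> + 1)\<^sup>2))"
proof (cases "snd z + \<tau> < T")
  case False
  have M: "0 \<le> M" using inv by (simp add: inv_def)
  have "T - \<epsilon> \<le> snd z" using False \<tau> by linarith
  then have "\<phi> z = 0" "D z = 0" "S z = 0" using inv S_late[of z] unfolding inv_def by blast+
  then show ?thesis using M B dd \<tau> by simp
next
  case True
  have M: "0 \<le> M" using inv by (simp add: inv_def)
  have z\<Omega>: "z \<in> \<Omega>" using z \<tau> by (auto simp: \<Omega>_def cyl_iff)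
  note shc = sh_cyl[OF z\<Omega> True]
  have b: "\<bar>\<phi> z\<bar> \<le> M" "norm (D z) \<le> M" using inv z\<Omega> by (auto simp: inv_def)
  define e where "e j = \<phi> (z + vv \<tau> j) - \<phi> z - vv \<tau> j \<bullet> D z" for j
  have e: "\<bar>e j\<bar> \<le> M * ((\<kappa> + 1) * \<tau>)\<^sup>2" if "j \<in> idx" for j
  proof -
    have "\<bar>e j\<bar> \<le> M * (norm (vv \<tau> j))\<^sup>2"
      unfolding e_def
      by (rule GDERIV_linearization[OF convex_\<Omega>, where D = D])
        (use inv vv_\<Omega>[OF z\<Omega>] z\<Omega> M in \<open>auto simp: inv_def\<close>)
    also have "\<dots> \<le> M * ((\<kappa> + 1) * \<tau>)\<^sup>2"
      using norm_vv[OF that] M by (intro mult_left_mono power_mono) auto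
    finally show ?thesis .
  qed
  define E where "E = (\<Sum>j\<in>idx. cc \<tau> j (sh z) *\<^sub>R e j)"
  have "norm E \<le> (1 + \<tau> * B) * (M * ((\<kappa> + 1) * \<tau>)\<^sup>2)"
    unfolding E_def by (rule sum_cc_bound[OF shc]) (use e M in auto)
  also have "\<dots> \<le> 2 * (M * ((\<kappa> + 1) * \<tau>)\<^sup>2)"
    using \<tau> M by (intro mult_right_mono) auto
  finally have E: "\<bar>E\<bar> \<le> \<tau> * (\<tau> * (M * (2 * (\<kappa> + 1)\<^sup>2)))"
    by (simp add: power2_eq_square algebra_simps)
  have moment: "(\<Sum>j\<in>idx. cc \<tau> j (sh z) * (vv \<tau> j \<bullet> D z)) = \<tau> * (- (b (sh z) \<bullet> fst (D z)) + (1 + \<tau> * f (sh z)) * snd (D z))"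
    using arg_cong[OF cc_moment[of \<tau> "sh z"], of "\<lambda>v. v \<bullet> D z"]
    by (cases "D z") (simp add: inner_sum_left right_diff_distrib mult.assoc)
  have "\<phi> z = (\<Sum>j\<in>idx. cc \<tau> j (sh z) * \<phi> (z + vv \<tau> j)) + \<tau> * S z"
    using fix_eq True by (simp add: step_def)
  also have "(\<Sum>j\<in>idx. cc \<tau> j (sh z) * \<phi> (z + vv \<tau> j)) =
      (\<Sum>j\<in>idx. cc \<tau> j (sh z)) * \<phi> z + (\<Sum>j\<in>idx. cc \<tau> j (sh z) * (vv \<tau> j \<bullet> D z)) + E"
    unfolding E_def sum_distrib_right sum.distrib[symmetric] by (rule sum.cong) (auto simp: e_def algebra_simps)
  finally have "0 = \<tau> * (f (sh z) * \<phi> z - b (sh z) \<bullet> fst (D z) + (1 + \<tau> * f (sh z)) * snd (D z) + S z) + E"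
    unfolding cc_sum moment by (simp add: algebra_simps)
  then have "\<tau> * (f (sh z) * \<phi> z - b (sh z) \<bullet> fst (D z) + (1 + \<tau> * f (sh z)) * snd (D z) + S z) = - E"
    by linarith
  then have "f (sh z) * \<phi> z - b (sh z) \<bullet> fst (D z) + (1 + \<tau> * f (sh z)) * snd (D z) + S z = - E / \<tau>"
    using \<tau> by (simp add: field_simps)
  then have eq: "snd (D z) - b z \<bullet> fst (D z) + f z * \<phi> z + S z =
      - E / \<tau> + (f z - f (sh z)) * \<phi> z - (b z - b (sh z)) \<bullet> fst (D z) - \<tau> * (f (sh z) * snd (D z))"
    by (simp add: algebra_simps)
  have 1: "\<bar>- E / \<tau>\<bar> \<le> \<tau> * (M * (2 * (\<kappa> + 1)\<^sup>2))"
    using E \<tau>(1) by (simp add: abs_divide pos_divide_le_eq mult.commute)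
  have nsh: "norm (z - sh z) = \<tau>" using \<tau> by (simp add: sh_def norm_Pair)
  have 2: "\<bar>(f z - f (sh z)) * \<phi> z\<bar> \<le> (B * \<tau>) * M"
    unfolding abs_mult using f_lip[OF z shc] b(1) B \<tau> by (intro mult_mono) (auto simp: nsh)
  have fD: "norm (fst (D z)) \<le> M" "\<bar>snd (D z)\<bar> \<le> M"
    using order.trans[OF norm_fst_le[of "fst (D z)" "snd (D z)"]] order.trans[OF norm_snd_le[of "snd (D z)" "fst (D z)"]] b(2)
    by auto
  have "norm (b z - b (sh z)) \<le> (\<Sum>i\<in>Basis. \<bar>(b z - b (sh z)) \<bullet> i\<bar>)" by (rule norm_le_l1)
  also have "\<dots> \<le> (\<Sum>i\<in>(Basis :: 'a set). B * \<tau>)"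
    using b_lip[OF _ z shc] by (intro sum_mono) (auto simp: inner_diff_left nsh)
  finally have nb: "norm (b z - b (sh z)) \<le> dd * (B * \<tau>)" by (simp add: dd_def)
  have "\<bar>(b z - b (sh z)) \<bullet> fst (D z)\<bar> \<le> norm (b z - b (sh z)) * norm (fst (D z))"
    by (rule Cauchy_Schwarz_ineq2)
  also have "\<dots> \<le> (dd * (B * \<tau>)) * M"
    using nb fD dd B \<tau> by (intro mult_mono) auto
  finally have 3: "\<bar>(b z - b (sh z)) \<bullet> fst (D z)\<bar> \<le> (dd * (B * \<tau>)) * M" .
  have "\<bar>f (sh z) * snd (D z)\<bar> \<le> B * M"
    unfolding abs_mult using f_bound[OF shc] fD B by (intro mult_mono) auto
  then have 4: "\<bar>\<tau> * (f (sh z) * snd (D z))\<bar> \<le> \<tau> * (B * M)"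
    using \<tau> by (simp add: abs_mult)
  have "\<tau> * (M * (2 * B + dd * B + 2 * (\<kappa> + 1)\<^sup>2)) =
      \<tau> * (M * (2 * (\<kappa> + 1)\<^sup>2)) + (B * \<tau>) * M + (dd * (B * \<tau>)) * M + \<tau> * (B * M)"
    by (simp add: algebra_simps)
  with 1 2 3 4 show ?thesis unfolding eq by linarith
qed

end

section \<open>Energy estimate for the scheme\<close>

lemma bounded_support_integrable:
  fixes F :: "'a::euclidean_space \<Rightarrow> real"
  assumes "F \<in> borel_measurable borel" "\<And>z. \<bar>F z\<bar> \<le> C" "bounded W" "\<And>z. z \<notin> W \<Longrightarrow> F z = 0"
  shows "integrable lborel F"
proof -
  obtain r where r: "W \<subseteq> cball 0 r"
    using assms(3) by (auto simp: bounded_iff subset_iff)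
  show ?thesis
  proof (rule Bochner_Integration.integrable_bound)
    show "integrable lborel (\<lambda>z::'a. indicator (cball 0 r) z * C :: real)"
      by (intro integrable_mult_left integrable_real_indicator emeasure_lborel_cball_finite) auto
    show "AE z in lborel. norm (F z) \<le> norm (indicator (cball 0 r) z * C)"
    proof (rule AE_I2)
      fix z
      show "norm (F z) \<le> norm (indicator (cball 0 r) z * C)"
        using assms(2)[of z] assms(4)[of z] r by (cases "z \<in> cball 0 r") (auto simp: subset_iff)
    qed
  qed (use assms(1) in simp)
qed

text \<open>The increment is the integral of the directional derivative over the segment from
  \<open>x\<close> to \<open>x + a\<close>; Jensen on the unit interval moves the square
  inside.\<close>

lemma translation_L2_pointwise:
  fixes \<phi> :: "'a::euclidean_space \<times> real \<Rightarrow> real" and D :: "'a \<times> real \<Rightarrow> 'a \<times> real"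
  assumes D: "\<And>x. GDERIV \<phi> (x, t) :> D (x, t)" and Dc: "continuous_on (UNIV \<times> {t}) D"
  shows "ennreal ((\<phi> (x + a, t) - \<phi> (x, t))\<^sup>2) \<le>
    (\<integral>\<^sup>+r. ennreal (indicator {0..1::real} r * ((norm a)\<^sup>2 * (norm (fst (D (x + r *\<^sub>R a, t))))\<^sup>2)) \<partial>lborel)"
proof -
  define g where "g = (\<lambda>r. a \<bullet> fst (D (x + r *\<^sub>R a, t)))"
  have cD: "continuous_on {0..1} (\<lambda>r. D (x + r *\<^sub>R a, t))"
    by (rule continuous_on_compose2[OF Dc]) (auto intro!: continuous_intros)
  have gc: "continuous_on {0..1} g"
    unfolding g_def by (intro continuous_intros cD)
  have [measurable]: "(\<lambda>r. indicator {0..1} r * g r) \<in> borel_measurable borel"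
    using borel_measurable_continuous_on_indicator[OF _ gc] by simp
  have d: "((\<lambda>r. \<phi> (x + r *\<^sub>R a, t)) has_real_derivative g r) (at r within {0..1})" for r
  proof -
    have "((\<lambda>r. (x + r *\<^sub>R a, t)) has_derivative (\<lambda>h. (h *\<^sub>R a, 0))) (at r)"
      by (auto intro!: derivative_eq_intros)
    from has_derivative_compose[OF this D[unfolded gderiv_def]]
    have "((\<lambda>r. \<phi> (x + r *\<^sub>R a, t)) has_derivative (\<lambda>h. (h *\<^sub>R a, 0) \<bullet> D (x + r *\<^sub>R a, t))) (at r)" .
    then show ?thesis
      unfolding has_field_derivative_def g_def
      by (auto simp: inner_prod_def mult_commute_abs intro: has_derivative_at_withinI)
  qed
  have "\<phi> (x + a, t) - \<phi> (x, t) = (LINT r|lborel. indicator {0..1} r *\<^sub>R g r)"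
    using integral_FTC_Icc[of 0 1 "\<lambda>r. \<phi> (x + r *\<^sub>R a, t)" g] d gc
    by (simp add: has_real_derivative_iff_has_vector_derivative)
  moreover have "(\<lambda>r. indicator {0..1::real} r *\<^sub>R g r) = (\<lambda>r. indicator {0..1} r * (indicator {0..1} r * g r))"
    by (auto simp: fun_eq_iff indicator_def)
  ultimately have eq: "\<phi> (x + a, t) - \<phi> (x, t) = (LINT r|lborel. indicator {0..1} r * (indicator {0..1} r * g r))"
    by (simp only:)
  have gi: "set_integrable lborel {0..1} (\<lambda>r. (g r)\<^sup>2)"
    by (intro borel_integrable_compact[unfolded set_integrable_def[symmetric]] continuous_intros gc) auto
  have eq2: "(\<lambda>r. indicator {0..1} r * (indicator {0..1} r * g r)\<^sup>2) = (\<lambda>r. indicator {0..1} r *\<^sub>R (g r)\<^sup>2)"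
    by (auto simp: indicator_def fun_eq_iff)
  have "(LINT r|lborel. indicator {0..1::real} r * (indicator {0..1} r * g r))\<^sup>2 \<le>
      (LINT r|lborel. indicator {0..1} r * (indicator {0..1} r * g r)\<^sup>2)"
    by (rule weighted_Jensen_square(2))
      (use gi in \<open>auto simp: eq2 set_integrable_def\<close>)
  then have "ennreal ((\<phi> (x + a, t) - \<phi> (x, t))\<^sup>2) \<le> ennreal (LINT r|lborel. indicator {0..1} r *\<^sub>R (g r)\<^sup>2)"
    unfolding eq eq2 by (rule ennreal_leI)
  also have "\<dots> = (\<integral>\<^sup>+r. ennreal (indicator {0..1} r *\<^sub>R (g r)\<^sup>2) \<partial>lborel)"
    using gi by (intro nn_integral_eq_integral[symmetric]) (auto simp: set_integrable_def)
  also have "\<dots> \<le> (\<integral>\<^sup>+r. ennreal (indicator {0..1::real} r * ((norm a)\<^sup>2 * (norm (fst (D (x + r *\<^sub>R a, t))))\<^sup>2)) \<partial>lborel)"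
  proof (rule nn_integral_mono, rule ennreal_leI)
    fix r :: real
    have "\<bar>g r\<bar> \<le> norm a * norm (fst (D (x + r *\<^sub>R a, t)))"
      unfolding g_def by (rule Cauchy_Schwarz_ineq2)
    then have "(g r)\<^sup>2 \<le> (norm a * norm (fst (D (x + r *\<^sub>R a, t))))\<^sup>2"
      by (subst abs_le_square_iff[symmetric]) (simp add: abs_mult)
    then show "indicator {0..1} r *\<^sub>R (g r)\<^sup>2 \<le> indicator {0..1} r * ((norm a)\<^sup>2 * (norm (fst (D (x + r *\<^sub>R a, t))))\<^sup>2)"
      by (simp add: power_mult_distrib indicator_def)
  qed
  finally show ?thesis .
qed

text \<open>Tonelli exchanges the segment parameter with space-time. The weight sees only time and
  Lebesgue measure is translation invariant, so every spatial translate has the same integral. A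
  long translation will give the Poincare inequality, a short one bounds for difference
  quotients.\<close>

lemma translation_L2:
  fixes \<phi> :: "'a::euclidean_space \<times> real \<Rightarrow> real" and D :: "'a \<times> real \<Rightarrow> 'a \<times> real"
  assumes D: "\<And>z. H (snd z) \<noteq> 0 \<Longrightarrow> GDERIV \<phi> z :> D z"
    and Dc: "\<And>t. H t \<noteq> 0 \<Longrightarrow> continuous_on (UNIV \<times> {t}) D"
    and H: "\<And>t. 0 \<le> H t"
    and [measurable]: "H \<in> borel_measurable borel" "(\<lambda>z. H (snd z) * (norm (fst (D z)))\<^sup>2) \<in> borel_measurable borel"
    and i: "integrable lborel (\<lambda>z. H (snd z) * (norm (fst (D z)))\<^sup>2)"
    and i': "integrable lborel (\<lambda>z. H (snd z) * (\<phi> (z + (a, 0)) - \<phi> z)\<^sup>2)"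
  shows "(LINT z|lborel. H (snd z) * (\<phi> (z + (a, 0)) - \<phi> z)\<^sup>2) \<le>
    (norm a)\<^sup>2 * (LINT z|lborel. H (snd z) * (norm (fst (D z)))\<^sup>2)"
proof -
  define U where "U = (\<lambda>z. H (snd z) * (norm (fst (D z)))\<^sup>2)"
  have [measurable]: "U \<in> borel_measurable borel" unfolding U_def by measurable
  have U0: "0 \<le> U z" for z using H by (simp add: U_def)
  have "ennreal (LINT z|lborel. H (snd z) * (\<phi> (z + (a, 0)) - \<phi> z)\<^sup>2) =
      (\<integral>\<^sup>+z. ennreal (H (snd z) * (\<phi> (z + (a, 0)) - \<phi> z)\<^sup>2) \<partial>lborel)"
    by (rule nn_integral_eq_integral[symmetric, OF i']) (simp add: H)
  also have "\<dots> \<le> (\<integral>\<^sup>+z. \<integral>\<^sup>+r. ennreal (indicator {0..1::real} r * ((norm a)\<^sup>2 * U (z + (r *\<^sub>R a, 0)))) \<partial>lborel \<partial>lborel)"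
  proof (rule nn_integral_mono)
    fix z :: "'a \<times> real"
    obtain x t where z: "z = (x, t)" by (cases z)
    show "ennreal (H (snd z) * (\<phi> (z + (a, 0)) - \<phi> z)\<^sup>2) \<le>
        (\<integral>\<^sup>+r. ennreal (indicator {0..1::real} r * ((norm a)\<^sup>2 * U (z + (r *\<^sub>R a, 0)))) \<partial>lborel)"
    proof (cases "H t = 0")
      case False
      have eqf: "ennreal (indicator {0..1} r * ((norm a)\<^sup>2 * U (z + (r *\<^sub>R a, 0)))) =
          ennreal (H t) * ennreal (indicator {0..1::real} r * ((norm a)\<^sup>2 * (norm (fst (D (x + r *\<^sub>R a, t))))\<^sup>2))" for r
        using H by (simp add: z U_def ennreal_mult'[symmetric] mult_ac)
      have meas: "(\<lambda>r. indicator {0..1::real} r * (norm (fst (D (x + r *\<^sub>R a, t))))\<^sup>2) \<in> borel_measurable borel"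
      proof -
        have "continuous_on {0..1} (\<lambda>r. D (x + r *\<^sub>R a, t))"
          by (rule continuous_on_compose2[OF Dc[OF False]]) (auto intro!: continuous_intros)
        then have "continuous_on {0..1} (\<lambda>r. (norm (fst (D (x + r *\<^sub>R a, t))))\<^sup>2)"
          by (intro continuous_intros)
        from borel_measurable_continuous_on_indicator[OF _ this] show ?thesis by simp
      qed
      have [measurable]: "(\<lambda>r. indicator {0..1::real} r * ((norm a)\<^sup>2 * (norm (fst (D (x + r *\<^sub>R a, t))))\<^sup>2)) \<in> borel_measurable borel"
        using borel_measurable_times[OF borel_measurable_const[of "(norm a)\<^sup>2"] meas]
        by (simp only: mult.left_commute[of "(norm a)\<^sup>2"])
      have "ennreal (H (snd z) * (\<phi> (z + (a, 0)) - \<phi> z)\<^sup>2) = ennreal (H t) * ennreal ((\<phi> (x + a, t) - \<phi> (x, t))\<^sup>2)"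
        using H by (simp add: z ennreal_mult')
      also have "\<dots> \<le> ennreal (H t) * (\<integral>\<^sup>+r. ennreal (indicator {0..1::real} r * ((norm a)\<^sup>2 * (norm (fst (D (x + r *\<^sub>R a, t))))\<^sup>2)) \<partial>lborel)"
        by (intro mult_left_mono translation_L2_pointwise Dc) (use D False in auto)
      also have "\<dots> = (\<integral>\<^sup>+r. ennreal (H t) * ennreal (indicator {0..1::real} r * ((norm a)\<^sup>2 * (norm (fst (D (x + r *\<^sub>R a, t))))\<^sup>2)) \<partial>lborel)"
        by (rule nn_integral_cmult[symmetric]) measurable
      finally show ?thesis unfolding eqf .
    qed (simp add: z)
  qed
  also have "\<dots> = (\<integral>\<^sup>+r. \<integral>\<^sup>+z. ennreal (indicator {0..1::real} r * ((norm a)\<^sup>2 * U (z + (r *\<^sub>R a, 0)))) \<partial>lborel \<partial>lborel)"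
    by (rule lborel_pair.Fubini'[symmetric]) measurable
  also have "\<dots> = (\<integral>\<^sup>+r. ennreal (indicator {0..1::real} r * ((norm a)\<^sup>2 * (LINT z|lborel. U z))) \<partial>lborel)"
  proof (rule nn_integral_cong)
    fix r :: real
    have iU: "integrable lborel (\<lambda>z. U (z + (r *\<^sub>R a, 0)))"
      using i lborel_translate(2)[of U "(r *\<^sub>R a, 0)"] by (simp add: U_def)
    show "(\<integral>\<^sup>+z. ennreal (indicator {0..1::real} r * ((norm a)\<^sup>2 * U (z + (r *\<^sub>R a, 0)))) \<partial>lborel) =
        ennreal (indicator {0..1::real} r * ((norm a)\<^sup>2 * (LINT z|lborel. U z)))"
      using iU U0 lborel_translate(1)[of U "(r *\<^sub>R a, 0)"]
      by (subst nn_integral_eq_integral) auto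
  qed
  also have "\<dots> = ennreal ((norm a)\<^sup>2 * (LINT z|lborel. U z))"
    using U0 by (subst nn_integral_eq_integral) auto
  finally show ?thesis
    using U0 by (subst (asm) ennreal_le_iff) (auto simp: U_def)
qed

lemma integrable_nonneg_bound:
  fixes F G :: "'a::euclidean_space \<Rightarrow> real"
  assumes "integrable lborel G" "F \<in> borel_measurable borel" "\<And>z. 0 \<le> F z" "\<And>z. F z \<le> G z"
  shows "integrable lborel F"
proof (rule Bochner_Integration.integrable_bound[OF assms(1)])
  show "AE z in lborel. norm (F z) \<le> norm (G z)"
  proof (rule AE_I2)
    fix z show "norm (F z) \<le> norm (G z)"
      using assms(3)[of z] assms(4)[of z] by simp
  qed
qed (use assms(2) in simp)

text \<open>Setting the solution to 0 outside \<Omega> makes it globally bounded and Borel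
  measurable. The step only looks forward in time, so the equations on \<Omega> are
  unaffected.\<close>

lemma (in scheme) scheme_solution_ext:
  obtains \<phi> D where "inv MM \<phi> D" "\<And>z. z \<in> \<Omega> \<Longrightarrow> \<phi> z = step \<phi> z" "\<And>z. z \<in> \<Omega> \<Longrightarrow> D z = stepD \<phi> D z"
    "\<And>z. R + \<kappa> * (T + 2) < norm (fst z) \<Longrightarrow> \<phi> z = 0 \<and> D z = 0"
    "\<And>z. z \<notin> \<Omega> \<Longrightarrow> \<phi> z = 0 \<and> D z = 0"
proof -
  obtain \<phi> D where 1: "inv MM \<phi> D" "\<And>z. z \<in> \<Omega> \<Longrightarrow> \<phi> z = step \<phi> z" "\<And>z. z \<in> \<Omega> \<Longrightarrow> D z = stepD \<phi> D z"
    "\<And>z. R + \<kappa> * (T + 2) < norm (fst z) \<Longrightarrow> \<phi> z = 0 \<and> D z = 0"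
    by (rule scheme_solution) blast
  define \<phi>' where "\<phi>' = (\<lambda>z. if z \<in> \<Omega> then \<phi> z else 0)"
  define D' where "D' = (\<lambda>z. if z \<in> \<Omega> then D z else 0)"
  have eq: "\<phi>' z = \<phi> z" "D' z = D z" if "z \<in> \<Omega>" for z
    using that by (auto simp: \<phi>'_def D'_def)
  have s: "step \<phi>' z = step \<phi> z" "stepD \<phi>' D' z = stepD \<phi> D z" if "z \<in> \<Omega>" for z
    using eq[OF vv_\<Omega>[OF that]] by (simp_all add: step_def stepD_def)
  have G: "GDERIV \<phi>' z :> D' z" if "z \<in> \<Omega>" for z
  proof -
    have "(\<phi> has_derivative (\<lambda>h. h \<bullet> D' z)) (at z)"
      using 1(1) that by (simp add: inv_def gderiv_def eq)
    then show ?thesis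
      unfolding gderiv_def by (rule has_derivative_transform_within_open[OF _ open_\<Omega> that]) (simp add: eq)
  qed
  have i: "inv MM \<phi>' D'"
    unfolding inv_def
  proof (intro conjI ballI allI impI)
    show "0 \<le> MM" using 1(1) by (simp add: inv_def)
    fix z z' assume "z \<in> \<Omega>" "z' \<in> \<Omega>"
    then show "norm (D' z - D' z') \<le> MM * norm (z - z')" using 1(1) by (simp add: inv_def eq)
  next
    fix z assume z: "z \<in> \<Omega>"
    then show "GDERIV \<phi>' z :> D' z" by (rule G)
    show "\<bar>\<phi>' z\<bar> \<le> MM" "norm (D' z) \<le> MM" using 1(1) z by (auto simp: inv_def eq)
  next
    fix z :: "'a \<times> real" assume "T - \<epsilon> \<le> snd z"
    then have "\<phi> z = 0 \<and> D z = 0" using 1(1) unfolding inv_def by blast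
    then show "\<phi>' z = 0" "D' z = 0" by (auto simp: \<phi>'_def D'_def)
  qed
  show thesis
  proof (rule that[OF i])
    show "\<phi>' z = step \<phi>' z" "D' z = stepD \<phi>' D' z" if "z \<in> \<Omega>" for z
      using eq[OF that] s[OF that] 1(2,3)[OF that] by simp_all
    show "\<phi>' z = 0 \<and> D' z = 0" if "R + \<kappa> * (T + 2) < norm (fst z)" for z
      unfolding \<phi>'_def D'_def using 1(4)[OF that] by simp
    show "\<phi>' z = 0 \<and> D' z = 0" if "z \<notin> \<Omega>" for z
      unfolding \<phi>'_def D'_def using that by simp
  qed
qed

locale energy = scheme T B b f Db Df \<tau> \<epsilon> s R S DS
  for T B :: real and b :: "'a::euclidean_space \<times> real \<Rightarrow> 'a" and f :: "'a \<times> real \<Rightarrow> real"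
    and Db :: "'a \<Rightarrow> 'a \<times> real \<Rightarrow> 'a \<times> real" and Df :: "'a \<times> real \<Rightarrow> 'a \<times> real"
    and \<tau> \<epsilon> s R :: real and S :: "'a \<times> real \<Rightarrow> real" and DS :: "'a \<times> real \<Rightarrow> 'a \<times> real" +
  fixes m :: "'a \<times> real \<Rightarrow> real" and \<delta> Mm :: real and \<phi> :: "'a \<times> real \<Rightarrow> real" and D :: "'a \<times> real \<Rightarrow> 'a \<times> real"
  assumes \<delta>: "0 < \<delta>" and m_bounds: "\<And>z. z \<in> cyl T \<Longrightarrow> \<delta> \<le> m z \<and> m z \<le> Mm"
    and m_lip: "\<And>z z'. z \<in> cyl T \<Longrightarrow> z' \<in> cyl T \<Longrightarrow> \<bar>m z - m z'\<bar> \<le> Mm * norm (z - z')"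
    and R: "0 \<le> R" and inv: "inv MM \<phi> D" and \<phi>_eq: "\<And>z. z \<in> \<Omega> \<Longrightarrow> \<phi> z = step \<phi> z"
    and D_eq: "\<And>z. z \<in> \<Omega> \<Longrightarrow> D z = stepD \<phi> D z"
    and far: "\<And>z. R + \<kappa> * (T + 2) < norm (fst z) \<Longrightarrow> \<phi> z = 0 \<and> D z = 0"
    and off: "\<And>z. z \<notin> \<Omega> \<Longrightarrow> \<phi> z = 0 \<and> D z = 0"
begin

definition R1 :: real where "R1 = R + \<kappa> * (T + 2)"

lemma R1: "0 \<le> R1" using R \<kappa> T by (simp add: R1_def)

lemma X_\<Omega>: "z \<in> cyl T \<Longrightarrow> z \<in> \<Omega>" using \<tau> by (simp add: cyl_iff \<Omega>_def)

lemma MM: "0 \<le> MM" using inv by (simp add: inv_def)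

lemma \<phi>_bound: "\<bar>\<phi> z\<bar> \<le> MM" and D_bound: "norm (D z) \<le> MM"
  using inv off[of z] MM by (cases "z \<in> \<Omega>"; auto simp: inv_def)+

lemma fstD_bound: "norm (fst (D z)) \<le> MM"
  using order.trans[OF norm_fst_le[of "fst (D z)" "snd (D z)"]] D_bound[of z] by simp

lemma late: "T \<le> snd z \<Longrightarrow> \<phi> z = 0 \<and> D z = 0"
proof -
  assume "T \<le> snd z"
  then have "T - \<epsilon> \<le> snd z" using \<tau> by linarith
  then show ?thesis using inv unfolding inv_def by blast
qed

lemma D_cont: "continuous_on \<Omega> D"
proof (rule continuous_onI)
  fix x e assume x: "x \<in> \<Omega>" and e: "(0::real) < e"
  show "\<exists>d>0. \<forall>x'\<in>\<Omega>. dist x' x < d \<longrightarrow> dist (D x') (D x) \<le> e"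
  proof (intro exI conjI ballI impI)
    show "0 < e / (MM + 1)" using e MM by simp
    fix x' assume x': "x' \<in> \<Omega>" "dist x' x < e / (MM + 1)"
    have "dist (D x') (D x) \<le> MM * dist x' x" using inv x x' by (simp add: inv_def dist_norm)
    also have "\<dots> \<le> (MM + 1) * (e / (MM + 1))" using MM x'(2) by (intro mult_mono) auto
    also have "\<dots> = e" using MM by simp
    finally show "dist (D x') (D x) \<le> e" .
  qed
qed

lemma \<phi>_cont: "continuous_on \<Omega> \<phi>"
  using inv by (auto simp: inv_def gderiv_def intro!: continuous_at_imp_continuous_on has_derivative_continuous)

lemma meas [measurable]: "\<phi> \<in> borel_measurable borel" "D \<in> borel_measurable borel"
proof -
  have \<Omega>: "\<Omega> \<in> sets borel" using open_\<Omega> by simp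
  have "(\<lambda>z. indicator \<Omega> z *\<^sub>R \<phi> z) = \<phi>" "(\<lambda>z. indicator \<Omega> z *\<^sub>R D z) = D"
    using off by (auto simp: indicator_def fun_eq_iff)
  then show "\<phi> \<in> borel_measurable borel" "D \<in> borel_measurable borel"
    using borel_measurable_continuous_on_indicator[OF \<Omega> \<phi>_cont]
      borel_measurable_continuous_on_indicator[OF \<Omega> D_cont] by simp_all
qed

lemma meas_fstD [measurable]: "(\<lambda>z. fst (D z)) \<in> borel_measurable borel"
  by (rule borel_measurable_continuous_on[OF continuous_on_fst[OF continuous_on_id] meas(2)])

lemma meas_snd [measurable]: "(\<lambda>z::'a \<times> real. snd z) \<in> borel_measurable borel"
  by (intro borel_measurable_continuous_onI continuous_intros)

lemma X_meas [measurable]: "(cyl T :: ('a \<times> real) set) \<in> sets borel"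
  by (rule borel_open[OF open_cyl])

text \<open>The time weight of the energy. Shifting it back by one step multiplies the exponential
  by \<open>exp (- l * \<tau>)\<close>, a gain of order \<tau> that a large \<open>l\<close> sets
  against all losses of that order.\<close>

definition H :: "real \<Rightarrow> real \<Rightarrow> real" where "H l t = indicator {0<..<T} t * exp (l * t)"
definition mX :: "'a \<times> real \<Rightarrow> real" where "mX z = indicator (cyl T) z * m z"
definition cX :: "'a \<times> real \<Rightarrow> 'a \<times> real \<Rightarrow> real" where "cX j z = indicator (cyl T) z * cc \<tau> j z"
definition U :: "'a \<times> real \<Rightarrow> real" where "U z = (norm (fst (D z)))\<^sup>2"

lemma H_meas [measurable]: "H l \<in> borel_measurable borel"
  unfolding H_def by measurable

lemma H_nonneg: "0 \<le> H l t" by (simp add: H_def)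

lemma H_le: "H l t \<le> exp (\<bar>l\<bar> * T)"
proof (cases "0 < t \<and> t < T")
  case True
  have "l * t \<le> \<bar>l\<bar> * T" using True by (intro mult_mono) auto
  then show ?thesis using True by (simp add: H_def)
qed (auto simp: H_def)

lemma mX_meas [measurable]: "mX \<in> borel_measurable borel"
proof -
  have "continuous_on (cyl T) m"
  proof (rule continuous_onI)
    fix x :: "'a \<times> real" and e :: real assume x: "x \<in> cyl T" and e: "0 < e"
    have Mm: "0 \<le> Mm" using m_bounds[OF x] \<delta> by linarith
    show "\<exists>d>0. \<forall>x'\<in>cyl T. dist x' x < d \<longrightarrow> dist (m x') (m x) \<le> e"
    proof (intro exI conjI ballI impI)
      show "0 < e / (Mm + 1)" using e Mm by simp
      fix x' :: "'a \<times> real" assume x': "x' \<in> cyl T" "dist x' x < e / (Mm + 1)"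
      have "dist (m x') (m x) \<le> Mm * dist x' x" using m_lip x x' by (simp add: dist_norm)
      also have "\<dots> \<le> (Mm + 1) * (e / (Mm + 1))" using Mm x'(2) by (intro mult_mono) auto
      also have "\<dots> = e" using Mm by simp
      finally show "dist (m x') (m x) \<le> e" .
    qed
  qed
  from borel_measurable_continuous_on_indicator[OF X_meas this]
  show ?thesis by (simp add: mX_def[abs_def])
qed

lemma cX_meas [measurable]: "j \<in> idx \<Longrightarrow> cX j \<in> borel_measurable borel"
proof -
  assume j: "j \<in> idx"
  have "continuous_on (cyl T) (cc \<tau> j)"
    using cc_deriv[OF j] by (auto simp: gderiv_def intro!: continuous_at_imp_continuous_on has_derivative_continuous)
  from borel_measurable_continuous_on_indicator[OF X_meas this]
  show ?thesis by (simp add: cX_def[abs_def])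
qed

lemma Mm: "0 \<le> Mm"
  using m_bounds[of "(0, T / 2)"] \<delta> T by (auto simp: cyl_iff)

lemma mX_bounds: "0 \<le> mX z" "mX z \<le> Mm"
  using m_bounds[of z] \<delta> Mm by (auto simp: mX_def indicator_def)

lemma U_meas [measurable]: "U \<in> borel_measurable borel"
  unfolding U_def by measurable

lemma U_bound: "0 \<le> U z" "U z \<le> MM\<^sup>2"
  using fstD_bound[of z] by (auto simp: U_def intro: power_mono)

lemma integrableX:
  fixes F :: "'a \<times> real \<Rightarrow> real"
  assumes [measurable]: "F \<in> borel_measurable borel" and F: "\<And>z. z \<in> cyl T \<Longrightarrow> norm (fst z) \<le> r \<Longrightarrow> \<bar>F z\<bar> \<le> C"
    and "\<And>z. r < norm (fst z) \<Longrightarrow> F z = 0" "\<And>z. z \<notin> cyl T \<Longrightarrow> F z = 0" "0 \<le> C"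
  shows "integrable lborel F"
proof (rule bounded_support_integrable[where W = "cball 0 r \<times> {0..T}"])
  show "bounded (cball (0::'a) r \<times> {0..T})" by (intro bounded_Times) auto
  show "\<bar>F z\<bar> \<le> C" for z
    using assms(2,3,4)[of z] assms(5) by (cases "z \<in> cyl T \<and> norm (fst z) \<le> r") (auto simp: not_le)
  show "F z = 0" if "z \<notin> cball 0 r \<times> {0..T}" for z
    using that assms(3,4)[of z] by (cases z) (auto simp: cyl_iff not_le)
qed fact

lemma H_X: "z \<notin> cyl T \<Longrightarrow> H l (snd z) = 0" "z \<in> cyl T \<Longrightarrow> H l (snd z) = exp (l * snd z)"
  by (auto simp: H_def cyl_iff indicator_def)

definition Z :: "real \<Rightarrow> real" where "Z l = (LINT z|lborel. H l (snd z) * U z)"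
definition Y :: "real \<Rightarrow> real" where "Y l = (LINT z|lborel. H l (snd z) * mX z * U z)"

lemma U_far: "R1 < norm (fst z) \<Longrightarrow> U z = 0"
  using far[of z] by (simp add: U_def R1_def)

lemma \<phi>_far: "R1 < norm (fst z) \<Longrightarrow> \<phi> z = 0"
  using far[of z] by (simp add: R1_def)

lemma HU_integrable: "integrable lborel (\<lambda>z. H l (snd z) * U z)"
proof (rule integrableX[where r = R1 and C = "exp (\<bar>l\<bar> * T) * MM\<^sup>2"])
  show "\<bar>H l (snd z) * U z\<bar> \<le> exp (\<bar>l\<bar> * T) * MM\<^sup>2" for z
    unfolding abs_mult using H_le[of l "snd z"] H_nonneg U_bound[of z] by (intro mult_mono) auto
qed (auto simp: U_far H_X)

lemma HmU_integrable: "integrable lborel (\<lambda>z. H l (snd z) * mX z * U z)"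
proof (rule integrableX[where r = R1 and C = "exp (\<bar>l\<bar> * T) * Mm * MM\<^sup>2"])
  show "\<bar>H l (snd z) * mX z * U z\<bar> \<le> exp (\<bar>l\<bar> * T) * Mm * MM\<^sup>2" for z
    unfolding abs_mult using H_le[of l "snd z"] H_nonneg U_bound[of z] mX_bounds[of z] Mm by (intro mult_mono) auto
qed (auto simp: U_far H_X Mm)

lemma Z_nonneg: "0 \<le> Z l"
  unfolding Z_def using H_nonneg U_bound by (intro Bochner_Integration.integral_nonneg mult_nonneg_nonneg) auto

lemma Z_le_Y: "\<delta> * Z l \<le> Y l"
proof -
  have "\<delta> * Z l = (LINT z|lborel. \<delta> * (H l (snd z) * U z))" by (simp add: Z_def)
  also have "\<dots> \<le> Y l"
    unfolding Y_def
  proof (rule integral_mono)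
    fix z :: "'a \<times> real"
    show "\<delta> * (H l (snd z) * U z) \<le> H l (snd z) * mX z * U z"
    proof (cases "z \<in> cyl T")
      case True
      then have "\<delta> \<le> mX z" using m_bounds by (simp add: mX_def)
      then have "\<delta> * (H l (snd z) * U z) \<le> mX z * (H l (snd z) * U z)"
        using H_nonneg U_bound by (intro mult_right_mono) auto
      then show ?thesis by (simp add: mult_ac)
    qed (simp add: H_X)
  qed (use HU_integrable HmU_integrable in auto)
  finally show ?thesis .
qed

lemma translation_estimate:
  "(LINT z|lborel. H l (snd z) * (\<phi> (z + (a, 0)) - \<phi> z)\<^sup>2) \<le> (norm a)\<^sup>2 * Z l"
  and translation_integrable: "integrable lborel (\<lambda>z. H l (snd z) * (\<phi> (z + (a, 0)) - \<phi> z)\<^sup>2)"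
proof -
  show i: "integrable lborel (\<lambda>z. H l (snd z) * (\<phi> (z + (a, 0)) - \<phi> z)\<^sup>2)"
  proof (rule integrableX[where r = "R1 + norm a" and C = "exp (\<bar>l\<bar> * T) * (2 * MM)\<^sup>2"])
    show "\<bar>H l (snd z) * (\<phi> (z + (a, 0)) - \<phi> z)\<^sup>2\<bar> \<le> exp (\<bar>l\<bar> * T) * (2 * MM)\<^sup>2" for z
    proof -
      have "\<bar>\<phi> (z + (a, 0)) - \<phi> z\<bar> \<le> \<bar>2 * MM\<bar>"
        using \<phi>_bound[of z] \<phi>_bound[of "z + (a, 0)"] by linarith
      then have "(\<phi> (z + (a, 0)) - \<phi> z)\<^sup>2 \<le> (2 * MM)\<^sup>2" by (simp only: abs_le_square_iff)
      then show ?thesis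
        unfolding abs_mult using H_le[of l "snd z"] H_nonneg by (intro mult_mono) auto
    qed
    show "H l (snd z) * (\<phi> (z + (a, 0)) - \<phi> z)\<^sup>2 = 0" if z: "R1 + norm a < norm (fst z)" for z
    proof -
      have "norm (fst z) \<le> norm (fst z + a) + norm a"
        using norm_triangle_ineq4[of "fst z + a" a] by simp
      moreover have "0 \<le> norm a" by simp
      ultimately have "R1 < norm (fst z)" "R1 < norm (fst (z + (a, 0)))"
        using z by (simp_all only: fst_add fst_conv)
      then show ?thesis using \<phi>_far by simp
    qed
  qed (auto simp: H_X)
  show "(LINT z|lborel. H l (snd z) * (\<phi> (z + (a, 0)) - \<phi> z)\<^sup>2) \<le> (norm a)\<^sup>2 * Z l"
    unfolding Z_def U_def
  proof (rule translation_L2[OF _ _ H_nonneg H_meas _ _ i])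
    fix z :: "'a \<times> real" assume "H l (snd z) \<noteq> 0"
    then have "z \<in> cyl T" using H_X(1) by blast
    then show "GDERIV \<phi> z :> D z" using inv X_\<Omega> unfolding inv_def by blast
  next
    fix t assume "H l t \<noteq> 0"
    then have "0 < t" by (auto simp: H_def indicator_def split: if_splits)
    then show "continuous_on (UNIV \<times> {t}) D"
      using \<tau> by (intro continuous_on_subset[OF D_cont]) (auto simp: \<Omega>_def)
  qed (use HU_integrable[of l] in \<open>auto simp: U_def\<close>)
qed

text \<open>The square of the length of the translation used in \<open>Poincare\<close>.\<close>

definition CP :: real where "CP = (2 * R1 + 1)\<^sup>2"

lemma H\<phi>_integrable: "integrable lborel (\<lambda>z. H l (snd z) * (\<phi> z)\<^sup>2)"
proof (rule integrableX[where r = R1 and C = "exp (\<bar>l\<bar> * T) * MM\<^sup>2"])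
  show "\<bar>H l (snd z) * (\<phi> z)\<^sup>2\<bar> \<le> exp (\<bar>l\<bar> * T) * MM\<^sup>2" for z
    unfolding abs_mult using H_le[of l "snd z"] H_nonneg \<phi>_bound[of z] power_mono[of "\<bar>\<phi> z\<bar>" MM 2]
    by (intro mult_mono) auto
qed (auto simp: \<phi>_far H_X)

text \<open>Translation by \<open>a\<close>, longer than the diameter of the support, makes \<open>\<phi> (z + (a, 0))\<close> vanish
  wherever \<open>\<phi> z\<close> does not.\<close>

lemma Poincare: "(LINT z|lborel. H l (snd z) * (\<phi> z)\<^sup>2) \<le> CP * Z l"
proof -
  obtain i :: 'a where i: "i \<in> Basis" using nonempty_Basis by blast
  define a where "a = (2 * R1 + 1) *\<^sub>R i"
  have na: "norm a = 2 * R1 + 1" using i R1 by (simp add: a_def)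
  have "(LINT z|lborel. H l (snd z) * (\<phi> z)\<^sup>2) \<le> (LINT z|lborel. H l (snd z) * (\<phi> (z + (a, 0)) - \<phi> z)\<^sup>2)"
  proof (rule integral_mono[OF H\<phi>_integrable translation_integrable])
    fix z :: "'a \<times> real"
    have "(\<phi> z)\<^sup>2 \<le> (\<phi> (z + (a, 0)) - \<phi> z)\<^sup>2"
    proof (cases "norm (fst z) \<le> R1")
      case True
      have "norm a \<le> norm (fst z + a) + norm (fst z)"
        using norm_triangle_ineq4[of "fst z + a" "fst z"] by simp
      then have "R1 < norm (fst (z + (a, 0)))" using True na R1 by simp
      then show ?thesis using \<phi>_far by simp
    qed (simp add: \<phi>_far)
    then show "H l (snd z) * (\<phi> z)\<^sup>2 \<le> H l (snd z) * (\<phi> (z + (a, 0)) - \<phi> z)\<^sup>2"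
      using H_nonneg by (intro mult_left_mono) auto
  qed
  also have "\<dots> \<le> CP * Z l"
    using translation_estimate[of l a] by (simp add: na CP_def)
  finally show ?thesis .
qed

text \<open>The weight grows with time, so reading it one step earlier makes it smaller. The
  exception is from time \<open>T\<close> on, where the indicator is 0 at \<open>z\<close> but may
  be 1 at the shifted point; there \<open>F\<close> vanishes.\<close>

lemma H_shift:
  assumes "0 \<le> l" "\<And>z. T \<le> snd z \<Longrightarrow> F z = 0" "\<And>z. 0 \<le> F z" "snd v = \<tau>"
  shows "H l (snd (z - v)) * F z \<le> H l (snd z) * F z"
proof (cases "T \<le> snd z")
  case False
  have "H l (snd (z - v)) \<le> H l (snd z)"
    using False \<tau>(1) assms(1,4) by (auto simp: H_def indicator_def mult_left_mono)
  then show ?thesis using assms(3) by (intro mult_right_mono)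
qed (simp add: assms(2))

lemma shifted_\<phi>_estimate:
  assumes l: "0 \<le> l" and j: "j \<in> idx"
  shows "integrable lborel (\<lambda>z. H l (snd z) * (\<phi> (z + vv \<tau> j))\<^sup>2)"
    and "(LINT z|lborel. H l (snd z) * (\<phi> (z + vv \<tau> j))\<^sup>2) \<le> CP * Z l"
proof -
  define F where "F = (\<lambda>z. H l (snd (z - vv \<tau> j)) * (\<phi> z)\<^sup>2)"
  have [measurable]: "F \<in> borel_measurable borel" unfolding F_def by measurable
  have le: "F z \<le> H l (snd z) * (\<phi> z)\<^sup>2" for z
    unfolding F_def by (rule H_shift[OF l, where F = "\<lambda>z. (\<phi> z)\<^sup>2"]) (use late in \<open>auto simp: snd_vv\<close>)
  have nn: "0 \<le> F z" for z using H_nonneg by (simp add: F_def)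
  have i: "integrable lborel F"
    by (rule integrable_nonneg_bound[OF H\<phi>_integrable[of l] _ nn le]) measurable
  have eq: "(\<lambda>z. F (z + vv \<tau> j)) = (\<lambda>z. H l (snd z) * (\<phi> (z + vv \<tau> j))\<^sup>2)"
    by (simp add: F_def)
  show "integrable lborel (\<lambda>z. H l (snd z) * (\<phi> (z + vv \<tau> j))\<^sup>2)"
    using lborel_translate(2)[of F "vv \<tau> j"] i by (simp add: eq)
  have "(LINT z|lborel. H l (snd z) * (\<phi> (z + vv \<tau> j))\<^sup>2) = (LINT z|lborel. F z)"
    using lborel_translate(1)[of F "vv \<tau> j"] by (simp add: eq)
  also have "\<dots> \<le> (LINT z|lborel. H l (snd z) * (\<phi> z)\<^sup>2)"
    by (rule integral_mono[OF i H\<phi>_integrable le])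
  also have "\<dots> \<le> CP * Z l" by (rule Poincare)
  finally show "(LINT z|lborel. H l (snd z) * (\<phi> (z + vv \<tau> j))\<^sup>2) \<le> CP * Z l" .
qed

lemma shifted_difference_estimate:
  assumes l: "0 \<le> l" and i: "i \<in> Basis"
  shows "integrable lborel (\<lambda>z. H l (snd z) * (\<phi> (z + vv \<tau> (i, 1)) - \<phi> (z + vv \<tau> (i, -1)))\<^sup>2)"
    and "(LINT z|lborel. H l (snd z) * (\<phi> (z + vv \<tau> (i, 1)) - \<phi> (z + vv \<tau> (i, -1)))\<^sup>2) \<le> (2 * \<kappa> * \<tau>)\<^sup>2 * Z l"
proof -
  define a where "a = (2 * \<kappa> * \<tau>) *\<^sub>R i"
  have na: "norm a = 2 * \<kappa> * \<tau>" using i \<kappa> \<tau> by (simp add: a_def)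
  have v: "vv \<tau> (i, 1) = vv \<tau> (i, -1) + (a, 0)"
    by (simp add: vv_def a_def scaleR_left_distrib[symmetric] del: scaleR_minus_left)
  define F where "F = (\<lambda>z. H l (snd (z - vv \<tau> (i, -1))) * (\<phi> (z + (a, 0)) - \<phi> z)\<^sup>2)"
  have [measurable]: "F \<in> borel_measurable borel" unfolding F_def by measurable
  have le: "F z \<le> H l (snd z) * (\<phi> (z + (a, 0)) - \<phi> z)\<^sup>2" for z
    unfolding F_def by (rule H_shift[OF l, where F = "\<lambda>z. (\<phi> (z + (a, 0)) - \<phi> z)\<^sup>2"]) (use late in \<open>auto simp: snd_vv\<close>)
  have nn: "0 \<le> F z" for z using H_nonneg by (simp add: F_def)
  have iF: "integrable lborel F"
    by (rule integrable_nonneg_bound[OF translation_integrable[of l a] _ nn le]) measurable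
  have eq: "(\<lambda>z. F (z + vv \<tau> (i, -1))) = (\<lambda>z. H l (snd z) * (\<phi> (z + vv \<tau> (i, 1)) - \<phi> (z + vv \<tau> (i, -1)))\<^sup>2)"
    unfolding F_def v by (simp add: add.assoc)
  show "integrable lborel (\<lambda>z. H l (snd z) * (\<phi> (z + vv \<tau> (i, 1)) - \<phi> (z + vv \<tau> (i, -1)))\<^sup>2)"
    using lborel_translate(2)[of F "vv \<tau> (i, -1)"] iF by (simp add: eq)
  have "(LINT z|lborel. H l (snd z) * (\<phi> (z + vv \<tau> (i, 1)) - \<phi> (z + vv \<tau> (i, -1)))\<^sup>2) = (LINT z|lborel. F z)"
    using lborel_translate(1)[of F "vv \<tau> (i, -1)"] by (simp add: eq)
  also have "\<dots> \<le> (LINT z|lborel. H l (snd z) * (\<phi> (z + (a, 0)) - \<phi> z)\<^sup>2)"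
    by (rule integral_mono[OF iF translation_integrable le])
  also have "\<dots> \<le> (2 * \<kappa> * \<tau>)\<^sup>2 * Z l" using translation_estimate[of l a] by (simp add: na)
  finally show "(LINT z|lborel. H l (snd z) * (\<phi> (z + vv \<tau> (i, 1)) - \<phi> (z + vv \<tau> (i, -1)))\<^sup>2) \<le> (2 * \<kappa> * \<tau>)\<^sup>2 * Z l" .
qed

end

section \<open>The pointwise energy balance and the transport of its flux\<close>

context energy
begin

text \<open>\<open>C1\<close> measures the relative change of \<open>m\<close> over one
  displacement, the lower bound \<delta> turning a Lipschitz bound into a relative one;
  \<open>C2\<close> measures the deviation of shifted weight sums from 1, and \<open>C3\<close> the
  remainder \<open>Q\<close> in terms of the energy.\<close>

definition C1 :: real where "C1 = Mm * (\<kappa> + 1) / \<delta>"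
definition C2 :: real where "C2 = B * (1 + dd + \<kappa>)"
definition C3 :: real where "C3 = Mm / \<delta> * (B * (dd + 1) / 2 + dd * B / 2 + B * CP / 2)"

lemma C_nonneg: "0 \<le> C1" "0 \<le> C2" "0 \<le> C3"
  using Mm \<kappa> \<delta> B dd by (auto simp: C1_def C2_def C3_def CP_def)

definition \<Delta> :: "'a \<Rightarrow> 'a \<times> real \<Rightarrow> real" where
  "\<Delta> i z = \<phi> (z + vv \<tau> (i, 1)) - \<phi> (z + vv \<tau> (i, -1))"

text \<open>What derivatives falling on the weights contribute, after Young: \<open>Db\<close> meets
  the difference of \<phi> across a pair, written here as a difference quotient, \<open>Df\<close>
  meets \<phi> itself, and the other factor is the gradient at \<open>z\<close>.\<close>

definition Q :: "'a \<times> real \<Rightarrow> real" where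
  "Q z = B * (dd + 1) / 2 * U z + B / 2 * (\<Sum>i\<in>Basis. (\<Delta> i z / (2 * \<kappa> * \<tau>))\<^sup>2) +
     B / (4 * dd) * (\<Sum>j\<in>idx. (\<phi> (z + vv \<tau> j))\<^sup>2)"

lemma Q_nonneg: "0 \<le> Q z"
  using B dd U_bound(1)[of z] unfolding Q_def by (intro add_nonneg_nonneg mult_nonneg_nonneg sum_nonneg) auto

lemma remainder_bound:
  assumes z: "z \<in> cyl T" "snd z + \<tau> < T"
  shows "norm (\<Sum>j\<in>idx. \<phi> (z + vv \<tau> j) *\<^sub>R fst (Dcc \<tau> j (sh z))) * norm (fst (D z)) \<le> \<tau> * Q z"
proof -
  define g where "g = norm (fst (D z))"
  have g: "0 \<le> g" "U z = g\<^sup>2" by (auto simp: g_def U_def)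
  note shc = sh_cyl[OF X_\<Omega>[OF z(1)] z(2)]
  have nfst: "norm (fst w) \<le> norm w" for w :: "'a \<times> real"
    using norm_fst_le[of "fst w" "snd w"] by simp
  have sum_eq: "(\<Sum>j\<in>idx. \<phi> (z + vv \<tau> j) *\<^sub>R fst (Dcc \<tau> j (sh z))) =
      (\<Sum>i\<in>Basis. (- \<Delta> i z / (2 * \<kappa>)) *\<^sub>R fst (Db i (sh z))) +
      (\<Sum>j\<in>idx. (\<phi> (z + vv \<tau> j) * (\<tau> / (2 * dd))) *\<^sub>R fst (Df (sh z)))"
  proof -
    have "(\<Sum>j\<in>idx. \<phi> (z + vv \<tau> j) *\<^sub>R fst (Dcc \<tau> j (sh z))) =
        (\<Sum>j\<in>idx. (\<phi> (z + vv \<tau> j) * (- snd j / (2 * \<kappa>))) *\<^sub>R fst (Db (fst j) (sh z))) +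
        (\<Sum>j\<in>idx. (\<phi> (z + vv \<tau> j) * (\<tau> / (2 * dd))) *\<^sub>R fst (Df (sh z)))"
      by (simp add: Dcc_def sum.distrib[symmetric] scaleR_add_right scaleR_diff_right)
    moreover have "(\<Sum>j\<in>idx. (\<phi> (z + vv \<tau> j) * (- snd j / (2 * \<kappa>))) *\<^sub>R fst (Db (fst j) (sh z))) =
        (\<Sum>i\<in>Basis. (- \<Delta> i z / (2 * \<kappa>)) *\<^sub>R fst (Db i (sh z)))"
      unfolding idx_sum \<Delta>_def by (intro sum.cong refl)
        (simp add: diff_divide_distrib scaleR_diff_left)
    ultimately show ?thesis by simp
  qed
  have 1: "norm (\<Sum>i\<in>Basis. (- \<Delta> i z / (2 * \<kappa>)) *\<^sub>R fst (Db i (sh z))) \<le> (\<Sum>i\<in>Basis. \<bar>\<Delta> i z\<bar> / (2 * \<kappa>) * B)"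
  proof (rule sum_norm_le)
    fix i :: 'a assume i: "i \<in> Basis"
    have "norm ((- \<Delta> i z / (2 * \<kappa>)) *\<^sub>R fst (Db i (sh z))) = \<bar>\<Delta> i z\<bar> / (2 * \<kappa>) * norm (fst (Db i (sh z)))"
      using \<kappa> by simp
    also have "\<dots> \<le> \<bar>\<Delta> i z\<bar> / (2 * \<kappa>) * B"
      using order.trans[OF nfst Db_bound[OF i shc]] \<kappa> by (intro mult_left_mono) auto
    finally show "norm ((- \<Delta> i z / (2 * \<kappa>)) *\<^sub>R fst (Db i (sh z))) \<le> \<bar>\<Delta> i z\<bar> / (2 * \<kappa>) * B" .
  qed
  have 2: "norm (\<Sum>j\<in>idx. (\<phi> (z + vv \<tau> j) * (\<tau> / (2 * dd))) *\<^sub>R fst (Df (sh z))) \<le>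
      (\<Sum>j\<in>idx. \<bar>\<phi> (z + vv \<tau> j)\<bar> * (\<tau> / (2 * dd)) * B)"
  proof (rule sum_norm_le)
    fix j
    have "norm ((\<phi> (z + vv \<tau> j) * (\<tau> / (2 * dd))) *\<^sub>R fst (Df (sh z))) =
        \<bar>\<phi> (z + vv \<tau> j)\<bar> * (\<tau> / (2 * dd)) * norm (fst (Df (sh z)))"
      using \<tau> dd by (simp add: abs_mult)
    also have "\<dots> \<le> \<bar>\<phi> (z + vv \<tau> j)\<bar> * (\<tau> / (2 * dd)) * B"
      using order.trans[OF nfst Df_bound[OF shc]] \<tau> dd by (intro mult_left_mono) auto
    finally show "norm ((\<phi> (z + vv \<tau> j) * (\<tau> / (2 * dd))) *\<^sub>R fst (Df (sh z))) \<le> \<bar>\<phi> (z + vv \<tau> j)\<bar> * (\<tau> / (2 * dd)) * B" .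
  qed
  have young: "x * y \<le> (x\<^sup>2 + y\<^sup>2) / 2" for x y :: real
    using zero_le_power2[of "x - y"] by (simp add: power2_eq_square algebra_simps)
  \<comment> \<open>The factor \<tau> is gained by writing
    \<open>\<bar>\<Delta> i z\<bar> / (2 * \<kappa>)\<close> as \<tau> times a difference quotient,
    whose square integral the gradient controls.\<close>
  have 3: "(\<Sum>i\<in>Basis. \<bar>\<Delta> i z\<bar> / (2 * \<kappa>) * B) * g \<le> (\<Sum>i\<in>Basis. \<tau> * B * ((\<Delta> i z / (2 * \<kappa> * \<tau>))\<^sup>2 + g\<^sup>2) / 2)"
    unfolding sum_distrib_right
  proof (rule sum_mono)
    fix i :: 'a
    have "\<bar>\<Delta> i z\<bar> / (2 * \<kappa>) * B * g = \<tau> * B * (\<bar>\<Delta> i z / (2 * \<kappa> * \<tau>)\<bar> * g)"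
      using \<tau> \<kappa> by (simp add: abs_divide abs_mult)
    also have "\<dots> \<le> \<tau> * B * ((\<bar>\<Delta> i z / (2 * \<kappa> * \<tau>)\<bar>\<^sup>2 + g\<^sup>2) / 2)"
      using \<tau> B by (intro mult_left_mono young) auto
    finally show "\<bar>\<Delta> i z\<bar> / (2 * \<kappa>) * B * g \<le> \<tau> * B * ((\<Delta> i z / (2 * \<kappa> * \<tau>))\<^sup>2 + g\<^sup>2) / 2"
      unfolding power2_abs by (simp only: times_divide_eq_right)
  qed
  have 4: "(\<Sum>j\<in>idx. \<bar>\<phi> (z + vv \<tau> j)\<bar> * (\<tau> / (2 * dd)) * B) * g \<le>
      (\<Sum>j\<in>idx. \<tau> / (4 * dd) * B * ((\<phi> (z + vv \<tau> j))\<^sup>2 + g\<^sup>2))"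
    unfolding sum_distrib_right
  proof (rule sum_mono)
    fix j
    have "\<bar>\<phi> (z + vv \<tau> j)\<bar> * (\<tau> / (2 * dd)) * B * g = \<tau> / (2 * dd) * B * (\<bar>\<phi> (z + vv \<tau> j)\<bar> * g)" by simp
    also have "\<dots> \<le> \<tau> / (2 * dd) * B * ((\<bar>\<phi> (z + vv \<tau> j)\<bar>\<^sup>2 + g\<^sup>2) / 2)"
      using \<tau> B dd by (intro mult_left_mono young) auto
    finally show "\<bar>\<phi> (z + vv \<tau> j)\<bar> * (\<tau> / (2 * dd)) * B * g \<le> \<tau> / (4 * dd) * B * ((\<phi> (z + vv \<tau> j))\<^sup>2 + g\<^sup>2)" by simp
  qed
  have 5: "(\<Sum>i\<in>Basis. \<tau> * B * ((\<Delta> i z / (2 * \<kappa> * \<tau>))\<^sup>2 + g\<^sup>2) / 2) =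
      \<tau> * B / 2 * (\<Sum>i\<in>Basis. (\<Delta> i z / (2 * \<kappa> * \<tau>))\<^sup>2) + dd * (\<tau> * B / 2 * g\<^sup>2)"
    by (simp add: sum_divide_distrib[symmetric] sum_distrib_left[symmetric] sum.distrib dd_def algebra_simps add_divide_distrib)
  have 6: "(\<Sum>j\<in>idx. \<tau> / (4 * dd) * B * ((\<phi> (z + vv \<tau> j))\<^sup>2 + g\<^sup>2)) =
      \<tau> / (4 * dd) * B * (\<Sum>j\<in>idx. (\<phi> (z + vv \<tau> j))\<^sup>2) + \<tau> * B / 2 * g\<^sup>2"
  proof -
    have "(\<Sum>j\<in>idx. \<tau> / (4 * dd) * B * ((\<phi> (z + vv \<tau> j))\<^sup>2 + g\<^sup>2)) =
        \<tau> / (4 * dd) * B * ((\<Sum>j\<in>idx. (\<phi> (z + vv \<tau> j))\<^sup>2) + 2 * dd * g\<^sup>2)"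
      by (simp only: sum_distrib_left[symmetric] sum.distrib sum_constant idx(3))
    also have "\<dots> = \<tau> / (4 * dd) * B * (\<Sum>j\<in>idx. (\<phi> (z + vv \<tau> j))\<^sup>2) + \<tau> * B / 2 * g\<^sup>2"
      using dd by (simp add: distrib_left)
    finally show ?thesis .
  qed
  have "norm (\<Sum>j\<in>idx. \<phi> (z + vv \<tau> j) *\<^sub>R fst (Dcc \<tau> j (sh z))) * g \<le>
      ((\<Sum>i\<in>Basis. \<bar>\<Delta> i z\<bar> / (2 * \<kappa>) * B) + (\<Sum>j\<in>idx. \<bar>\<phi> (z + vv \<tau> j)\<bar> * (\<tau> / (2 * dd)) * B)) * g"
    unfolding sum_eq by (intro mult_right_mono norm_triangle_mono 1 2 g)
  also have "\<dots> \<le> \<tau> * Q z"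
    using 3 4 unfolding 5 6 Q_def g distrib_right by (simp add: algebra_simps add_divide_distrib)
  finally show ?thesis by (simp add: g_def)
qed

lemma cc_le_2:
  assumes "j \<in> idx" "z \<in> cyl T"
  shows "cc \<tau> j z \<le> 2"
proof -
  have nn: "0 \<le> cc \<tau> j z" if "j \<in> idx" for j
    using cc_nonneg[OF that assms(2)] \<tau> by simp
  have "cc \<tau> j z \<le> (\<Sum>j\<in>idx. cc \<tau> j z)"
    by (rule member_le_sum) (use nn assms idx in auto)
  also have "\<dots> = 1 + \<tau> * f z" by (rule cc_sum)
  also have "\<dots> \<le> 1 + \<tau> * B"
    using f_bound[OF assms(2)] \<tau> by (intro add_left_mono mult_left_mono) auto
  finally show ?thesis using \<tau> by linarith
qed

lemma cX_bounds: "j \<in> idx \<Longrightarrow> 0 \<le> cX j z" "j \<in> idx \<Longrightarrow> cX j z \<le> 2"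
  using cc_nonneg[of j z \<tau>] cc_le_2[of j z] \<tau> by (auto simp: cX_def indicator_def)

text \<open>The differentiated scheme is multiplied by the gradient at \<open>z\<close>. Young on
  the products of gradients at different nodes leaves half of \<open>U\<close> at \<open>z\<close>
  against half of its weighted average over the next nodes; integrated, these two halves nearly
  cancel.\<close>

lemma energy_pointwise:
  "\<tau> * (H l (snd z) * mX z * (fst (DS z) \<bullet> fst (D z))) \<ge>
    (1 - \<tau> * B) / 2 * (H l (snd z) * mX z * U z)
    - 1 / 2 * (\<Sum>j\<in>idx. H l (snd z) * mX z * cX j (sh z) * U (z + vv \<tau> j))
    - \<tau> * Mm * (H l (snd z) * Q z)"
proof (cases "z \<in> cyl T")
  case True
  show ?thesis
  proof (cases "snd z + \<tau> < T")
    case False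
    then have D0: "D z = 0" using D_eq[OF X_\<Omega>[OF True]] by (simp add: stepD_def)
    have "U (z + vv \<tau> j) = 0" for j using False late[of "z + vv \<tau> j"] by (simp add: U_def snd_vv)
    moreover have "0 \<le> \<tau> * Mm * (H l (snd z) * Q z)" using \<tau> Mm H_nonneg Q_nonneg by simp
    ultimately show ?thesis using D0 by (simp add: U_def)
  next
    case z: True
    note shc = sh_cyl[OF X_\<Omega>[OF True] z]
    define g where "g = fst (D z)"
    define r where "r = (\<Sum>j\<in>idx. \<phi> (z + vv \<tau> j) *\<^sub>R fst (Dcc \<tau> j (sh z)))"
    have c: "cX j (sh z) = cc \<tau> j (sh z)" for j using shc by (simp add: cX_def)
    have nn: "0 \<le> cc \<tau> j (sh z)" if "j \<in> idx" for j
      using cc_nonneg[OF that shc] \<tau> by simp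
    have "g = (\<Sum>j\<in>idx. cc \<tau> j (sh z) *\<^sub>R fst (D (z + vv \<tau> j))) + r + \<tau> *\<^sub>R fst (DS z)"
      using arg_cong[OF D_eq[OF X_\<Omega>[OF True]], of fst] z
      by (simp add: stepD_def g_def r_def fst_sum sum.distrib)
    then have "\<tau> *\<^sub>R fst (DS z) = g - (\<Sum>j\<in>idx. cc \<tau> j (sh z) *\<^sub>R fst (D (z + vv \<tau> j))) - r"
      by (simp add: algebra_simps)
    then have "\<tau> * (fst (DS z) \<bullet> g) = g \<bullet> g - (\<Sum>j\<in>idx. cc \<tau> j (sh z) * (fst (D (z + vv \<tau> j)) \<bullet> g)) - r \<bullet> g"
      by (simp add: inner_diff_left inner_sum_left flip: inner_scaleR_left)
    moreover have "(\<Sum>j\<in>idx. cc \<tau> j (sh z) * (fst (D (z + vv \<tau> j)) \<bullet> g)) \<le>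
        (\<Sum>j\<in>idx. cc \<tau> j (sh z) * ((U (z + vv \<tau> j) + U z) / 2))"
    proof (intro sum_mono mult_left_mono nn)
      fix j
      have "fst (D (z + vv \<tau> j)) \<bullet> g \<le> norm (fst (D (z + vv \<tau> j))) * norm g"
        by (rule norm_cauchy_schwarz)
      also have "\<dots> \<le> (U (z + vv \<tau> j) + U z) / 2"
        using zero_le_power2[of "norm (fst (D (z + vv \<tau> j))) - norm g"]
        by (simp add: U_def g_def power2_eq_square algebra_simps)
      finally show "fst (D (z + vv \<tau> j)) \<bullet> g \<le> (U (z + vv \<tau> j) + U z) / 2" .
    qed
    moreover have "(\<Sum>j\<in>idx. cc \<tau> j (sh z) * ((U (z + vv \<tau> j) + U z) / 2)) =
        1 / 2 * (\<Sum>j\<in>idx. cc \<tau> j (sh z) * U (z + vv \<tau> j)) + 1 / 2 * (\<Sum>j\<in>idx. cc \<tau> j (sh z)) * U z"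
      unfolding sum_distrib_left sum_distrib_right sum.distrib[symmetric]
      by (intro sum.cong refl) (simp add: algebra_simps add_divide_distrib)
    moreover have "(\<Sum>j\<in>idx. cc \<tau> j (sh z)) * U z \<le> (1 + \<tau> * B) * U z"
      unfolding cc_sum using f_bound[OF shc] \<tau> U_bound(1)
      by (intro mult_right_mono add_left_mono mult_left_mono) auto
    moreover have "r \<bullet> g \<le> \<tau> * Q z"
      using remainder_bound[OF True z] norm_cauchy_schwarz[of r g] by (simp add: r_def g_def)
    moreover have "g \<bullet> g = U z" by (simp add: U_def g_def power2_norm_eq_inner)
    ultimately have main: "(1 - \<tau> * B) / 2 * U z - 1 / 2 * (\<Sum>j\<in>idx. cc \<tau> j (sh z) * U (z + vv \<tau> j)) - \<tau> * Q z
        \<le> \<tau> * (fst (DS z) \<bullet> g)"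
      by (simp add: algebra_simps diff_divide_distrib)
    define w where "w = H l (snd z) * mX z"
    have w: "0 \<le> w" using H_nonneg mX_bounds by (simp add: w_def)
    have "w * ((1 - \<tau> * B) / 2 * U z - 1 / 2 * (\<Sum>j\<in>idx. cc \<tau> j (sh z) * U (z + vv \<tau> j)) - \<tau> * Q z)
        \<le> w * (\<tau> * (fst (DS z) \<bullet> g))"
      using main w by (rule mult_left_mono)
    moreover have "w * (\<tau> * Q z) \<le> \<tau> * Mm * (H l (snd z) * Q z)"
    proof -
      have "mX z * (H l (snd z) * (\<tau> * Q z)) \<le> Mm * (H l (snd z) * (\<tau> * Q z))"
        using mX_bounds(2) H_nonneg \<tau> Q_nonneg by (intro mult_right_mono) auto
      then show ?thesis by (simp add: w_def mult_ac)
    qed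
    moreover have "(\<Sum>j\<in>idx. w * cX j (sh z) * U (z + vv \<tau> j)) = w * (\<Sum>j\<in>idx. cc \<tau> j (sh z) * U (z + vv \<tau> j))"
      by (simp add: c sum_distrib_left mult.assoc)
    ultimately show ?thesis
      unfolding w_def[symmetric] g_def[symmetric] by (simp add: right_diff_distrib mult_ac)
  qed
qed (simp add: H_X)

lemma shifted_point:
  assumes y: "y \<in> cyl T" and j: "j \<in> idx"
  shows "sh (y - vv \<tau> j) \<in> cyl T" "norm (y - sh (y - vv \<tau> j)) = \<kappa> * \<tau>"
proof -
  have e: "sh (y - vv \<tau> j) = y - (fst (vv \<tau> j), 0)"
    by (simp add: sh_def prod_eq_iff snd_vv)
  show "sh (y - vv \<tau> j) \<in> cyl T" using y by (simp add: e cyl_iff)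
  show "norm (y - sh (y - vv \<tau> j)) = \<kappa> * \<tau>"
    using norm_fst_vv[OF j] \<kappa> \<tau> by (simp add: e norm_Pair)
qed

text \<open>A column sum of the weights, regarded as a transition matrix: the nodes from which
  \<open>y\<close> is reached, not the nodes reached from one point. The row sums are
  \<open>1 + \<tau> * f\<close> by \<open>cc_sum\<close>, and the Lipschitz bounds keep both sums
  within O(\<tau>) of each other.\<close>

lemma cX_shift_sum:
  assumes y: "y \<in> cyl T"
  shows "\<bar>(\<Sum>j\<in>idx. cX j (sh (y - vv \<tau> j))) - 1\<bar> \<le> C2 * \<tau>"
proof -
  have d: "\<bar>cX j (sh (y - vv \<tau> j)) - cc \<tau> j y\<bar> \<le> (B * \<tau> + \<tau> * B * \<kappa> / dd) / 2" if j: "j \<in> idx" for j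
  proof -
    define y' where "y' = sh (y - vv \<tau> j)"
    have y': "y' \<in> cyl T" "norm (y' - y) = \<kappa> * \<tau>"
      using shifted_point[OF y j] by (auto simp: y'_def norm_minus_commute)
    have e: "cX j y' - cc \<tau> j y = snd j * (- (b y' \<bullet> fst j - b y \<bullet> fst j) / (2 * \<kappa>)) + \<tau> / (2 * dd) * (f y' - f y)"
      using y' \<kappa> dd by (simp add: cX_def cc_def field_simps)
    have "\<bar>snd j * (- (b y' \<bullet> fst j - b y \<bullet> fst j) / (2 * \<kappa>))\<bar> \<le> B * (\<kappa> * \<tau>) / (2 * \<kappa>)"
    proof -
      have "\<bar>b y' \<bullet> fst j - b y \<bullet> fst j\<bar> \<le> B * (\<kappa> * \<tau>)"
        using b_lip[of "fst j" y' y] y y' j by (auto simp: idx_def)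
      moreover have "\<bar>snd j * (- (b y' \<bullet> fst j - b y \<bullet> fst j) / (2 * \<kappa>))\<bar> = \<bar>b y' \<bullet> fst j - b y \<bullet> fst j\<bar> / (2 * \<kappa>)"
        using j \<kappa> by (auto simp: idx_def abs_mult abs_minus_commute)
      ultimately show ?thesis using \<kappa> by (simp only:) (rule divide_right_mono, auto)
    qed
    moreover have "\<bar>\<tau> / (2 * dd) * (f y' - f y)\<bar> \<le> \<tau> / (2 * dd) * (B * (\<kappa> * \<tau>))"
      using f_lip[of y' y] y y' dd \<tau> by (auto simp: abs_mult intro!: divide_right_mono mult_left_mono)
    moreover have "\<tau> / (2 * dd) * (B * (\<kappa> * \<tau>)) \<le> \<tau> / (2 * dd) * (B * (\<kappa> * 1))"
      using \<tau> dd B \<kappa> by (intro mult_left_mono) auto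
    moreover have "B * (\<kappa> * \<tau>) / (2 * \<kappa>) + \<tau> / (2 * dd) * (B * (\<kappa> * 1)) = (B * \<tau> + \<tau> * B * \<kappa> / dd) / 2"
      using \<kappa> dd by (simp add: field_simps)
    ultimately show ?thesis unfolding y'_def[symmetric] e by linarith
  qed
  have "\<bar>(\<Sum>j\<in>idx. cX j (sh (y - vv \<tau> j)) - cc \<tau> j y)\<bar> \<le> (\<Sum>j\<in>idx. (B * \<tau> + \<tau> * B * \<kappa> / dd) / 2)"
    by (rule order.trans[OF sum_abs sum_mono[OF d]])
  also have "\<dots> = dd * (B * \<tau>) + \<tau> * B * \<kappa>"
    using dd by (simp add: idx(3) field_simps)
  finally have 1: "\<bar>(\<Sum>j\<in>idx. cX j (sh (y - vv \<tau> j))) - (1 + \<tau> * f y)\<bar> \<le> dd * (B * \<tau>) + \<tau> * B * \<kappa>"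
    by (simp only: sum_subtractf cc_sum)
  have 2: "\<bar>\<tau> * f y\<bar> \<le> \<tau> * B" using f_bound[OF y] \<tau> by (simp add: abs_mult)
  have "C2 * \<tau> = \<tau> * B + dd * (B * \<tau>) + \<tau> * B * \<kappa>" by (simp add: C2_def algebra_simps)
  with 1 2 show ?thesis by linarith
qed

text \<open>Three effects multiply: the change of \<open>m\<close> over a displacement, the column
  sum of the weights, and the gain \<open>exp (- l * \<tau>)\<close> of the time weight.\<close>

lemma shifted_flux_bound:
  assumes l: "0 \<le> l"
  shows "(\<Sum>j\<in>idx. H l (snd (y - vv \<tau> j)) * mX (y - vv \<tau> j) * cX j (sh (y - vv \<tau> j)) * U y) \<le>
    (1 + C1 * \<tau>) * (1 + C2 * \<tau>) * exp (- l * \<tau>) * (H l (snd y) * mX y * U y)"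
proof (cases "snd y - \<tau> \<le> 0 \<or> T \<le> snd y")
  case True
  then have "H l (snd (y - vv \<tau> j)) * U y = 0" for j
    using late[of y] by (auto simp: H_def snd_vv U_def)
  then have "(\<Sum>j\<in>idx. H l (snd (y - vv \<tau> j)) * mX (y - vv \<tau> j) * cX j (sh (y - vv \<tau> j)) * U y) = 0"
    by (intro sum.neutral) auto
  moreover have "0 \<le> (1 + C1 * \<tau>) * (1 + C2 * \<tau>) * exp (- l * \<tau>) * (H l (snd y) * mX y * U y)"
    using C_nonneg \<tau> H_nonneg mX_bounds U_bound by (intro mult_nonneg_nonneg) auto
  ultimately show ?thesis by simp
next
  case False
  then have y: "y \<in> cyl T" and yv: "y - vv \<tau> j \<in> cyl T" for j
    using \<tau> by (auto simp: cyl_iff snd_vv)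
  have H: "H l (snd (y - vv \<tau> j)) = exp (- l * \<tau>) * H l (snd y)" for j
    using H_X(2)[OF y] H_X(2)[OF yv] by (simp add: snd_vv exp_add[symmetric] algebra_simps)
  have my: "mX y = m y" "\<delta> \<le> m y" using y m_bounds by (auto simp: mX_def)
  have m: "mX (y - vv \<tau> j) \<le> (1 + C1 * \<tau>) * mX y" if j: "j \<in> idx" for j
  proof -
    have "mX (y - vv \<tau> j) \<le> m y + Mm * norm (vv \<tau> j)"
      using m_lip[OF yv[of j] y] yv[of j] by (simp add: mX_def)
    also have "\<dots> \<le> m y + Mm * ((\<kappa> + 1) * \<tau>)"
      using norm_vv[OF j] Mm by (intro add_left_mono mult_left_mono) auto
    also have "Mm * ((\<kappa> + 1) * \<tau>) = C1 * \<tau> * \<delta>" using \<delta> by (simp add: C1_def)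
    also have "C1 * \<tau> * \<delta> \<le> C1 * \<tau> * m y" using my C_nonneg \<tau> by (intro mult_left_mono) auto
    finally show ?thesis by (simp add: my algebra_simps)
  qed
  have "(\<Sum>j\<in>idx. H l (snd (y - vv \<tau> j)) * mX (y - vv \<tau> j) * cX j (sh (y - vv \<tau> j)) * U y) \<le>
      (\<Sum>j\<in>idx. exp (- l * \<tau>) * H l (snd y) * ((1 + C1 * \<tau>) * mX y) * cX j (sh (y - vv \<tau> j)) * U y)"
    unfolding H using m cX_bounds H_nonneg U_bound
    by (intro sum_mono mult_right_mono mult_left_mono) auto
  also have "\<dots> = exp (- l * \<tau>) * H l (snd y) * ((1 + C1 * \<tau>) * mX y) * U y * (\<Sum>j\<in>idx. cX j (sh (y - vv \<tau> j)))"
    by (simp add: sum_distrib_left mult_ac)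
  also have "\<dots> \<le> exp (- l * \<tau>) * H l (snd y) * ((1 + C1 * \<tau>) * mX y) * U y * (1 + C2 * \<tau>)"
    using cX_shift_sum[OF y] H_nonneg C_nonneg \<tau> mX_bounds U_bound
    by (intro mult_left_mono mult_nonneg_nonneg) auto
  finally show ?thesis by (simp add: mult_ac)
qed

end

section \<open>The integrated energy estimate and the weak bound for the source\<close>

context energy
begin

lemma cX_sh_meas [measurable]: "j \<in> idx \<Longrightarrow> (\<lambda>z. cX j (sh z)) \<in> borel_measurable borel"
  unfolding sh_def by measurable

lemma flux_integrable:
  assumes j: "j \<in> idx"
  shows "integrable lborel (\<lambda>z. H l (snd z) * mX z * cX j (sh z) * U (z + vv \<tau> j))"
proof (rule integrableX[where r = "R1 + \<kappa> * \<tau>" and C = "exp (\<bar>l\<bar> * T) * Mm * 2 * MM\<^sup>2"])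
  show "\<bar>H l (snd z) * mX z * cX j (sh z) * U (z + vv \<tau> j)\<bar> \<le> exp (\<bar>l\<bar> * T) * Mm * 2 * MM\<^sup>2" for z
    unfolding abs_mult using H_le[of l "snd z"] H_nonneg U_bound[of "z + vv \<tau> j"] mX_bounds[of z] Mm cX_bounds[OF j, of "sh z"]
    by (intro mult_mono) auto
  show "H l (snd z) * mX z * cX j (sh z) * U (z + vv \<tau> j) = 0" if z: "R1 + \<kappa> * \<tau> < norm (fst z)" for z
  proof -
    have "norm (fst z) \<le> norm (fst z + fst (vv \<tau> j)) + norm (fst (vv \<tau> j))"
      using norm_triangle_ineq4[of "fst z + fst (vv \<tau> j)" "fst (vv \<tau> j)"] by simp
    then have "R1 < norm (fst (z + vv \<tau> j))" using z norm_fst_vv[OF j] by simp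
    then show ?thesis using U_far by simp
  qed
qed (use j in \<open>auto simp: H_X Mm\<close>)

text \<open>The squared pair distance \<open>K\<close> cancels between the difference quotients and
  the translation estimate. Values of \<phi> are paid for by the Poincare inequality, and
  \<open>Z\<close> by \<open>Y\<close> through the lower bound \<delta> of \<open>m\<close>.\<close>

lemma HQ_estimate:
  assumes l: "0 \<le> l"
  shows "integrable lborel (\<lambda>z. H l (snd z) * Q z)"
    and "Mm * (LINT z|lborel. H l (snd z) * Q z) \<le> C3 * Y l"
proof -
  define K where "K = (2 * \<kappa> * \<tau>)\<^sup>2"
  have K: "0 < K" using \<kappa> \<tau> by (simp add: K_def)
  have eq: "(\<lambda>z. H l (snd z) * Q z) = (\<lambda>z. B * (dd + 1) / 2 * (H l (snd z) * U z) +
      B / (2 * K) * (\<Sum>i\<in>Basis. H l (snd z) * (\<Delta> i z)\<^sup>2) + B / (4 * dd) * (\<Sum>j\<in>idx. H l (snd z) * (\<phi> (z + vv \<tau> j))\<^sup>2))"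
    by (rule ext) (simp add: Q_def K_def power_divide sum_divide_distrib[symmetric] sum_distrib_left[symmetric] algebra_simps)
  have i2: "integrable lborel (\<lambda>z. \<Sum>i\<in>Basis. H l (snd z) * (\<Delta> i z)\<^sup>2)"
    unfolding \<Delta>_def using shifted_difference_estimate(1)[OF l] by auto
  have i3: "integrable lborel (\<lambda>z. \<Sum>j\<in>idx. H l (snd z) * (\<phi> (z + vv \<tau> j))\<^sup>2)"
    using shifted_\<phi>_estimate(1)[OF l] by auto
  show i: "integrable lborel (\<lambda>z. H l (snd z) * Q z)"
    unfolding eq using HU_integrable[of l] i2 i3 by auto
  have s2: "(LINT z|lborel. (\<Sum>i\<in>Basis. H l (snd z) * (\<Delta> i z)\<^sup>2)) \<le> dd * (K * Z l)"
  proof -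
    have "(LINT z|lborel. (\<Sum>i\<in>Basis. H l (snd z) * (\<Delta> i z)\<^sup>2)) = (\<Sum>i\<in>Basis. (LINT z|lborel. H l (snd z) * (\<Delta> i z)\<^sup>2))"
      by (rule Bochner_Integration.integral_sum) (simp add: \<Delta>_def shifted_difference_estimate(1)[OF l])
    also have "\<dots> \<le> (\<Sum>i\<in>(Basis::'a set). K * Z l)"
      unfolding \<Delta>_def K_def by (intro sum_mono shifted_difference_estimate(2)[OF l])
    finally show ?thesis by (simp add: dd_def)
  qed
  have s3: "(LINT z|lborel. (\<Sum>j\<in>idx. H l (snd z) * (\<phi> (z + vv \<tau> j))\<^sup>2)) \<le> 2 * dd * (CP * Z l)"
  proof -
    have "(LINT z|lborel. (\<Sum>j\<in>idx. H l (snd z) * (\<phi> (z + vv \<tau> j))\<^sup>2)) = (\<Sum>j\<in>idx. (LINT z|lborel. H l (snd z) * (\<phi> (z + vv \<tau> j))\<^sup>2))"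
      by (rule Bochner_Integration.integral_sum) (simp add: shifted_\<phi>_estimate(1)[OF l])
    also have "\<dots> \<le> (\<Sum>j\<in>idx. CP * Z l)"
      by (intro sum_mono shifted_\<phi>_estimate(2)[OF l])
    finally show ?thesis by (simp add: idx(3))
  qed
  have "(LINT z|lborel. H l (snd z) * Q z) = B * (dd + 1) / 2 * Z l +
      B / (2 * K) * (LINT z|lborel. (\<Sum>i\<in>Basis. H l (snd z) * (\<Delta> i z)\<^sup>2)) +
      B / (4 * dd) * (LINT z|lborel. (\<Sum>j\<in>idx. H l (snd z) * (\<phi> (z + vv \<tau> j))\<^sup>2))"
    unfolding eq Z_def using HU_integrable[of l] i2 i3 by simp
  also have "\<dots> \<le> B * (dd + 1) / 2 * Z l + B / (2 * K) * (dd * (K * Z l)) + B / (4 * dd) * (2 * dd * (CP * Z l))"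
    using B dd K by (intro add_mono order.refl mult_left_mono s2 s3) auto
  also have "\<dots> = (B * (dd + 1) / 2 + dd * B / 2 + B * CP / 2) * Z l"
    using K dd by (simp add: algebra_simps add_divide_distrib)
  finally have "Mm * (LINT z|lborel. H l (snd z) * Q z) \<le> Mm * ((B * (dd + 1) / 2 + dd * B / 2 + B * CP / 2) * Z l)"
    using Mm by (rule mult_left_mono)
  also have "\<dots> = C3 * (\<delta> * Z l)" using \<delta> by (simp add: C3_def)
  also have "\<dots> \<le> C3 * Y l" using Z_le_Y C_nonneg by (intro mult_left_mono)
  finally show "Mm * (LINT z|lborel. H l (snd z) * Q z) \<le> C3 * Y l" .
qed

text \<open>\<open>lam\<close> outweighs the growth rates \<open>C1\<close> and \<open>C2\<close>
  and leaves a net decay rate \<open>aa\<close>. The value of \<open>aa\<close> makes the final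
  balance exact: a quarter of it pays for \<open>B / 2\<close> and \<open>C3\<close> and leaves
  precisely one \<open>Y\<close>.\<close>

definition aa :: real where "aa = 4 * (1 + B / 2 + C3)"
definition lam :: real where "lam = C1 + C2 + aa"

lemma aa: "4 \<le> aa" using B C_nonneg by (simp add: aa_def)
lemma lam: "0 \<le> lam" using aa C_nonneg by (simp add: lam_def)

lemma DS_meas: "(\<lambda>z. fst (DS z)) \<in> borel_measurable borel"
proof -
  have "continuous_on UNIV DS"
  proof (rule continuous_onI)
    fix x :: "'a \<times> real" and e :: real assume e: "0 < e"
    show "\<exists>d>0. \<forall>x'\<in>UNIV. dist x' x < d \<longrightarrow> dist (DS x') (DS x) \<le> e"
    proof (intro exI conjI ballI impI)
      show "0 < e / (s + 1)" using e s by simp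
      fix x' assume x': "dist x' x < e / (s + 1)"
      have "dist (DS x') (DS x) \<le> s * dist x' x" using DS_lip by (simp add: dist_norm)
      also have "\<dots> \<le> (s + 1) * (e / (s + 1))" using s x' by (intro mult_mono) auto
      also have "\<dots> = e" using s by simp
      finally show "dist (DS x') (DS x) \<le> e" .
    qed
  qed
  then show ?thesis by (intro borel_measurable_continuous_onI continuous_intros)
qed

text \<open>The translated flux is at most \<open>1 - aa * \<tau> / 2\<close> times the energy, so
  the balance retains a multiple of \<tau>, and dividing by \<tau> gives an estimate uniform in the
  time step. The rate \<open>lam\<close> is built from the coefficients and the support radius
  alone.\<close>

theorem energy_estimate:
  assumes small: "aa * \<tau> \<le> 1"
  shows "integrable lborel (\<lambda>z. H lam (snd z) * mX z * (fst (DS z) \<bullet> fst (D z)))"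
    and "Y lam \<le> (LINT z|lborel. H lam (snd z) * mX z * (fst (DS z) \<bullet> fst (D z)))"
proof -
  note [measurable] = DS_meas
  have fstDS: "norm (fst (DS z)) \<le> s" for z
    using order.trans[OF norm_fst_le[of "fst (DS z)" "snd (DS z)"]] S_bound(2)[of z] by simp
  show i1: "integrable lborel (\<lambda>z. H lam (snd z) * mX z * (fst (DS z) \<bullet> fst (D z)))"
  proof (rule integrableX[where r = R1 and C = "exp (\<bar>lam\<bar> * T) * Mm * (s * MM)"])
    show "\<bar>H lam (snd z) * mX z * (fst (DS z) \<bullet> fst (D z))\<bar> \<le> exp (\<bar>lam\<bar> * T) * Mm * (s * MM)" for z
    proof -
      have "\<bar>fst (DS z) \<bullet> fst (D z)\<bar> \<le> norm (fst (DS z)) * norm (fst (D z))" by (rule Cauchy_Schwarz_ineq2)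
      also have "\<dots> \<le> s * MM" using fstDS[of z] fstD_bound[of z] s by (intro mult_mono) auto
      finally show ?thesis
        unfolding abs_mult using H_le[of lam "snd z"] H_nonneg mX_bounds[of z] Mm by (intro mult_mono) auto
    qed
    show "H lam (snd z) * mX z * (fst (DS z) \<bullet> fst (D z)) = 0" if "R1 < norm (fst z)" for z
      using that far[of z] by (simp add: R1_def)
  qed (auto simp: H_X Mm s MM)
  define F where "F = (\<lambda>j z. H lam (snd z) * mX z * cX j (sh z) * U (z + vv \<tau> j))"
  have iF: "integrable lborel (F j)" if "j \<in> idx" for j
    unfolding F_def by (rule flux_integrable[OF that])
  have iFs: "integrable lborel (\<lambda>z. \<Sum>j\<in>idx. F j z)" using iF by auto
  have [measurable]: "F j \<in> borel_measurable borel" if "j \<in> idx" for j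
    using borel_measurable_integrable[OF iF[OF that]] by simp
  define J where "J = (LINT z|lborel. H lam (snd z) * mX z * (fst (DS z) \<bullet> fst (D z)))"
  \<comment> \<open>Each summand is translated by its own \<open>vv \<tau> j\<close>, so that all
    gradients are read at one point and the weights move instead.\<close>
  have flux: "(LINT z|lborel. (\<Sum>j\<in>idx. F j z)) \<le> (1 + C1 * \<tau>) * (1 + C2 * \<tau>) * exp (- lam * \<tau>) * Y lam"
  proof -
    have iF': "integrable lborel (\<lambda>z. F j (z - vv \<tau> j))" "(LINT z|lborel. F j (z - vv \<tau> j)) = (LINT z|lborel. F j z)"
      if "j \<in> idx" for j
      using lborel_translate[of "F j" "- vv \<tau> j"] that iF by auto
    have "(LINT z|lborel. (\<Sum>j\<in>idx. F j z)) = (\<Sum>j\<in>idx. LINT z|lborel. F j (z - vv \<tau> j))"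
      using iF iF'(2) by (subst Bochner_Integration.integral_sum) auto
    also have "\<dots> = (LINT z|lborel. (\<Sum>j\<in>idx. F j (z - vv \<tau> j)))"
      using iF'(1) by (subst Bochner_Integration.integral_sum) auto
    also have "\<dots> \<le> (LINT z|lborel. (1 + C1 * \<tau>) * (1 + C2 * \<tau>) * exp (- lam * \<tau>) * (H lam (snd z) * mX z * U z))"
    proof (rule integral_mono)
      show "integrable lborel (\<lambda>z. \<Sum>j\<in>idx. F j (z - vv \<tau> j))" using iF'(1) by auto
      show "integrable lborel (\<lambda>z. (1 + C1 * \<tau>) * (1 + C2 * \<tau>) * exp (- lam * \<tau>) * (H lam (snd z) * mX z * U z))"
        using HmU_integrable by (intro integrable_mult_right)
      show "(\<Sum>j\<in>idx. F j (z - vv \<tau> j)) \<le> (1 + C1 * \<tau>) * (1 + C2 * \<tau>) * exp (- lam * \<tau>) * (H lam (snd z) * mX z * U z)" for z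
        using shifted_flux_bound[OF lam, of z] by (simp add: F_def)
    qed
    finally show ?thesis by (simp add: Y_def)
  qed
  have Y: "0 \<le> Y lam" using Z_nonneg[of lam] Z_le_Y[of lam] \<delta> by (smt (verit) mult_nonneg_nonneg)
  have "(1 + C1 * \<tau>) * (1 + C2 * \<tau>) * exp (- lam * \<tau>) \<le> exp (C1 * \<tau>) * exp (C2 * \<tau>) * exp (- lam * \<tau>)"
    using C_nonneg \<tau> by (intro mult_right_mono mult_mono exp_ge_add_one_self) auto
  also have "\<dots> = exp (- (aa * \<tau>))" by (simp add: exp_add[symmetric] lam_def algebra_simps)
  \<comment> \<open>Half of the linear decay survives while the exponent is at most 1: there
    \<open>(1 - x / 2) * (1 + x) \<ge> 1\<close>, hence
    \<open>exp (- x) \<le> 1 - x / 2\<close>.\<close>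
  also have "\<dots> \<le> 1 - aa * \<tau> / 2"
  proof -
    define x where "x = aa * \<tau>"
    have x: "0 \<le> x" "x \<le> 1" using small aa \<tau> by (auto simp: x_def)
    have "1 \<le> (1 - x / 2) * (1 + x)" using mult_right_mono[OF x(2,1)] by (simp add: algebra_simps)
    also have "\<dots> \<le> (1 - x / 2) * exp x" using x by (intro mult_left_mono exp_ge_add_one_self) auto
    finally show ?thesis unfolding x_def[symmetric] by (simp add: exp_minus field_simps)
  qed
  finally have K: "(1 + C1 * \<tau>) * (1 + C2 * \<tau>) * exp (- lam * \<tau>) * Y lam \<le> (1 - aa * \<tau> / 2) * Y lam"
    using Y by (rule mult_right_mono)
  note iQ = HQ_estimate[OF lam]
  have "(LINT z|lborel. (1 - \<tau> * B) / 2 * (H lam (snd z) * mX z * U z) - 1 / 2 * (\<Sum>j\<in>idx. F j z)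
      - \<tau> * Mm * (H lam (snd z) * Q z)) \<le> (LINT z|lborel. \<tau> * (H lam (snd z) * mX z * (fst (DS z) \<bullet> fst (D z))))"
  proof (rule integral_mono)
    show "integrable lborel (\<lambda>z. (1 - \<tau> * B) / 2 * (H lam (snd z) * mX z * U z) - 1 / 2 * (\<Sum>j\<in>idx. F j z)
      - \<tau> * Mm * (H lam (snd z) * Q z))"
      by (intro Bochner_Integration.integrable_diff integrable_mult_right HmU_integrable iFs iQ)
    show "integrable lborel (\<lambda>z. \<tau> * (H lam (snd z) * mX z * (fst (DS z) \<bullet> fst (D z))))"
      by (intro integrable_mult_right i1)
    show "(1 - \<tau> * B) / 2 * (H lam (snd z) * mX z * U z) - 1 / 2 * (\<Sum>j\<in>idx. F j z)
      - \<tau> * Mm * (H lam (snd z) * Q z) \<le> \<tau> * (H lam (snd z) * mX z * (fst (DS z) \<bullet> fst (D z)))" for z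
      unfolding F_def by (rule energy_pointwise)
  qed
  moreover have "(LINT z|lborel. (1 - \<tau> * B) / 2 * (H lam (snd z) * mX z * U z) - 1 / 2 * (\<Sum>j\<in>idx. F j z)
      - \<tau> * Mm * (H lam (snd z) * Q z)) =
      (1 - \<tau> * B) / 2 * Y lam - 1 / 2 * (LINT z|lborel. (\<Sum>j\<in>idx. F j z)) - \<tau> * Mm * (LINT z|lborel. H lam (snd z) * Q z)"
    unfolding Y_def
    by (subst Bochner_Integration.integral_diff; (intro Bochner_Integration.integrable_diff integrable_mult_right HmU_integrable iFs iQ)?)+
      (simp only: integral_mult_right_zero)
  ultimately have "(1 - \<tau> * B) / 2 * Y lam - 1 / 2 * (LINT z|lborel. (\<Sum>j\<in>idx. F j z)) - \<tau> * Mm * (LINT z|lborel. H lam (snd z) * Q z) \<le> \<tau> * J"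
    by (simp add: J_def)
  moreover have "\<tau> * Mm * (LINT z|lborel. H lam (snd z) * Q z) \<le> \<tau> * (C3 * Y lam)"
    using iQ(2) \<tau> by (simp add: mult.assoc)
  ultimately have "(1 - \<tau> * B) / 2 * Y lam - 1 / 2 * ((1 - aa * \<tau> / 2) * Y lam) - \<tau> * (C3 * Y lam) \<le> \<tau> * J"
    using flux K by linarith
  moreover have "(1 - \<tau> * B) / 2 * Y lam - 1 / 2 * ((1 - aa * \<tau> / 2) * Y lam) - \<tau> * (C3 * Y lam) = \<tau> * Y lam"
    by (simp add: aa_def field_simps)
  ultimately have "\<tau> * Y lam \<le> \<tau> * J" by simp
  then show "Y lam \<le> (LINT z|lborel. H lam (snd z) * mX z * (fst (DS z) \<bullet> fst (D z)))"
    using \<tau> by (simp add: J_def)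
qed

definition Vol :: real where "Vol = measure lborel (cball (0::'a) R1 \<times> {0..T})"

text \<open>The discrete transport equation in weak form: \<open>\<tau> * S\<close> is \<phi> minus
  its average, and moving the translations onto the Lipschitz function \<omega> leaves O(\<tau>)
  times the integral of the absolute value of \<phi>. The Poincare inequality then bounds the
  source, tested with \<omega>, by the energy, although the source itself is not small in any
  pointwise sense. The support condition keeps all translates of \<omega> within the time
  interval.\<close>

lemma weak_test:
  assumes \<omega>: "\<omega> \<in> borel_measurable borel" "\<And>z. \<bar>\<omega> z\<bar> \<le> L" "\<And>z z'. \<bar>\<omega> z - \<omega> z'\<bar> \<le> L * norm (z - z')"
    and supp: "\<And>z. \<omega> z \<noteq> 0 \<Longrightarrow> \<tau> < snd z \<and> snd z + \<tau> < T \<and> norm (fst z) \<le> r" and \<alpha>: "0 < \<alpha>" and l: "0 \<le> l"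
  shows "\<bar>LINT z|lborel. \<omega> z * S z\<bar> \<le> L * (C2 + (1 + C2) * (\<kappa> + 1)) * (\<alpha> * Vol + CP * Z l / \<alpha>)"
proof -
  note [measurable] = \<omega>(1)
  have L: "0 \<le> L" using \<omega>(2)[of 0] by linarith
  have X: "z \<in> cyl T" if "\<omega> z \<noteq> 0" for z using supp[OF that] \<tau> by (simp add: cyl_iff)
  define F where "F = (\<lambda>j z. \<omega> z * cX j (sh z) * \<phi> (z + vv \<tau> j))"
  have \<omega>0: "\<omega> z = 0" if "r < norm (fst z) \<or> z \<notin> cyl T" for z
    using supp[of z] X[of z] that by (cases "\<omega> z = 0") auto
  have iF: "integrable lborel (F j)" if j: "j \<in> idx" for j
    unfolding F_def
  proof (rule integrableX[where r = r and C = "L * 2 * MM"])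
    show "\<bar>\<omega> z * cX j (sh z) * \<phi> (z + vv \<tau> j)\<bar> \<le> L * 2 * MM" for z
      unfolding abs_mult using \<omega>(2)[of z] cX_bounds[OF j, of "sh z"] \<phi>_bound[of "z + vv \<tau> j"] L
      by (intro mult_mono) auto
  qed (use j L MM \<omega>0 in auto)
  have i0: "integrable lborel (\<lambda>z. \<omega> z * \<phi> z)"
  proof (rule integrableX[where r = r and C = "L * MM"])
    show "\<bar>\<omega> z * \<phi> z\<bar> \<le> L * MM" for z
      unfolding abs_mult using \<omega>(2)[of z] \<phi>_bound[of z] L by (intro mult_mono) auto
  qed (use L MM \<omega>0 in auto)
  have [measurable]: "F j \<in> borel_measurable borel" if "j \<in> idx" for j
    using borel_measurable_integrable[OF iF[OF that]] by simp
  have iF': "integrable lborel (\<lambda>z. F j (z - vv \<tau> j))" "(LINT z|lborel. F j (z - vv \<tau> j)) = (LINT z|lborel. F j z)"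
    if "j \<in> idx" for j
    using lborel_translate[of "F j" "- vv \<tau> j"] that iF by auto
  have eq: "\<tau> * (\<omega> z * S z) = \<omega> z * \<phi> z - (\<Sum>j\<in>idx. F j z)" for z
  proof (cases "\<omega> z = 0")
    case False
    then have t: "snd z + \<tau> < T" and zX: "z \<in> cyl T" using supp X by auto
    have c: "cX j (sh z) = cc \<tau> j (sh z)" for j using sh_cyl[OF X_\<Omega>[OF zX] t] by (simp add: cX_def)
    have "\<phi> z = (\<Sum>j\<in>idx. cX j (sh z) * \<phi> (z + vv \<tau> j)) + \<tau> * S z"
      using \<phi>_eq[OF X_\<Omega>[OF zX]] t by (simp add: step_def c)
    then have "\<omega> z * \<phi> z = \<omega> z * (\<Sum>j\<in>idx. cX j (sh z) * \<phi> (z + vv \<tau> j)) + \<omega> z * (\<tau> * S z)"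
      by (simp add: distrib_left[symmetric])
    then show ?thesis by (simp add: F_def sum_distrib_left mult_ac)
  qed (simp add: F_def)
  have "\<tau> * (LINT z|lborel. \<omega> z * S z) = (LINT z|lborel. \<omega> z * \<phi> z - (\<Sum>j\<in>idx. F j z))"
    by (simp add: eq[symmetric])
  also have "\<dots> = (LINT z|lborel. \<omega> z * \<phi> z) - (\<Sum>j\<in>idx. LINT z|lborel. F j (z - vv \<tau> j))"
    using i0 iF iF'(2) by (subst Bochner_Integration.integral_diff) (auto simp: Bochner_Integration.integral_sum)
  also have "\<dots> = (LINT z|lborel. \<omega> z * \<phi> z - (\<Sum>j\<in>idx. F j (z - vv \<tau> j)))"
    using i0 iF'(1) by (subst Bochner_Integration.integral_diff) (auto simp: Bochner_Integration.integral_sum)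
  finally have S\<phi>: "\<tau> * (LINT z|lborel. \<omega> z * S z) = (LINT z|lborel. \<omega> z * \<phi> z - (\<Sum>j\<in>idx. F j (z - vv \<tau> j)))" .
  define C where "C = L * (C2 + (1 + C2) * (\<kappa> + 1))"
  have C: "0 \<le> C" using L C_nonneg \<kappa> by (simp add: C_def)
  define V where "V = (\<lambda>z::'a\<times>real. indicator (cball 0 R1 \<times> {0..T}) z :: real)"
  \<comment> \<open>What remains compares \<omega> with its translates and the column sum
    \<open>W\<close> with 1. Both are O(\<tau>), which cancels the \<tau> in front of
    \<open>S\<close>.\<close>
  have pw: "\<bar>\<omega> y * \<phi> y - (\<Sum>j\<in>idx. F j (y - vv \<tau> j))\<bar> \<le> \<tau> * C * (\<alpha> * V y + H l (snd y) * (\<phi> y)\<^sup>2 / \<alpha>)" for y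
  proof (cases "y \<in> cyl T \<and> \<phi> y \<noteq> 0")
    case True
    then have y: "y \<in> cyl T" by simp
    have "norm (fst y) \<le> R1" using True \<phi>_far[of y] by (rule_tac ccontr) auto
    then have V: "V y = 1" using y by (cases y) (auto simp: V_def cyl_iff indicator_def)
    define W where "W = (\<Sum>j\<in>idx. cX j (sh (y - vv \<tau> j)))"
    have "\<omega> y * \<phi> y - (\<Sum>j\<in>idx. F j (y - vv \<tau> j)) =
        (\<omega> y * (1 - W) + (\<Sum>j\<in>idx. cX j (sh (y - vv \<tau> j)) * (\<omega> y - \<omega> (y - vv \<tau> j)))) * \<phi> y"
      by (simp add: F_def W_def sum_subtractf sum_distrib_left sum_distrib_right algebra_simps)
    also have "\<bar>\<dots>\<bar> \<le> (L * (C2 * \<tau>) + (1 + C2) * (L * ((\<kappa> + 1) * \<tau>))) * \<bar>\<phi> y\<bar>"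
      unfolding abs_mult
    proof (intro mult_right_mono order.trans[OF abs_triangle_ineq] add_mono)
      show "\<bar>\<omega> y * (1 - W)\<bar> \<le> L * (C2 * \<tau>)"
        unfolding abs_mult using \<omega>(2)[of y] cX_shift_sum[OF y] L
        by (intro mult_mono) (auto simp: W_def abs_minus_commute)
      have "\<bar>\<Sum>j\<in>idx. cX j (sh (y - vv \<tau> j)) * (\<omega> y - \<omega> (y - vv \<tau> j))\<bar> \<le>
          (\<Sum>j\<in>idx. cX j (sh (y - vv \<tau> j)) * (L * ((\<kappa> + 1) * \<tau>)))"
      proof (rule order.trans[OF sum_abs sum_mono])
        fix j assume j: "j \<in> idx"
        have "\<bar>\<omega> y - \<omega> (y - vv \<tau> j)\<bar> \<le> L * norm (vv \<tau> j)"
          using \<omega>(3)[of y "y - vv \<tau> j"] by simp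
        also have "\<dots> \<le> L * ((\<kappa> + 1) * \<tau>)" using norm_vv[OF j] L by (rule mult_left_mono)
        finally show "\<bar>cX j (sh (y - vv \<tau> j)) * (\<omega> y - \<omega> (y - vv \<tau> j))\<bar> \<le> cX j (sh (y - vv \<tau> j)) * (L * ((\<kappa> + 1) * \<tau>))"
          unfolding abs_mult using cX_bounds(1)[OF j, of "sh (y - vv \<tau> j)"] by (simp add: mult_left_mono)
      qed
      also have "\<dots> = W * (L * ((\<kappa> + 1) * \<tau>))" by (simp add: W_def sum_distrib_right)
      also have "\<dots> \<le> (1 + C2) * (L * ((\<kappa> + 1) * \<tau>))"
      proof (rule mult_right_mono)
        have "C2 * \<tau> \<le> C2 * 1" using C_nonneg \<tau> by (intro mult_left_mono) auto
        then show "W \<le> 1 + C2" using cX_shift_sum[OF y] unfolding W_def[symmetric] by linarith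
        show "0 \<le> L * ((\<kappa> + 1) * \<tau>)" using L \<kappa> \<tau> by simp
      qed
      finally show "\<bar>\<Sum>j\<in>idx. cX j (sh (y - vv \<tau> j)) * (\<omega> y - \<omega> (y - vv \<tau> j))\<bar> \<le> (1 + C2) * (L * ((\<kappa> + 1) * \<tau>))" .
    qed simp
    also have "\<dots> = \<tau> * C * \<bar>\<phi> y\<bar>" by (simp add: C_def algebra_simps)
    \<comment> \<open>The free \<alpha> trades the volume of the support against the energy; it is
      balanced once the size of the energy is known.\<close>
    also have "\<bar>\<phi> y\<bar> \<le> \<alpha> * V y + H l (snd y) * (\<phi> y)\<^sup>2 / \<alpha>"
    proof -
      have "0 \<le> (\<alpha> - \<bar>\<phi> y\<bar>)\<^sup>2" by simp
      then have "2 * \<alpha> * \<bar>\<phi> y\<bar> \<le> \<alpha>\<^sup>2 + (\<phi> y)\<^sup>2" by (simp add: power2_eq_square algebra_simps abs_mult_self_eq)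
      moreover have "0 \<le> \<alpha> * \<bar>\<phi> y\<bar>" using \<alpha> by simp
      ultimately have "\<bar>\<phi> y\<bar> * \<alpha> \<le> \<alpha>\<^sup>2 + (\<phi> y)\<^sup>2" by (simp add: mult_ac)
      then have "\<bar>\<phi> y\<bar> \<le> (\<alpha>\<^sup>2 + (\<phi> y)\<^sup>2) / \<alpha>" using \<alpha> by (simp add: pos_le_divide_eq)
      also have "\<dots> = \<alpha> * V y + 1 * (\<phi> y)\<^sup>2 / \<alpha>" using \<alpha> V by (simp add: field_simps power2_eq_square)
      also have "\<dots> \<le> \<alpha> * V y + H l (snd y) * (\<phi> y)\<^sup>2 / \<alpha>"
        using \<alpha> y l by (intro add_left_mono divide_right_mono mult_right_mono) (auto simp: H_X cyl_iff)
      finally show ?thesis .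
    qed
    finally show ?thesis using C \<tau> by (simp add: mult_left_mono)
  next
    case False
    have z: "\<omega> y * \<phi> y = 0" "F j (y - vv \<tau> j) = 0" for j
    proof -
      have "\<omega> y = 0 \<and> \<omega> (y - vv \<tau> j) = 0" if \<phi>y: "\<phi> y \<noteq> 0"
      proof (intro conjI; rule ccontr)
        have y: "snd y \<le> 0 \<or> T \<le> snd y" using False \<phi>y by (auto simp: cyl_iff)
        show False if "\<omega> y \<noteq> 0" using supp[OF that] y \<tau> by linarith
        show False if "\<omega> (y - vv \<tau> j) \<noteq> 0" using supp[OF that] y \<tau> by (simp add: snd_vv)
      qed
      then show "\<omega> y * \<phi> y = 0" "F j (y - vv \<tau> j) = 0" by (auto simp: F_def)
    qed
    have "0 \<le> \<tau> * C * (\<alpha> * V y + H l (snd y) * (\<phi> y)\<^sup>2 / \<alpha>)"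
      using C \<tau> \<alpha> H_nonneg by (simp add: V_def)
    then show ?thesis by (simp only: z sum.neutral_const diff_0_right abs_zero)
  qed
  have iV: "integrable lborel V"
    unfolding V_def
  proof (rule integrable_real_indicator)
    have "bounded (cball (0::'a) R1 \<times> {0..T})" by (intro bounded_Times) auto
    then show "emeasure lborel (cball (0::'a) R1 \<times> {0..T}) < \<infinity>" by (rule emeasure_bounded_finite)
    show "cball (0::'a) R1 \<times> {0..T} \<in> sets lborel"
      by (simp, intro borel_closed closed_Times) auto
  qed
  have VolV: "(LINT y|lborel. V y) = Vol"
    by (simp add: V_def Vol_def)
  have "\<bar>LINT z|lborel. \<omega> z * \<phi> z - (\<Sum>j\<in>idx. F j (z - vv \<tau> j))\<bar> \<le>
      (LINT y|lborel. \<tau> * C * (\<alpha> * V y + H l (snd y) * (\<phi> y)\<^sup>2 / \<alpha>))"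
  proof (rule integral_abs_bound_integral)
    show "integrable lborel (\<lambda>z. \<omega> z * \<phi> z - (\<Sum>j\<in>idx. F j (z - vv \<tau> j)))"
      using i0 iF'(1) by auto
    show "integrable lborel (\<lambda>y. \<tau> * C * (\<alpha> * V y + H l (snd y) * (\<phi> y)\<^sup>2 / \<alpha>))"
      using iV H\<phi>_integrable[of l] by auto
  qed (rule pw)
  also have "\<dots> = \<tau> * C * (\<alpha> * Vol + (LINT y|lborel. H l (snd y) * (\<phi> y)\<^sup>2) / \<alpha>)"
    using iV H\<phi>_integrable[of l] by (simp add: VolV)
  also have "\<dots> \<le> \<tau> * C * (\<alpha> * Vol + CP * Z l / \<alpha>)"
    using Poincare[of l] C \<tau> \<alpha> by (intro mult_left_mono add_left_mono divide_right_mono) auto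
  finally have "\<tau> * \<bar>LINT z|lborel. \<omega> z * S z\<bar> \<le> \<tau> * (C * (\<alpha> * Vol + CP * Z l / \<alpha>))"
    unfolding S\<phi>[symmetric] using \<tau> by (simp add: abs_mult mult.assoc)
  then show ?thesis using \<tau> by (simp add: C_def)
qed

end

section \<open>Reduction of the weak formulation\<close>

text \<open>\<open>P\<close> may be nonmeasurable, hence the detour through a Borel null set
  \<open>N\<close> that contains the exceptional points.\<close>

lemma AE_slices:
  fixes P :: "'a::euclidean_space \<times> real \<Rightarrow> bool"
  assumes "AE z in lborel. P z"
  shows "AE t in lborel. AE x in lborel. P (x, t)"
proof -
  obtain N where N: "{z \<in> space lborel. \<not> P z} \<subseteq> N" "N \<in> sets (lborel :: ('a \<times> real) measure)" "emeasure lborel N = 0"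
    using assms by (auto elim!: AE_E)
  then have "AE z in lborel. z \<notin> N" by (intro AE_not_in) auto
  then have "AE z in lborel \<Otimes>\<^sub>M lborel. z \<notin> N" unfolding lborel_prod .
  from lborel_pair.AE_pair[OF this] have "AE x in lborel. AE t in lborel. (x, t) \<notin> N" .
  moreover have "{z \<in> space (lborel \<Otimes>\<^sub>M lborel). (fst z, snd z) \<notin> N} \<in> sets (lborel \<Otimes>\<^sub>M lborel)"
    using N(2) unfolding lborel_prod by (simp add: Compl_eq[symmetric])
  ultimately have "AE t in lborel. AE x in lborel. (x, t) \<notin> N"
    using lborel_pair.AE_commute[of "\<lambda>x t. (x, t) \<notin> N"] by simp
  moreover have "P z" if "z \<notin> N" for z using that N(1) by auto
  ultimately show ?thesis
    by (auto elim!: eventually_mono)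
qed

text \<open>In this direction measurability is assumed: a set with null slices is null by Tonelli,
  but only if it is measurable.\<close>

lemma AE_of_slices:
  fixes P :: "'a::euclidean_space \<times> real \<Rightarrow> bool"
  assumes "AE t in lborel. AE x in lborel. P (x, t)" "{z. P z} \<in> sets borel"
  shows "AE z in lborel. P z"
proof -
  have m: "{z \<in> space (lborel \<Otimes>\<^sub>M lborel). P (fst z, snd z)} \<in> sets (lborel \<Otimes>\<^sub>M lborel)"
    using assms(2) unfolding lborel_prod by simp
  then have "AE x in lborel. AE t in lborel. P (x, t)"
    using lborel_pair.AE_commute[of "\<lambda>x t. P (x, t)"] assms(1) by simp
  then have "AE z in lborel \<Otimes>\<^sub>M lborel. P z"
    using lborel_pair.AE_pair_iff[of "\<lambda>x t. P (x, t)"] m by simp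
  then show ?thesis unfolding lborel_prod .
qed

lemma integral_slices:
  fixes F :: "'a::euclidean_space \<times> real \<Rightarrow> real"
  assumes "integrable lborel F"
  shows "(LINT z|lborel. F z) = (LINT t|lborel. LINT x|lborel. F (x, t))"
    and "AE t in lborel. integrable lborel (\<lambda>x. F (x, t))"
proof -
  have "integrable (lborel \<Otimes>\<^sub>M lborel) (case_prod (\<lambda>x t. F (x, t)))"
    using assms by (simp add: lborel_prod)
  from lborel_pair.integral_snd[OF this] lborel_pair.AE_integrable_snd[OF this]
  show "(LINT z|lborel. F z) = (LINT t|lborel. LINT x|lborel. F (x, t))"
    and "AE t in lborel. integrable lborel (\<lambda>x. F (x, t))"
    by (simp_all add: lborel_prod)
qed

lemma lebesgue_integral_lborel:
  fixes F F' :: "'a::euclidean_space \<Rightarrow> real"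
  assumes F': "F' \<in> borel_measurable borel" and eq: "AE x in lborel. F x = F' x"
  shows "(LINT x|lebesgue. F x) = (LINT x|lborel. F' x)"
    and "integrable lebesgue F \<longleftrightarrow> integrable lborel F'"
proof -
  have m': "F' \<in> borel_measurable lebesgue" using F' by (auto intro: measurable_completion)
  have ae: "AE x in lebesgue. F x = F' x" using eq by (rule AE_completion)
  then have m: "F \<in> borel_measurable lebesgue"
    by (intro borel_measurable_AE[OF m']) (auto elim: eventually_mono)
  have "(LINT x|lebesgue. F x) = (LINT x|lebesgue. F' x)"
    by (rule integral_cong_AE[OF m m' ae])
  also have "\<dots> = (LINT x|lborel. F' x)" using F' by (intro integral_completion) simp
  finally show "(LINT x|lebesgue. F x) = (LINT x|lborel. F' x)" .
  have "integrable lebesgue F \<longleftrightarrow> integrable lebesgue F'"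
    by (rule integrable_cong_AE[OF m m' ae])
  also have "\<dots> \<longleftrightarrow> integrable lborel F'" using F' by (intro integrable_completion) simp
  finally show "integrable lebesgue F \<longleftrightarrow> integrable lborel F'" .
qed

lemma cyl_lebesgue: "(cyl T :: ('a::euclidean_space \<times> real) set) \<in> sets lebesgue"
  by (rule sets_completionI_sets) (use borel_open[OF open_cyl[of T]] in simp)

lemma AE_lebesgue_on: "S \<in> sets lebesgue \<Longrightarrow> (AE x in lebesgue_on S. P x) \<longleftrightarrow> (AE x in lborel. x \<in> S \<longrightarrow> P x)"
  by (subst AE_restrict_space_iff) (auto simp: AE_completion_iff)

lemma integral_lebesgue_on_cyl:
  fixes F F' :: "'a::euclidean_space \<times> real \<Rightarrow> real"
  assumes F': "F' \<in> borel_measurable borel" and eq: "AE z in lborel. z \<in> cyl T \<longrightarrow> F z = F' z"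
    and 0: "\<And>z. z \<notin> cyl T \<Longrightarrow> F' z = 0"
  shows "(LINT z|lebesgue_on (cyl T). F z) = (LINT z|lborel. F' z)"
    and "integrable (lebesgue_on (cyl T)) F \<longleftrightarrow> integrable lborel F'"
proof -
  have ae: "AE z in lborel. indicator (cyl T) z *\<^sub>R F z = F' z"
    using eq by eventually_elim (use 0 in \<open>auto simp: indicator_def\<close>)
  note L = lebesgue_integral_lborel[OF F' ae]
  show "(LINT z|lebesgue_on (cyl T). F z) = (LINT z|lborel. F' z)"
    using L(1) cyl_lebesgue[of T] by (subst integral_restrict_space) auto
  show "integrable (lebesgue_on (cyl T)) F \<longleftrightarrow> integrable lborel F'"
    using L(2) cyl_lebesgue[of T] by (subst integrable_restrict_space) auto
qed

text \<open>Solutions are Lebesgue measurable, a property that individual time slices need not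
  inherit. Borel representatives, zero off the cylinder, have measurable slices and can be
  integrated over the whole space.\<close>

lemma borel_representative:
  fixes u :: "'a::euclidean_space \<times> real \<Rightarrow> real"
  assumes "u \<in> borel_measurable (lebesgue_on (cyl T))"
  obtains u' where "u' \<in> borel_measurable borel" "\<And>z. z \<notin> cyl T \<Longrightarrow> u' z = 0"
    "AE z in lborel. z \<in> cyl T \<longrightarrow> u z = u' z"
proof -
  have "(\<lambda>z. indicator (cyl T) z *\<^sub>R u z) \<in> borel_measurable lebesgue"
    using assms cyl_lebesgue[of T] by (subst (asm) borel_measurable_restrict_space_iff) (auto simp: mult.commute)
  then obtain g where g: "g \<in> borel_measurable lborel" "AE z in lborel. indicator (cyl T) z *\<^sub>R u z = g z"
    using completion_ex_borel_measurable_real by blast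
  show thesis
  proof (rule that[of "\<lambda>z. indicator (cyl T) z * g z"])
    show "(\<lambda>z. indicator (cyl T) z * g z) \<in> borel_measurable borel"
      using g(1) borel_open[OF open_cyl[of T]] by (intro borel_measurable_times borel_measurable_indicator) auto
    show "AE z in lborel. z \<in> cyl T \<longrightarrow> u z = indicator (cyl T) z * g z"
      using g(2) by eventually_elim auto
  qed auto
qed

lemma borel_representative_vector:
  fixes G :: "'a::euclidean_space \<times> real \<Rightarrow> 'a"
  assumes "G \<in> borel_measurable (lebesgue_on (cyl T))"
  obtains G' where "G' \<in> borel_measurable borel" "\<And>z. z \<notin> cyl T \<Longrightarrow> G' z = 0"
    "AE z in lborel. z \<in> cyl T \<longrightarrow> G z = G' z"
proof -
  have "\<exists>u'. u' \<in> borel_measurable borel \<and> (\<forall>z. z \<notin> cyl T \<longrightarrow> u' z = 0) \<and>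
      (AE z in lborel. z \<in> cyl T \<longrightarrow> G z \<bullet> i = u' z)" for i
  proof -
    have "(\<lambda>z. G z \<bullet> i) \<in> borel_measurable (lebesgue_on (cyl T))" using assms by measurable
    then show ?thesis by (rule borel_representative) blast
  qed
  from choice[OF allI[OF this]] obtain U where "\<forall>i. U i \<in> borel_measurable borel \<and> (\<forall>z. z \<notin> cyl T \<longrightarrow> U i z = 0) \<and>
      (AE z in lborel. z \<in> cyl T \<longrightarrow> G z \<bullet> i = U i z)" ..
  then have U: "\<And>i. U i \<in> borel_measurable borel" "\<And>i z. z \<notin> cyl T \<Longrightarrow> U i z = 0"
    "\<And>i. AE z in lborel. z \<in> cyl T \<longrightarrow> G z \<bullet> i = U i z"
    by blast+
  show thesis
  proof (rule that[of "\<lambda>z. \<Sum>i\<in>Basis. U i z *\<^sub>R i"])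
    show "(\<lambda>z. \<Sum>i\<in>Basis. U i z *\<^sub>R i) \<in> borel_measurable borel"
      using U(1) by measurable
    have "AE z in lborel. \<forall>i\<in>Basis. z \<in> cyl T \<longrightarrow> G z \<bullet> i = U i z"
      using U(3) by (intro AE_finite_allI) auto
    then show "AE z in lborel. z \<in> cyl T \<longrightarrow> G z = (\<Sum>i\<in>Basis. U i z *\<^sub>R i)"
    proof eventually_elim
      case (elim z)
      show ?case
      proof
        assume z: "z \<in> cyl T"
        have "G z = (\<Sum>i\<in>Basis. (G z \<bullet> i) *\<^sub>R i)" by (simp only: euclidean_representation)
        also have "\<dots> = (\<Sum>i\<in>Basis. U i z *\<^sub>R i)" using elim z by (intro sum.cong) auto
        finally show "G z = (\<Sum>i\<in>Basis. U i z *\<^sub>R i)" .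
      qed
    qed
  qed (simp add: U(2))
qed

lemma GDERIV_frechet: "GDERIV \<phi> x :> D \<Longrightarrow> frechet_derivative \<phi> (at x) v = v \<bullet> D"
  unfolding gderiv_def by (rule fun_cong[OF frechet_derivative_at[symmetric]])

section \<open>C1 test functions for weak gradients\<close>

definition C1_sequence :: "'a::euclidean_space set \<Rightarrow> 'a set \<Rightarrow> ('a \<Rightarrow> real) \<Rightarrow> ('a \<Rightarrow> 'a) \<Rightarrow> real \<Rightarrow>
    (nat \<Rightarrow> 'a \<Rightarrow> real) \<Rightarrow> (nat \<Rightarrow> 'a \<Rightarrow> 'a) \<Rightarrow> bool" where
  "C1_sequence U K \<phi> D Bd \<psi> D' \<longleftrightarrow>
    (\<forall>n. test_function U (\<psi> n)) \<and> (\<forall>n x. GDERIV (\<psi> n) x :> D' n x) \<and>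
    (\<forall>n x. x \<notin> K \<longrightarrow> \<psi> n x = 0) \<and> (\<forall>n x. x \<notin> K \<longrightarrow> D' n x = 0) \<and>
    (\<forall>n x. \<bar>\<psi> n x\<bar> \<le> Bd) \<and> (\<forall>n x. norm (D' n x) \<le> Bd) \<and>
    (\<forall>x. (\<lambda>n. \<psi> n x) \<longlonglongrightarrow> \<phi> x) \<and> (\<forall>x. (\<lambda>n. D' n x) \<longlonglongrightarrow> D x) \<and>
    continuous_on UNIV \<phi> \<and> continuous_on UNIV D \<and> (\<forall>n. continuous_on UNIV (\<psi> n)) \<and> (\<forall>n. continuous_on UNIV (D' n)) \<and>
    (\<forall>x. \<bar>\<phi> x\<bar> \<le> Bd) \<and> (\<forall>x. norm (D x) \<le> Bd) \<and> (\<forall>x. x \<notin> K \<longrightarrow> \<phi> x = 0) \<and> (\<forall>x. x \<notin> K \<longrightarrow> D x = 0)"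

lemma C1_sequenceD:
  assumes "C1_sequence U K \<phi> D Bd \<psi> D'"
  shows "test_function U (\<psi> n)" "GDERIV (\<psi> n) x :> D' n x" "x \<notin> K \<Longrightarrow> \<psi> n x = 0" "x \<notin> K \<Longrightarrow> D' n x = 0"
    "\<bar>\<psi> n x\<bar> \<le> Bd" "norm (D' n x) \<le> Bd" "(\<lambda>n. \<psi> n x) \<longlonglongrightarrow> \<phi> x" "(\<lambda>n. D' n x) \<longlonglongrightarrow> D x"
    "continuous_on UNIV \<phi>" "continuous_on UNIV D" "continuous_on UNIV (\<psi> n)" "continuous_on UNIV (D' n)"
    "\<bar>\<phi> x\<bar> \<le> Bd" "norm (D x) \<le> Bd" "x \<notin> K \<Longrightarrow> \<phi> x = 0" "x \<notin> K \<Longrightarrow> D x = 0"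
  using assms unfolding C1_sequence_def by blast+

lemma C1_smooth_sequence:
  fixes \<phi> :: "'a::euclidean_space \<Rightarrow> real"
  assumes \<phi>: "\<And>x. GDERIV \<phi> x :> D x" "continuous_on UNIV D"
    and K: "compact K" "\<And>x. x \<notin> K \<Longrightarrow> \<phi> x = 0" "K \<subseteq> U" "open U"
  shows "\<exists>K' \<psi> D' Bd. compact K' \<and> K' \<subseteq> U \<and> 0 < Bd \<and> C1_sequence U K' \<phi> D Bd \<psi> D'"
proof -
  have "\<exists>K'. compact K' \<and> K' \<subseteq> U \<and> (\<forall>e>0. \<exists>\<psi> D'. C1_close U K' \<phi> D e \<psi> D')"
    by (rule C1_smooth_approx[OF \<phi> K])
  then obtain K' where K': "compact K' \<and> K' \<subseteq> U \<and> (\<forall>e>0. \<exists>\<psi> D'. C1_close U K' \<phi> D e \<psi> D')" ..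
  then have "\<exists>\<psi> D'. C1_close U K' \<phi> D (1 / real (Suc n)) \<psi> D'" for n by simp
  from choice[OF allI[OF this]] obtain \<psi> where "\<forall>n. \<exists>D'. C1_close U K' \<phi> D (1 / real (Suc n)) (\<psi> n) D'" ..
  from choice[OF this] obtain D' where P: "\<forall>n. C1_close U K' \<phi> D (1 / real (Suc n)) (\<psi> n) (D' n)" ..
  have tf: "\<And>n. test_function U (\<psi> n)" and cD': "\<And>n. continuous_on UNIV (D' n)"
    and gd: "\<And>n x. GDERIV (\<psi> n) x :> D' n x"
    and c1: "\<And>n x. \<bar>\<psi> n x - \<phi> x\<bar> \<le> 1 / real (Suc n)" and c2: "\<And>n x. norm (D' n x - D x) \<le> 1 / real (Suc n)"
    and s1: "\<And>n x. x \<notin> K' \<Longrightarrow> \<psi> n x = 0" and s2: "\<And>n x. x \<notin> K' \<Longrightarrow> D' n x = 0"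
    using P unfolding C1_close_def by blast+
  have inv: "(\<lambda>n. 1 / real (Suc n)) \<longlonglongrightarrow> 0"
    using LIMSEQ_inverse_real_of_nat by (simp add: inverse_eq_divide)
  have lim1: "(\<lambda>n. \<psi> n x) \<longlonglongrightarrow> \<phi> x" for x
    by (rule LIM_zero_cancel, rule tendsto_rabs_zero_cancel, rule tendsto_sandwich[OF _ _ tendsto_const inv])
      (use c1 in auto)
  have lim2: "(\<lambda>n. D' n x) \<longlonglongrightarrow> D x" for x
    by (rule LIM_zero_cancel, rule tendsto_norm_zero_cancel, rule tendsto_sandwich[OF _ _ tendsto_const inv])
      (use c2 in auto)
  have \<phi>0: "\<phi> x = 0" "D x = 0" if "x \<notin> K'" for x
    using LIMSEQ_unique[OF lim1[of x]] LIMSEQ_unique[OF lim2[of x]] s1[OF that] s2[OF that] by auto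
  have cont\<phi>: "continuous_on UNIV \<phi>"
    using \<phi>(1) by (auto intro!: continuous_at_imp_continuous_on has_derivative_continuous simp: gderiv_def)
  have cont\<psi>: "continuous_on UNIV (\<psi> n)" for n
    using gd by (auto intro!: continuous_at_imp_continuous_on has_derivative_continuous simp: gderiv_def)
  have cK': "compact K'" using K' by simp
  obtain B1 where B1: "0 < B1" "\<And>x. norm (\<phi> x) \<le> B1"
    by (rule compact_support_bounded[OF cont\<phi> cK']) (auto simp: \<phi>0)
  obtain B2 where B2: "0 < B2" "\<And>x. norm (D x) \<le> B2"
    by (rule compact_support_bounded[OF \<phi>(2) cK']) (auto simp: \<phi>0)
  have one: "1 / real (Suc n) \<le> 1" for n by simp
  define Bd where "Bd = B1 + B2 + 1"
  have b1: "\<bar>\<psi> n x\<bar> \<le> Bd" "\<bar>\<phi> x\<bar> \<le> Bd" for n x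
    using c1[of n x] B1(2)[of x] one[of n] B1(1) B2(1) unfolding Bd_def real_norm_def by linarith+
  have b2: "norm (D' n x) \<le> Bd" "norm (D x) \<le> Bd" for n x
    using norm_triangle_ineq[of "D' n x - D x" "D x"] c2[of n x] B2(2)[of x] one[of n] B1(1)
    unfolding Bd_def diff_add_cancel by linarith+
  have "0 < Bd" using B1 B2 by (simp add: Bd_def)
  moreover have "C1_sequence U K' \<phi> D Bd \<psi> D'"
    unfolding C1_sequence_def
    by (intro conjI allI impI tf gd s1 s2 b1 b2 lim1 lim2 cont\<phi> \<phi>(2) cont\<psi> cD' \<phi>0)
  ultimately show ?thesis using K' by blast
qed

text \<open>Dominated convergence on the common support of smooth approximations extends integration
  by parts to C1 test functions, and the identity passes to Borel representatives. Local
  integrability of both functions supplies the dominating functions.\<close>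

lemma has_weak_gradient_C1:
  fixes u u' :: "'a::euclidean_space \<Rightarrow> real" and g g' :: "'a \<Rightarrow> 'a"
  assumes w: "has_weak_gradient u g"
    and u': "u' \<in> borel_measurable borel" "AE x in lborel. u x = u' x"
    and g': "g' \<in> borel_measurable borel" "AE x in lborel. g x = g' x"
    and \<phi>: "\<And>x. GDERIV \<phi> x :> D x" "continuous_on UNIV D" and K: "compact K" "\<And>x. x \<notin> K \<Longrightarrow> \<phi> x = 0"
    and i: "i \<in> Basis"
  shows "(LINT x|lborel. u' x * (D x \<bullet> i)) = - (LINT x|lborel. (g' x \<bullet> i) * \<phi> x)"
    and "integrable lborel (\<lambda>x. (g' x \<bullet> i) * \<phi> x)" "integrable lborel (\<lambda>x. u' x * (D x \<bullet> i))"
proof -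
  note [measurable] = u'(1) g'(1)
  have "\<exists>K' \<psi> D' Bd. compact K' \<and> K' \<subseteq> UNIV \<and> 0 < Bd \<and> C1_sequence UNIV K' \<phi> D Bd \<psi> D'"
    by (rule C1_smooth_sequence[OF \<phi> K subset_UNIV open_UNIV])
  then obtain K' \<psi> D' Bd where K': "compact K'" and Bd: "0 < Bd" and S: "C1_sequence UNIV K' \<phi> D Bd \<psi> D'"
    by (elim exE conjE) (rule that)
  note S = C1_sequenceD[OF S]
  have [measurable]: "K' \<in> sets borel" by (rule borel_closed[OF compact_imp_closed[OF K']])
  have [measurable]: "\<phi> \<in> borel_measurable borel" "D \<in> borel_measurable borel"
    "\<And>n. \<psi> n \<in> borel_measurable borel" "\<And>n. D' n \<in> borel_measurable borel"
    using S(9-12) by (auto intro: borel_measurable_continuous_onI)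
  have iu: "integrable lborel (\<lambda>x. indicator K' x * \<bar>u' x\<bar>)"
  proof -
    have "integrable lebesgue (\<lambda>x. indicator K' x *\<^sub>R u x)"
      using w K' by (simp add: has_weak_gradient_def locally_integrable_def set_integrable_def)
    moreover have "AE x in lborel. indicator K' x *\<^sub>R u x = indicator K' x * u' x"
      using u'(2) by eventually_elim simp
    ultimately have "integrable lborel (\<lambda>x. indicator K' x * u' x)"
      by (subst (asm) lebesgue_integral_lborel(2)[where F' = "\<lambda>x. indicator K' x * u' x"]) auto
    then have "integrable lborel (\<lambda>x. \<bar>indicator K' x * u' x\<bar>)" by (rule integrable_abs)
    then show ?thesis by (simp add: abs_mult)
  qed
  have ig: "integrable lborel (\<lambda>x. indicator K' x * \<bar>g' x \<bullet> i\<bar>)"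
  proof -
    have "integrable lebesgue (\<lambda>x. indicator K' x *\<^sub>R g x)"
      using w K' by (simp add: has_weak_gradient_def locally_integrable_def set_integrable_def)
    then have "integrable lebesgue (\<lambda>x. (indicator K' x *\<^sub>R g x) \<bullet> i)" by (rule integrable_inner_left)
    moreover have "AE x in lborel. (indicator K' x *\<^sub>R g x) \<bullet> i = indicator K' x * (g' x \<bullet> i)"
      using g'(2) by eventually_elim simp
    ultimately have "integrable lborel (\<lambda>x. indicator K' x * (g' x \<bullet> i))"
      by (subst (asm) lebesgue_integral_lborel(2)[where F' = "\<lambda>x. indicator K' x * (g' x \<bullet> i)"]) auto
    then have "integrable lborel (\<lambda>x. \<bar>indicator K' x * (g' x \<bullet> i)\<bar>)" by (rule integrable_abs)
    then show ?thesis by (simp add: abs_mult)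
  qed
  have eq: "(LINT x|lborel. u' x * (D' n x \<bullet> i)) = - (LINT x|lborel. (g' x \<bullet> i) * \<psi> n x)" for n
  proof -
    have "(LINT x|lebesgue. u x * frechet_derivative (\<psi> n) (at x) i) = - (LINT x|lebesgue. (g x \<bullet> i) * \<psi> n x)"
      using w S(1) i by (auto simp: has_weak_gradient_def)
    moreover have "(LINT x|lebesgue. u x * frechet_derivative (\<psi> n) (at x) i) = (LINT x|lborel. u' x * (D' n x \<bullet> i))"
    proof (rule lebesgue_integral_lborel(1))
      show "AE x in lborel. u x * frechet_derivative (\<psi> n) (at x) i = u' x * (D' n x \<bullet> i)"
        using u'(2) by eventually_elim (simp add: GDERIV_frechet[OF S(2)] inner_commute)
    qed measurable
    moreover have "(LINT x|lebesgue. (g x \<bullet> i) * \<psi> n x) = (LINT x|lborel. (g' x \<bullet> i) * \<psi> n x)"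
    proof (rule lebesgue_integral_lborel(1))
      show "AE x in lborel. (g x \<bullet> i) * \<psi> n x = (g' x \<bullet> i) * \<psi> n x"
        using g'(2) by eventually_elim simp
    qed measurable
    ultimately show ?thesis by simp
  qed
  have L1: "(\<lambda>n. LINT x|lborel. u' x * (D' n x \<bullet> i)) \<longlonglongrightarrow> (LINT x|lborel. u' x * (D x \<bullet> i))"
  proof (rule integral_dominated_convergence[where w = "\<lambda>x. (indicator K' x * \<bar>u' x\<bar>) * (Bd)"])
    show "integrable lborel (\<lambda>x. (indicator K' x * \<bar>u' x\<bar>) * (Bd))" by (intro integrable_mult_left iu)
    show "AE x in lborel. (\<lambda>n. u' x * (D' n x \<bullet> i)) \<longlonglongrightarrow> u' x * (D x \<bullet> i)"
      by (intro AE_I2 tendsto_intros S(8))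
    show "AE x in lborel. norm (u' x * (D' n x \<bullet> i)) \<le> (indicator K' x * \<bar>u' x\<bar>) * (Bd)" for n
    proof (rule AE_I2)
      fix x
      show "norm (u' x * (D' n x \<bullet> i)) \<le> (indicator K' x * \<bar>u' x\<bar>) * (Bd)"
      proof (cases "x \<in> K'")
        case True
        have "\<bar>D' n x \<bullet> i\<bar> \<le> Bd"
          using Basis_le_norm[OF i, of "D' n x"] S(6)[of n x] by linarith
        then show ?thesis using True by (simp add: abs_mult mult_left_mono)
      qed (simp add: S(4))
    qed
  qed measurable
  have L2: "(\<lambda>n. LINT x|lborel. (g' x \<bullet> i) * \<psi> n x) \<longlonglongrightarrow> (LINT x|lborel. (g' x \<bullet> i) * \<phi> x)"
  proof (rule integral_dominated_convergence[where w = "\<lambda>x. (indicator K' x * \<bar>g' x \<bullet> i\<bar>) * (Bd)"])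
    show "integrable lborel (\<lambda>x. (indicator K' x * \<bar>g' x \<bullet> i\<bar>) * (Bd))" by (intro integrable_mult_left ig)
    show "AE x in lborel. (\<lambda>n. (g' x \<bullet> i) * \<psi> n x) \<longlonglongrightarrow> (g' x \<bullet> i) * \<phi> x"
      by (intro AE_I2 tendsto_intros S(7))
    show "AE x in lborel. norm ((g' x \<bullet> i) * \<psi> n x) \<le> (indicator K' x * \<bar>g' x \<bullet> i\<bar>) * (Bd)" for n
    proof (rule AE_I2)
      fix x
      show "norm ((g' x \<bullet> i) * \<psi> n x) \<le> (indicator K' x * \<bar>g' x \<bullet> i\<bar>) * (Bd)"
        using S(5)[of n x] by (cases "x \<in> K'") (auto simp add: abs_mult mult_left_mono S(3))
    qed
  qed measurable
  have "(\<lambda>n. LINT x|lborel. u' x * (D' n x \<bullet> i)) \<longlonglongrightarrow> - (LINT x|lborel. (g' x \<bullet> i) * \<phi> x)"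
    unfolding eq by (intro tendsto_minus L2)
  with L1 show "(LINT x|lborel. u' x * (D x \<bullet> i)) = - (LINT x|lborel. (g' x \<bullet> i) * \<phi> x)"
    by (rule LIMSEQ_unique)
  show "integrable lborel (\<lambda>x. (g' x \<bullet> i) * \<phi> x)"
  proof (rule Bochner_Integration.integrable_bound[OF integrable_mult_left[OF ig, of Bd]])
    show "AE x in lborel. norm ((g' x \<bullet> i) * \<phi> x) \<le> norm ((indicator K' x * \<bar>g' x \<bullet> i\<bar>) * Bd)"
    proof (rule AE_I2)
      fix x show "norm ((g' x \<bullet> i) * \<phi> x) \<le> norm ((indicator K' x * \<bar>g' x \<bullet> i\<bar>) * Bd)"
        using Bd S(13)[of x] by (cases "x \<in> K'") (auto simp: abs_mult mult_left_mono S(15,16))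
    qed
  qed measurable
  show "integrable lborel (\<lambda>x. u' x * (D x \<bullet> i))"
  proof (rule Bochner_Integration.integrable_bound[OF integrable_mult_left[OF iu, of Bd]])
    show "AE x in lborel. norm (u' x * (D x \<bullet> i)) \<le> norm ((indicator K' x * \<bar>u' x\<bar>) * Bd)"
    proof (rule AE_I2)
      fix x
      have "\<bar>D x \<bullet> i\<bar> \<le> Bd" using Basis_le_norm[OF i, of "D x"] S(14)[of x] by linarith
      then show "norm (u' x * (D x \<bullet> i)) \<le> norm ((indicator K' x * \<bar>u' x\<bar>) * Bd)"
        using Bd by (cases "x \<in> K'") (auto simp: abs_mult mult_left_mono S(15,16))
    qed
  qed measurable
qed

section \<open>Consequences of the regularity class\<close>

lemma cyl_indicator_measurable:
  fixes F :: "'a::euclidean_space \<times> real \<Rightarrow> 'b::euclidean_space"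
  assumes "continuous_on (cyl T) F"
  shows "(\<lambda>z. indicator (cyl T) z *\<^sub>R F z) \<in> borel_measurable borel"
  by (rule borel_measurable_continuous_on_indicator[OF borel_open[OF open_cyl] assms])

lemma AE_time: "(AE t in lebesgue_on {0<..<T}. P t) \<longleftrightarrow> (AE t in lborel. t \<in> {0<..<T} \<longrightarrow> P t)" for T :: real
  by (rule AE_lebesgue_on) simp

lemma AE_representative_slices:
  fixes T :: real
  assumes "AE z in lborel. z \<in> cyl T \<longrightarrow> u z = u' z"
  shows "AE t in lborel. t \<in> {0<..<T} \<longrightarrow> (AE x in lborel. slice u t x = slice u' t x)"
  using AE_slices[OF assms]
proof eventually_elim
  case (elim t)
  show ?case
  proof
    assume "t \<in> {0<..<T}"
    then show "AE x in lborel. slice u t x = slice u' t x"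
      using elim by (auto simp: cyl_iff slice_def elim!: eventually_mono)
  qed
qed

lemma slice_measurable:
  fixes u :: "'a::euclidean_space \<times> real \<Rightarrow> 'b::euclidean_space"
  assumes "u \<in> borel_measurable borel"
  shows "slice u t \<in> borel_measurable borel"
  unfolding slice_def
  by (rule measurable_compose[OF _ assms]) (intro borel_measurable_continuous_onI continuous_intros)

text \<open>The bounds on almost every time slice combine into one bound almost everywhere in the
  cylinder; the Borel representative provides the measurable exceptional set that
  \<open>AE_of_slices\<close> asks for.\<close>

lemma Linf_L1_Linf_bounded:
  fixes \<rho> r :: "'a::euclidean_space \<times> real \<Rightarrow> real"
  assumes \<rho>: "\<rho> \<in> Linf_L1_Linf T" and r: "r \<in> borel_measurable borel" and eq: "AE z in lborel. z \<in> cyl T \<longrightarrow> \<rho> z = r z"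
    and 0: "\<And>z. z \<notin> cyl T \<Longrightarrow> r z = 0"
  obtains M where "0 \<le> M" "AE z in lborel. \<bar>r z\<bar> \<le> M"
proof -
  define E where "E = esssup (lebesgue_on {0<..<T}) (\<lambda>t. L1_norm (slice \<rho> t) + Linf_norm (slice \<rho> t))"
  have E: "E < \<infinity>" using \<rho> by (simp add: Linf_L1_Linf_def E_def)
  define M where "M = enn2real E"
  have EM: "E = ennreal M" using E by (simp add: M_def)
  have "AE t in lebesgue_on {0<..<T}. L1_norm (slice \<rho> t) + Linf_norm (slice \<rho> t) \<le> E"
    unfolding E_def by (rule esssup_AE)
  then have "AE t in lborel. t \<in> {0<..<T} \<longrightarrow> L1_norm (slice \<rho> t) + Linf_norm (slice \<rho> t) \<le> E"
    by (simp only: AE_time)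
  moreover note AE_representative_slices[OF eq]
  ultimately have "AE t in lborel. AE x in lborel. \<bar>r (x, t)\<bar> \<le> M"
  proof eventually_elim
    case (elim t)
    show ?case
    proof (cases "t \<in> {0<..<T}")
      case True
      have "Linf_norm (slice \<rho> t) \<le> E"
        using elim(1) True order.trans[OF add_increasing[OF zero_le order.refl]] by blast
      then have le: "esssup lebesgue (\<lambda>x. ennreal (norm (slice \<rho> t x))) \<le> ennreal M"
        by (simp add: Linf_norm_def EM)
      have "AE x in lebesgue. ennreal (norm (slice \<rho> t x)) \<le> ennreal M"
        using esssup_AE[of "\<lambda>x. ennreal (norm (slice \<rho> t x))" lebesgue]
        by eventually_elim (use le in \<open>auto intro: order.trans\<close>)
      then have "AE x in lborel. ennreal (norm (slice \<rho> t x)) \<le> ennreal M" by (simp add: AE_completion_iff)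
      then show ?thesis
        using elim(2)[rule_format, OF True]
        by eventually_elim (simp add: slice_def M_def)
    next
      case False
      then show ?thesis using 0 by (intro AE_I2) (auto simp: cyl_iff M_def)
    qed
  qed
  then have "AE z in lborel. \<bar>r z\<bar> \<le> M"
    by (rule AE_of_slices) (use r in measurable)
  then show thesis by (intro that[of M]) (simp_all add: M_def)
qed

lemma nn_integral_slices:
  fixes F :: "'a::euclidean_space \<times> real \<Rightarrow> ennreal"
  assumes "F \<in> borel_measurable borel"
  shows "(\<integral>\<^sup>+z. F z \<partial>lborel) = (\<integral>\<^sup>+t. \<integral>\<^sup>+x. F (x, t) \<partial>lborel \<partial>lborel)"
proof -
  have "F \<in> borel_measurable (lborel \<Otimes>\<^sub>M lborel)" using assms unfolding lborel_prod by simp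
  from lborel_pair.nn_integral_snd[OF this] show ?thesis unfolding lborel_prod by simp
qed

lemma L2_norm_sq_AE:
  fixes v v' :: "'a::euclidean_space \<Rightarrow> 'b::euclidean_space"
  assumes "AE x in lborel. v x = v' x"
  shows "L2_norm_sq v = (\<integral>\<^sup>+x. ennreal ((norm (v' x))\<^sup>2) \<partial>lborel)"
  unfolding L2_norm_sq_def nn_integral_completion
  using assms by (intro nn_integral_cong_AE) (auto elim: eventually_mono)

lemma L2_H1_Linf_square_integrable:
  fixes p u :: "'a::euclidean_space \<times> real \<Rightarrow> real" and G G' :: "'a \<times> real \<Rightarrow> 'a"
  assumes fin: "(\<integral>\<^sup>+t. L2_norm_sq (slice p t) + L2_norm_sq (slice G t) + (Linf_norm (slice p t))\<^sup>2
           \<partial>lebesgue_on {0<..<T}) < \<infinity>"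
    and u: "u \<in> borel_measurable borel" "AE z in lborel. z \<in> cyl T \<longrightarrow> p z = u z" "\<And>z. z \<notin> cyl T \<Longrightarrow> u z = 0"
    and G': "G' \<in> borel_measurable borel" "AE z in lborel. z \<in> cyl T \<longrightarrow> G z = G' z" "\<And>z. z \<notin> cyl T \<Longrightarrow> G' z = 0"
  shows "integrable lborel (\<lambda>z. (u z)\<^sup>2)" "integrable lborel (\<lambda>z. (norm (G' z))\<^sup>2)"
proof -
  have key: "integrable lborel (\<lambda>z. (norm (v' z))\<^sup>2)"
    if v': "v' \<in> borel_measurable borel" "AE z in lborel. z \<in> cyl T \<longrightarrow> v z = v' z" "\<And>z. z \<notin> cyl T \<Longrightarrow> v' z = 0"
      and le: "\<And>t. L2_norm_sq (slice v t) \<le> L2_norm_sq (slice p t) + L2_norm_sq (slice G t) + (Linf_norm (slice p t))\<^sup>2"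
    for v v' :: "'a \<times> real \<Rightarrow> 'b::euclidean_space"
  proof -
    note [measurable] = v'(1)
    have "(\<integral>\<^sup>+z. ennreal ((norm (v' z))\<^sup>2) \<partial>lborel) = (\<integral>\<^sup>+t. \<integral>\<^sup>+x. ennreal ((norm (v' (x, t)))\<^sup>2) \<partial>lborel \<partial>lborel)"
      by (rule nn_integral_slices) measurable
    also have "\<dots> \<le> (\<integral>\<^sup>+t. (L2_norm_sq (slice p t) + L2_norm_sq (slice G t) + (Linf_norm (slice p t))\<^sup>2) * indicator {0<..<T} t \<partial>lborel)"
    proof (rule nn_integral_mono_AE)
      show "AE t in lborel. (\<integral>\<^sup>+x. ennreal ((norm (v' (x, t)))\<^sup>2) \<partial>lborel) \<le>
          (L2_norm_sq (slice p t) + L2_norm_sq (slice G t) + (Linf_norm (slice p t))\<^sup>2) * indicator {0<..<T} t"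
        using AE_representative_slices[OF v'(2)]
      proof eventually_elim
        case (elim t)
        show ?case
        proof (cases "t \<in> {0<..<T}")
          case True
          have "(\<integral>\<^sup>+x. ennreal ((norm (v' (x, t)))\<^sup>2) \<partial>lborel) = L2_norm_sq (slice v t)"
            using L2_norm_sq_AE[OF elim[rule_format, OF True]] by (simp add: slice_def)
          then show ?thesis using le[of t] True by simp
        next
          case False
          then show ?thesis using v'(3) by (simp add: cyl_iff)
        qed
      qed
    qed
    also have "\<dots> = (\<integral>\<^sup>+t. L2_norm_sq (slice p t) + L2_norm_sq (slice G t) + (Linf_norm (slice p t))\<^sup>2 \<partial>lebesgue_on {0<..<T})"
      by (subst nn_integral_restrict_space) (auto simp: nn_integral_completion)
    finally have "(\<integral>\<^sup>+z. ennreal ((norm (v' z))\<^sup>2) \<partial>lborel) < \<infinity>" using fin by (rule le_less_trans)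
    then show ?thesis by (intro integrableI_nonneg) auto
  qed
  show "integrable lborel (\<lambda>z. (u z)\<^sup>2)"
    using key[OF u] by (simp add: add.assoc)
  show "integrable lborel (\<lambda>z. (norm (G' z))\<^sup>2)"
  proof (rule key[OF G'])
    fix t
    show "L2_norm_sq (slice G t) \<le> L2_norm_sq (slice p t) + L2_norm_sq (slice G t) + (Linf_norm (slice p t))\<^sup>2"
      by (rule add_increasing2[OF zero_le add_increasing[OF zero_le order.refl]])
  qed
qed

lemma slice_gradient:
  fixes \<psi> :: "'a::euclidean_space \<times> real \<Rightarrow> real"
  assumes "GDERIV \<psi> (x, t) :> D"
  shows "GDERIV (\<lambda>x. \<psi> (x, t)) x :> fst D"
proof -
  have "((\<lambda>x. (x, t)) has_derivative (\<lambda>h. (h, 0))) (at x)"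
    by (auto intro!: derivative_eq_intros)
  from has_derivative_compose[OF this assms[unfolded gderiv_def]]
  show ?thesis unfolding gderiv_def by (cases D) simp
qed

lemma weak_space_gradient_AE:
  fixes p :: "'a::euclidean_space \<times> real \<Rightarrow> real"
  assumes "has_weak_space_gradient T p G"
    and "AE z in lborel. z \<in> cyl T \<longrightarrow> p z = u z" "AE z in lborel. z \<in> cyl T \<longrightarrow> G z = G' z"
  shows "AE t in lborel. t \<in> {0<..<T} \<longrightarrow> has_weak_gradient (slice p t) (slice G t) \<and>
    (AE x in lborel. slice p t x = slice u t x) \<and> (AE x in lborel. slice G t x = slice G' t x)"
proof -
  have "AE t in lborel. t \<in> {0<..<T} \<longrightarrow> has_weak_gradient (slice p t) (slice G t)"
    using assms(1) by (simp add: has_weak_space_gradient_def AE_time)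
  with AE_representative_slices[OF assms(2)] AE_representative_slices[OF assms(3)] show ?thesis
    by eventually_elim blast
qed

text \<open>Integration by parts holds on almost every time slice. It involves spatial derivatives
  only, so it can be integrated over time; square integrability of both factors justifies
  Fubini.\<close>

lemma weak_space_gradient_integral:
  fixes p u :: "'a::euclidean_space \<times> real \<Rightarrow> real" and G G' :: "'a \<times> real \<Rightarrow> 'a"
  assumes w: "has_weak_space_gradient T p G"
    and u: "u \<in> borel_measurable borel" "AE z in lborel. z \<in> cyl T \<longrightarrow> p z = u z" "\<And>z. z \<notin> cyl T \<Longrightarrow> u z = 0"
    and G': "G' \<in> borel_measurable borel" "AE z in lborel. z \<in> cyl T \<longrightarrow> G z = G' z" "\<And>z. z \<notin> cyl T \<Longrightarrow> G' z = 0"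
    and u2: "integrable lborel (\<lambda>z. (u z)\<^sup>2)" and G2: "integrable lborel (\<lambda>z. (norm (G' z))\<^sup>2)"
    and \<psi>: "\<And>z. GDERIV \<psi> z :> D z" "continuous_on UNIV D" and K: "compact K" "\<And>z. z \<notin> K \<Longrightarrow> \<psi> z = 0" "\<And>z. z \<notin> K \<Longrightarrow> D z = 0"
    and i: "i \<in> Basis"
  shows "(LINT z|lborel. u z * (fst (D z) \<bullet> i)) = - (LINT z|lborel. (G' z \<bullet> i) * \<psi> z)"
    and "integrable lborel (\<lambda>z. u z * (fst (D z) \<bullet> i))" "integrable lborel (\<lambda>z. (G' z \<bullet> i) * \<psi> z)"
proof -
  note [measurable] = u(1) G'(1)
  have cont\<psi>: "continuous_on UNIV \<psi>"
    using \<psi>(1) by (auto intro!: continuous_at_imp_continuous_on has_derivative_continuous simp: gderiv_def)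
  have [measurable]: "\<psi> \<in> borel_measurable borel" "(\<lambda>z. fst (D z) \<bullet> i) \<in> borel_measurable borel"
    using cont\<psi> \<psi>(2) by (auto intro!: borel_measurable_continuous_onI continuous_intros)
  have product: "integrable lborel (\<lambda>z. a z * c z)"
    if a: "a \<in> borel_measurable borel" "integrable lborel (\<lambda>z. (a z)\<^sup>2)"
      and c: "c \<in> borel_measurable borel" "integrable lborel (\<lambda>z. (c z)\<^sup>2)" for a c :: "'a \<times> real \<Rightarrow> real"
  proof (rule Bochner_Integration.integrable_bound)
    note [measurable] = a(1) c(1)
    show "integrable lborel (\<lambda>z. (a z)\<^sup>2 + (c z)\<^sup>2)" using a c by auto
    show "AE z in lborel. norm (a z * c z) \<le> norm ((a z)\<^sup>2 + (c z)\<^sup>2)"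
    proof (rule AE_I2)
      fix z
      have "0 \<le> (\<bar>a z\<bar> - \<bar>c z\<bar>)\<^sup>2" by simp
      then have "2 * (\<bar>a z\<bar> * \<bar>c z\<bar>) \<le> (a z)\<^sup>2 + (c z)\<^sup>2" by (simp add: power2_diff)
      moreover have "0 \<le> \<bar>a z\<bar> * \<bar>c z\<bar>" by simp
      ultimately have "\<bar>a z\<bar> * \<bar>c z\<bar> \<le> (a z)\<^sup>2 + (c z)\<^sup>2" by linarith
      then show "norm (a z * c z) \<le> norm ((a z)\<^sup>2 + (c z)\<^sup>2)" by (simp add: abs_mult)
    qed
  qed (use a(1) c(1) in simp)
  have c2: "integrable lborel (\<lambda>z. (c z)\<^sup>2)" if "continuous_on UNIV c" "\<And>z. z \<notin> K \<Longrightarrow> c z = 0" for c :: "'a \<times> real \<Rightarrow> real"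
    by (rule continuous_compact_support_integrable[OF _ K(1)]) (use that in \<open>auto intro!: continuous_intros\<close>)
  show i1: "integrable lborel (\<lambda>z. u z * (fst (D z) \<bullet> i))"
    by (intro product u2 c2) (use K(3) \<psi>(2) in \<open>auto intro!: continuous_intros\<close>)
  have Gi2: "integrable lborel (\<lambda>z. (G' z \<bullet> i)\<^sup>2)"
  proof (rule integrable_nonneg_bound[OF G2])
    show "(G' z \<bullet> i)\<^sup>2 \<le> (norm (G' z))\<^sup>2" for z
      using Basis_le_norm[OF i, of "G' z"] by (simp add: abs_le_square_iff[symmetric])
  qed auto
  show i2: "integrable lborel (\<lambda>z. (G' z \<bullet> i) * \<psi> z)"
    by (intro product Gi2 c2) (use K(2) cont\<psi> in auto)
  have sum0: "(LINT z|lborel. u z * (fst (D z) \<bullet> i) + (G' z \<bullet> i) * \<psi> z) = 0"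
  proof -
    have iF: "integrable lborel (\<lambda>z. u z * (fst (D z) \<bullet> i) + (G' z \<bullet> i) * \<psi> z)" using i1 i2 by simp
    have "AE t in lborel. (LINT x|lborel. u (x, t) * (fst (D (x, t)) \<bullet> i) + (G' (x, t) \<bullet> i) * \<psi> (x, t)) = 0"
      using weak_space_gradient_AE[OF w u(2) G'(2)]
    proof eventually_elim
      case (elim t)
      show ?case
      proof (cases "t \<in> {0<..<T}")
        case True
        with elim have e: "has_weak_gradient (slice p t) (slice G t)"
          "AE x in lborel. slice p t x = slice u t x" "AE x in lborel. slice G t x = slice G' t x" by auto
        have cK: "compact (fst ` K)" using K(1) by (intro compact_continuous_image continuous_intros)
        have z: "\<psi> (x, t) = 0" if "x \<notin> fst ` K" for x using that by (intro K(2)) force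
        have cD: "continuous_on UNIV (\<lambda>x. fst (D (x, t)))"
          by (intro continuous_intros continuous_on_compose2[OF \<psi>(2)]) auto
        note H = has_weak_gradient_C1[OF e(1) slice_measurable[OF u(1)] e(2) slice_measurable[OF G'(1)] e(3)
            slice_gradient[OF \<psi>(1)] cD cK z i, unfolded slice_def]
        show ?thesis using H by simp
      next
        case False
        then show ?thesis using u(3) G'(3) by (simp add: cyl_iff)
      qed
    qed
    then have "(LINT t|lborel. LINT x|lborel. u (x, t) * (fst (D (x, t)) \<bullet> i) + (G' (x, t) \<bullet> i) * \<psi> (x, t)) = 0"
      by (rule integral_eq_zero_AE)
    then show ?thesis using integral_slices(1)[OF iF] by simp
  qed
  then show "(LINT z|lborel. u z * (fst (D z) \<bullet> i)) = - (LINT z|lborel. (G' z \<bullet> i) * \<psi> z)"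
    using i1 i2 by simp
qed

text \<open>The last clause is meant for \<open>flux_unique\<close>, where components of the
  gradient become test functions themselves.\<close>

lemma test_function_gradient:
  fixes \<phi> :: "'a::euclidean_space \<Rightarrow> real"
  assumes "test_function U \<phi>"
  obtains D K where "compact K" "K \<subseteq> U" "\<And>x. GDERIV \<phi> x :> D x" "continuous_on UNIV D"
    "\<And>x. x \<notin> K \<Longrightarrow> \<phi> x = 0" "\<And>x. x \<notin> K \<Longrightarrow> D x = 0"
    "\<And>i. i \<in> Basis \<Longrightarrow> \<exists>E. (\<forall>x. GDERIV (\<lambda>x. D x \<bullet> i) x :> E x) \<and> continuous_on UNIV E"
proof -
  obtain K where K: "compact K" "K \<subseteq> U" "\<And>x. x \<notin> K \<Longrightarrow> \<phi> x = 0" and sm: "smooth_on UNIV \<phi>"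
    using assms by (auto simp: test_function_def)
  define D where "D = (\<lambda>x. \<Sum>i\<in>Basis. iter_deriv [i] \<phi> x *\<^sub>R i)"
  have cont: "continuous_on UNIV (\<lambda>x. \<Sum>i\<in>Basis. iter_deriv (i # vs) \<phi> x *\<^sub>R i)" if "vs \<in> lists Basis" for vs
    using that by (intro continuous_intros smooth_imp_continuous[OF sm]) auto
  show thesis
  proof (rule that[of K D])
    show "GDERIV \<phi> x :> D x" for x
      using smooth_GDERIV[OF sm, of "[]" x] unfolding D_def iter_deriv.simps(1) by simp
    show "continuous_on UNIV D" unfolding D_def by (rule cont) simp
    show "D x = 0" if "x \<notin> K" for x
      unfolding D_def using iter_deriv_support[OF compact_imp_closed[OF K(1)] K(3) that]
      by (simp del: iter_deriv.simps)
    fix i :: 'a assume i: "i \<in> Basis"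
    have eq: "(\<lambda>x. D x \<bullet> i) = iter_deriv [i] \<phi>"
      unfolding D_def inner_sum_left_Basis[OF i] by (rule refl)
    show "\<exists>E. (\<forall>x. GDERIV (\<lambda>x. D x \<bullet> i) x :> E x) \<and> continuous_on UNIV E"
      unfolding eq by (intro exI[of _ "\<lambda>x. \<Sum>ia\<in>Basis. iter_deriv (ia # [i]) \<phi> x *\<^sub>R ia"] conjI allI smooth_GDERIV[OF sm] cont)
        (use i in auto)
  qed (use K in auto)
qed

section \<open>Borel form of a single weak solution\<close>

locale hs_data = transport_coeffs T B b f Db Df
  for T B :: real and b :: "'a::euclidean_space \<times> real \<Rightarrow> 'a" and f :: "'a \<times> real \<Rightarrow> real"
    and Db :: "'a \<Rightarrow> 'a \<times> real \<Rightarrow> 'a \<times> real" and Df :: "'a \<times> real \<Rightarrow> 'a \<times> real" +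
  fixes m :: "'a \<times> real \<Rightarrow> real" and Dm :: "'a \<times> real \<Rightarrow> 'a \<times> real" and \<delta> Mm :: real
  assumes \<delta>: "0 < \<delta>" and m_bounds: "\<And>z. z \<in> cyl T \<Longrightarrow> \<delta> \<le> m z \<and> m z \<le> Mm"
    and m_deriv: "\<And>z. z \<in> cyl T \<Longrightarrow> GDERIV m z :> Dm z" and Dm_cont: "continuous_on (cyl T) Dm"
    and m_lip: "\<And>z z'. z \<in> cyl T \<Longrightarrow> z' \<in> cyl T \<Longrightarrow> \<bar>m z - m z'\<bar> \<le> Mm * norm (z - z')"
begin

text \<open>Extended by zero, the coefficients are Borel on the whole space, and integrals over the
  cylinder become integrals over \<open>lborel\<close>.\<close>

definition mX :: "'a \<times> real \<Rightarrow> real" where "mX z = indicator (cyl T) z * m z"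
definition fX :: "'a \<times> real \<Rightarrow> real" where "fX z = indicator (cyl T) z * f z"
definition bX :: "'a \<times> real \<Rightarrow> 'a" where "bX z = indicator (cyl T) z *\<^sub>R b z"

lemma m_cont: "continuous_on (cyl T) m"
  using m_deriv by (auto simp: gderiv_def intro!: continuous_at_imp_continuous_on has_derivative_continuous)

lemma f_cont: "continuous_on (cyl T) f"
  using f_deriv by (auto simp: gderiv_def intro!: continuous_at_imp_continuous_on has_derivative_continuous)

lemma b_cont: "continuous_on (cyl T) b"
proof -
  have "continuous_on (cyl T) (\<lambda>z. b z \<bullet> i)" if "i \<in> Basis" for i
    using b_deriv[OF that] by (auto simp: gderiv_def intro!: continuous_at_imp_continuous_on has_derivative_continuous)
  then show ?thesis by (rule continuous_on_componentwise[THEN iffD2, rule_format])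
qed

lemma coeff_meas [measurable]: "mX \<in> borel_measurable borel" "fX \<in> borel_measurable borel" "bX \<in> borel_measurable borel"
  using cyl_indicator_measurable[OF m_cont] cyl_indicator_measurable[OF f_cont] cyl_indicator_measurable[OF b_cont]
  by (simp_all add: mX_def[abs_def] fX_def[abs_def] bX_def[abs_def])

lemma Mm: "0 \<le> Mm"
  using m_bounds[of "(0, T / 2)"] \<delta> T by (auto simp: cyl_iff)

lemma coeff_bounds: "0 \<le> mX z" "mX z \<le> Mm" "\<bar>fX z\<bar> \<le> B" "norm (bX z) \<le> dd * B"
proof -
  show "0 \<le> mX z" "mX z \<le> Mm" using m_bounds[of z] \<delta> Mm by (auto simp: mX_def indicator_def)
  show "\<bar>fX z\<bar> \<le> B" using f_bound[of z] B by (auto simp: fX_def indicator_def)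
  show "norm (bX z) \<le> dd * B"
  proof (cases "z \<in> cyl T")
    case True
    have "norm (b z) \<le> (\<Sum>i\<in>Basis. \<bar>b z \<bullet> i\<bar>)" by (rule norm_le_l1)
    also have "\<dots> \<le> (\<Sum>i\<in>(Basis :: 'a set). B)" using b_bound True by (intro sum_mono) auto
    finally show ?thesis using True by (simp add: bX_def dd_def)
  qed (use B dd in \<open>simp add: bX_def\<close>)
qed

text \<open>A solution in the form used from here on: Borel representatives that satisfy their
  bounds and support conditions at every point, and the gradient that is square integrable. The
  initial datum occurs in one term only, the same for all solutions sharing it.\<close>

definition reduction :: "('a \<Rightarrow> real) \<Rightarrow> ('a \<times> real \<Rightarrow> real) \<Rightarrow> ('a \<times> real \<Rightarrow> real) \<Rightarrow>
    ('a \<times> real \<Rightarrow> real) \<Rightarrow> ('a \<times> real \<Rightarrow> real) \<Rightarrow> ('a \<times> real \<Rightarrow> 'a) \<Rightarrow> real \<Rightarrow> real \<Rightarrow> bool" where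
  "reduction \<rho>0 \<rho> p r u G M R0 \<longleftrightarrow>
    r \<in> borel_measurable borel \<and> u \<in> borel_measurable borel \<and> G \<in> borel_measurable borel \<and>
    (\<forall>z. z \<notin> cyl T \<longrightarrow> r z = 0 \<and> u z = 0 \<and> G z = 0) \<and> (\<forall>z. R0 < norm (fst z) \<longrightarrow> r z = 0 \<and> u z = 0) \<and>
    0 \<le> M \<and> 0 \<le> R0 \<and> (\<forall>z. \<bar>r z\<bar> \<le> M) \<and> integrable lborel (\<lambda>z. (u z)\<^sup>2) \<and> integrable lborel (\<lambda>z. (norm (G z))\<^sup>2) \<and>
    (AE z in lborel. z \<in> cyl T \<longrightarrow> \<rho> z = r z \<and> p z = u z) \<and>
    (AE z in lborel. z \<in> cyl T \<longrightarrow> 0 \<le> u z \<and> r z \<le> m z \<and> u z * (m z - r z) = 0) \<and>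
    (\<forall>\<phi> D. test_function (UNIV \<times> {..<T}) \<phi> \<longrightarrow> (\<forall>z. GDERIV \<phi> z :> D z) \<longrightarrow>
      integrable lborel (\<lambda>z. r z * (snd (D z) - bX z \<bullet> fst (D z) + fX z * \<phi> z)) \<and>
      integrable lborel (\<lambda>z. mX z * (G z \<bullet> fst (D z))) \<and>
      (LINT z|lborel. r z * (snd (D z) - bX z \<bullet> fst (D z) + fX z * \<phi> z)) - (LINT z|lborel. mX z * (G z \<bullet> fst (D z)))
        = - (LINT x|lebesgue. \<phi> (x, 0) * \<rho>0 x)) \<and>
    (\<forall>\<psi> D K i. (\<forall>z. GDERIV \<psi> z :> D z) \<longrightarrow> continuous_on UNIV D \<longrightarrow> compact K \<longrightarrow> (\<forall>z. z \<notin> K \<longrightarrow> \<psi> z = 0 \<and> D z = 0) \<longrightarrow>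
      i \<in> Basis \<longrightarrow> (LINT z|lborel. u z * (fst (D z) \<bullet> i)) = - (LINT z|lborel. (G z \<bullet> i) * \<psi> z) \<and>
      integrable lborel (\<lambda>z. u z * (fst (D z) \<bullet> i)) \<and> integrable lborel (\<lambda>z. (G z \<bullet> i) * \<psi> z))"

text \<open>The notion of weak solution and the membership in \<open>L2_H1_Linf\<close> provide two gradients of \<open>p\<close>,
  and only the latter is known to be square integrable.\<close>

lemma flux_unique:
  fixes p u :: "'a \<times> real \<Rightarrow> real" and G1 G2 G1' G2' :: "'a \<times> real \<Rightarrow> 'a" and D :: "'a \<times> real \<Rightarrow> 'a \<times> real"
  assumes w: "has_weak_space_gradient T p G1" "has_weak_space_gradient T p G2"
    and u: "u \<in> borel_measurable borel" "AE z in lborel. z \<in> cyl T \<longrightarrow> p z = u z"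
    and G1': "G1' \<in> borel_measurable borel" "AE z in lborel. z \<in> cyl T \<longrightarrow> G1 z = G1' z"
    and G2': "G2' \<in> borel_measurable borel" "AE z in lborel. z \<in> cyl T \<longrightarrow> G2 z = G2' z"
    and i1: "integrable lborel (\<lambda>z. mX z * (G1' z \<bullet> fst (D z)))" and i2: "integrable lborel (\<lambda>z. mX z * (G2' z \<bullet> fst (D z)))"
    and D: "continuous_on UNIV D" "compact K" "\<And>x. x \<notin> K \<Longrightarrow> D x = 0"
      "\<And>i. i \<in> Basis \<Longrightarrow> \<exists>E. (\<forall>x. GDERIV (\<lambda>x. D x \<bullet> i) x :> E x) \<and> continuous_on UNIV E"
  shows "(LINT z|lborel. mX z * (G1' z \<bullet> fst (D z))) = (LINT z|lborel. mX z * (G2' z \<bullet> fst (D z)))"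
proof -
  define F where "F = (\<lambda>z. mX z * (G1' z \<bullet> fst (D z)) - mX z * (G2' z \<bullet> fst (D z)))"
  have iF: "integrable lborel F" unfolding F_def using i1 i2 by simp
  have "AE t in lborel. (LINT x|lborel. F (x, t)) = 0"
    using weak_space_gradient_AE[OF w(1) u(2) G1'(2)] weak_space_gradient_AE[OF w(2) u(2) G2'(2)]
  proof eventually_elim
    case (elim t)
    show ?case
    proof (cases "t \<in> {0<..<T}")
      case True
      have X: "(x, t) \<in> cyl T" for x using True by (simp add: cyl_iff)
      have e1: "has_weak_gradient (slice p t) (slice G1 t)"
        "AE x in lborel. slice p t x = slice u t x" "AE x in lborel. slice G1 t x = slice G1' t x"
        and e2: "has_weak_gradient (slice p t) (slice G2 t)" "AE x in lborel. slice G2 t x = slice G2' t x"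
        using elim True by auto
      \<comment> \<open>\<open>m\<close> times a component of the test gradient is an admissible C1
        test function on the slice, so both weak gradients of \<open>p\<close> give the same
        integral against it.\<close>
      define V where "V i x = m (x, t) * (D (x, t) \<bullet> (i, 0))" for i x
      have cK: "compact (fst ` K)" using D(2) by (intro compact_continuous_image continuous_intros)
      have V0: "V i x = 0" if "x \<notin> fst ` K" for i x
      proof -
        have "(x, t) \<notin> K" using that by force
        then show ?thesis using D(3) by (simp add: V_def)
      qed
      have comp: "(LINT x|lborel. (G1' (x, t) \<bullet> i) * V i x) = (LINT x|lborel. (G2' (x, t) \<bullet> i) * V i x)"
        "integrable lborel (\<lambda>x. (G1' (x, t) \<bullet> i) * V i x)" "integrable lborel (\<lambda>x. (G2' (x, t) \<bullet> i) * V i x)"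
        if i: "i \<in> Basis" for i
      proof -
        have i0: "(i, 0) \<in> (Basis :: ('a \<times> real) set)" using i by (simp add: Basis_prod_def)
        obtain E where E: "\<And>x. GDERIV (\<lambda>x. D x \<bullet> (i, 0)) x :> E x" "continuous_on UNIV E"
          using D(4)[OF i0] by blast
        define DV where "DV x = m (x, t) *\<^sub>R fst (E (x, t)) + (D (x, t) \<bullet> (i, 0)) *\<^sub>R fst (Dm (x, t))" for x
        have G: "GDERIV (V i) x :> DV x" for x
        proof -
          have 1: "((\<lambda>x. m (x, t)) has_derivative (\<lambda>h. h \<bullet> fst (Dm (x, t)))) (at x)"
            using slice_gradient[OF m_deriv[OF X]] by (simp add: gderiv_def)
          have 2: "((\<lambda>x. D (x, t) \<bullet> (i, 0)) has_derivative (\<lambda>h. h \<bullet> fst (E (x, t)))) (at x)"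
            using slice_gradient[OF E(1)] by (simp add: gderiv_def)
          from has_derivative_mult[OF 1 2] show ?thesis
            unfolding gderiv_def V_def[abs_def] DV_def inner_add_right inner_scaleR_right by (simp add: mult.commute)
        qed
        have c: "continuous_on UNIV (\<lambda>x::'a. (x, t))" by (intro continuous_intros)
        have sub: "(\<lambda>x::'a. (x, t)) ` UNIV \<subseteq> cyl T" using X by blast
        have "continuous_on UNIV (\<lambda>x. m (x, t))" by (rule continuous_on_compose2[OF m_cont c sub])
        moreover have "continuous_on UNIV (\<lambda>x. Dm (x, t))" by (rule continuous_on_compose2[OF Dm_cont c sub])
        moreover have "continuous_on UNIV (\<lambda>x. D (x, t))" by (rule continuous_on_compose2[OF D(1) c subset_UNIV])
        moreover have "continuous_on UNIV (\<lambda>x. E (x, t))" by (rule continuous_on_compose2[OF E(2) c subset_UNIV])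
        ultimately have cDV: "continuous_on UNIV DV" unfolding DV_def by (intro continuous_intros)
        note H1 = has_weak_gradient_C1[OF e1(1) slice_measurable[OF u(1)] e1(2) slice_measurable[OF G1'(1)] e1(3) G cDV cK V0 i]
        note H2 = has_weak_gradient_C1[OF e2(1) slice_measurable[OF u(1)] e1(2) slice_measurable[OF G2'(1)] e2(2) G cDV cK V0 i]
        show "(LINT x|lborel. (G1' (x, t) \<bullet> i) * V i x) = (LINT x|lborel. (G2' (x, t) \<bullet> i) * V i x)"
          "integrable lborel (\<lambda>x. (G1' (x, t) \<bullet> i) * V i x)" "integrable lborel (\<lambda>x. (G2' (x, t) \<bullet> i) * V i x)"
          using H1 H2 by (simp_all add: slice_def)
      qed
      have "F (x, t) = (\<Sum>i\<in>Basis. (G1' (x, t) \<bullet> i) * V i x - (G2' (x, t) \<bullet> i) * V i x)" for x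
      proof -
        have "w \<bullet> fst (D (x, t)) = (\<Sum>i\<in>Basis. (w \<bullet> i) * (D (x, t) \<bullet> (i, 0)))" for w :: 'a
          by (subst euclidean_inner) (simp add: inner_prod_def)
        then show ?thesis
          using X[of x] by (simp add: F_def mX_def V_def sum_subtractf sum_distrib_left mult_ac)
      qed
      then have "(LINT x|lborel. F (x, t)) = (\<Sum>i\<in>Basis. (LINT x|lborel. (G1' (x, t) \<bullet> i) * V i x - (G2' (x, t) \<bullet> i) * V i x))"
        using comp(2,3) by (simp add: Bochner_Integration.integral_sum)
      also have "\<dots> = 0" using comp by (intro sum.neutral) simp
      finally show ?thesis .
    next
      case False
      then show ?thesis by (simp add: F_def mX_def cyl_iff)
    qed
  qed
  then have "(LINT t|lborel. LINT x|lborel. F (x, t)) = 0" by (rule integral_eq_zero_AE)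
  then have "(LINT z|lborel. F z) = 0" using integral_slices(1)[OF iF] by simp
  then show ?thesis using i1 i2 by (simp add: F_def)
qed

lemma support_radius:
  assumes "compactly_supported_in_space T v"
  obtains R where "0 \<le> R" "AE z in lborel. z \<in> cyl T \<longrightarrow> R < norm (fst z) \<longrightarrow> v z = 0"
proof -
  obtain K where K: "compact K" "AE z in lebesgue_on (cyl T). fst z \<notin> K \<longrightarrow> v z = 0"
    using assms by (auto simp: compactly_supported_in_space_def)
  obtain R where R: "0 < R" "\<And>x. x \<in> K \<Longrightarrow> norm x \<le> R"
    using compact_imp_bounded[OF K(1)] by (auto simp: bounded_pos)
  have "AE z in lborel. z \<in> cyl T \<longrightarrow> fst z \<notin> K \<longrightarrow> v z = 0"
    using K(2) by (simp add: AE_lebesgue_on cyl_lebesgue)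
  then have "AE z in lborel. z \<in> cyl T \<longrightarrow> R < norm (fst z) \<longrightarrow> v z = 0"
    by eventually_elim (use R in force)
  then show thesis using R by (intro that[of R]) auto
qed

lemma reduction_exists:
  assumes sol: "hele_shaw_weak_solution T m b f \<rho>0 \<rho> p"
    and \<rho>: "\<rho> \<in> Linf_L1_Linf T" and p: "p \<in> L2_H1_Linf T"
    and s\<rho>: "compactly_supported_in_space T \<rho>" and sp: "compactly_supported_in_space T p"
  shows "\<exists>r u G M R0. reduction \<rho>0 \<rho> p r u G M R0"
proof -
  obtain R1 where R1: "0 \<le> R1" "AE z in lborel. z \<in> cyl T \<longrightarrow> R1 < norm (fst z) \<longrightarrow> \<rho> z = 0"
    using support_radius[OF s\<rho>] by blast
  obtain R2 where R2: "0 \<le> R2" "AE z in lborel. z \<in> cyl T \<longrightarrow> R2 < norm (fst z) \<longrightarrow> p z = 0"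
    using support_radius[OF sp] by blast
  define R0 where "R0 = max R1 R2"
  obtain r0 where r0: "r0 \<in> borel_measurable borel" "\<And>z. z \<notin> cyl T \<Longrightarrow> r0 z = 0" "AE z in lborel. z \<in> cyl T \<longrightarrow> \<rho> z = r0 z"
    by (rule borel_representative[of \<rho> T]) (use \<rho> in \<open>auto simp: Linf_L1_Linf_def\<close>)
  obtain u0 where u0: "u0 \<in> borel_measurable borel" "\<And>z. z \<notin> cyl T \<Longrightarrow> u0 z = 0" "AE z in lborel. z \<in> cyl T \<longrightarrow> p z = u0 z"
    by (rule borel_representative[of p T]) (use p in \<open>auto simp: L2_H1_Linf_def\<close>)
  obtain GL where GL: "has_weak_space_gradient T p GL"
    "(\<integral>\<^sup>+t. L2_norm_sq (slice p t) + L2_norm_sq (slice GL t) + (Linf_norm (slice p t))\<^sup>2 \<partial>lebesgue_on {0<..<T}) < \<infinity>"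
    using p by (auto simp: L2_H1_Linf_def)
  obtain G where G: "G \<in> borel_measurable borel" "\<And>z. z \<notin> cyl T \<Longrightarrow> G z = 0" "AE z in lborel. z \<in> cyl T \<longrightarrow> GL z = G z"
    by (rule borel_representative_vector[of GL T]) (use GL in \<open>auto simp: has_weak_space_gradient_def\<close>)
  obtain GH where GH: "has_weak_space_gradient T p GH"
    and eqn: "\<And>\<phi>. test_function (UNIV \<times> {..<T}) \<phi> \<Longrightarrow>
          integrable lebesgue (\<lambda>x. \<phi> (x, 0) * \<rho>0 x) \<and>
          integrable (lebesgue_on (cyl T)) (\<lambda>z. \<rho> z * time_deriv \<phi> z) \<and>
          integrable (lebesgue_on (cyl T))
            (\<lambda>z. - (space_grad \<phi> z \<bullet> (m z *\<^sub>R GH z + \<rho> z *\<^sub>R b z)) + f z * \<phi> z * \<rho> z) \<and>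
          - (LINT x|lebesgue. \<phi> (x, 0) * \<rho>0 x)
            - (LINT z|lebesgue_on (cyl T). \<rho> z * time_deriv \<phi> z) =
          (LINT z|lebesgue_on (cyl T).
             - (space_grad \<phi> z \<bullet> (m z *\<^sub>R GH z + \<rho> z *\<^sub>R b z)) + f z * \<phi> z * \<rho> z)"
    using sol unfolding hele_shaw_weak_solution_def by blast
  have constraint: "AE z in lborel. z \<in> cyl T \<longrightarrow> 0 \<le> p z \<and> \<rho> z \<le> m z \<and> p z * (m z - \<rho> z) = 0"
    using sol unfolding hele_shaw_weak_solution_def AE_lebesgue_on[OF cyl_lebesgue] by blast
  obtain G' where G': "G' \<in> borel_measurable borel" "\<And>z. z \<notin> cyl T \<Longrightarrow> G' z = 0" "AE z in lborel. z \<in> cyl T \<longrightarrow> GH z = G' z"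
    by (rule borel_representative_vector[of GH T]) (use GH in \<open>auto simp: has_weak_space_gradient_def\<close>)
  obtain M where M: "0 \<le> M" "AE z in lborel. \<bar>r0 z\<bar> \<le> M"
    by (rule Linf_L1_Linf_bounded[OF \<rho> r0(1,3,2)])
  note [measurable] = r0(1) u0(1) G(1) G'(1)
  have ms: "(\<lambda>z::'a \<times> real. norm (fst z)) \<in> borel_measurable borel"
    by (intro borel_measurable_continuous_onI continuous_intros)
  note [measurable] = ms
  \<comment> \<open>Changing the representatives on null sets makes the bound and the support
    condition hold at every point.\<close>
  define r where "r = (\<lambda>z. if \<bar>r0 z\<bar> \<le> M \<and> norm (fst z) \<le> R0 then r0 z else 0)"
  define u where "u = (\<lambda>z. if norm (fst z) \<le> R0 then u0 z else 0)"
  have r_meas [measurable]: "r \<in> borel_measurable borel" unfolding r_def by measurable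
  have u_meas [measurable]: "u \<in> borel_measurable borel" unfolding u_def by measurable
  have r_eq: "AE z in lborel. z \<in> cyl T \<longrightarrow> \<rho> z = r z"
    using r0(3) R1(2) M(2) by eventually_elim (auto simp: r_def R0_def)
  have u_eq: "AE z in lborel. z \<in> cyl T \<longrightarrow> p z = u z"
    using u0(3) R2(2) by eventually_elim (auto simp: u_def R0_def)
  have rb: "\<bar>r z\<bar> \<le> M" for z using M(1) by (simp add: r_def)
  have r_out: "r z = 0" if "z \<notin> cyl T" for z using r0(2)[OF that] by (simp add: r_def)
  have u_out: "u z = 0" if "z \<notin> cyl T" for z using u0(2)[OF that] by (simp add: u_def)
  have sq: "integrable lborel (\<lambda>z. (u z)\<^sup>2)" "integrable lborel (\<lambda>z. (norm (G z))\<^sup>2)"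
    by (rule L2_H1_Linf_square_integrable[OF GL(2) u_meas u_eq u_out G(1,3,2)]; assumption)+
  have formula: "integrable lborel (\<lambda>z. r z * (snd (D z) - bX z \<bullet> fst (D z) + fX z * \<phi> z)) \<and>
      integrable lborel (\<lambda>z. mX z * (G z \<bullet> fst (D z))) \<and>
      (LINT z|lborel. r z * (snd (D z) - bX z \<bullet> fst (D z) + fX z * \<phi> z)) - (LINT z|lborel. mX z * (G z \<bullet> fst (D z)))
        = - (LINT x|lebesgue. \<phi> (x, 0) * \<rho>0 x)"
    if tf: "test_function (UNIV \<times> {..<T}) \<phi>" and gd: "\<forall>z. GDERIV \<phi> z :> D z" for \<phi> D
  proof -
    obtain D' K where K: "compact K" and D': "\<And>x. GDERIV \<phi> x :> D' x" "continuous_on UNIV D'"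
      "\<And>x. x \<notin> K \<Longrightarrow> \<phi> x = 0" "\<And>x. x \<notin> K \<Longrightarrow> D' x = 0"
      "\<And>i. i \<in> Basis \<Longrightarrow> \<exists>E. (\<forall>x. GDERIV (\<lambda>x. D' x \<bullet> i) x :> E x) \<and> continuous_on UNIV E"
      by (rule test_function_gradient[OF tf]) blast
    have DD: "D = D'"
    proof
      fix z
      have "(\<lambda>h. h \<bullet> D z) = (\<lambda>h. h \<bullet> D' z)"
        using has_derivative_unique gd D'(1) unfolding gderiv_def by blast
      then have "h \<bullet> (D z - D' z) = 0" for h by (metis eq_iff_diff_eq_0 inner_diff_right)
      then show "D z = D' z" by (metis inner_eq_zero_iff eq_iff_diff_eq_0)
    qed
    have td: "time_deriv \<phi> z = snd (D z)" for z
      unfolding time_deriv_def DD by (subst GDERIV_frechet[OF D'(1)]) (simp add: inner_prod_def)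
    have sg: "space_grad \<phi> z = fst (D z)" for z
    proof -
      have "space_grad \<phi> z = (\<Sum>i\<in>Basis. (fst (D z) \<bullet> i) *\<^sub>R i)"
        unfolding space_grad_def DD
        by (intro sum.cong refl) (subst GDERIV_frechet[OF D'(1)], simp add: inner_prod_def inner_commute)
      then show ?thesis by (simp only: euclidean_representation)
    qed
    have cont\<phi>: "continuous_on UNIV \<phi>"
      using D'(1) by (auto intro!: continuous_at_imp_continuous_on has_derivative_continuous simp: gderiv_def)
    have cD: "continuous_on UNIV D" using D'(2) DD by simp
    have D0: "D z = 0" if "z \<notin> K" for z using D'(4)[OF that] DD by simp
    obtain C1 where C1: "0 < C1" "\<And>x. norm (\<phi> x) \<le> C1"
      by (rule compact_support_bounded[OF cont\<phi> K]) (auto simp: D'(3))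
    obtain C2 where C2: "0 < C2" "\<And>x. norm (D x) \<le> C2"
      by (rule compact_support_bounded[OF cD K]) (auto simp: D0)
    have [measurable]: "\<phi> \<in> borel_measurable borel" "(\<lambda>z. fst (D z)) \<in> borel_measurable borel" "(\<lambda>z. snd (D z)) \<in> borel_measurable borel"
      using cont\<phi> cD by (auto intro!: borel_measurable_continuous_onI continuous_intros)
    have fsD: "norm (fst (D z)) \<le> C2" "\<bar>snd (D z)\<bar> \<le> C2" for z
      using order.trans[OF norm_fst_le[of "fst (D z)" "snd (D z)"]] order.trans[OF norm_snd_le[of "snd (D z)" "fst (D z)"]] C2(2)[of z]
      by auto
    note bK = compact_imp_bounded[OF K]
    have ia: "integrable lborel (\<lambda>z. r z * snd (D z))"
    proof (rule bounded_support_integrable[where C = "M * C2", OF _ _ bK])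
      show "\<bar>r z * snd (D z)\<bar> \<le> M * C2" for z
        unfolding abs_mult using rb fsD M(1) by (intro mult_mono) auto
    qed (auto simp: D0)
    have ib: "integrable lborel (\<lambda>z. r z * (bX z \<bullet> fst (D z)))"
    proof (rule bounded_support_integrable[where C = "M * (dd * B * C2)", OF _ _ bK])
      show "\<bar>r z * (bX z \<bullet> fst (D z))\<bar> \<le> M * (dd * B * C2)" for z
      proof -
        have "\<bar>bX z \<bullet> fst (D z)\<bar> \<le> norm (bX z) * norm (fst (D z))" by (rule Cauchy_Schwarz_ineq2)
        also have "\<dots> \<le> (dd * B) * C2" using coeff_bounds fsD dd B by (intro mult_mono) auto
        finally show ?thesis unfolding abs_mult using rb M(1) by (intro mult_mono) auto
      qed
    qed (auto simp: D0)
    have ic: "integrable lborel (\<lambda>z. r z * (fX z * \<phi> z))"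
    proof (rule bounded_support_integrable[where C = "M * (B * C1)", OF _ _ bK])
      show "\<bar>r z * (fX z * \<phi> z)\<bar> \<le> M * (B * C1)" for z
        unfolding abs_mult using rb coeff_bounds(3) C1(2) M(1) B by (intro mult_mono) (auto intro!: mult_nonneg_nonneg)
    qed (auto simp: D'(3))
    note E = eqn[OF tf]
    define F2 where "F2 = (\<lambda>z. - (fst (D z) \<bullet> (mX z *\<^sub>R G' z + r z *\<^sub>R bX z)) + fX z * \<phi> z * r z)"
    have [measurable]: "F2 \<in> borel_measurable borel" unfolding F2_def by measurable
    have I1: "(LINT z|lebesgue_on (cyl T). \<rho> z * time_deriv \<phi> z) = (LINT z|lborel. r z * snd (D z))"
    proof (rule integral_lebesgue_on_cyl(1))
      show "AE z in lborel. z \<in> cyl T \<longrightarrow> \<rho> z * time_deriv \<phi> z = r z * snd (D z)"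
        using r_eq by eventually_elim (simp add: td)
    qed (auto simp: r_out)
    have ae2: "AE z in lborel. z \<in> cyl T \<longrightarrow> - (space_grad \<phi> z \<bullet> (m z *\<^sub>R GH z + \<rho> z *\<^sub>R b z)) + f z * \<phi> z * \<rho> z = F2 z"
      using r_eq G'(3) by eventually_elim (simp add: F2_def sg mX_def bX_def fX_def)
    have F20: "F2 z = 0" if "z \<notin> cyl T" for z using that by (simp add: F2_def mX_def r_out)
    note I2 = integral_lebesgue_on_cyl[OF _ ae2 F20, simplified]
    have iF2: "integrable lborel F2" using E I2(2) by simp
    have F2eq: "mX z * (G' z \<bullet> fst (D z)) = - F2 z - r z * (bX z \<bullet> fst (D z)) + r z * (fX z * \<phi> z)" for z
      by (simp add: F2_def inner_add_right inner_commute algebra_simps)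
    \<comment> \<open>\<open>G'\<close> comes from the weak formulation and carries no L2 bound, so
      integrability of its flux is extracted from that of the whole right-hand side.\<close>
    have iG': "integrable lborel (\<lambda>z. mX z * (G' z \<bullet> fst (D z)))"
      unfolding F2eq using iF2 ib ic by auto
    have iG: "integrable lborel (\<lambda>z. mX z * (G z \<bullet> fst (D z)))"
    proof (rule Bochner_Integration.integrable_bound)
      have iK: "integrable lborel (\<lambda>z. indicator K z :: real)"
        using emeasure_compact_finite[OF K] compact_imp_closed[OF K]
        by (intro integrable_real_indicator) (auto intro: borel_closed)
      show "integrable lborel (\<lambda>z. Mm * C2 * ((norm (G z))\<^sup>2 + indicator K z))"
        using sq(2) iK by (intro integrable_mult_right Bochner_Integration.integrable_add)
      show "AE z in lborel. norm (mX z * (G z \<bullet> fst (D z))) \<le> norm (Mm * C2 * ((norm (G z))\<^sup>2 + indicator K z))"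
      proof (rule AE_I2)
        fix z
        show "norm (mX z * (G z \<bullet> fst (D z))) \<le> norm (Mm * C2 * ((norm (G z))\<^sup>2 + indicator K z))"
        proof (cases "z \<in> K")
          case True
          have "\<bar>G z \<bullet> fst (D z)\<bar> \<le> norm (G z) * norm (fst (D z))" by (rule Cauchy_Schwarz_ineq2)
          also have "\<dots> \<le> norm (G z) * C2" using fsD by (intro mult_left_mono) auto
          also have "\<dots> \<le> ((norm (G z))\<^sup>2 + 1) * C2"
          proof (rule mult_right_mono)
            have "0 \<le> (norm (G z) - 1)\<^sup>2" by simp
            then have "2 * norm (G z) \<le> (norm (G z))\<^sup>2 + 1" by (simp add: power2_diff)
            then show "norm (G z) \<le> (norm (G z))\<^sup>2 + 1" using norm_ge_zero[of "G z"] by linarith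
          qed (use C2 in simp)
          finally have "\<bar>mX z\<bar> * \<bar>G z \<bullet> fst (D z)\<bar> \<le> Mm * (((norm (G z))\<^sup>2 + 1) * C2)"
            using coeff_bounds(1,2)[of z] Mm by (intro mult_mono) auto
          then have "norm (mX z * (G z \<bullet> fst (D z))) \<le> Mm * C2 * ((norm (G z))\<^sup>2 + indicator K z)"
            using True by (simp add: abs_mult mult_ac)
          then show ?thesis by (rule order.trans) simp
        qed (simp add: D0)
      qed
    qed measurable
    have flux: "(LINT z|lborel. mX z * (G' z \<bullet> fst (D z))) = (LINT z|lborel. mX z * (G z \<bullet> fst (D z)))"
      by (rule flux_unique[OF GH GL(1) u_meas u_eq G'(1,3) G(1,3) iG' iG cD K D0]) (use D'(5) DD in auto)
    have i0: "integrable lborel (\<lambda>z. r z * (snd (D z) - bX z \<bullet> fst (D z) + fX z * \<phi> z))"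
      unfolding distrib_left right_diff_distrib using ia ib ic by auto
    have "(LINT z|lborel. r z * (snd (D z) - bX z \<bullet> fst (D z) + fX z * \<phi> z)) =
        (LINT z|lborel. r z * snd (D z)) - (LINT z|lborel. r z * (bX z \<bullet> fst (D z))) + (LINT z|lborel. r z * (fX z * \<phi> z))"
      unfolding distrib_left right_diff_distrib using ia ib ic by simp
    moreover have "(LINT z|lborel. mX z * (G' z \<bullet> fst (D z))) =
        - (LINT z|lborel. F2 z) - (LINT z|lborel. r z * (bX z \<bullet> fst (D z))) + (LINT z|lborel. r z * (fX z * \<phi> z))"
      unfolding F2eq using iF2 ib ic by simp
    moreover have "- (LINT x|lebesgue. \<phi> (x, 0) * \<rho>0 x) - (LINT z|lborel. r z * snd (D z)) = (LINT z|lborel. F2 z)"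
      using E I1 I2(1) by simp
    ultimately have "(LINT z|lborel. r z * (snd (D z) - bX z \<bullet> fst (D z) + fX z * \<phi> z)) - (LINT z|lborel. mX z * (G z \<bullet> fst (D z)))
        = - (LINT x|lebesgue. \<phi> (x, 0) * \<rho>0 x)"
      using flux by linarith
    with i0 iG show ?thesis by blast
  qed
  have weak: "(LINT z|lborel. u z * (fst (D z) \<bullet> i)) = - (LINT z|lborel. (G z \<bullet> i) * \<psi> z) \<and>
      integrable lborel (\<lambda>z. u z * (fst (D z) \<bullet> i)) \<and> integrable lborel (\<lambda>z. (G z \<bullet> i) * \<psi> z)"
    if "\<forall>z. GDERIV \<psi> z :> D z" "continuous_on UNIV D" "compact K" "\<forall>z. z \<notin> K \<longrightarrow> \<psi> z = 0 \<and> D z = 0" "i \<in> Basis" for \<psi> D K i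
  proof (intro conjI)
    have z: "z \<notin> K \<Longrightarrow> \<psi> z = 0" "z \<notin> K \<Longrightarrow> D z = 0" for z using that(4) by blast+
    note W = weak_space_gradient_integral[OF GL(1) u_meas u_eq u_out G(1,3,2) sq that(1)[rule_format] that(2,3) z that(5)]
    show "(LINT z|lborel. u z * (fst (D z) \<bullet> i)) = - (LINT z|lborel. (G z \<bullet> i) * \<psi> z)" by (rule W(1))
    show "integrable lborel (\<lambda>z. u z * (fst (D z) \<bullet> i))" by (rule W(2))
    show "integrable lborel (\<lambda>z. (G z \<bullet> i) * \<psi> z)" by (rule W(3))
  qed
  have c: "AE z in lborel. z \<in> cyl T \<longrightarrow> 0 \<le> u z \<and> r z \<le> m z \<and> u z * (m z - r z) = 0"
    using constraint r_eq u_eq by eventually_elim auto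
  have e: "AE z in lborel. z \<in> cyl T \<longrightarrow> \<rho> z = r z \<and> p z = u z"
    using r_eq u_eq by eventually_elim auto
  have R0: "0 \<le> R0" using R1 by (simp add: R0_def)
  have far: "r z = 0 \<and> u z = 0" if "R0 < norm (fst z)" for z using that by (simp add: r_def u_def)
  have "reduction \<rho>0 \<rho> p r u G M R0"
    unfolding reduction_def
  proof (intro conjI)
    show "\<forall>z. z \<notin> cyl T \<longrightarrow> r z = 0 \<and> u z = 0 \<and> G z = 0" using r_out u_out G(2) by simp
    show "\<forall>z. R0 < norm (fst z) \<longrightarrow> r z = 0 \<and> u z = 0" using far by simp
    show "\<forall>\<phi> D. test_function (UNIV \<times> {..<T}) \<phi> \<longrightarrow> (\<forall>z. GDERIV \<phi> z :> D z) \<longrightarrow>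
      integrable lborel (\<lambda>z. r z * (snd (D z) - bX z \<bullet> fst (D z) + fX z * \<phi> z)) \<and>
      integrable lborel (\<lambda>z. mX z * (G z \<bullet> fst (D z))) \<and>
      (LINT z|lborel. r z * (snd (D z) - bX z \<bullet> fst (D z) + fX z * \<phi> z)) - (LINT z|lborel. mX z * (G z \<bullet> fst (D z)))
        = - (LINT x|lebesgue. \<phi> (x, 0) * \<rho>0 x)"
      by (rule allI, rule allI, rule impI, rule impI, rule formula; assumption)
    show "\<forall>\<psi> D K i. (\<forall>z. GDERIV \<psi> z :> D z) \<longrightarrow> continuous_on UNIV D \<longrightarrow> compact K \<longrightarrow> (\<forall>z. z \<notin> K \<longrightarrow> \<psi> z = 0 \<and> D z = 0) \<longrightarrow>
      i \<in> Basis \<longrightarrow> (LINT z|lborel. u z * (fst (D z) \<bullet> i)) = - (LINT z|lborel. (G z \<bullet> i) * \<psi> z) \<and>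
      integrable lborel (\<lambda>z. u z * (fst (D z) \<bullet> i)) \<and> integrable lborel (\<lambda>z. (G z \<bullet> i) * \<psi> z)"
      by (rule allI, rule allI, rule allI, rule allI, rule impI, rule impI, rule impI, rule impI, rule impI, rule weak; assumption)
  qed (fact r_meas u_meas G(1) M(1) R0 sq e c | simp add: rb)+
  then show ?thesis by blast
qed

end

section \<open>The equation for the difference of two solutions\<close>

context hs_data
begin

text \<open>The common initial term has cancelled. The equation is recorded for C1 test functions
  with support below time \<open>T\<close>; they may be nonzero at time 0 and before.\<close>

definition difference :: "('a \<times> real \<Rightarrow> real) \<Rightarrow> ('a \<times> real \<Rightarrow> real) \<Rightarrow> ('a \<times> real \<Rightarrow> 'a) \<Rightarrow> real \<Rightarrow> real \<Rightarrow> bool" where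
  "difference w q G M R0 \<longleftrightarrow>
    w \<in> borel_measurable borel \<and> q \<in> borel_measurable borel \<and> G \<in> borel_measurable borel \<and>
    (\<forall>z. z \<notin> cyl T \<longrightarrow> w z = 0 \<and> q z = 0 \<and> G z = 0) \<and> (\<forall>z. R0 < norm (fst z) \<longrightarrow> w z = 0 \<and> q z = 0) \<and>
    0 \<le> M \<and> 0 \<le> R0 \<and> (\<forall>z. \<bar>w z\<bar> \<le> M) \<and> integrable lborel (\<lambda>z. (q z)\<^sup>2) \<and> integrable lborel (\<lambda>z. (norm (G z))\<^sup>2) \<and>
    (AE z in lborel. 0 \<le> w z * q z) \<and>
    (\<forall>\<phi> D K. (\<forall>z. GDERIV \<phi> z :> D z) \<longrightarrow> continuous_on UNIV D \<longrightarrow> compact K \<longrightarrow> K \<subseteq> UNIV \<times> {..<T} \<longrightarrow>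
      (\<forall>z. z \<notin> K \<longrightarrow> \<phi> z = 0) \<longrightarrow>
      integrable lborel (\<lambda>z. w z * (snd (D z) - bX z \<bullet> fst (D z) + fX z * \<phi> z)) \<and>
      integrable lborel (\<lambda>z. mX z * (G z \<bullet> fst (D z))) \<and>
      (LINT z|lborel. w z * (snd (D z) - bX z \<bullet> fst (D z) + fX z * \<phi> z)) = (LINT z|lborel. mX z * (G z \<bullet> fst (D z)))) \<and>
    (\<forall>\<psi> D K i. (\<forall>z. GDERIV \<psi> z :> D z) \<longrightarrow> continuous_on UNIV D \<longrightarrow> compact K \<longrightarrow> (\<forall>z. z \<notin> K \<longrightarrow> \<psi> z = 0 \<and> D z = 0) \<longrightarrow>
      i \<in> Basis \<longrightarrow> (LINT z|lborel. q z * (fst (D z) \<bullet> i)) = - (LINT z|lborel. (G z \<bullet> i) * \<psi> z))"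

text \<open>Dominated convergence along smooth approximations with a common support. For the flux
  only square integrability of \<open>G\<close> is at hand, so \<open>norm (G z)\<close> is
  dominated by \<open>(norm (G z))\<^sup>2\<close> plus the indicator of that support.\<close>

lemma C1_formula:
  assumes w: "w \<in> borel_measurable borel" "\<And>z. \<bar>w z\<bar> \<le> M" "0 \<le> M"
    and G: "G \<in> borel_measurable borel" "integrable lborel (\<lambda>z. (norm (G z))\<^sup>2)"
    and smooth: "\<And>\<phi> D. test_function (UNIV \<times> {..<T}) \<phi> \<Longrightarrow> (\<And>z. GDERIV \<phi> z :> D z) \<Longrightarrow>
      (LINT z|lborel. w z * (snd (D z) - bX z \<bullet> fst (D z) + fX z * \<phi> z)) = (LINT z|lborel. mX z * (G z \<bullet> fst (D z)))"
    and \<phi>: "\<And>z. GDERIV \<phi> z :> D z" "continuous_on UNIV D"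
    and K: "compact K" "\<And>z. z \<notin> K \<Longrightarrow> \<phi> z = 0" "K \<subseteq> UNIV \<times> {..<T}"
  shows "(LINT z|lborel. w z * (snd (D z) - bX z \<bullet> fst (D z) + fX z * \<phi> z)) = (LINT z|lborel. mX z * (G z \<bullet> fst (D z)))"
    and "integrable lborel (\<lambda>z. w z * (snd (D z) - bX z \<bullet> fst (D z) + fX z * \<phi> z))"
    and "integrable lborel (\<lambda>z. mX z * (G z \<bullet> fst (D z)))"
proof -
  note [measurable] = w(1) G(1)
  have op: "open ((UNIV :: 'a set) \<times> {..<T})" by (intro open_Times) auto
  have "\<exists>K' \<psi> D' Bd. compact K' \<and> K' \<subseteq> UNIV \<times> {..<T} \<and> 0 < Bd \<and> C1_sequence (UNIV \<times> {..<T}) K' \<phi> D Bd \<psi> D'"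
    by (rule C1_smooth_sequence[OF \<phi> K op])
  then obtain K' \<psi> D' Bd where K': "compact K'" and Bd: "0 < Bd" and S: "C1_sequence (UNIV \<times> {..<T}) K' \<phi> D Bd \<psi> D'"
    by (elim exE conjE) (rule that)
  note S = C1_sequenceD[OF S]
  have [measurable]: "K' \<in> sets borel" by (rule borel_closed[OF compact_imp_closed[OF K']])
  have [measurable]: "\<phi> \<in> borel_measurable borel" "(\<lambda>z. fst (D z)) \<in> borel_measurable borel" "(\<lambda>z. snd (D z)) \<in> borel_measurable borel"
    "\<And>n. \<psi> n \<in> borel_measurable borel" "\<And>n. (\<lambda>z. fst (D' n z)) \<in> borel_measurable borel" "\<And>n. (\<lambda>z. snd (D' n z)) \<in> borel_measurable borel"
    using S(9-12) by (auto intro!: borel_measurable_continuous_onI continuous_intros)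
  have fs: "norm (fst v) \<le> norm v" "\<bar>snd v\<bar> \<le> norm v" for v :: "'a \<times> real"
    using norm_fst_le[of "fst v" "snd v"] norm_snd_le[of "snd v" "fst v"] by auto
  have iK: "integrable lborel (\<lambda>z. indicator K' z :: real)"
    using emeasure_compact_finite[OF K'] by (intro integrable_real_indicator) auto
  define A1 where "A1 = M * (Bd + dd * B * Bd + B * Bd)"
  have bound1: "\<bar>w z * (snd v - bX z \<bullet> fst v + fX z * c)\<bar> \<le> A1 * indicator K' z"
    if "norm v \<le> Bd" "\<bar>c\<bar> \<le> Bd" "z \<notin> K' \<Longrightarrow> v = 0 \<and> c = 0" for z v c
  proof (cases "z \<in> K'")
    case True
    have "\<bar>bX z \<bullet> fst v\<bar> \<le> norm (bX z) * norm (fst v)" by (rule Cauchy_Schwarz_ineq2)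
    also have "\<dots> \<le> (dd * B) * Bd"
      using coeff_bounds(4)[of z] order.trans[OF fs(1) that(1)] dd B by (intro mult_mono) auto
    finally have 1: "\<bar>bX z \<bullet> fst v\<bar> \<le> dd * B * Bd" .
    have 2: "\<bar>fX z * c\<bar> \<le> B * Bd"
      unfolding abs_mult using coeff_bounds(3)[of z] that(2) B by (intro mult_mono) auto
    have "\<bar>snd v - bX z \<bullet> fst v + fX z * c\<bar> \<le> Bd + dd * B * Bd + B * Bd"
      using 1 2 order.trans[OF fs(2) that(1)] by linarith
    then have "\<bar>w z\<bar> * \<bar>snd v - bX z \<bullet> fst v + fX z * c\<bar> \<le> A1"
      unfolding A1_def using w(2,3) by (intro mult_mono) auto
    then show ?thesis using True by (simp add: abs_mult)
  qed (use that in auto)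
  define A2 where "A2 = Mm * Bd"
  have A2: "0 \<le> A2" using Mm Bd by (simp add: A2_def)
  have bound2: "\<bar>mX z * (G z \<bullet> fst v)\<bar> \<le> A2 * ((norm (G z))\<^sup>2 + indicator K' z)"
    if "norm v \<le> Bd" "z \<notin> K' \<Longrightarrow> v = 0" for z and v :: "'a \<times> real"
  proof (cases "z \<in> K'")
    case True
    have "\<bar>G z \<bullet> fst v\<bar> \<le> norm (G z) * norm (fst v)" by (rule Cauchy_Schwarz_ineq2)
    also have "\<dots> \<le> norm (G z) * Bd" using order.trans[OF fs(1) that(1)] by (intro mult_left_mono) auto
    also have "\<dots> \<le> ((norm (G z))\<^sup>2 + 1) * Bd"
    proof (rule mult_right_mono)
      have "0 \<le> (norm (G z) - 1)\<^sup>2" by simp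
      then have "2 * norm (G z) \<le> (norm (G z))\<^sup>2 + 1" by (simp add: power2_diff)
      then show "norm (G z) \<le> (norm (G z))\<^sup>2 + 1" using norm_ge_zero[of "G z"] by linarith
    qed (use Bd in simp)
    finally have "\<bar>mX z\<bar> * \<bar>G z \<bullet> fst v\<bar> \<le> Mm * (((norm (G z))\<^sup>2 + 1) * Bd)"
      using coeff_bounds(1,2)[of z] Mm by (intro mult_mono) auto
    then show ?thesis using True by (simp add: abs_mult mult_ac A2_def)
  qed (use that A2 in auto)
  have i1: "integrable lborel (\<lambda>z. A1 * indicator K' z)" using iK by (rule integrable_mult_right)
  have i2: "integrable lborel (\<lambda>z. A2 * ((norm (G z))\<^sup>2 + indicator K' z))"
    using G(2) iK by (intro integrable_mult_right Bochner_Integration.integrable_add)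
  have L1: "(\<lambda>n. LINT z|lborel. w z * (snd (D' n z) - bX z \<bullet> fst (D' n z) + fX z * \<psi> n z)) \<longlonglongrightarrow>
      (LINT z|lborel. w z * (snd (D z) - bX z \<bullet> fst (D z) + fX z * \<phi> z))"
  proof (rule integral_dominated_convergence[OF _ _ i1])
    show "AE z in lborel. (\<lambda>n. w z * (snd (D' n z) - bX z \<bullet> fst (D' n z) + fX z * \<psi> n z)) \<longlonglongrightarrow>
        w z * (snd (D z) - bX z \<bullet> fst (D z) + fX z * \<phi> z)"
      by (intro AE_I2 tendsto_intros S(7,8))
    show "AE z in lborel. norm (w z * (snd (D' n z) - bX z \<bullet> fst (D' n z) + fX z * \<psi> n z)) \<le> A1 * indicator K' z" for n
      unfolding real_norm_def by (intro AE_I2 bound1 S(5,6)) (use S(3,4) in auto)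
  qed measurable
  have L2: "(\<lambda>n. LINT z|lborel. mX z * (G z \<bullet> fst (D' n z))) \<longlonglongrightarrow> (LINT z|lborel. mX z * (G z \<bullet> fst (D z)))"
  proof (rule integral_dominated_convergence[OF _ _ i2])
    show "AE z in lborel. (\<lambda>n. mX z * (G z \<bullet> fst (D' n z))) \<longlonglongrightarrow> mX z * (G z \<bullet> fst (D z))"
      by (intro AE_I2 tendsto_intros S(8))
    show "AE z in lborel. norm (mX z * (G z \<bullet> fst (D' n z))) \<le> A2 * ((norm (G z))\<^sup>2 + indicator K' z)" for n
      unfolding real_norm_def by (intro AE_I2 bound2 S(6)) (use S(4) in auto)
  qed measurable
  have "(\<lambda>n. LINT z|lborel. w z * (snd (D' n z) - bX z \<bullet> fst (D' n z) + fX z * \<psi> n z)) =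
      (\<lambda>n. LINT z|lborel. mX z * (G z \<bullet> fst (D' n z)))"
    by (intro ext smooth S(1,2))
  with L1 L2 show "(LINT z|lborel. w z * (snd (D z) - bX z \<bullet> fst (D z) + fX z * \<phi> z)) = (LINT z|lborel. mX z * (G z \<bullet> fst (D z)))"
    by (auto intro: LIMSEQ_unique)
  show "integrable lborel (\<lambda>z. w z * (snd (D z) - bX z \<bullet> fst (D z) + fX z * \<phi> z))"
  proof (rule Bochner_Integration.integrable_bound[OF i1])
    show "AE z in lborel. norm (w z * (snd (D z) - bX z \<bullet> fst (D z) + fX z * \<phi> z)) \<le> norm (A1 * indicator K' z :: real)"
      unfolding real_norm_def by (intro AE_I2 order.trans[OF bound1 abs_ge_self] S(13,14)) (use S(15,16) in auto)
  qed measurable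
  show "integrable lborel (\<lambda>z. mX z * (G z \<bullet> fst (D z)))"
  proof (rule Bochner_Integration.integrable_bound[OF i2])
    show "AE z in lborel. norm (mX z * (G z \<bullet> fst (D z))) \<le> norm (A2 * ((norm (G z))\<^sup>2 + indicator K' z))"
      unfolding real_norm_def by (intro AE_I2 order.trans[OF bound2 abs_ge_self] S(14)) (use S(16) in auto)
  qed measurable
qed

lemma difference_exists:
  assumes 1: "reduction \<rho>0 \<rho>1 p1 r1 u1 G1 M1 R1" and 2: "reduction \<rho>0 \<rho>2 p2 r2 u2 G2 M2 R2"
  shows "difference (\<lambda>z. r1 z - r2 z) (\<lambda>z. u1 z - u2 z) (\<lambda>z. G1 z - G2 z) (M1 + M2) (max R1 R2)"
proof -
  have a: "r1 \<in> borel_measurable borel" "u1 \<in> borel_measurable borel" "G1 \<in> borel_measurable borel"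
    "\<And>z. z \<notin> cyl T \<Longrightarrow> r1 z = 0 \<and> u1 z = 0 \<and> G1 z = 0" "\<And>z. R1 < norm (fst z) \<Longrightarrow> r1 z = 0 \<and> u1 z = 0"
    "0 \<le> M1" "0 \<le> R1" "\<And>z. \<bar>r1 z\<bar> \<le> M1" "integrable lborel (\<lambda>z. (u1 z)\<^sup>2)" "integrable lborel (\<lambda>z. (norm (G1 z))\<^sup>2)"
    "AE z in lborel. z \<in> cyl T \<longrightarrow> 0 \<le> u1 z \<and> r1 z \<le> m z \<and> u1 z * (m z - r1 z) = 0"
    using 1 unfolding reduction_def by blast+
  have b: "r2 \<in> borel_measurable borel" "u2 \<in> borel_measurable borel" "G2 \<in> borel_measurable borel"
    "\<And>z. z \<notin> cyl T \<Longrightarrow> r2 z = 0 \<and> u2 z = 0 \<and> G2 z = 0" "\<And>z. R2 < norm (fst z) \<Longrightarrow> r2 z = 0 \<and> u2 z = 0"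
    "0 \<le> M2" "0 \<le> R2" "\<And>z. \<bar>r2 z\<bar> \<le> M2" "integrable lborel (\<lambda>z. (u2 z)\<^sup>2)" "integrable lborel (\<lambda>z. (norm (G2 z))\<^sup>2)"
    "AE z in lborel. z \<in> cyl T \<longrightarrow> 0 \<le> u2 z \<and> r2 z \<le> m z \<and> u2 z * (m z - r2 z) = 0"
    using 2 unfolding reduction_def by blast+
  note [measurable] = a(1-3) b(1-3)
  have sub2: "integrable lborel (\<lambda>z. (norm (x z - y z))\<^sup>2)"
    if "x \<in> borel_measurable borel" "y \<in> borel_measurable borel" "integrable lborel (\<lambda>z. (norm (x z))\<^sup>2)" "integrable lborel (\<lambda>z. (norm (y z))\<^sup>2)"
    for x y :: "'a \<times> real \<Rightarrow> 'c::euclidean_space"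
  proof (rule integrable_nonneg_bound)
    note [measurable] = that(1,2)
    show "integrable lborel (\<lambda>z. 2 * (norm (x z))\<^sup>2 + 2 * (norm (y z))\<^sup>2)" using that by auto
    show "(\<lambda>z. (norm (x z - y z))\<^sup>2) \<in> borel_measurable borel" by measurable
    fix z
    have "(norm (x z - y z))\<^sup>2 \<le> (norm (x z) + norm (y z))\<^sup>2" by (intro power_mono norm_triangle_ineq4) auto
    also have "\<dots> \<le> 2 * (norm (x z))\<^sup>2 + 2 * (norm (y z))\<^sup>2" by (rule power2_sum_le)
    finally show "(norm (x z - y z))\<^sup>2 \<le> 2 * (norm (x z))\<^sup>2 + 2 * (norm (y z))\<^sup>2" .
  qed auto
  have q2: "integrable lborel (\<lambda>z. (u1 z - u2 z)\<^sup>2)" using sub2[of u1 u2] a b by simp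
  have G2: "integrable lborel (\<lambda>z. (norm (G1 z - G2 z))\<^sup>2)" using sub2[of G1 G2] a b by simp
  \<comment> \<open>Where one pressure is positive, its density equals \<open>m\<close> and is at
    least the other density. The algebraic identity used below expresses this without distinguishing
    cases.\<close>
  have mono: "AE z in lborel. 0 \<le> (r1 z - r2 z) * (u1 z - u2 z)"
    using a(11) b(11)
  proof eventually_elim
    case (elim z)
    show ?case
    proof (cases "z \<in> cyl T")
      case True
      with elim have e: "0 \<le> u1 z" "r1 z \<le> m z" "u1 z * (m z - r1 z) = 0" "0 \<le> u2 z" "r2 z \<le> m z" "u2 z * (m z - r2 z) = 0"
        by auto
      have "(r1 z - r2 z) * (u1 z - u2 z) = u1 z * (m z - r2 z) + u2 z * (m z - r1 z) - u1 z * (m z - r1 z) - u2 z * (m z - r2 z)"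
        by (simp add: algebra_simps)
      moreover have "0 \<le> u1 z * (m z - r2 z)" "0 \<le> u2 z * (m z - r1 z)"
        using e by (auto intro: mult_nonneg_nonneg)
      ultimately show ?thesis using e by linarith
    qed (use a(4)[of z] b(4)[of z] in auto)
  qed
  have wb: "\<bar>r1 z - r2 z\<bar> \<le> M1 + M2" for z using a(8)[of z] b(8)[of z] by linarith
  have smooth: "(LINT z|lborel. (r1 z - r2 z) * (snd (D z) - bX z \<bullet> fst (D z) + fX z * \<phi> z)) =
      (LINT z|lborel. mX z * ((G1 z - G2 z) \<bullet> fst (D z)))"
    if tf: "test_function (UNIV \<times> {..<T}) \<phi>" and gd: "\<And>z. GDERIV \<phi> z :> D z" for \<phi> D
  proof -
    have A: "integrable lborel (\<lambda>z. r1 z * (snd (D z) - bX z \<bullet> fst (D z) + fX z * \<phi> z))"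
      "integrable lborel (\<lambda>z. mX z * (G1 z \<bullet> fst (D z)))"
      "(LINT z|lborel. r1 z * (snd (D z) - bX z \<bullet> fst (D z) + fX z * \<phi> z)) - (LINT z|lborel. mX z * (G1 z \<bullet> fst (D z)))
        = - (LINT x|lebesgue. \<phi> (x, 0) * \<rho>0 x)"
      using 1 tf gd unfolding reduction_def by blast+
    have Bf: "integrable lborel (\<lambda>z. r2 z * (snd (D z) - bX z \<bullet> fst (D z) + fX z * \<phi> z))"
      "integrable lborel (\<lambda>z. mX z * (G2 z \<bullet> fst (D z)))"
      "(LINT z|lborel. r2 z * (snd (D z) - bX z \<bullet> fst (D z) + fX z * \<phi> z)) - (LINT z|lborel. mX z * (G2 z \<bullet> fst (D z)))
        = - (LINT x|lebesgue. \<phi> (x, 0) * \<rho>0 x)"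
      using 2 tf gd unfolding reduction_def by blast+
    have "(LINT z|lborel. (r1 z - r2 z) * (snd (D z) - bX z \<bullet> fst (D z) + fX z * \<phi> z)) =
        (LINT z|lborel. r1 z * (snd (D z) - bX z \<bullet> fst (D z) + fX z * \<phi> z)) - (LINT z|lborel. r2 z * (snd (D z) - bX z \<bullet> fst (D z) + fX z * \<phi> z))"
      unfolding left_diff_distrib by (rule Bochner_Integration.integral_diff[OF A(1) Bf(1)])
    moreover have "(LINT z|lborel. mX z * ((G1 z - G2 z) \<bullet> fst (D z))) =
        (LINT z|lborel. mX z * (G1 z \<bullet> fst (D z))) - (LINT z|lborel. mX z * (G2 z \<bullet> fst (D z)))"
      unfolding inner_diff_left right_diff_distrib by (rule Bochner_Integration.integral_diff[OF A(2) Bf(2)])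
    ultimately show ?thesis using A(3) Bf(3) by linarith
  qed
  have wm: "(\<lambda>z. r1 z - r2 z) \<in> borel_measurable borel" and Gm: "(\<lambda>z. G1 z - G2 z) \<in> borel_measurable borel"
    by measurable
  have M: "0 \<le> M1 + M2" using a(6) b(6) by simp
  show ?thesis
    unfolding difference_def
  proof (intro conjI)
    show "\<forall>z. z \<notin> cyl T \<longrightarrow> r1 z - r2 z = 0 \<and> u1 z - u2 z = 0 \<and> G1 z - G2 z = 0" using a(4) b(4) by simp
    show "\<forall>z. max R1 R2 < norm (fst z) \<longrightarrow> r1 z - r2 z = 0 \<and> u1 z - u2 z = 0" using a(5) b(5) by simp
    show "\<forall>z. \<bar>r1 z - r2 z\<bar> \<le> M1 + M2" using wb by simp
    show "0 \<le> max R1 R2" using a(7) by simp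
    show "(\<lambda>z. u1 z - u2 z) \<in> borel_measurable borel" by measurable
    show "\<forall>\<phi> D K. (\<forall>z. GDERIV \<phi> z :> D z) \<longrightarrow> continuous_on UNIV D \<longrightarrow> compact K \<longrightarrow> K \<subseteq> UNIV \<times> {..<T} \<longrightarrow>
      (\<forall>z. z \<notin> K \<longrightarrow> \<phi> z = 0) \<longrightarrow>
      integrable lborel (\<lambda>z. (r1 z - r2 z) * (snd (D z) - bX z \<bullet> fst (D z) + fX z * \<phi> z)) \<and>
      integrable lborel (\<lambda>z. mX z * ((G1 z - G2 z) \<bullet> fst (D z))) \<and>
      (LINT z|lborel. (r1 z - r2 z) * (snd (D z) - bX z \<bullet> fst (D z) + fX z * \<phi> z)) = (LINT z|lborel. mX z * ((G1 z - G2 z) \<bullet> fst (D z)))"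
    proof (intro allI impI)
      fix \<phi> :: "'a \<times> real \<Rightarrow> real" and D :: "'a \<times> real \<Rightarrow> 'a \<times> real" and K
      assume h: "\<forall>z. GDERIV \<phi> z :> D z" "continuous_on UNIV D" "compact K" "K \<subseteq> UNIV \<times> {..<T}" "\<forall>z. z \<notin> K \<longrightarrow> \<phi> z = 0"
      have z: "z \<notin> K \<Longrightarrow> \<phi> z = 0" for z using h(5) by blast
      show "integrable lborel (\<lambda>z. (r1 z - r2 z) * (snd (D z) - bX z \<bullet> fst (D z) + fX z * \<phi> z)) \<and>
        integrable lborel (\<lambda>z. mX z * ((G1 z - G2 z) \<bullet> fst (D z))) \<and>
        (LINT z|lborel. (r1 z - r2 z) * (snd (D z) - bX z \<bullet> fst (D z) + fX z * \<phi> z)) = (LINT z|lborel. mX z * ((G1 z - G2 z) \<bullet> fst (D z)))"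
        (is "?A \<and> ?B \<and> ?C")
      proof (intro conjI)
        note F = C1_formula[where w = "\<lambda>z. r1 z - r2 z" and G = "\<lambda>z. G1 z - G2 z" and M = "M1 + M2" and \<phi> = \<phi> and D = D and K = K]
        note facts = wm Gm G2 M h(2-4)
        show ?A by (rule F(2); (rule facts | rule wb | rule h(1)[rule_format] | (rule z, assumption) | (rule smooth; blast)))
        show ?B by (rule F(3); (rule facts | rule wb | rule h(1)[rule_format] | (rule z, assumption) | (rule smooth; blast)))
        show ?C by (rule F(1); (rule facts | rule wb | rule h(1)[rule_format] | (rule z, assumption) | (rule smooth; blast)))
      qed
    qed
    show "\<forall>\<psi> D K i. (\<forall>z. GDERIV \<psi> z :> D z) \<longrightarrow> continuous_on UNIV D \<longrightarrow> compact K \<longrightarrow> (\<forall>z. z \<notin> K \<longrightarrow> \<psi> z = 0 \<and> D z = 0) \<longrightarrow>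
      i \<in> Basis \<longrightarrow> (LINT z|lborel. (u1 z - u2 z) * (fst (D z) \<bullet> i)) = - (LINT z|lborel. ((G1 z - G2 z) \<bullet> i) * \<psi> z)"
    proof (intro allI impI)
      fix \<psi> :: "'a \<times> real \<Rightarrow> real" and D :: "'a \<times> real \<Rightarrow> 'a \<times> real" and K and i :: 'a
      assume h: "\<forall>z. GDERIV \<psi> z :> D z" "continuous_on UNIV D" "compact K" "\<forall>z. z \<notin> K \<longrightarrow> \<psi> z = 0 \<and> D z = 0" "i \<in> Basis"
      have A: "(LINT z|lborel. u1 z * (fst (D z) \<bullet> i)) = - (LINT z|lborel. (G1 z \<bullet> i) * \<psi> z)"
        "integrable lborel (\<lambda>z. u1 z * (fst (D z) \<bullet> i))" "integrable lborel (\<lambda>z. (G1 z \<bullet> i) * \<psi> z)"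
        using 1 h unfolding reduction_def by blast+
      have Bf: "(LINT z|lborel. u2 z * (fst (D z) \<bullet> i)) = - (LINT z|lborel. (G2 z \<bullet> i) * \<psi> z)"
        "integrable lborel (\<lambda>z. u2 z * (fst (D z) \<bullet> i))" "integrable lborel (\<lambda>z. (G2 z \<bullet> i) * \<psi> z)"
        using 2 h unfolding reduction_def by blast+
      show "(LINT z|lborel. (u1 z - u2 z) * (fst (D z) \<bullet> i)) = - (LINT z|lborel. ((G1 z - G2 z) \<bullet> i) * \<psi> z)"
        unfolding left_diff_distrib inner_diff_left
        by (simp only: Bochner_Integration.integral_diff[OF A(2) Bf(2)] Bochner_Integration.integral_diff[OF A(3) Bf(3)] A(1) Bf(1))
    qed
  qed (fact wm Gm M q2 G2 mono)+
qed

end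

section \<open>Test functions for the continuous problem\<close>

lemma DERIV_max_power2: "DERIV (\<lambda>x::real. (max 0 x)\<^sup>2) x :> 2 * max 0 x"
proof -
  consider "x < 0" | "x = 0" | "x > 0" by linarith
  then show ?thesis
  proof cases
    case 1
    have "DERIV (\<lambda>x::real. (max 0 x)\<^sup>2) x :> 0"
      by (rule has_field_derivative_transform_within_open[of "\<lambda>_. 0" _ _ "{..<0}"]) (use 1 in auto)
    with 1 show ?thesis by simp
  next
    case 2
    have "((\<lambda>h::real. max 0 h) \<longlongrightarrow> max 0 0) (at 0)" by (intro tendsto_intros)
    moreover have "eventually (\<lambda>h::real. max 0 h = ((max 0 (x + h))\<^sup>2 - (max 0 x)\<^sup>2) / h) (at 0)"
      using 2 by (auto simp: eventually_at_filter power2_eq_square max_def)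
    ultimately have "((\<lambda>h. ((max 0 (x + h))\<^sup>2 - (max 0 x)\<^sup>2) / h) \<longlongrightarrow> 0) (at 0)"
      by (auto intro: Lim_transform_eventually)
    with 2 show ?thesis by (simp add: DERIV_def)
  next
    case 3
    have "DERIV (\<lambda>x::real. x\<^sup>2) x :> 2 * max 0 x" using 3 by (auto intro!: derivative_eq_intros)
    then show ?thesis
      by (rule has_field_derivative_transform_within_open[of _ _ _ "{0<..}"]) (use 3 in auto)
  qed
qed

text \<open>Two nested squared positive parts already give a C1 transition, and C1 is the regularity
  asked of test functions at this stage.\<close>

lemma cutoff_exists:
  fixes r :: real
  assumes "0 < r"
  obtains \<zeta> \<zeta>' where "\<And>t. DERIV \<zeta> t :> \<zeta>' t" "continuous_on UNIV \<zeta>'" "\<And>t. 0 \<le> t \<Longrightarrow> \<zeta> t = 1 \<and> \<zeta>' t = 0"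
    "\<And>t. t \<le> - r \<Longrightarrow> \<zeta> t = 0 \<and> \<zeta>' t = 0"
proof
  define \<zeta> where "\<zeta> = (\<lambda>t. (max 0 (1 - (max 0 (- t))\<^sup>2 / r\<^sup>2))\<^sup>2)"
  define \<zeta>' where "\<zeta>' = (\<lambda>t. 2 * max 0 (1 - (max 0 (- t))\<^sup>2 / r\<^sup>2) * (2 * max 0 (- t) / r\<^sup>2))"
  show "DERIV \<zeta> t :> \<zeta>' t" for t
  proof -
    have "DERIV (\<lambda>t. (max 0 (- t))\<^sup>2) t :> 2 * max 0 (- t) * - 1"
      by (rule DERIV_chain2[OF DERIV_max_power2]) (auto intro!: derivative_eq_intros)
    then have "DERIV (\<lambda>t. 1 - (max 0 (- t))\<^sup>2 / r\<^sup>2) t :> 0 - (2 * max 0 (- t) * - 1) / r\<^sup>2"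
      by (intro DERIV_diff DERIV_const DERIV_cdivide)
    then have "DERIV (\<lambda>t. 1 - (max 0 (- t))\<^sup>2 / r\<^sup>2) t :> 2 * max 0 (- t) / r\<^sup>2" by simp
    from DERIV_chain2[OF DERIV_max_power2 this] show ?thesis by (simp add: \<zeta>_def \<zeta>'_def)
  qed
  show "continuous_on UNIV \<zeta>'" unfolding \<zeta>'_def using assms by (intro continuous_intros) auto
  show "\<zeta> t = 1 \<and> \<zeta>' t = 0" if "0 \<le> t" for t using that by (simp add: \<zeta>_def \<zeta>'_def)
  show "\<zeta> t = 0 \<and> \<zeta>' t = 0" if "t \<le> - r" for t
  proof -
    have le: "r \<le> max 0 (- t)" using that by simp
    have "r\<^sup>2 \<le> (max 0 (- t))\<^sup>2" by (rule power_mono[OF le]) (use assms in simp)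
    then have "1 \<le> (max 0 (- t))\<^sup>2 / r\<^sup>2"
      by (rule le_divide_eq_1_pos[THEN iffD2, rotated]) (use assms in simp)
    then show ?thesis by (simp add: \<zeta>_def \<zeta>'_def)
  qed
qed

text \<open>The scheme solution is C1 only after time \<open>- \<tau>\<close>, while a test function
  must be C1 everywhere. The cutoff acts between \<open>- \<tau> / 2\<close> and 0 and leaves the
  cylinder untouched; the distance of the support from time \<open>T\<close> comes from the
  vanishing after \<open>T - \<epsilon>\<close>.\<close>

lemma (in energy) C1_test:
  obtains \<Phi> D\<Phi> K where "\<And>z. GDERIV \<Phi> z :> D\<Phi> z" "continuous_on UNIV D\<Phi>" "compact K" "K \<subseteq> UNIV \<times> {..<T}"
    "\<And>z. z \<notin> K \<Longrightarrow> \<Phi> z = 0" "\<And>z. z \<in> cyl T \<Longrightarrow> \<Phi> z = \<phi> z \<and> D\<Phi> z = D z"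
proof -
  obtain \<zeta> \<zeta>' where \<zeta>: "\<And>t. DERIV \<zeta> t :> \<zeta>' t" "continuous_on UNIV \<zeta>'" "\<And>t. 0 \<le> t \<Longrightarrow> \<zeta> t = 1 \<and> \<zeta>' t = 0"
    "\<And>t. t \<le> - (\<tau> / 2) \<Longrightarrow> \<zeta> t = 0 \<and> \<zeta>' t = 0"
    by (rule cutoff_exists[of "\<tau> / 2"]) (use \<tau> in auto)
  define \<Phi> where "\<Phi> = (\<lambda>z. \<zeta> (snd z) * \<phi> z)"
  define D\<Phi> where "D\<Phi> = (\<lambda>z. \<zeta> (snd z) *\<^sub>R D z + (\<phi> z * \<zeta>' (snd z)) *\<^sub>R (0, 1))"
  define N where "N = {z::'a \<times> real. snd z < - (\<tau> / 2)}"
  have N: "open N" unfolding N_def by (intro open_Collect_less continuous_intros)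
  have N0: "\<Phi> z = 0" "D\<Phi> z = 0" if "z \<in> N" for z
    using \<zeta>(4)[of "snd z"] that by (auto simp: \<Phi>_def D\<Phi>_def N_def zero_prod_def)
  have cover: "z \<in> \<Omega> \<or> z \<in> N" for z using \<tau> by (auto simp: \<Omega>_def N_def)
  have c\<zeta>: "continuous_on UNIV \<zeta>"
    using \<zeta>(1) by (auto intro!: continuous_at_imp_continuous_on DERIV_isCont)
  define K where "K = cball (0::'a) R1 \<times> {- \<tau>..T - \<epsilon>}"
  show thesis
  proof (rule that[of \<Phi> D\<Phi> K])
    fix z :: "'a \<times> real"
    show "GDERIV \<Phi> z :> D\<Phi> z"
    proof (cases "z \<in> \<Omega>")
      case True
      have 1: "(\<phi> has_derivative (\<lambda>h. h \<bullet> D z)) (at z)" using inv True by (simp add: inv_def gderiv_def)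
      have "((\<lambda>z::'a \<times> real. snd z) has_derivative snd) (at z)" by (rule has_derivative_snd[OF has_derivative_ident])
      from has_derivative_compose[OF this \<zeta>(1)[of "snd z", THEN has_field_derivative_imp_has_derivative]]
      have 2: "((\<lambda>z. \<zeta> (snd z)) has_derivative (\<lambda>h. \<zeta>' (snd z) * snd h)) (at z)" .
      have eq: "(\<lambda>h. \<zeta> (snd z) * (h \<bullet> D z) + \<zeta>' (snd z) * snd h * \<phi> z) = (\<lambda>h. h \<bullet> D\<Phi> z)"
        by (rule ext) (simp add: D\<Phi>_def inner_add_right inner_prod_def algebra_simps)
      from has_derivative_mult[OF 2 1] show ?thesis
        unfolding gderiv_def \<Phi>_def eq .
    next
      case False
      then have z: "z \<in> N" using cover by blast
      have "(\<Phi> has_derivative (\<lambda>h. 0)) (at z)"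
        by (rule has_derivative_transform_within_open[OF has_derivative_const[of 0] N z]) (simp add: N0)
      then show ?thesis using N0(2)[OF z] by (simp add: gderiv_def)
    qed
    show "\<Phi> z = 0" if "z \<notin> K"
    proof (rule ccontr)
      assume "\<Phi> z \<noteq> 0"
      then have nz: "\<zeta> (snd z) \<noteq> 0" "\<phi> z \<noteq> 0" by (auto simp: \<Phi>_def)
      have "- (\<tau> / 2) < snd z" using \<zeta>(4)[of "snd z"] nz(1) by force
      moreover have "norm (fst z) \<le> R1" using \<phi>_far[of z] nz(2) by force
      moreover have "snd z < T - \<epsilon>"
      proof (rule ccontr)
        assume "\<not> snd z < T - \<epsilon>"
        then have "\<phi> z = 0" using inv unfolding inv_def by (meson not_less)
        then show False using nz by simp
      qed
      ultimately show False using that \<tau> by (cases z) (auto simp: K_def)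
    qed
    show "\<Phi> z = \<phi> z \<and> D\<Phi> z = D z" if "z \<in> cyl T"
      using \<zeta>(3)[of "snd z"] that by (simp add: \<Phi>_def D\<Phi>_def cyl_iff zero_prod_def[symmetric])
  next
    have "continuous_on \<Omega> D\<Phi>"
      unfolding D\<Phi>_def
      by (intro continuous_intros D_cont \<phi>_cont continuous_on_compose2[OF c\<zeta>] continuous_on_compose2[OF \<zeta>(2)]) auto
    moreover have "continuous_on N D\<Phi>"
      by (rule continuous_on_eq[OF continuous_on_const[of _ 0]]) (simp add: N0)
    ultimately have "continuous_on (\<Omega> \<union> N) D\<Phi>"
      using open_\<Omega> N by (intro continuous_on_open_Un)
    moreover have "\<Omega> \<union> N = UNIV" using cover by blast
    ultimately show "continuous_on UNIV D\<Phi>" by simp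
    show "compact K" unfolding K_def by (intro compact_Times) auto
    show "K \<subseteq> UNIV \<times> {..<T}" using \<tau> by (auto simp: K_def)
  qed
qed

section \<open>The dual problem for a given source\<close>

context hs_data
begin

text \<open>The constants of the locale \<open>energy\<close>, restated outside it to exhibit that
  they depend on the coefficients and the support radius \<open>R\<close>, but not on the source or
  the time step.\<close>

definition CPc :: "real \<Rightarrow> real" where "CPc R = (2 * (R + \<kappa> * (T + 2)) + 1)\<^sup>2"
definition aac :: "real \<Rightarrow> real" where
  "aac R = 4 * (1 + B / 2 + Mm / \<delta> * (B * (dd + 1) / 2 + dd * B / 2 + B * CPc R / 2))"
definition lamc :: "real \<Rightarrow> real" where
  "lamc R = Mm * (\<kappa> + 1) / \<delta> + B * (1 + dd + \<kappa>) + aac R"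
definition C4c :: real where "C4c = B * (1 + dd + \<kappa>) + (1 + B * (1 + dd + \<kappa>)) * (\<kappa> + 1)"
definition Volc :: "real \<Rightarrow> real" where "Volc R = measure lborel (cball (0::'a) (R + \<kappa> * (T + 2)) \<times> {0..T})"
definition wt :: "real \<Rightarrow> 'a \<times> real \<Rightarrow> real" where "wt R z = exp (lamc R * snd z) * mX z"

text \<open>All that the duality argument needs from the scheme. The weight and the constants
  \<open>C4c\<close>, \<open>Volc R\<close> and \<open>CPc R\<close> involve neither the source
  bound \<open>s\<close> nor the tolerance \<eta>; these enter only through the choice of
  \<tau>.\<close>

lemma dual_test:
  assumes R: "0 \<le> R" and \<epsilon>: "0 < \<epsilon>" and \<eta>: "0 < \<eta>"
    and S: "\<And>z. GDERIV S z :> DS z" "\<And>z. \<bar>S z\<bar> \<le> s" "\<And>z. norm (DS z) \<le> s"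
      "\<And>z z'. norm (DS z - DS z') \<le> s * norm (z - z')"
      "\<And>z. T - \<epsilon> \<le> snd z \<Longrightarrow> S z = 0 \<and> DS z = 0" "\<And>z. R < norm (fst z) \<Longrightarrow> S z = 0 \<and> DS z = 0"
    and \<omega>: "\<omega> \<in> borel_measurable borel" "\<And>z. \<bar>\<omega> z\<bar> \<le> L" "\<And>z z'. \<bar>\<omega> z - \<omega> z'\<bar> \<le> L * norm (z - z')"
      "\<And>z. \<omega> z \<noteq> 0 \<Longrightarrow> t0 \<le> snd z \<and> snd z \<le> T - t0 \<and> norm (fst z) \<le> r" "0 < t0"
  obtains \<Phi> D K Y where "\<And>z. GDERIV \<Phi> z :> D z" "continuous_on UNIV D" "compact K" "K \<subseteq> UNIV \<times> {..<T}"
    "\<And>z. z \<notin> K \<Longrightarrow> \<Phi> z = 0"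
    "\<And>z. z \<in> cyl T \<Longrightarrow> \<bar>snd (D z) - b z \<bullet> fst (D z) + f z * \<Phi> z + S z\<bar> \<le> \<eta>"
    "integrable lborel (\<lambda>z. wt R z * (norm (fst (D z)))\<^sup>2)" "Y = (LINT z|lborel. wt R z * (norm (fst (D z)))\<^sup>2)"
    "integrable lborel (\<lambda>z. wt R z * (fst (DS z) \<bullet> fst (D z)))" "Y \<le> (LINT z|lborel. wt R z * (fst (DS z) \<bullet> fst (D z)))"
    "0 \<le> Y" "\<And>\<alpha>. 0 < \<alpha> \<Longrightarrow> \<bar>LINT z|lborel. \<omega> z * S z\<bar> \<le> L * C4c * (\<alpha> * Volc R + CPc R * Y / (\<delta> * \<alpha>))"
proof -
  define MMc where "MMc = exp (4 * B * (dd + 1) * (T + 2)) * ((T + 2) * s)"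
  define Ac where "Ac = MMc * (2 * B + dd * B + 2 * (\<kappa> + 1)\<^sup>2)"
  have s: "0 \<le> s" using S(2)[of 0] by linarith
  have Ac: "0 \<le> Ac" using s T B dd by (simp add: Ac_def MMc_def)
  have aac: "4 \<le> aac R" using B dd Mm \<delta> by (simp add: aac_def CPc_def)
  \<comment> \<open>One entry per demand: staying below \<epsilon>, below 1, nonnegative weights,
    the energy estimate, the time margin of \<omega>, and a scheme error of at most \<eta>. As
    \<open>Ac\<close> contains \<open>s\<close>, the time step is chosen after the source.\<close>
  define \<tau> where "\<tau> = Min {\<epsilon> / 2, 1, 1 / (2 * B), 1 / aac R, t0 / 2, \<eta> / (Ac + 1)}"
  have fin: "finite {\<epsilon> / 2, 1, 1 / (2 * B), 1 / aac R, t0 / 2, \<eta> / (Ac + 1)}" by simp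
  have le: "\<tau> \<le> \<epsilon> / 2" "\<tau> \<le> 1" "\<tau> \<le> 1 / (2 * B)" "\<tau> \<le> 1 / aac R" "\<tau> \<le> t0 / 2" "\<tau> \<le> \<eta> / (Ac + 1)"
    unfolding \<tau>_def by (rule Min_le[OF fin], simp)+
  have \<tau>: "0 < \<tau>"
    unfolding \<tau>_def using \<epsilon> B aac \<omega>(5) \<eta> Ac by (subst Min_gr_iff) auto
  have \<tau>B: "\<tau> * B \<le> 1 / 2" using le(3) B by (simp add: field_simps)
  have \<tau>a: "aac R * \<tau> \<le> 1" using le(4) aac by (simp add: field_simps)
  have \<tau>\<eta>: "\<tau> * Ac \<le> \<eta>"
  proof -
    have "\<tau> * Ac \<le> \<eta> / (Ac + 1) * (Ac + 1)" using le(6) Ac \<tau> by (intro mult_mono) auto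
    then show ?thesis using Ac by simp
  qed
  interpret sc: scheme T B b f Db Df \<tau> \<epsilon> s R S DS
    by unfold_locales (use \<tau> le \<epsilon> \<tau>B S in auto)
  obtain \<phi> D where sol: "sc.inv sc.MM \<phi> D" "\<And>z. z \<in> sc.\<Omega> \<Longrightarrow> \<phi> z = sc.step \<phi> z" "\<And>z. z \<in> sc.\<Omega> \<Longrightarrow> D z = sc.stepD \<phi> D z"
    "\<And>z. R + \<kappa> * (T + 2) < norm (fst z) \<Longrightarrow> \<phi> z = 0 \<and> D z = 0" "\<And>z. z \<notin> sc.\<Omega> \<Longrightarrow> \<phi> z = 0 \<and> D z = 0"
    by (rule sc.scheme_solution_ext) blast
  interpret en: energy T B b f Db Df \<tau> \<epsilon> s R S DS m \<delta> Mm \<phi> D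
    by unfold_locales (fact \<delta> m_bounds m_lip R sol)+
  have MMeq: "sc.MM = MMc" by (simp add: sc.MM_def sc.CC_def MMc_def)
  have cst: "en.CP = CPc R" "en.aa = aac R" "en.lam = lamc R" "en.Vol = Volc R" "en.C2 = B * (1 + dd + \<kappa>)"
    by (simp_all add: en.CP_def en.R1_def CPc_def en.aa_def en.C3_def aac_def en.lam_def en.C1_def en.C2_def lamc_def
        en.Vol_def Volc_def)
  obtain \<Phi> D\<Phi> K where test: "\<And>z. GDERIV \<Phi> z :> D\<Phi> z" "continuous_on UNIV D\<Phi>" "compact K" "K \<subseteq> UNIV \<times> {..<T}"
    "\<And>z. z \<notin> K \<Longrightarrow> \<Phi> z = 0" "\<And>z. z \<in> cyl T \<Longrightarrow> \<Phi> z = \<phi> z \<and> D\<Phi> z = D z"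
    by (rule en.C1_test) blast
  have mXeq: "en.mX = mX" by (simp add: fun_eq_iff en.mX_def mX_def)
  have weight: "en.H (lamc R) (snd z) * mX z = wt R z" for z
    by (cases "z \<in> cyl T") (simp_all add: en.H_X wt_def mX_def)
  have off: "wt R z = 0" if "z \<notin> cyl T" for z using that by (simp add: wt_def mX_def)
  have e1: "wt R z * (norm (fst (D\<Phi> z)))\<^sup>2 = en.H en.lam (snd z) * en.mX z * en.U z" for z
    using test(6)[of z] off[of z] unfolding mXeq cst weight en.U_def by (cases "z \<in> cyl T") auto
  have e2: "wt R z * (fst (DS z) \<bullet> fst (D\<Phi> z)) = en.H en.lam (snd z) * en.mX z * (fst (DS z) \<bullet> fst (D z))" for z
    using test(6)[of z] off[of z] unfolding mXeq cst weight by (cases "z \<in> cyl T") auto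
  have Yeq: "en.Y en.lam = (LINT z|lborel. wt R z * (norm (fst (D\<Phi> z)))\<^sup>2)"
    unfolding e1 en.Y_def ..
  have ee: "integrable lborel (\<lambda>z. wt R z * (fst (DS z) \<bullet> fst (D\<Phi> z)))"
    "en.Y en.lam \<le> (LINT z|lborel. wt R z * (fst (DS z) \<bullet> fst (D\<Phi> z)))"
    using en.energy_estimate \<tau>a unfolding e2 cst(2) by auto
  show thesis
  proof (rule that[OF test(1-5) _ _ Yeq ee])
    fix z :: "'a \<times> real" assume z: "z \<in> cyl T"
    have "\<bar>snd (D z) - b z \<bullet> fst (D z) + f z * \<phi> z + S z\<bar> \<le> \<tau> * (sc.MM * (2 * B + dd * B + 2 * (\<kappa> + 1)\<^sup>2))"
      by (rule sc.scheme_consistent[OF sol(1) sol(2) z]) (rule en.X_\<Omega>[OF z])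
    then have "\<bar>snd (D z) - b z \<bullet> fst (D z) + f z * \<phi> z + S z\<bar> \<le> \<eta>"
      using \<tau>\<eta> unfolding MMeq Ac_def by linarith
    then show "\<bar>snd (D\<Phi> z) - b z \<bullet> fst (D\<Phi> z) + f z * \<Phi> z + S z\<bar> \<le> \<eta>"
      by (simp add: test(6)[OF z])
  next
    show "integrable lborel (\<lambda>z. wt R z * (norm (fst (D\<Phi> z)))\<^sup>2)"
      unfolding e1 by (rule en.HmU_integrable)
    have "0 \<le> \<delta> * en.Z en.lam" using \<delta> en.Z_nonneg by simp
    then show "0 \<le> en.Y en.lam" using en.Z_le_Y[of en.lam] by linarith
    fix \<alpha> :: real assume \<alpha>: "0 < \<alpha>"
    have L: "0 \<le> L" using \<omega>(2)[of 0] by linarith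
    have "\<bar>LINT z|lborel. \<omega> z * S z\<bar> \<le> L * (en.C2 + (1 + en.C2) * (\<kappa> + 1)) * (\<alpha> * en.Vol + en.CP * en.Z en.lam / \<alpha>)"
    proof (rule en.weak_test[OF \<omega>(1-3) _ \<alpha> en.lam])
      show "\<tau> < snd z \<and> snd z + \<tau> < T \<and> norm (fst z) \<le> r" if "\<omega> z \<noteq> 0" for z
        using \<omega>(4)[OF that] \<omega>(5) le(5) by linarith
    qed
    also have "\<dots> \<le> L * C4c * (\<alpha> * Volc R + CPc R * en.Y en.lam / (\<delta> * \<alpha>))"
    proof -
      have "en.Z en.lam \<le> en.Y en.lam / \<delta>" using en.Z_le_Y[of en.lam] \<delta> by (simp add: field_simps)
      then have "CPc R * en.Z en.lam / \<alpha> \<le> CPc R * (en.Y en.lam / \<delta>) / \<alpha>"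
        using \<alpha> by (intro divide_right_mono mult_left_mono) (auto simp: CPc_def)
      moreover have "0 \<le> L * C4c" using L B dd \<kappa> by (simp add: C4c_def)
      ultimately show ?thesis
        unfolding cst C4c_def[symmetric] by (intro mult_left_mono add_left_mono) auto
    qed
    finally show "\<bar>LINT z|lborel. \<omega> z * S z\<bar> \<le> L * C4c * (\<alpha> * Volc R + CPc R * en.Y en.lam / (\<delta> * \<alpha>))" .
  qed
qed

end

text \<open>A kernel around \<open>(0, c)\<close> moves the time support by \<open>c\<close> and
  widens it by \<rho>. The bound \<open>s\<close> exists because the convolution is smooth with
  compact support, its second derivatives giving the Lipschitz constant of the gradient; no control
  of \<open>s\<close> in terms of \<rho> is claimed.\<close>

lemma mollified_source:
  fixes g \<eta> :: "'a::euclidean_space \<times> real \<Rightarrow> real"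
  assumes g: "integrable lborel g" "\<And>z. g z \<noteq> 0 \<Longrightarrow> a < snd z \<and> snd z < T" "\<And>z. R0 < norm (fst z) \<Longrightarrow> g z = 0"
    and \<eta>: "smooth_on UNIV \<eta>" "\<And>z. z \<notin> ball (0, c) \<rho> \<Longrightarrow> \<eta> z = 0" and \<rho>: "0 < \<rho>"
  obtains s where "\<And>z. GDERIV (convol g \<eta>) z :> convol g (\<lambda>z. \<Sum>i\<in>Basis. iter_deriv [i] \<eta> z *\<^sub>R i) z"
    "\<And>z. \<bar>convol g \<eta> z\<bar> \<le> s" "\<And>z. norm (convol g (\<lambda>z. \<Sum>i\<in>Basis. iter_deriv [i] \<eta> z *\<^sub>R i) z) \<le> s"
    "\<And>z z'. norm (convol g (\<lambda>z. \<Sum>i\<in>Basis. iter_deriv [i] \<eta> z *\<^sub>R i) z - convol g (\<lambda>z. \<Sum>i\<in>Basis. iter_deriv [i] \<eta> z *\<^sub>R i) z')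
      \<le> s * norm (z - z')"
    "\<And>z. T + c + \<rho> \<le> snd z \<or> snd z \<le> a + c - \<rho> \<or> R0 + \<rho> < norm (fst z) \<Longrightarrow>
      convol g \<eta> z = 0 \<and> convol g (\<lambda>z. \<Sum>i\<in>Basis. iter_deriv [i] \<eta> z *\<^sub>R i) z = 0"
proof -
  define S where "S = convol g \<eta>"
  define D\<eta> where "D\<eta> = (\<lambda>z. \<Sum>i\<in>Basis. iter_deriv [i] \<eta> z *\<^sub>R i)"
  define DS where "DS = convol g D\<eta>"
  have \<eta>c: "\<eta> z = 0" if "z \<notin> cball (0, c) \<rho>" for z using \<eta>(2) that by auto
  have G: "GDERIV S z :> DS z" for z
    using iter_deriv_convol(2)[OF g(1) \<eta>(1) compact_cball \<eta>c, where vs = "[]" and x = z]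
    unfolding S_def DS_def D\<eta>_def iter_deriv.simps(1) by simp
  have smooth: "smooth_on UNIV S"
    unfolding S_def by (rule smooth_convol[OF g(1) \<eta>(1) compact_cball[of "(0, c)" \<rho>]]) (rule \<eta>c)
  have D\<eta>0: "D\<eta> z = 0" if "z \<notin> cball (0, c) \<rho>" for z
    unfolding D\<eta>_def using iter_deriv_support[OF closed_cball \<eta>c that] by (simp del: iter_deriv.simps)
  have vanish: "S z = 0 \<and> DS z = 0" if z: "T + c + \<rho> \<le> snd z \<or> snd z \<le> a + c - \<rho> \<or> R0 + \<rho> < norm (fst z)" for z
  proof -
    have cases: "g y = 0 \<or> z - y \<notin> cball (0, c) \<rho>" for y
    proof (rule ccontr)
      assume "\<not> ?thesis"
      then have gy: "g y \<noteq> 0" and zy: "z - y \<in> cball (0, c) \<rho>" by auto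
      have ny: "norm (fst y) \<le> R0" using gy g(3)[of y] by (meson not_less)
      define v where "v = (0, c) - (z - y)"
      have v: "norm v \<le> \<rho>" using zy by (simp add: v_def dist_norm)
      have "norm (fst v) \<le> norm v" "norm (snd v) \<le> norm v"
        using norm_fst_le[of "fst v" "snd v"] norm_snd_le[of "snd v" "fst v"] by simp_all
      then have "norm (fst v) \<le> \<rho>" "\<bar>snd v\<bar> \<le> \<rho>" using v by simp_all
      moreover have "fst v = - (fst z - fst y)" "snd v = c - (snd z - snd y)" by (simp_all add: v_def)
      ultimately have n: "norm (fst z - fst y) \<le> \<rho>" "\<bar>c - (snd z - snd y)\<bar> \<le> \<rho>"
        by (simp_all only: norm_minus_cancel)
      have "norm (fst z) \<le> norm (fst z - fst y) + norm (fst y)"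
        using norm_triangle_ineq[of "fst z - fst y" "fst y"] by simp
      moreover have "a < snd y" "snd y < T" using g(2)[OF gy] by auto
      ultimately show False using z n ny by linarith
    qed
    have zero: "g y *\<^sub>R \<eta> (z - y) = 0 \<and> g y *\<^sub>R D\<eta> (z - y) = 0" for y
    proof (cases "g y = 0")
      case False
      then have nz: "z - y \<notin> cball (0, c) \<rho>" using cases[of y] by (simp only: simp_thms)
      show ?thesis using \<eta>c[OF nz] D\<eta>0[OF nz] by (simp only: scaleR_zero_right simp_thms)
    qed (simp only: scaleR_zero_left simp_thms)
    have "(\<lambda>y. g y *\<^sub>R \<eta> (z - y)) = (\<lambda>_. 0)" "(\<lambda>y. g y *\<^sub>R D\<eta> (z - y)) = (\<lambda>_. 0)"
      by (rule ext, rule conjunct1[OF zero], rule ext, rule conjunct2[OF zero])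
    then show ?thesis unfolding S_def DS_def convol_def by simp
  qed
  define K where "K = cball (0::'a) (R0 + \<rho>) \<times> {a + c - \<rho>..T + c + \<rho>}"
  have cK: "compact K" unfolding K_def by (intro compact_Times) auto
  have K0: "S z = 0" "DS z = 0" if "z \<notin> K" for z
    using that vanish[of z] by (cases z; force simp: K_def not_le)+
  have tf: "test_function UNIV S"
    unfolding test_function_def using smooth cK K0(1) by blast
  obtain D' K' where K': "compact K'" "\<And>x. GDERIV S x :> D' x" "continuous_on UNIV D'"
    "\<And>x. x \<notin> K' \<Longrightarrow> S x = 0" "\<And>x. x \<notin> K' \<Longrightarrow> D' x = 0"
    and E: "\<And>i. i \<in> Basis \<Longrightarrow> \<exists>E. (\<forall>x. GDERIV (\<lambda>x. D' x \<bullet> i) x :> E x) \<and> continuous_on UNIV E"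
    by (rule test_function_gradient[OF tf]) blast
  have D'DS: "D' = DS"
  proof
    fix z
    have "(\<lambda>h. h \<bullet> D' z) = (\<lambda>h. h \<bullet> DS z)"
      using has_derivative_unique[OF K'(2)[of z, unfolded gderiv_def] G[of z, unfolded gderiv_def]] .
    then have "(D' z - DS z) \<bullet> (D' z - DS z) = 0"
      using fun_cong[of _ _ "D' z - DS z"] by (fastforce simp: inner_diff_right)
    then show "D' z = DS z" by simp
  qed
  have contS: "continuous_on UNIV S" using smooth_imp_continuous[OF smooth, of "[]"] by simp
  obtain s1 where s1: "0 < s1" "\<And>z. norm (S z) \<le> s1"
    by (rule compact_support_bounded[OF contS cK]) (auto simp: K0)
  obtain s2 where s2: "0 < s2" "\<And>z. norm (DS z) \<le> s2"
    by (rule compact_support_bounded[OF K'(3)[unfolded D'DS] cK]) (auto simp: K0)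
  have "\<exists>C. \<forall>z z'. \<bar>DS z \<bullet> i - DS z' \<bullet> i\<bar> \<le> C * norm (z - z')" if i: "i \<in> Basis" for i
  proof -
    obtain E where E: "\<And>x. GDERIV (\<lambda>x. DS x \<bullet> i) x :> E x" "continuous_on UNIV E"
      using E[OF i] unfolding D'DS by blast
    have E0: "E x = 0" if "x \<notin> K" for x
    proof -
      have "GDERIV (\<lambda>x. DS x \<bullet> i) x :> 0"
        unfolding gderiv_def
        by (rule has_derivative_transform_within_open[where s = "- K" and f = "\<lambda>_. 0"])
          (use that cK compact_imp_closed K0 in auto)
      from has_derivative_unique[OF E(1)[of x, unfolded gderiv_def] this[unfolded gderiv_def]]
      have "E x \<bullet> E x = 0" using fun_cong[of _ _ "E x"] by fastforce
      then show ?thesis by simp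
    qed
    obtain C where C: "0 < C" "\<And>x. norm (E x) \<le> C"
      by (rule compact_support_bounded[OF E(2) cK]) (auto simp: E0)
    have "\<bar>DS z \<bullet> i - DS z' \<bullet> i\<bar> \<le> C * norm (z - z')" for z z'
      by (rule GDERIV_Lipschitz[OF convex_UNIV, where D = E]) (use E(1) C(2) in auto)
    then show ?thesis by blast
  qed
  then obtain C where C: "\<And>i z z'. i \<in> Basis \<Longrightarrow> \<bar>DS z \<bullet> i - DS z' \<bullet> i\<bar> \<le> C i * norm (z - z')"
    using bchoice[of Basis "\<lambda>i C. \<forall>z z'. \<bar>DS z \<bullet> i - DS z' \<bullet> i\<bar> \<le> C * norm (z - z')"] by blast
  define s3 where "s3 = (\<Sum>i\<in>Basis. C i)"
  have lip: "norm (DS z - DS z') \<le> s3 * norm (z - z')" for z z'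
  proof -
    have "norm (DS z - DS z') \<le> (\<Sum>i\<in>Basis. \<bar>(DS z - DS z') \<bullet> i\<bar>)" by (rule norm_le_l1)
    also have "\<dots> \<le> (\<Sum>i\<in>Basis. C i * norm (z - z'))" using C by (intro sum_mono) (simp add: inner_diff_left)
    finally show ?thesis by (simp add: s3_def sum_distrib_right)
  qed
  define s where "s = s1 + s2 + \<bar>s3\<bar>"
  show thesis
  proof (rule that[of s, folded D\<eta>_def, folded S_def DS_def])
    show "GDERIV S z :> DS z" for z by (rule G)
    show "\<bar>S z\<bar> \<le> s" for z using s1(2)[of z] s2(1) by (simp add: s_def)
    show "norm (DS z) \<le> s" for z using s2(2)[of z] s1(1) by (simp add: s_def)
    show "norm (DS z - DS z') \<le> s * norm (z - z')" for z z'
    proof -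
      have "s3 * norm (z - z') \<le> s * norm (z - z')" using s1(1) s2(1) by (intro mult_right_mono) (auto simp: s_def)
      with lip[of z z'] show ?thesis by linarith
    qed
  qed (use vanish in blast)
qed

section \<open>Quantitative regularity from bounded derivatives\<close>

lemma smooth_bounded_component:
  fixes g :: "'e::euclidean_space \<Rightarrow> 'b::euclidean_space"
  assumes g: "smooth_bounded_on X g" and vs: "vs \<in> lists Basis"
  obtains C where "0 \<le> C" "\<And>z i. z \<in> X \<Longrightarrow> i \<in> Basis \<Longrightarrow> GDERIV (\<lambda>z. iter_deriv vs g z \<bullet> i) z :>
      (\<Sum>v\<in>Basis. (iter_deriv (v # vs) g z \<bullet> i) *\<^sub>R v)"
    "\<And>z i. z \<in> X \<Longrightarrow> i \<in> Basis \<Longrightarrow> norm (\<Sum>v\<in>Basis. (iter_deriv (v # vs) g z \<bullet> i) *\<^sub>R v) \<le> C"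
    "\<And>z. z \<in> X \<Longrightarrow> norm (iter_deriv vs g z) \<le> C"
proof -
  have "\<exists>C. \<forall>z\<in>X. norm (iter_deriv vs g z) \<le> C" if "vs \<in> lists Basis" for vs
    using g that unfolding smooth_bounded_on_def bounded_iff by blast
  then obtain C0 where C0: "\<And>z. z \<in> X \<Longrightarrow> norm (iter_deriv vs g z) \<le> C0" using vs by blast
  have "\<exists>C. \<forall>z\<in>X. norm (iter_deriv (v # vs) g z) \<le> C" if "v \<in> Basis" for v
    using g vs that unfolding smooth_bounded_on_def bounded_iff by (metis Cons_in_lists_iff image_eqI)
  then obtain C1 where C1: "\<And>v z. v \<in> Basis \<Longrightarrow> z \<in> X \<Longrightarrow> norm (iter_deriv (v # vs) g z) \<le> C1 v"
    using bchoice[of Basis "\<lambda>v C. \<forall>z\<in>X. norm (iter_deriv (v # vs) g z) \<le> C"] by blast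
  define C where "C = \<bar>C0\<bar> + (\<Sum>v\<in>Basis. \<bar>C1 v\<bar>)"
  show thesis
  proof (rule that[of C])
    show "0 \<le> C" by (auto simp: C_def intro: add_nonneg_nonneg sum_nonneg)
    show "norm (iter_deriv vs g z) \<le> C" if "z \<in> X" for z
    proof -
      have "0 \<le> (\<Sum>v\<in>Basis. \<bar>C1 v\<bar>)" by (intro sum_nonneg) auto
      then show ?thesis using C0[OF that] unfolding C_def by linarith
    qed
    fix z and i :: 'b assume z: "z \<in> X" and i: "i \<in> Basis"
    define L where "L = frechet_derivative (iter_deriv vs g) (at z)"
    have d: "(iter_deriv vs g has_derivative L) (at z)"
      unfolding L_def
      by (rule frechet_derivative_works[THEN iffD1], rule g[unfolded smooth_bounded_on_def smooth_on_def, THEN conjunct1, rule_format])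
        (fact vs z)+
    then have L: "linear L" by (rule has_derivative_linear)
    have "L h \<bullet> i = h \<bullet> (\<Sum>v\<in>Basis. (L v \<bullet> i) *\<^sub>R v)" for h
    proof -
      have "L h = L (\<Sum>v\<in>Basis. (h \<bullet> v) *\<^sub>R v)"
        using euclidean_representation[of h] by (rule arg_cong[OF sym])
      also have "\<dots> = (\<Sum>v\<in>Basis. (h \<bullet> v) *\<^sub>R L v)"
        unfolding linear_sum[OF L] linear_cmul[OF L] ..
      finally have "L h \<bullet> i = (\<Sum>v\<in>Basis. (h \<bullet> v) * (L v \<bullet> i))" by (simp add: inner_sum_left)
      also have "\<dots> = h \<bullet> (\<Sum>v\<in>Basis. (L v \<bullet> i) *\<^sub>R v)"
        unfolding inner_sum_right by (rule sum.cong) auto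
      finally show ?thesis .
    qed
    then have eq: "(\<lambda>h. L h \<bullet> i) = (\<lambda>h. h \<bullet> (\<Sum>v\<in>Basis. (L v \<bullet> i) *\<^sub>R v))" by (rule ext)
    have "((\<lambda>z. iter_deriv vs g z \<bullet> i) has_derivative (\<lambda>h. L h \<bullet> i)) (at z)"
      by (rule has_derivative_inner_left[OF d])
    from this[unfolded eq]
    show "GDERIV (\<lambda>z. iter_deriv vs g z \<bullet> i) z :> (\<Sum>v\<in>Basis. (iter_deriv (v # vs) g z \<bullet> i) *\<^sub>R v)"
      unfolding gderiv_def iter_deriv.simps(2) L_def .
    have "norm (\<Sum>v\<in>Basis. (iter_deriv (v # vs) g z \<bullet> i) *\<^sub>R v) \<le> (\<Sum>v\<in>Basis. \<bar>C1 v\<bar>)"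
    proof (rule sum_norm_le)
      fix v :: 'e assume v: "v \<in> Basis"
      have "norm ((iter_deriv (v # vs) g z \<bullet> i) *\<^sub>R v) = \<bar>iter_deriv (v # vs) g z \<bullet> i\<bar>" using v by simp
      also have "\<dots> \<le> norm (iter_deriv (v # vs) g z)" by (rule Basis_le_norm[OF i])
      also have "\<dots> \<le> C1 v" by (rule C1[OF v z])
      finally show "norm ((iter_deriv (v # vs) g z \<bullet> i) *\<^sub>R v) \<le> \<bar>C1 v\<bar>" by simp
    qed
    then show "norm (\<Sum>v\<in>Basis. (iter_deriv (v # vs) g z \<bullet> i) *\<^sub>R v) \<le> C" by (simp add: C_def)
  qed
qed

text \<open>Convexity of \<open>X\<close> turns bounds on second derivatives into a Lipschitz bound
  for the gradient, by the mean value inequality.\<close>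

lemma smooth_bounded_regularity:
  fixes g :: "'e::euclidean_space \<Rightarrow> 'b::euclidean_space"
  assumes g: "smooth_bounded_on X g" and X: "convex X"
  obtains C D where "0 \<le> C" "\<And>z i. z \<in> X \<Longrightarrow> i \<in> Basis \<Longrightarrow> GDERIV (\<lambda>z. g z \<bullet> i) z :> D i z"
    "\<And>z. z \<in> X \<Longrightarrow> norm (g z) \<le> C" "\<And>z i. z \<in> X \<Longrightarrow> i \<in> Basis \<Longrightarrow> norm (D i z) \<le> C"
    "\<And>z z' i. z \<in> X \<Longrightarrow> z' \<in> X \<Longrightarrow> i \<in> Basis \<Longrightarrow> norm (D i z - D i z') \<le> C * norm (z - z')"
proof -
  define D where "D i z = (\<Sum>v\<in>Basis. (iter_deriv [v] g z \<bullet> i) *\<^sub>R v)" for i z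
  obtain C0 where C0: "0 \<le> C0" "\<And>z i. z \<in> X \<Longrightarrow> i \<in> Basis \<Longrightarrow> GDERIV (\<lambda>z. g z \<bullet> i) z :> D i z"
    "\<And>z i. z \<in> X \<Longrightarrow> i \<in> Basis \<Longrightarrow> norm (D i z) \<le> C0" "\<And>z. z \<in> X \<Longrightarrow> norm (g z) \<le> C0"
    unfolding D_def by (rule smooth_bounded_component[OF g, of "[]", unfolded iter_deriv.simps(1)]) auto
  have "\<exists>C. 0 \<le> C \<and> (\<forall>z\<in>X. \<forall>z'\<in>X. \<forall>i\<in>Basis. \<bar>iter_deriv [v] g z \<bullet> i - iter_deriv [v] g z' \<bullet> i\<bar> \<le> C * norm (z - z'))"
    if v: "v \<in> Basis" for v
  proof -
    have vs: "[v] \<in> lists Basis" using v by simp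
    obtain C where C: "0 \<le> C" "\<And>z i. z \<in> X \<Longrightarrow> i \<in> Basis \<Longrightarrow> GDERIV (\<lambda>z. iter_deriv [v] g z \<bullet> i) z :>
        (\<Sum>u\<in>Basis. (iter_deriv (u # [v]) g z \<bullet> i) *\<^sub>R u)"
      "\<And>z i. z \<in> X \<Longrightarrow> i \<in> Basis \<Longrightarrow> norm (\<Sum>u\<in>Basis. (iter_deriv (u # [v]) g z \<bullet> i) *\<^sub>R u) \<le> C"
      by (rule smooth_bounded_component[OF g vs]) blast
    have "\<bar>iter_deriv [v] g z \<bullet> i - iter_deriv [v] g z' \<bullet> i\<bar> \<le> C * norm (z - z')"
      if "z \<in> X" "z' \<in> X" "i \<in> Basis" for z z' i
      by (rule GDERIV_Lipschitz[OF X C(2) C(3)]) (use that in auto)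
    with C(1) show ?thesis by blast
  qed
  then obtain C1 where C1: "\<And>v. v \<in> Basis \<Longrightarrow> 0 \<le> C1 v"
    "\<And>v z z' i. v \<in> Basis \<Longrightarrow> z \<in> X \<Longrightarrow> z' \<in> X \<Longrightarrow> i \<in> Basis \<Longrightarrow>
      \<bar>iter_deriv [v] g z \<bullet> i - iter_deriv [v] g z' \<bullet> i\<bar> \<le> C1 v * norm (z - z')"
    using bchoice[of Basis "\<lambda>v C. 0 \<le> C \<and> (\<forall>z\<in>X. \<forall>z'\<in>X. \<forall>i\<in>Basis. \<bar>iter_deriv [v] g z \<bullet> i - iter_deriv [v] g z' \<bullet> i\<bar> \<le> C * norm (z - z'))"]
    by blast
  define C where "C = C0 + (\<Sum>v\<in>Basis. C1 v)"
  have sum: "0 \<le> (\<Sum>v\<in>Basis. C1 v)" using C1(1) by (rule sum_nonneg)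
  have lip: "norm (D i z - D i z') \<le> C * norm (z - z')" if z: "z \<in> X" "z' \<in> X" and i: "i \<in> Basis" for z z' i
  proof -
    have "D i z - D i z' = (\<Sum>v\<in>Basis. (iter_deriv [v] g z \<bullet> i - iter_deriv [v] g z' \<bullet> i) *\<^sub>R v)"
      unfolding D_def sum_subtractf[symmetric] scaleR_diff_left ..
    also have "norm \<dots> \<le> (\<Sum>v\<in>Basis. C1 v * norm (z - z'))"
    proof (rule sum_norm_le)
      fix v :: 'e assume v: "v \<in> Basis"
      then have "norm ((iter_deriv [v] g z \<bullet> i - iter_deriv [v] g z' \<bullet> i) *\<^sub>R v) = \<bar>iter_deriv [v] g z \<bullet> i - iter_deriv [v] g z' \<bullet> i\<bar>"
        by (simp del: iter_deriv.simps)
      also have "\<dots> \<le> C1 v * norm (z - z')" by (rule C1(2)[OF v z i])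
      finally show "norm ((iter_deriv [v] g z \<bullet> i - iter_deriv [v] g z' \<bullet> i) *\<^sub>R v) \<le> C1 v * norm (z - z')" .
    qed
    also have "\<dots> = (\<Sum>v\<in>Basis. C1 v) * norm (z - z')" by (simp add: sum_distrib_right)
    also have "\<dots> \<le> C * norm (z - z')" using C0(1) by (intro mult_right_mono) (auto simp: C_def)
    finally show ?thesis .
  qed
  show thesis
  proof (rule that[of C D])
    show "0 \<le> C" using C0(1) sum by (simp add: C_def)
    show "norm (g z) \<le> C" if "z \<in> X" for z using C0(4)[OF that] sum by (simp add: C_def)
    show "norm (D i z) \<le> C" if "z \<in> X" "i \<in> Basis" for z i using C0(3)[OF that] sum by (simp add: C_def)
  qed (use C0(2) lip in auto)
qed

section \<open>Uniqueness\<close>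

lemma L2_Young:
  fixes u v :: "'a::euclidean_space \<Rightarrow> real"
  assumes [measurable]: "u \<in> borel_measurable borel" "v \<in> borel_measurable borel"
    and u: "integrable lborel (\<lambda>z. (u z)\<^sup>2)" and v: "integrable lborel (\<lambda>z. (v z)\<^sup>2)"
  shows "integrable lborel (\<lambda>z. u z * v z)"
    and "0 < \<mu> \<Longrightarrow> \<bar>LINT z|lborel. u z * v z\<bar> \<le> (\<mu> * (LINT z|lborel. (u z)\<^sup>2) + (LINT z|lborel. (v z)\<^sup>2) / \<mu>) / 2"
proof -
  have pt: "\<bar>u z * v z\<bar> \<le> \<mu> / 2 * (u z)\<^sup>2 + 1 / (2 * \<mu>) * (v z)\<^sup>2" if "0 < \<mu>" for z and \<mu> :: real
  proof -
    have "0 \<le> (\<mu> * \<bar>u z\<bar> - \<bar>v z\<bar>)\<^sup>2 / (2 * \<mu>)" using that by simp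
    also have "\<dots> = \<mu> / 2 * (u z)\<^sup>2 + 1 / (2 * \<mu>) * (v z)\<^sup>2 - \<bar>u z * v z\<bar>"
      using that by (simp add: power2_diff power_mult_distrib abs_mult field_simps power2_eq_square)
    finally show ?thesis by simp
  qed
  show i: "integrable lborel (\<lambda>z. u z * v z)"
  proof (rule Bochner_Integration.integrable_bound)
    show "integrable lborel (\<lambda>z. 1 / 2 * (u z)\<^sup>2 + 1 / 2 * (v z)\<^sup>2)" using u v by auto
    show "AE z in lborel. norm (u z * v z) \<le> norm (1 / 2 * (u z)\<^sup>2 + 1 / 2 * (v z)\<^sup>2)"
    proof (rule AE_I2)
      fix z
      have "norm (u z * v z) \<le> 1 / 2 * (u z)\<^sup>2 + 1 / 2 * (v z)\<^sup>2" using pt[of 1 z] by simp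
      then show "norm (u z * v z) \<le> norm (1 / 2 * (u z)\<^sup>2 + 1 / 2 * (v z)\<^sup>2)" by (rule order_trans) simp
    qed
  qed measurable
  assume \<mu>: "0 < \<mu>"
  have "\<bar>LINT z|lborel. u z * v z\<bar> \<le> (LINT z|lborel. \<bar>u z * v z\<bar>)" by (rule integral_abs_bound)
  also have "\<dots> \<le> (LINT z|lborel. \<mu> / 2 * (u z)\<^sup>2 + 1 / (2 * \<mu>) * (v z)\<^sup>2)"
    by (rule integral_mono) (use i u v pt[OF \<mu>] in auto)
  also have "\<dots> = \<mu> / 2 * (LINT z|lborel. (u z)\<^sup>2) + 1 / (2 * \<mu>) * (LINT z|lborel. (v z)\<^sup>2)"
    using u v by simp
  finally show "\<bar>LINT z|lborel. u z * v z\<bar> \<le> (\<mu> * (LINT z|lborel. (u z)\<^sup>2) + (LINT z|lborel. (v z)\<^sup>2) / \<mu>) / 2"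
    using \<mu> by (simp add: field_simps)
qed

text \<open>One kernel has to serve \<open>g\<close> and all components of its gradient at the same
  time.\<close>

lemma L2_mollify_finite:
  fixes U :: "('a::euclidean_space \<Rightarrow> real) set"
  assumes "finite U" and "\<And>u. u \<in> U \<Longrightarrow> u \<in> borel_measurable borel \<and> integrable lborel (\<lambda>x. (u x)\<^sup>2)" and e: "e > 0"
  shows "\<exists>d>0. \<forall>\<eta>. (\<forall>x. 0 \<le> \<eta> x) \<longrightarrow> (\<forall>x. x \<notin> ball 0 d \<longrightarrow> \<eta> x = 0) \<longrightarrow> integrable lborel \<eta> \<longrightarrow>
      (LINT x|lborel. \<eta> x) = 1 \<longrightarrow>
      (\<forall>u\<in>U. integrable lborel (\<lambda>x. (convol u \<eta> x - u x)\<^sup>2) \<and> (LINT x|lborel. (convol u \<eta> x - u x)\<^sup>2) \<le> e)"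
  using assms(1,2)
proof (induction U rule: finite_induct)
  case empty
  show ?case by (intro exI[of _ 1]) simp
next
  case (insert u U)
  then obtain d1 where d1: "d1 > 0" "\<forall>\<eta>. (\<forall>x. 0 \<le> \<eta> x) \<longrightarrow> (\<forall>x. x \<notin> ball 0 d1 \<longrightarrow> \<eta> x = 0) \<longrightarrow> integrable lborel \<eta> \<longrightarrow>
      (LINT x|lborel. \<eta> x) = 1 \<longrightarrow>
      (\<forall>u\<in>U. integrable lborel (\<lambda>x. (convol u \<eta> x - u x)\<^sup>2) \<and> (LINT x|lborel. (convol u \<eta> x - u x)\<^sup>2) \<le> e)"
    by (auto simp del: mem_ball)
  have u: "u \<in> borel_measurable borel" "integrable lborel (\<lambda>x. (u x)\<^sup>2)" using insert.prems by auto
  obtain d2 where d2: "d2 > 0"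
    "\<And>\<eta>. (\<And>x. 0 \<le> \<eta> x) \<Longrightarrow> (\<And>x. x \<notin> ball 0 d2 \<Longrightarrow> \<eta> x = 0) \<Longrightarrow> integrable lborel \<eta> \<Longrightarrow>
      (LINT x|lborel. \<eta> x) = 1 \<Longrightarrow>
      integrable lborel (\<lambda>x. (convol u \<eta> x - u x)\<^sup>2) \<and> (LINT x|lborel. (convol u \<eta> x - u x)\<^sup>2) \<le> e"
    by (rule L2_mollify[OF u e]) blast
  show ?case
  proof (intro exI[of _ "min d1 d2"] conjI allI impI ballI)
    fix \<eta> :: "'a \<Rightarrow> real" and u'
    assume \<eta>: "\<forall>x. 0 \<le> \<eta> x" "\<forall>x. x \<notin> ball 0 (min d1 d2) \<longrightarrow> \<eta> x = 0" "integrable lborel \<eta>" "(LINT x|lborel. \<eta> x) = 1"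
      and u': "u' \<in> insert u U"
    have 1: "\<forall>x. x \<notin> ball 0 d1 \<longrightarrow> \<eta> x = 0" using \<eta>(2) by (simp add: mem_ball)
    have 2: "\<eta> x = 0" if "x \<notin> ball 0 d2" for x using \<eta>(2) that by (simp add: mem_ball)
    have "integrable lborel (\<lambda>x. (convol u' \<eta> x - u' x)\<^sup>2) \<and> (LINT x|lborel. (convol u' \<eta> x - u' x)\<^sup>2) \<le> e"
    proof (cases "u' = u")
      case True
      show ?thesis unfolding True by (rule d2(2)) (use \<eta> 2 in blast)+
    next
      case False
      then have "u' \<in> U" using u' by blast
      from d1(2)[rule_format, OF \<eta>(1)[rule_format] 1[rule_format] \<eta>(3,4) this] show ?thesis by assumption
    qed
    then show "integrable lborel (\<lambda>x. (convol u' \<eta> x - u' x)\<^sup>2)" "(LINT x|lborel. (convol u' \<eta> x - u' x)\<^sup>2) \<le> e" by blast+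
  qed (use d1(1) d2(1) in auto)
qed

text \<open>The kernels are concentrated near times \<open>-2\<rho>\<close>, so that mollification of a function vanishing
  after time \<open>T\<close> produces one that vanishes shortly before \<open>T\<close> already.\<close>

lemma delayed_kernel:
  fixes U :: "('a::euclidean_space \<times> real \<Rightarrow> real) set"
  assumes "finite U" and "\<And>u. u \<in> U \<Longrightarrow> u \<in> borel_measurable borel \<and> integrable lborel (\<lambda>x. (u x)\<^sup>2)" and e: "e > 0"
  obtains \<rho> \<eta> where "0 < \<rho>" "\<rho> \<le> 1" "smooth_on UNIV \<eta>" "\<forall>z. z \<notin> ball (0, -2 * \<rho>) \<rho> \<longrightarrow> \<eta> z = 0"
    "\<forall>u\<in>U. integrable lborel (\<lambda>x. (convol u \<eta> x - u x)\<^sup>2) \<and> (LINT x|lborel. (convol u \<eta> x - u x)\<^sup>2) \<le> e"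
proof -
  obtain d where d: "d > 0" and D: "\<forall>\<eta>. (\<forall>x. 0 \<le> \<eta> x) \<longrightarrow> (\<forall>x. x \<notin> ball 0 d \<longrightarrow> \<eta> x = 0) \<longrightarrow> integrable lborel \<eta> \<longrightarrow>
      (LINT x|lborel. \<eta> x) = 1 \<longrightarrow>
      (\<forall>u\<in>U. integrable lborel (\<lambda>x. (convol u \<eta> x - u x)\<^sup>2) \<and> (LINT x|lborel. (convol u \<eta> x - u x)\<^sup>2) \<le> e)"
    using L2_mollify_finite[OF assms] by blast
  \<comment> \<open>A ball of radius \<rho> around a point at distance \<open>2 * \<rho>\<close>
    lies within \<open>3 * \<rho>\<close> of the origin. The bound 1 keeps mollified sources within
    the fixed radius \<open>R0 + 1\<close>.\<close>
  define \<rho> where "\<rho> = min 1 (d / 3)"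
  have \<rho>: "0 < \<rho>" "\<rho> \<le> 1" "3 * \<rho> \<le> d" using d by (auto simp: \<rho>_def)
  obtain \<eta> :: "'a \<times> real \<Rightarrow> real" where \<eta>: "smooth_on UNIV \<eta>" "\<And>x. 0 \<le> \<eta> x"
    "\<And>x. x \<notin> ball (0, -2 * \<rho>) \<rho> \<Longrightarrow> \<eta> x = 0" "integrable lborel \<eta>" "(LINT x|lborel. \<eta> x) = 1"
    by (rule smooth_mollifier[OF \<rho>(1)]) blast
  have 0: "\<eta> x = 0" if "x \<notin> ball 0 d" for x
  proof (rule \<eta>(3), rule notI)
    assume "x \<in> ball (0, -2 * \<rho>) \<rho>"
    then have "norm ((0, -2 * \<rho>) - x) < \<rho>" by (simp add: dist_norm)
    moreover have "norm x \<le> norm ((0, -2 * \<rho>) - x) + norm (0::'a, -2 * \<rho>)"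
      using norm_triangle_ineq4[of "(0, -2 * \<rho>)" "(0, -2 * \<rho>) - x"] by simp
    moreover have "norm (0::'a, -2 * \<rho>) = 2 * \<rho>" using \<rho>(1) by (simp add: norm_Pair real_sqrt_mult)
    ultimately have "norm x < d" using \<rho>(3) by linarith
    then show False using that by simp
  qed
  have "\<forall>u\<in>U. integrable lborel (\<lambda>x. (convol u \<eta> x - u x)\<^sup>2) \<and> (LINT x|lborel. (convol u \<eta> x - u x)\<^sup>2) \<le> e"
    by (rule D[THEN spec, THEN mp, THEN mp, THEN mp, THEN mp]) (use \<eta> 0 in auto)
  with \<eta>(3) show thesis by (intro that[OF \<rho>(1,2) \<eta>(1)]) blast+
qed

lemma AE_zero_of_square_integral:
  fixes u :: "'a::euclidean_space \<Rightarrow> real"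
  assumes u: "integrable lborel (\<lambda>z. (u z)\<^sup>2)" and le: "\<And>\<mu>. 0 < \<mu> \<Longrightarrow> (LINT z|lborel. (u z)\<^sup>2) \<le> \<mu> * K"
  shows "AE z in lborel. u z = 0"
proof -
  have "(LINT z|lborel. (u z)\<^sup>2) \<le> 0"
  proof (rule field_le_epsilon)
    fix e :: real assume "0 < e"
    have "\<bar>K\<bar> + 1 > 0" by simp
    then have "0 < e / (\<bar>K\<bar> + 1)" using \<open>0 < e\<close> by simp
    from le[OF this] have "(LINT z|lborel. (u z)\<^sup>2) \<le> e / (\<bar>K\<bar> + 1) * K" .
    also have "\<dots> \<le> e / (\<bar>K\<bar> + 1) * (\<bar>K\<bar> + 1)" using \<open>0 < e\<close> by (intro mult_left_mono) auto
    also have "\<dots> = e" using \<open>\<bar>K\<bar> + 1 > 0\<close> by simp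
    finally show "(LINT z|lborel. (u z)\<^sup>2) \<le> 0 + e" by simp
  qed
  moreover have "0 \<le> (LINT z|lborel. (u z)\<^sup>2)" by (rule integral_nonneg_AE) simp
  ultimately have "(LINT z|lborel. (u z)\<^sup>2) = 0" by (rule antisym)
  then have "AE z in lborel. (u z)\<^sup>2 = 0"
    using integral_nonneg_eq_0_iff_AE[OF u] by simp
  then show ?thesis by eventually_elim simp
qed

lemma exp_cyl_integrable:
  fixes F :: "'a::euclidean_space \<times> real \<Rightarrow> real"
  assumes F: "integrable lborel F" "\<And>z. z \<notin> cyl T \<Longrightarrow> F z = 0"
  shows "integrable lborel (\<lambda>z. exp (c * snd z) * F z)"
proof (rule Bochner_Integration.integrable_bound)
  have e: "(\<lambda>z::'a \<times> real. exp (c * snd z)) \<in> borel_measurable lborel"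
    by (simp, intro borel_measurable_continuous_onI continuous_intros)
  show "integrable lborel (\<lambda>z. exp (\<bar>c\<bar> * \<bar>T\<bar>) * F z)" using F(1) by simp
  show "AE z in lborel. norm (exp (c * snd z) * F z) \<le> norm (exp (\<bar>c\<bar> * \<bar>T\<bar>) * F z)"
  proof (rule AE_I2)
    fix z
    show "norm (exp (c * snd z) * F z) \<le> norm (exp (\<bar>c\<bar> * \<bar>T\<bar>) * F z)"
    proof (cases "z \<in> cyl T")
      case True
      then have "c * snd z \<le> \<bar>c\<bar> * \<bar>T\<bar>"
        by (intro order_trans[OF abs_ge_self[of "c * snd z"]]) (auto simp: abs_mult cyl_iff intro!: mult_mono)
      then show ?thesis by (auto simp: abs_mult intro!: mult_right_mono)
    qed (simp add: F(2))
  qed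
  show "(\<lambda>z. exp (c * snd z) * F z) \<in> borel_measurable lborel"
    using e borel_measurable_integrable[OF F(1)] by (rule borel_measurable_times)
qed

section \<open>Vanishing of the difference of two solutions\<close>

locale hs_difference = hs_data T B b f Db Df m Dm \<delta> Mm
  for T B :: real and b :: "'a::euclidean_space \<times> real \<Rightarrow> 'a" and f :: "'a \<times> real \<Rightarrow> real"
    and Db :: "'a \<Rightarrow> 'a \<times> real \<Rightarrow> 'a \<times> real" and Df :: "'a \<times> real \<Rightarrow> 'a \<times> real"
    and m :: "'a \<times> real \<Rightarrow> real" and Dm :: "'a \<times> real \<Rightarrow> 'a \<times> real" and \<delta> Mm :: real +
  fixes w q :: "'a \<times> real \<Rightarrow> real" and G :: "'a \<times> real \<Rightarrow> 'a" and M R0 :: real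
  assumes diff: "difference w q G M R0"
begin

lemma meas: "w \<in> borel_measurable borel" "q \<in> borel_measurable borel" "G \<in> borel_measurable borel"
  using diff unfolding difference_def by auto

lemma off_cyl: "z \<notin> cyl T \<Longrightarrow> w z = 0 \<and> q z = 0 \<and> G z = 0"
  using diff unfolding difference_def by metis

lemma far: "R0 < norm (fst z) \<Longrightarrow> w z = 0 \<and> q z = 0"
  using diff unfolding difference_def by metis

lemma bounds: "0 \<le> M" "0 \<le> R0" "\<bar>w z\<bar> \<le> M"
  using diff unfolding difference_def by metis+

lemma square_integrable: "integrable lborel (\<lambda>z. (q z)\<^sup>2)" "integrable lborel (\<lambda>z. (norm (G z))\<^sup>2)"
  using diff unfolding difference_def by blast+

lemma monotone_pressure: "AE z in lborel. 0 \<le> w z * q z"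
  using diff unfolding difference_def by blast

lemma C1_test_equation:
  assumes "\<And>z. GDERIV \<phi> z :> D z" "continuous_on UNIV D" "compact K" "K \<subseteq> UNIV \<times> {..<T}" "\<And>z. z \<notin> K \<Longrightarrow> \<phi> z = 0"
  shows "integrable lborel (\<lambda>z. w z * (snd (D z) - bX z \<bullet> fst (D z) + fX z * \<phi> z))"
    "integrable lborel (\<lambda>z. mX z * (G z \<bullet> fst (D z)))"
    "(LINT z|lborel. w z * (snd (D z) - bX z \<bullet> fst (D z) + fX z * \<phi> z)) = (LINT z|lborel. mX z * (G z \<bullet> fst (D z)))"
  using diff[unfolded difference_def, THEN conjunct2, THEN conjunct2, THEN conjunct2, THEN conjunct2, THEN conjunct2,
    THEN conjunct2, THEN conjunct2, THEN conjunct2, THEN conjunct2, THEN conjunct2, THEN conjunct2, THEN conjunct1,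
    rule_format, OF assms] by auto

lemma weak_gradient:
  assumes "\<And>z. GDERIV \<psi> z :> D z" "continuous_on UNIV D" "compact K" "\<And>z. z \<notin> K \<Longrightarrow> \<psi> z = 0 \<and> D z = 0" "i \<in> Basis"
  shows "(LINT z|lborel. q z * (fst (D z) \<bullet> i)) = - (LINT z|lborel. (G z \<bullet> i) * \<psi> z)"
  by (rule diff[unfolded difference_def, THEN conjunct2, THEN conjunct2, THEN conjunct2, THEN conjunct2, THEN conjunct2,
    THEN conjunct2, THEN conjunct2, THEN conjunct2, THEN conjunct2, THEN conjunct2, THEN conjunct2, THEN conjunct2,
    rule_format, OF assms]) assumption+

text \<open>Mollification with radius at most 1 enlarges the support radius from \<open>R0\<close>
  to \<open>R0 + 1\<close>, hence the rate for that radius. The damping depends on time only, so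
  \<Gamma> is the weak spatial gradient of \<open>g\<close>, and \<open>wt (R0 + 1) z\<close> undoes
  the damping up to the factor \<open>mX z\<close>.\<close>

definition l :: real where "l = lamc (R0 + 1)"
definition g :: "'a \<times> real \<Rightarrow> real" where "g z = exp (- l * snd z) * q z"
definition \<Gamma> :: "'a \<times> real \<Rightarrow> 'a" where "\<Gamma> z = exp (- l * snd z) *\<^sub>R G z"
definition space_time_grad :: "('a \<times> real \<Rightarrow> real) \<Rightarrow> 'a \<times> real \<Rightarrow> 'a \<times> real" where
  "space_time_grad \<eta> = (\<lambda>z. \<Sum>i\<in>Basis. iter_deriv [i] \<eta> z *\<^sub>R i)"

lemma exp_meas: "(\<lambda>z::'a \<times> real. exp (c * snd z)) \<in> borel_measurable borel"
  by (intro borel_measurable_continuous_onI continuous_intros)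

lemma g_meas: "g \<in> borel_measurable borel"
  unfolding g_def[abs_def] by (intro borel_measurable_times exp_meas meas)

lemma \<Gamma>_meas: "\<Gamma> \<in> borel_measurable borel"
  unfolding \<Gamma>_def[abs_def] by (intro borel_measurable_scaleR exp_meas meas)

lemma \<Gamma>_comp_meas: "(\<lambda>z. \<Gamma> z \<bullet> i) \<in> borel_measurable borel"
  by (intro borel_measurable_inner \<Gamma>_meas borel_measurable_const)

lemma g_off: "z \<notin> cyl T \<Longrightarrow> g z = 0" and \<Gamma>_off: "z \<notin> cyl T \<Longrightarrow> \<Gamma> z = 0"
  using off_cyl by (simp_all add: g_def \<Gamma>_def)

lemma g_far: "R0 < norm (fst z) \<Longrightarrow> g z = 0"
  using far by (simp add: g_def)

lemma g_square: "integrable lborel (\<lambda>z. (g z)\<^sup>2)"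
proof -
  have "(g z)\<^sup>2 = exp ((-2 * l) * snd z) * (q z)\<^sup>2" for z
    by (simp add: g_def power_mult_distrib exp_of_nat_mult[symmetric])
  moreover have "integrable lborel (\<lambda>z. exp ((-2 * l) * snd z) * (q z)\<^sup>2)"
    by (rule exp_cyl_integrable[OF square_integrable(1)]) (use off_cyl in auto)
  ultimately show ?thesis by simp
qed

lemma \<Gamma>_square: "integrable lborel (\<lambda>z. (norm (\<Gamma> z))\<^sup>2)"
proof -
  have "(norm (\<Gamma> z))\<^sup>2 = exp ((-2 * l) * snd z) * (norm (G z))\<^sup>2" for z
    by (simp add: \<Gamma>_def power_mult_distrib exp_of_nat_mult[symmetric])
  moreover have "integrable lborel (\<lambda>z. exp ((-2 * l) * snd z) * (norm (G z))\<^sup>2)"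
    by (rule exp_cyl_integrable[OF square_integrable(2)]) (use off_cyl in auto)
  ultimately show ?thesis by simp
qed

lemma \<Gamma>_comp_square:
  assumes "i \<in> Basis"
  shows "integrable lborel (\<lambda>z. (\<Gamma> z \<bullet> i)\<^sup>2)"
proof (rule integrable_nonneg_bound[OF \<Gamma>_square])
  show "(\<Gamma> z \<bullet> i)\<^sup>2 \<le> (norm (\<Gamma> z))\<^sup>2" for z
    using power_mono[OF Basis_le_norm[OF assms, of "\<Gamma> z"], of 2] by simp
qed (use \<Gamma>_comp_meas[of i] in measurable)

definition box :: "('a \<times> real) set" where "box = cball 0 R0 \<times> {0..T}"

lemma bounded_box: "bounded box"
  unfolding box_def by (intro bounded_Times) auto

lemma off_box: "z \<notin> box \<Longrightarrow> w z = 0 \<and> q z = 0 \<and> g z = 0"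
  using off_cyl[of z] far[of z] g_off[of z] g_far[of z] by (cases z) (force simp: box_def cyl_iff not_le)

lemma w_integrable: "integrable lborel w"
  by (rule bounded_support_integrable[OF meas(1) bounds(3) bounded_box]) (use off_box in blast)

lemma w_square: "integrable lborel (\<lambda>z. (w z)\<^sup>2)"
proof (rule bounded_support_integrable[OF _ _ bounded_box])
  show "\<bar>(w z)\<^sup>2\<bar> \<le> M\<^sup>2" for z using power_mono[OF bounds(3)[of z], of 2] by simp
qed (use off_box meas(1) in \<open>auto intro: borel_measurable_power\<close>)

lemma g_integrable: "integrable lborel g"
proof -
  define I :: "'a \<times> real \<Rightarrow> real" where "I = indicator box"
  have "box \<in> sets borel" unfolding box_def by (intro borel_closed closed_Times) auto
  then have I: "I \<in> borel_measurable borel" unfolding I_def by simp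
  have I2: "integrable lborel (\<lambda>z. (I z)\<^sup>2)"
  proof (rule bounded_support_integrable[OF _ _ bounded_box])
    show "\<bar>(I z)\<^sup>2\<bar> \<le> 1" for z by (simp add: I_def indicator_def)
    show "(I z)\<^sup>2 = 0" if "z \<notin> box" for z using that by (simp add: I_def)
  qed (use I in measurable)
  have "g z = g z * I z" for z using off_box[of z] by (cases "z \<in> box") (simp_all add: I_def)
  then have eq: "g = (\<lambda>z. g z * I z)" by (rule ext)
  show ?thesis by (rule ssubst[where P = "integrable lborel", OF eq L2_Young(1)[OF g_meas I g_square I2]])
qed

lemma wt_bounds: "0 \<le> wt R z" "wt (R0 + 1) z * (\<Gamma> z \<bullet> v) = mX z * (G z \<bullet> v)"
  "wt R z \<le> exp (\<bar>lamc R\<bar> * T) * Mm"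
proof -
  show "0 \<le> wt R z" using coeff_bounds(1) by (simp add: wt_def)
  have "exp (l * snd z) * exp (- l * snd z) = 1" by (simp add: exp_add[symmetric])
  then show "wt (R0 + 1) z * (\<Gamma> z \<bullet> v) = mX z * (G z \<bullet> v)"
    by (simp add: wt_def \<Gamma>_def l_def[symmetric])
  show "wt R z \<le> exp (\<bar>lamc R\<bar> * T) * Mm"
  proof (cases "z \<in> cyl T")
    case True
    then have "lamc R * snd z \<le> \<bar>lamc R\<bar> * T"
      by (intro order_trans[OF abs_ge_self[of "lamc R * snd z"]]) (auto simp: abs_mult cyl_iff intro!: mult_mono)
    then show ?thesis unfolding wt_def using coeff_bounds(1,2) by (intro mult_mono) auto
  qed (use Mm in \<open>simp add: wt_def mX_def\<close>)
qed

text \<open>The weak gradient identity of \<open>q\<close> is tested with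
  \<open>exp (- l * snd y) * \<eta> (z - y)\<close> as a function of \<open>y\<close>; a spatial
  derivative leaves the exponential alone.\<close>

lemma grad_convol:
  assumes \<eta>: "smooth_on UNIV \<eta>" "\<And>z. z \<notin> ball c \<rho> \<Longrightarrow> \<eta> z = 0" and i: "i \<in> Basis"
  shows "fst (convol g (space_time_grad \<eta>) z) \<bullet> i = convol (\<lambda>z. \<Gamma> z \<bullet> i) \<eta> z"
proof -
  define D where "D = space_time_grad \<eta>"
  have G\<eta>: "GDERIV \<eta> z :> D z" for z
    using smooth_GDERIV[OF \<eta>(1), where vs = "[]"] unfolding D_def space_time_grad_def iter_deriv.simps(1) by simp
  have cD: "continuous_on UNIV D"
    unfolding D_def space_time_grad_def
    by (intro continuous_on_sum continuous_on_scaleR continuous_on_const smooth_imp_continuous[OF \<eta>(1)]) simp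
  have D0: "D z = 0" if "z \<notin> cball c \<rho>" for z
  proof -
    have "iter_deriv [v] \<eta> z = 0" for v
      by (rule iter_deriv_support[OF closed_cball _ that]) (use \<eta>(2) in auto)
    then show ?thesis unfolding D_def space_time_grad_def by (simp del: iter_deriv.simps)
  qed
  obtain C where C: "0 < C" "\<And>z. norm (D z) \<le> C"
    by (rule compact_support_bounded[OF cD compact_cball[of c \<rho>]], rule D0, assumption, rule that, assumption+)
  define E where "E y = exp (- l * snd y)" for y :: "'a \<times> real"
  define \<psi> where "\<psi> y = E y * \<eta> (z - y)" for y
  define D\<psi> where "D\<psi> y = E y *\<^sub>R (- D (z - y)) + (\<eta> (z - y) * (- l * E y)) *\<^sub>R (0, 1)" for y
  define K where "K = cball (z - c) \<rho>"
  have K: "z - y \<notin> cball c \<rho>" if "y \<notin> K" for y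
    using that by (simp add: K_def dist_norm algebra_simps norm_minus_commute)
  have E': "GDERIV E y :> (- l * E y) *\<^sub>R (0, 1)" for y
    unfolding gderiv_def E_def by (auto intro!: derivative_eq_intros simp: inner_prod_def fun_eq_iff)
  have cE: "continuous_on UNIV E" unfolding E_def by (intro continuous_intros)
  have c\<eta>: "continuous_on UNIV \<eta>" using smooth_imp_continuous[OF \<eta>(1), of "[]"] by simp
  have \<psi>': "GDERIV \<psi> y :> D\<psi> y" for y
  proof -
    have d: "((\<lambda>y. \<eta> (z - y)) has_derivative (\<lambda>h. - h \<bullet> D (z - y))) (at y)"
    proof (rule has_derivative_compose[where f = "\<lambda>y. z - y" and f' = "\<lambda>h. - h" and g = \<eta>
          and g' = "\<lambda>h. h \<bullet> D (z - y)" and x = y and s = UNIV])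
      show "((\<lambda>y. z - y) has_derivative (\<lambda>h. - h)) (at y)" by (auto intro!: derivative_eq_intros)
      show "(\<eta> has_derivative (\<lambda>h. h \<bullet> D (z - y))) (at (z - y))" by (rule G\<eta>[unfolded gderiv_def])
    qed
    show ?thesis
      unfolding gderiv_def \<psi>_def
      by (rule has_derivative_eq_rhs[OF has_derivative_mult[OF E'[of y, unfolded gderiv_def] d]])
        (simp add: D\<psi>_def inner_add_right algebra_simps fun_eq_iff)
  qed
  have cD\<psi>: "continuous_on UNIV D\<psi>"
    unfolding D\<psi>_def
    by (intro continuous_intros cE continuous_on_compose2[OF cD] continuous_on_compose2[OF c\<eta>]) auto
  have 0: "\<psi> y = 0 \<and> D\<psi> y = 0" if "y \<notin> K" for y
  proof -
    have "\<eta> (z - y) = 0" using K[OF that] \<eta>(2)[of "z - y"] by auto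
    then show ?thesis using D0[OF K[OF that]] by (simp add: \<psi>_def D\<psi>_def zero_prod_def[symmetric])
  qed
  have int: "integrable lborel (\<lambda>y. g y *\<^sub>R D (z - y))"
    by (rule convol_integrable[OF g_integrable cD C(2)])
  have "fst (convol g D z) \<bullet> i = (LINT y|lborel. (g y *\<^sub>R D (z - y)) \<bullet> (i, 0))"
    unfolding integral_inner_left[OF int] convol_def by (simp add: inner_prod_def)
  also have "\<dots> = (LINT y|lborel. - (q y * (fst (D\<psi> y) \<bullet> i)))"
    by (rule arg_cong[of _ _ "integral\<^sup>L lborel"]) (simp add: fun_eq_iff inner_prod_def D\<psi>_def g_def E_def algebra_simps)
  also have "\<dots> = (LINT y|lborel. (G y \<bullet> i) * \<psi> y)"
    using weak_gradient[OF \<psi>' cD\<psi> compact_cball[of "z - c" \<rho>, folded K_def] 0 i] by simp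
  also have "\<dots> = convol (\<lambda>z. \<Gamma> z \<bullet> i) \<eta> z"
    unfolding convol_def \<Gamma>_def \<psi>_def E_def by (simp add: algebra_simps)
  finally show ?thesis unfolding D_def .
qed


text \<open>The flux of \<open>G\<close> against the dual solution is evaluated twice. From above,
  the equation for \<open>w\<close> and the approximate transport equation give minus the integral
  of \<open>w z * S z\<close> plus an error. From below, the flux is the weighted one of \<Gamma>,
  which is compared with \<open>P\<close>, the spatial gradient of the source in the application,
  and the energy inequality for \<open>P\<close> is inserted.\<close>

lemma dirichlet_bound:
  assumes test: "\<And>z. GDERIV \<Phi> z :> D z" "continuous_on UNIV D" "compact K" "K \<subseteq> UNIV \<times> {..<T}" "\<And>z. z \<notin> K \<Longrightarrow> \<Phi> z = 0"
    and err: "\<And>z. z \<in> cyl T \<Longrightarrow> \<bar>snd (D z) - b z \<bullet> fst (D z) + f z * \<Phi> z + S z\<bar> \<le> \<eta>"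
    and Y: "integrable lborel (\<lambda>z. wt (R0 + 1) z * (norm (fst (D z)))\<^sup>2)"
      "Y = (LINT z|lborel. wt (R0 + 1) z * (norm (fst (D z)))\<^sup>2)"
    and P: "integrable lborel (\<lambda>z. wt (R0 + 1) z * (P z \<bullet> fst (D z)))"
      "Y \<le> (LINT z|lborel. wt (R0 + 1) z * (P z \<bullet> fst (D z)))"
    and V: "integrable lborel (\<lambda>z. (norm (\<Gamma> z - P z))\<^sup>2)" and wS: "integrable lborel (\<lambda>z. w z * S z)"
  shows "Y \<le> 2 * (\<eta> * (LINT z|lborel. \<bar>w z\<bar>) - (LINT z|lborel. w z * S z))
    + exp (\<bar>l\<bar> * T) * Mm * (LINT z|lborel. (norm (\<Gamma> z - P z))\<^sup>2)"
proof -
  define \<nu> where "\<nu> = wt (R0 + 1)"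
  define A where "A z = snd (D z) - bX z \<bullet> fst (D z) + fX z * \<Phi> z" for z
  have \<nu>: "0 \<le> \<nu> z" "\<nu> z * (\<Gamma> z \<bullet> v) = mX z * (G z \<bullet> v)" "\<nu> z \<le> exp (\<bar>l\<bar> * T) * Mm" for z v
    unfolding \<nu>_def l_def by (rule wt_bounds)+
  have \<nu>m: "\<nu> \<in> borel_measurable borel"
    unfolding \<nu>_def wt_def[abs_def] by (intro borel_measurable_times exp_meas coeff_meas)
  note eqn = C1_test_equation[OF test, folded A_def]
  have Vi: "integrable lborel (\<lambda>z. \<nu> z * (norm (\<Gamma> z - P z))\<^sup>2)"
  proof (rule integrable_nonneg_bound)
    show "integrable lborel (\<lambda>z. exp (\<bar>l\<bar> * T) * Mm * (norm (\<Gamma> z - P z))\<^sup>2)" using V by simp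
    show "(\<lambda>z. \<nu> z * (norm (\<Gamma> z - P z))\<^sup>2) \<in> borel_measurable borel"
      using \<nu>m borel_measurable_integrable[OF V] by simp
    show "\<nu> z * (norm (\<Gamma> z - P z))\<^sup>2 \<le> exp (\<bar>l\<bar> * T) * Mm * (norm (\<Gamma> z - P z))\<^sup>2" for z
      by (rule mult_right_mono[OF \<nu>(3)]) simp
  qed (use \<nu>(1) in simp)
  have up: "(LINT z|lborel. mX z * (G z \<bullet> fst (D z))) \<le> \<eta> * (LINT z|lborel. \<bar>w z\<bar>) - (LINT z|lborel. w z * S z)"
  proof -
    have "w z * A z \<le> \<eta> * \<bar>w z\<bar> - w z * S z" for z
    proof (cases "z \<in> cyl T")
      case True
      then have "A z = snd (D z) - b z \<bullet> fst (D z) + f z * \<Phi> z" by (simp add: A_def bX_def fX_def)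
      then have "\<bar>A z + S z\<bar> \<le> \<eta>" using err[OF True] by simp
      then have "\<bar>w z * (A z + S z)\<bar> \<le> \<bar>w z\<bar> * \<eta>" unfolding abs_mult by (rule mult_left_mono) simp
      then show ?thesis by (simp add: algebra_simps)
    qed (simp add: off_cyl)
    then have "(LINT z|lborel. w z * A z) \<le> (LINT z|lborel. \<eta> * \<bar>w z\<bar> - w z * S z)"
      by (intro integral_mono eqn(1) Bochner_Integration.integrable_diff wS) (use w_integrable in auto)
    also have "\<dots> = \<eta> * (LINT z|lborel. \<bar>w z\<bar>) - (LINT z|lborel. w z * S z)"
      using w_integrable wS by simp
    finally show ?thesis using eqn(3) by simp
  qed
  have pt: "\<nu> z * (P z \<bullet> fst (D z)) - \<nu> z * (norm (fst (D z)))\<^sup>2 / 2 - \<nu> z * (norm (\<Gamma> z - P z))\<^sup>2 / 2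
      \<le> mX z * (G z \<bullet> fst (D z))" for z
  proof -
    \<comment> \<open>Young as a square: replacing \<open>P\<close> by \<Gamma> costs half of the
      energy, and the other half stays on the left.\<close>
    have "0 \<le> (norm ((\<Gamma> z - P z) + fst (D z)))\<^sup>2" by simp
    also have "\<dots> = (norm (\<Gamma> z - P z))\<^sup>2 + 2 * ((\<Gamma> z - P z) \<bullet> fst (D z)) + (norm (fst (D z)))\<^sup>2"
      unfolding power2_norm_eq_inner inner_add_left inner_add_right by (simp only: inner_commute)
    finally have "P z \<bullet> fst (D z) - (norm (fst (D z)))\<^sup>2 / 2 - (norm (\<Gamma> z - P z))\<^sup>2 / 2 \<le> \<Gamma> z \<bullet> fst (D z)"
      by (simp add: inner_diff_left)
    from mult_left_mono[OF this \<nu>(1)[of z]] show ?thesis unfolding \<nu>(2) by (simp add: algebra_simps)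
  qed
  have "(LINT z|lborel. \<nu> z * (P z \<bullet> fst (D z)) - \<nu> z * (norm (fst (D z)))\<^sup>2 / 2 - \<nu> z * (norm (\<Gamma> z - P z))\<^sup>2 / 2)
      \<le> (LINT z|lborel. mX z * (G z \<bullet> fst (D z)))"
    by (intro integral_mono eqn(2) pt Bochner_Integration.integrable_diff integrable_divide_zero)
      (use P(1) Y(1) Vi in \<open>simp_all add: \<nu>_def\<close>)
  also have "(LINT z|lborel. \<nu> z * (P z \<bullet> fst (D z)) - \<nu> z * (norm (fst (D z)))\<^sup>2 / 2 - \<nu> z * (norm (\<Gamma> z - P z))\<^sup>2 / 2)
      = (LINT z|lborel. \<nu> z * (P z \<bullet> fst (D z))) - Y / 2 - (LINT z|lborel. \<nu> z * (norm (\<Gamma> z - P z))\<^sup>2) / 2"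
    using P(1) Y Vi by (simp add: \<nu>_def)
  finally have low: "Y / 2 - (LINT z|lborel. \<nu> z * (norm (\<Gamma> z - P z))\<^sup>2) / 2 \<le> (LINT z|lborel. mX z * (G z \<bullet> fst (D z)))"
    using P(2) by (simp add: \<nu>_def)
  have "(LINT z|lborel. \<nu> z * (norm (\<Gamma> z - P z))\<^sup>2) \<le> (LINT z|lborel. exp (\<bar>l\<bar> * T) * Mm * (norm (\<Gamma> z - P z))\<^sup>2)"
    by (intro integral_mono Vi mult_right_mono \<nu>(3)) (use V in auto)
  also have "\<dots> = exp (\<bar>l\<bar> * T) * Mm * (LINT z|lborel. (norm (\<Gamma> z - P z))\<^sup>2)" by simp
  finally have V_le: "(LINT z|lborel. \<nu> z * (norm (\<Gamma> z - P z))\<^sup>2) \<le> exp (\<bar>l\<bar> * T) * Mm * (LINT z|lborel. (norm (\<Gamma> z - P z))\<^sup>2)" .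
  have "Y \<le> 2 * a + E" if "X \<le> E" "Y / 2 - X / 2 \<le> I" "I \<le> a" for X E I a :: real
    using that by linarith
  from this[OF V_le low up] show ?thesis .
qed

lemma mollified_data:
  assumes u: "integrable lborel u" "\<And>z. z \<notin> cyl T \<Longrightarrow> u z = 0" "\<And>z. R0 < norm (fst z) \<Longrightarrow> u z = 0"
    and \<eta>: "smooth_on UNIV \<eta>" "\<And>z. z \<notin> ball (0, - 2 * \<rho>) \<rho> \<Longrightarrow> \<eta> z = 0" and \<rho>: "0 < \<rho>" "\<rho> \<le> 1"
  obtains s where "\<And>z. GDERIV (convol u \<eta>) z :> convol u (space_time_grad \<eta>) z"
    "\<And>z. \<bar>convol u \<eta> z\<bar> \<le> s" "\<And>z. norm (convol u (space_time_grad \<eta>) z) \<le> s"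
    "\<And>z z'. norm (convol u (space_time_grad \<eta>) z - convol u (space_time_grad \<eta>) z') \<le> s * norm (z - z')"
    "\<And>z. T - \<rho> \<le> snd z \<Longrightarrow> convol u \<eta> z = 0 \<and> convol u (space_time_grad \<eta>) z = 0"
    "\<And>z. R0 + 1 < norm (fst z) \<Longrightarrow> convol u \<eta> z = 0 \<and> convol u (space_time_grad \<eta>) z = 0"
proof -
  have u2: "0 < snd z \<and> snd z < T" if "u z \<noteq> 0" for z
    using u(2)[of z] that unfolding cyl_iff by blast
  show thesis
  proof (rule mollified_source[where g = u and \<eta> = \<eta> and c = "- 2 * \<rho>" and \<rho> = \<rho> and a = 0 and T = T and ?R0.0 = R0,
        folded space_time_grad_def])
    fix s
    assume s: "\<And>z. GDERIV (convol u \<eta>) z :> convol u (space_time_grad \<eta>) z"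
      "\<And>z. \<bar>convol u \<eta> z\<bar> \<le> s" "\<And>z. norm (convol u (space_time_grad \<eta>) z) \<le> s"
      "\<And>z z'. norm (convol u (space_time_grad \<eta>) z - convol u (space_time_grad \<eta>) z') \<le> s * norm (z - z')"
      "\<And>z. T + (- 2 * \<rho>) + \<rho> \<le> snd z \<or> snd z \<le> 0 + - 2 * \<rho> - \<rho> \<or> R0 + \<rho> < norm (fst z) \<Longrightarrow>
        convol u \<eta> z = 0 \<and> convol u (space_time_grad \<eta>) z = 0"
    show thesis
    proof (rule that[OF s(1-4)])
      show "convol u \<eta> z = 0 \<and> convol u (space_time_grad \<eta>) z = 0" if "T - \<rho> \<le> snd z" for z
        by (rule s(5)) (use that in simp)
      show "convol u \<eta> z = 0 \<and> convol u (space_time_grad \<eta>) z = 0" if "R0 + 1 < norm (fst z)" for z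
        by (rule s(5)) (use that \<rho> in simp)
    qed
  qed (fact u(1) u2 u(3) \<eta> \<rho>(1))+
qed


text \<open>Here the sign condition on \<open>w\<close> and \<open>q\<close> enters: up to the
  mollification error the integral of \<open>w z * S z\<close> is nonnegative. The squared L2 error
  is required to be at most \<open>\<mu>\<^sup>2\<close>, so that Young with parameter \<mu> leaves
  one power of \<mu>.\<close>

lemma dirichlet_small:
  assumes \<mu>: "0 < \<mu>" "\<mu> \<le> 1" and Y0: "0 \<le> W"
    and W: "W = (LINT z|lborel. \<bar>w z\<bar>)" "W2 = (LINT z|lborel. (w z)\<^sup>2)" "C = exp (\<bar>l\<bar> * T) * Mm * dd"
    and S: "S \<in> borel_measurable borel" "integrable lborel (\<lambda>z. (S z - g z)\<^sup>2)" "(LINT z|lborel. (S z - g z)\<^sup>2) \<le> \<mu>\<^sup>2"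
    and Y: "integrable lborel (\<lambda>z. w z * S z) \<Longrightarrow>
      Y \<le> 2 * (\<mu> * W - (LINT z|lborel. w z * S z)) + exp (\<bar>l\<bar> * T) * Mm * V" and V: "V \<le> dd * \<mu>\<^sup>2"
  shows "Y \<le> \<mu> * (W2 + 1 + 2 * W + C)"
proof -
  have Sg: "(\<lambda>z. S z - g z) \<in> borel_measurable borel" using S(1) g_meas by (rule borel_measurable_diff)
  note i1 = L2_Young(1)[OF meas(1) g_meas w_square g_square]
  note i2 = L2_Young(1)[OF meas(1) Sg w_square S(2)]
  have eq: "w z * S z = w z * g z + w z * (S z - g z)" for z by (simp add: algebra_simps)
  have wS: "integrable lborel (\<lambda>z. w z * S z)" unfolding eq using i1 i2 by (rule Bochner_Integration.integrable_add)
  have split: "(LINT z|lborel. w z * S z) = (LINT z|lborel. w z * g z) + (LINT z|lborel. w z * (S z - g z))"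
    unfolding eq using i1 i2 by (rule Bochner_Integration.integral_add)
  have "AE z in lborel. 0 \<le> w z * g z"
    using monotone_pressure
  proof eventually_elim
    case (elim z)
    then have "0 \<le> exp (- l * snd z) * (w z * q z)" by simp
    then show ?case by (simp add: g_def algebra_simps)
  qed
  then have pos: "0 \<le> (LINT z|lborel. w z * g z)" by (rule integral_nonneg_AE)
  have "\<bar>LINT z|lborel. w z * (S z - g z)\<bar> \<le> (\<mu> * W2 + (LINT z|lborel. (S z - g z)\<^sup>2) / \<mu>) / 2"
    unfolding W(2) by (rule L2_Young(2)[OF meas(1) Sg w_square S(2) \<mu>(1)])
  also have "\<dots> \<le> (\<mu> * W2 + \<mu>\<^sup>2 / \<mu>) / 2"
    using S(3) \<mu> by (intro divide_right_mono add_left_mono) auto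
  also have "\<dots> = \<mu> * (W2 + 1) / 2" using \<mu> by (simp add: power2_eq_square algebra_simps)
  finally have "- (LINT z|lborel. w z * (S z - g z)) \<le> \<mu> * (W2 + 1) / 2" by simp
  moreover have "Mm * exp (\<bar>l\<bar> * T) * V \<le> Mm * exp (\<bar>l\<bar> * T) * (dd * \<mu>)"
  proof (rule mult_left_mono)
    have "\<mu>\<^sup>2 \<le> \<mu>" using \<mu> by (simp add: power2_eq_square mult_left_le)
    then have "dd * \<mu>\<^sup>2 \<le> dd * \<mu>" using dd by (intro mult_left_mono) auto
    then show "V \<le> dd * \<mu>" using V by linarith
  qed (use Mm in simp)
  then have "exp (\<bar>l\<bar> * T) * Mm * V \<le> \<mu> * C" by (simp add: W(3) algebra_simps)
  moreover have "Y \<le> \<mu> * (W2 + 1 + 2 * W + C)"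
    if "Y \<le> 2 * (\<mu> * W - (x + y)) + v" "0 \<le> x" "- y \<le> \<mu> * (W2 + 1) / 2" "v \<le> \<mu> * C" for x y v
    using that by (simp add: algebra_simps)
  ultimately show ?thesis using Y[OF wS] pos unfolding split by blast
qed

text \<open>The energy is O(\<mu>) by \<open>dirichlet_small\<close>, so the weak bound of
  \<open>dual_test\<close> makes the source, and hence \<open>g\<close>, small when tested with
  \<omega>. The test function is fixed while the mollification is removed.\<close>

lemma g_annihilated:
  assumes \<omega>: "\<omega> \<in> borel_measurable borel" "\<And>z. \<bar>\<omega> z\<bar> \<le> L" "\<And>z z'. \<bar>\<omega> z - \<omega> z'\<bar> \<le> L * norm (z - z')"
      "\<And>z. \<omega> z \<noteq> 0 \<Longrightarrow> t0 \<le> snd z \<and> snd z \<le> T - t0 \<and> norm (fst z) \<le> r" "0 < t0"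
  shows "(LINT z|lborel. \<omega> z * g z) = 0"
proof -
  define W where "W = (LINT z|lborel. \<bar>w z\<bar>)"
  define W2 where "W2 = (LINT z|lborel. (w z)\<^sup>2)"
  define C where "C = exp (\<bar>l\<bar> * T) * Mm * dd"
  define K1 where "K1 = W2 + 1 + 2 * W + C"
  define \<Omega>2 where "\<Omega>2 = (LINT z|lborel. (\<omega> z)\<^sup>2)"
  define K where "K = L * C4c * (Volc (R0 + 1) + CPc (R0 + 1) * K1 / \<delta>) + (\<Omega>2 + 1) / 2"
  have W: "0 \<le> W" unfolding W_def by (rule integral_nonneg_AE) simp
  have \<Omega>: "0 \<le> \<Omega>2" unfolding \<Omega>2_def by (rule integral_nonneg_AE) simp
  have L: "0 \<le> L" using \<omega>(2)[of 0] by linarith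
  have C4: "0 \<le> C4c" unfolding C4c_def using B dd \<kappa> by (intro add_nonneg_nonneg mult_nonneg_nonneg) auto
  have CP: "0 \<le> CPc (R0 + 1)" by (simp add: CPc_def)
  have \<omega>2: "integrable lborel (\<lambda>z. (\<omega> z)\<^sup>2)"
  proof (rule bounded_support_integrable)
    show "(\<lambda>z. (\<omega> z)\<^sup>2) \<in> borel_measurable borel" using \<omega>(1) by (rule borel_measurable_power)
    show "\<bar>(\<omega> z)\<^sup>2\<bar> \<le> L\<^sup>2" for z using power_mono[OF \<omega>(2)[of z], of 2] by simp
    show "bounded (cball (0::'a) r \<times> {t0..T - t0})" by (intro bounded_Times) auto
    show "(\<omega> z)\<^sup>2 = 0" if "z \<notin> cball 0 r \<times> {t0..T - t0}" for z
      using \<omega>(4)[of z] that by (cases z) auto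
  qed
  have main: "\<bar>LINT z|lborel. \<omega> z * g z\<bar> \<le> \<alpha> * K" if \<alpha>: "0 < \<alpha>" "\<alpha> \<le> 1" for \<alpha>
  proof -
    \<comment> \<open>The weak bound has the two terms \<alpha> and energy over \<alpha>; with
      energy of order \<mu>, the choice \<open>\<alpha>\<^sup>2\<close> makes both of order
      \<alpha>.\<close>
    define \<mu> where "\<mu> = \<alpha>\<^sup>2"
    have \<mu>: "0 < \<mu>" "\<mu> \<le> 1" "\<mu> \<le> \<alpha>"
      using \<alpha> power_le_one[of \<alpha> 2] mult_left_le[of \<alpha> \<alpha>] by (simp_all add: \<mu>_def power2_eq_square)
    have fin: "finite (insert g ((\<lambda>i z. \<Gamma> z \<bullet> i) ` Basis))" by simp
    have mem: "u \<in> borel_measurable borel \<and> integrable lborel (\<lambda>x. (u x)\<^sup>2)"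
      if "u \<in> insert g ((\<lambda>i z. \<Gamma> z \<bullet> i) ` Basis)" for u
      using that g_meas g_square \<Gamma>_comp_meas \<Gamma>_comp_square by (elim insertE imageE) simp_all
    have e: "0 < \<mu>\<^sup>2" using \<mu> by simp
    obtain \<rho> \<eta> where \<rho>: "0 < \<rho>" "\<rho> \<le> 1" and \<eta>1: "smooth_on UNIV \<eta>" "\<forall>z. z \<notin> ball (0, - 2 * \<rho>) \<rho> \<longrightarrow> \<eta> z = 0"
      and app': "\<forall>u\<in>insert g ((\<lambda>i z. \<Gamma> z \<bullet> i) ` Basis).
        integrable lborel (\<lambda>x. (convol u \<eta> x - u x)\<^sup>2) \<and> (LINT x|lborel. (convol u \<eta> x - u x)\<^sup>2) \<le> \<mu>\<^sup>2"
      by (rule delayed_kernel[OF fin mem e], assumption, rule that, assumption+)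
    note \<eta> = \<eta>1(1) \<eta>1(2)[rule_format]
    note app = app'[rule_format, THEN conjunct1] app'[rule_format, THEN conjunct2]
    define S where "S = convol g \<eta>"
    define DS where "DS = convol g (space_time_grad \<eta>)"
    have DS_eq: "fst (DS z) \<bullet> i = convol (\<lambda>z. \<Gamma> z \<bullet> i) \<eta> z" if "i \<in> Basis" for z i
      unfolding DS_def by (rule grad_convol[OF \<eta>(1) _ that], rule \<eta>(2), assumption)
    have P_eq: "(norm (\<Gamma> z - fst (DS z)))\<^sup>2 = (\<Sum>i\<in>Basis. (convol (\<lambda>z. \<Gamma> z \<bullet> i) \<eta> z - \<Gamma> z \<bullet> i)\<^sup>2)" for z
    proof -
      have "(norm (\<Gamma> z - fst (DS z)))\<^sup>2 = (\<Sum>i\<in>Basis. ((\<Gamma> z - fst (DS z)) \<bullet> i)\<^sup>2)"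
        unfolding power2_norm_eq_inner by (subst euclidean_inner) (simp only: power2_eq_square)
      also have "\<dots> = (\<Sum>i\<in>Basis. (convol (\<lambda>z. \<Gamma> z \<bullet> i) \<eta> z - \<Gamma> z \<bullet> i)\<^sup>2)"
        by (rule sum.cong) (simp_all add: inner_diff_left DS_eq power2_commute)
      finally show ?thesis .
    qed
    have V: "integrable lborel (\<lambda>z. (norm (\<Gamma> z - fst (DS z)))\<^sup>2)"
      unfolding P_eq by (intro Bochner_Integration.integrable_sum app(1)) simp
    have Vle: "(LINT z|lborel. (norm (\<Gamma> z - fst (DS z)))\<^sup>2) \<le> dd * \<mu>\<^sup>2"
    proof -
      have "(LINT z|lborel. (norm (\<Gamma> z - fst (DS z)))\<^sup>2)
          = (\<Sum>i\<in>Basis. LINT z|lborel. (convol (\<lambda>z. \<Gamma> z \<bullet> i) \<eta> z - \<Gamma> z \<bullet> i)\<^sup>2)"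
        unfolding P_eq by (intro Bochner_Integration.integral_sum app(1)) simp
      also have "\<dots> \<le> (\<Sum>i\<in>(Basis :: 'a set). \<mu>\<^sup>2)" by (intro sum_mono app(2)) simp
      also have "\<dots> = dd * \<mu>\<^sup>2" by (simp add: dd_def)
      finally show ?thesis .
    qed
    show ?thesis
    proof (rule mollified_data[OF g_integrable g_off g_far \<eta> \<rho>, folded S_def DS_def])
      fix s
      assume S: "\<And>z. GDERIV S z :> DS z" "\<And>z. \<bar>S z\<bar> \<le> s" "\<And>z. norm (DS z) \<le> s"
        "\<And>z z'. norm (DS z - DS z') \<le> s * norm (z - z')"
        "\<And>z. T - \<rho> \<le> snd z \<Longrightarrow> S z = 0 \<and> DS z = 0" "\<And>z. R0 + 1 < norm (fst z) \<Longrightarrow> S z = 0 \<and> DS z = 0"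
      have "continuous_on UNIV S"
        using S(1) by (auto simp: gderiv_def intro!: continuous_at_imp_continuous_on has_derivative_continuous)
      then have Sm: "S \<in> borel_measurable borel" by (rule borel_measurable_continuous_onI)
      have R1: "0 \<le> R0 + 1" using bounds(2) by simp
      have Sg: "integrable lborel (\<lambda>z. (S z - g z)\<^sup>2)" "(LINT z|lborel. (S z - g z)\<^sup>2) \<le> \<mu>\<^sup>2"
        unfolding S_def using app[of g] by simp_all
      have Sgm: "(\<lambda>z. S z - g z) \<in> borel_measurable borel" using Sm g_meas by (rule borel_measurable_diff)
      show ?thesis
      proof (rule dual_test[OF R1 \<rho>(1) \<mu>(1) S \<omega>])
        fix \<Phi> D K' Y
        assume test: "\<And>z. GDERIV \<Phi> z :> D z" "continuous_on UNIV D" "compact K'" "K' \<subseteq> UNIV \<times> {..<T}"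
          "\<And>z. z \<notin> K' \<Longrightarrow> \<Phi> z = 0"
          and err: "\<And>z. z \<in> cyl T \<Longrightarrow> \<bar>snd (D z) - b z \<bullet> fst (D z) + f z * \<Phi> z + S z\<bar> \<le> \<mu>"
          and Y: "integrable lborel (\<lambda>z. wt (R0 + 1) z * (norm (fst (D z)))\<^sup>2)"
            "Y = (LINT z|lborel. wt (R0 + 1) z * (norm (fst (D z)))\<^sup>2)"
          and P: "integrable lborel (\<lambda>z. wt (R0 + 1) z * (fst (DS z) \<bullet> fst (D z)))"
            "Y \<le> (LINT z|lborel. wt (R0 + 1) z * (fst (DS z) \<bullet> fst (D z)))" "0 \<le> Y"
          and main: "\<And>\<alpha>. 0 < \<alpha> \<Longrightarrow> \<bar>LINT z|lborel. \<omega> z * S z\<bar>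
            \<le> L * C4c * (\<alpha> * Volc (R0 + 1) + CPc (R0 + 1) * Y / (\<delta> * \<alpha>))"
        have Yle: "Y \<le> \<mu> * K1"
          unfolding K1_def
        proof (rule dirichlet_small[OF \<mu>(1,2) W W_def W2_def C_def Sm Sg _ Vle])
          assume wS: "integrable lborel (\<lambda>z. w z * S z)"
          show "Y \<le> 2 * (\<mu> * W - (LINT z|lborel. w z * S z)) + exp (\<bar>l\<bar> * T) * Mm * (LINT z|lborel. (norm (\<Gamma> z - fst (DS z)))\<^sup>2)"
            unfolding W_def by (rule dirichlet_bound[OF test err Y P(1,2) V wS])
        qed
        have "CPc (R0 + 1) * Y / (\<delta> * \<alpha>) \<le> CPc (R0 + 1) * (\<mu> * K1) / (\<delta> * \<alpha>)"
          by (rule divide_right_mono[OF mult_left_mono[OF Yle CP]]) (use \<delta> \<alpha> in simp)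
        also have "\<dots> = \<alpha> * (CPc (R0 + 1) * K1 / \<delta>)"
          using \<alpha> by (simp add: \<mu>_def power2_eq_square)
        finally have "L * C4c * (\<alpha> * Volc (R0 + 1) + CPc (R0 + 1) * Y / (\<delta> * \<alpha>))
            \<le> L * C4c * (\<alpha> * Volc (R0 + 1) + \<alpha> * (CPc (R0 + 1) * K1 / \<delta>))"
          using L C4 by (intro mult_left_mono add_left_mono) auto
        with main[OF \<alpha>(1)] have b1: "\<bar>LINT z|lborel. \<omega> z * S z\<bar>
            \<le> \<alpha> * (L * C4c * (Volc (R0 + 1) + CPc (R0 + 1) * K1 / \<delta>))"
          by (simp only: distrib_left mult_ac)
        note i1 = L2_Young(1)[OF \<omega>(1) g_meas \<omega>2 g_square]
        note i2 = L2_Young(1)[OF \<omega>(1) Sgm \<omega>2 Sg(1)]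
        have eq: "\<omega> z * S z = \<omega> z * g z + \<omega> z * (S z - g z)" for z by (simp add: algebra_simps)
        have split: "(LINT z|lborel. \<omega> z * S z) = (LINT z|lborel. \<omega> z * g z) + (LINT z|lborel. \<omega> z * (S z - g z))"
          unfolding eq using i1 i2 by (rule Bochner_Integration.integral_add)
        have "\<bar>LINT z|lborel. \<omega> z * (S z - g z)\<bar> \<le> (\<mu> * \<Omega>2 + (LINT z|lborel. (S z - g z)\<^sup>2) / \<mu>) / 2"
          unfolding \<Omega>2_def by (rule L2_Young(2)[OF \<omega>(1) Sgm \<omega>2 Sg(1) \<mu>(1)])
        also have "\<dots> \<le> (\<mu> * \<Omega>2 + \<mu>\<^sup>2 / \<mu>) / 2"
          using Sg(2) \<mu> by (intro divide_right_mono add_left_mono) auto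
        also have "\<dots> = \<mu> * ((\<Omega>2 + 1) / 2)" using \<mu> by (simp add: power2_eq_square algebra_simps)
        also have "\<dots> \<le> \<alpha> * ((\<Omega>2 + 1) / 2)" using \<mu>(3) \<Omega> by (intro mult_right_mono) auto
        finally have b2: "\<bar>LINT z|lborel. \<omega> z * (S z - g z)\<bar> \<le> \<alpha> * ((\<Omega>2 + 1) / 2)" .
        have "\<bar>x\<bar> \<le> \<alpha> * (k + k')" if "\<bar>x + y\<bar> \<le> \<alpha> * k" "\<bar>y\<bar> \<le> \<alpha> * k'" for x y k k' :: real
        proof -
          have "\<bar>x\<bar> \<le> \<bar>x + y\<bar> + \<bar>y\<bar>" by simp
          also have "\<dots> \<le> \<alpha> * (k + k')" using that by (simp add: distrib_left)
          finally show ?thesis .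
        qed
        from this[OF b1[unfolded split] b2] show ?thesis unfolding K_def .
      qed
    qed
  qed
  show ?thesis
  proof (rule ccontr)
    define x where "x = \<bar>LINT z|lborel. \<omega> z * g z\<bar>"
    assume "\<not> ?thesis"
    then have x: "0 < x" by (simp add: x_def)
    have xK: "x \<le> \<alpha> * K" if "0 < \<alpha>" "\<alpha> \<le> 1" for \<alpha> using main[OF that] by (simp add: x_def)
    have K: "0 < K" using xK[of 1] x by simp
    define \<alpha> where "\<alpha> = min 1 (x / (2 * K))"
    have "0 < \<alpha>" "\<alpha> \<le> 1" "\<alpha> \<le> x / (2 * K)" using x K by (auto simp: \<alpha>_def)
    then have "x \<le> x / (2 * K) * K" using xK[of \<alpha>] mult_right_mono[of \<alpha> "x / (2 * K)" K] K by linarith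
    then show False using x K by simp
  qed
qed


text \<open>\<open>g\<close> is tested with a mollification of its own restriction to interior
  times. That function is Lipschitz and stays away from the end times, as
  \<open>g_annihilated\<close> demands, and its integral against \<open>g\<close> is close to the
  square integral of the restriction.\<close>

lemma interior_g_zero:
  assumes a: "0 < a"
  shows "AE z in lborel. a < snd z \<and> snd z < T - a \<longrightarrow> g z = 0"
proof -
  define A where "A = {z::'a \<times> real. a < snd z \<and> snd z < T - a}"
  define h where "h z = indicator A z * g z" for z
  have "A = UNIV \<times> {a<..<T - a}" by (auto simp: A_def)
  then have "open A" by (simp add: open_Times)
  then have A: "A \<in> sets borel" by (rule borel_open)
  have hm: "h \<in> borel_measurable borel"
    unfolding h_def[abs_def] by (intro borel_measurable_times borel_measurable_indicator A g_meas)
  have hg: "(h z)\<^sup>2 = h z * g z" for z by (simp add: h_def indicator_def power2_eq_square)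
  have h2: "integrable lborel (\<lambda>z. (h z)\<^sup>2)"
  proof (rule integrable_nonneg_bound[OF g_square])
    show "(\<lambda>z. (h z)\<^sup>2) \<in> borel_measurable borel" using hm by (rule borel_measurable_power)
  qed (simp_all add: h_def indicator_def)
  have hi: "integrable lborel h"
  proof (rule Bochner_Integration.integrable_bound[OF g_integrable])
    show "AE z in lborel. norm (h z) \<le> norm (g z)" by (simp add: h_def indicator_def)
  qed (use hm in simp)
  have hint: "a < snd z \<and> snd z < T - a" if "h z \<noteq> 0" for z
    using that by (auto simp: h_def A_def indicator_def split: if_splits)
  have hfar: "h z = 0" if "R0 < norm (fst z)" for z using g_far[OF that] by (simp add: h_def)
  have "AE z in lborel. h z = 0"
  proof (rule AE_zero_of_square_integral[OF h2])
    fix \<mu> :: real assume \<mu>: "0 < \<mu>"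
    then have \<mu>2: "0 < \<mu>\<^sup>2" by simp
    obtain d where d: "0 < d" and D: "\<And>\<eta>. (\<And>x. 0 \<le> \<eta> x) \<Longrightarrow> (\<And>x. x \<notin> ball 0 d \<Longrightarrow> \<eta> x = 0) \<Longrightarrow> integrable lborel \<eta> \<Longrightarrow>
      (LINT x|lborel. \<eta> x) = 1 \<Longrightarrow>
      integrable lborel (\<lambda>x. (convol h \<eta> x - h x)\<^sup>2) \<and> (LINT x|lborel. (convol h \<eta> x - h x)\<^sup>2) \<le> \<mu>\<^sup>2"
      by (rule L2_mollify[OF hm h2 \<mu>2]) blast
    \<comment> \<open>Radius at most \<open>a / 2\<close> leaves a margin \<open>a / 2\<close>
      between the support of \<omega> and the times 0 and \<open>T\<close>.\<close>
    define \<rho> where "\<rho> = min d (a / 2)"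
    have \<rho>: "0 < \<rho>" "\<rho> \<le> d" "\<rho> \<le> a / 2" using d a by (auto simp: \<rho>_def)
    obtain \<eta> :: "'a \<times> real \<Rightarrow> real" where \<eta>: "smooth_on UNIV \<eta>" "\<And>x. 0 \<le> \<eta> x"
      "\<And>x. x \<notin> ball (0, 0) \<rho> \<Longrightarrow> \<eta> x = 0" "integrable lborel \<eta>" "(LINT x|lborel. \<eta> x) = 1"
      by (rule smooth_mollifier[OF \<rho>(1)]) blast
    have \<eta>d: "\<eta> x = 0" if "x \<notin> ball 0 d" for x
      by (rule \<eta>(3)) (use that \<rho>(2) in \<open>auto simp: zero_prod_def[symmetric]\<close>)
    define \<omega> where "\<omega> = convol h \<eta>"
    have close: "integrable lborel (\<lambda>x. (\<omega> x - h x)\<^sup>2)" "(LINT x|lborel. (\<omega> x - h x)\<^sup>2) \<le> \<mu>\<^sup>2"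
      unfolding \<omega>_def using D[OF \<eta>(2) \<eta>d \<eta>(4,5)] by blast+
    have \<omega>: "\<omega> \<in> borel_measurable borel \<and> (LINT z|lborel. \<omega> z * g z) = 0"
    proof (rule mollified_source[where g = h and \<eta> = \<eta> and c = 0 and \<rho> = \<rho> and a = a and T = "T - a" and ?R0.0 = R0,
          folded space_time_grad_def \<omega>_def])
      fix s
      assume s: "\<And>z. GDERIV \<omega> z :> convol h (space_time_grad \<eta>) z"
        "\<And>z. \<bar>\<omega> z\<bar> \<le> s" "\<And>z. norm (convol h (space_time_grad \<eta>) z) \<le> s"
        "\<And>z. T - a + 0 + \<rho> \<le> snd z \<or> snd z \<le> a + 0 - \<rho> \<or> R0 + \<rho> < norm (fst z) \<Longrightarrow>
          \<omega> z = 0 \<and> convol h (space_time_grad \<eta>) z = 0"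
      have "continuous_on UNIV \<omega>"
        using s(1) by (auto simp: gderiv_def intro!: continuous_at_imp_continuous_on has_derivative_continuous)
      then have m: "\<omega> \<in> borel_measurable borel" by (rule borel_measurable_continuous_onI)
      have "(LINT z|lborel. \<omega> z * g z) = 0"
      proof (rule g_annihilated[OF m s(2)])
        show "\<bar>\<omega> z - \<omega> z'\<bar> \<le> s * norm (z - z')" for z z'
          by (rule GDERIV_Lipschitz[OF convex_UNIV s(1) s(3)]) auto
        show "a / 2 \<le> snd z \<and> snd z \<le> T - a / 2 \<and> norm (fst z) \<le> R0 + \<rho>" if nz: "\<omega> z \<noteq> 0" for z
        proof -
          have "\<not> (T - a + 0 + \<rho> \<le> snd z \<or> snd z \<le> a + 0 - \<rho> \<or> R0 + \<rho> < norm (fst z))"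
            using s(4)[of z] nz by blast
          then show ?thesis using \<rho>(3) by auto
        qed
      qed (use a in simp)
      with m show ?thesis by blast
    qed (fact hi hint hfar \<eta>(1,3) \<rho>(1))+
    then have \<omega>m: "\<omega> \<in> borel_measurable borel" and \<omega>g: "(LINT z|lborel. \<omega> z * g z) = 0" by blast+
    have dm: "(\<lambda>z. \<omega> z - h z) \<in> borel_measurable borel" using \<omega>m hm by (rule borel_measurable_diff)
    note i = L2_Young(1)[OF g_meas dm g_square close(1)]
    have eq: "\<omega> z * g z = (h z)\<^sup>2 + g z * (\<omega> z - h z)" for z unfolding hg by (simp add: algebra_simps)
    have "0 = (LINT z|lborel. (h z)\<^sup>2) + (LINT z|lborel. g z * (\<omega> z - h z))"
      unfolding \<omega>g[symmetric] eq using h2 i by (rule Bochner_Integration.integral_add)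
    then have "(LINT z|lborel. (h z)\<^sup>2) \<le> \<bar>LINT z|lborel. g z * (\<omega> z - h z)\<bar>" by linarith
    also have "\<dots> \<le> (\<mu> * (LINT z|lborel. (g z)\<^sup>2) + (LINT z|lborel. (\<omega> z - h z)\<^sup>2) / \<mu>) / 2"
      by (rule L2_Young(2)[OF g_meas dm g_square close(1) \<mu>])
    also have "\<dots> \<le> (\<mu> * (LINT z|lborel. (g z)\<^sup>2) + \<mu>\<^sup>2 / \<mu>) / 2"
      using close(2) \<mu> by (intro divide_right_mono add_left_mono) auto
    also have "\<dots> = \<mu> * (((LINT z|lborel. (g z)\<^sup>2) + 1) / 2)" using \<mu> by (simp add: power2_eq_square algebra_simps)
    finally show "(LINT z|lborel. (h z)\<^sup>2) \<le> \<mu> * (((LINT z|lborel. (g z)\<^sup>2) + 1) / 2)" .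
  qed
  then show ?thesis by eventually_elim (auto simp: h_def A_def indicator_def)
qed

lemma g_zero: "AE z in lborel. g z = 0"
proof -
  have "AE z in lborel. \<forall>n. 1 / real (Suc n) < snd z \<and> snd z < T - 1 / real (Suc n) \<longrightarrow> g z = 0"
    unfolding AE_all_countable by (intro allI interior_g_zero) simp
  then show ?thesis
  proof eventually_elim
    case (elim z)
    show ?case
    proof (cases "z \<in> cyl T")
      case True
      then have "0 < min (snd z) (T - snd z)" by (simp add: cyl_iff)
      then obtain n where "1 / real (Suc n) < min (snd z) (T - snd z)" using nat_approx_posE by blast
      then have "1 / real (Suc n) < snd z \<and> snd z < T - 1 / real (Suc n)" by auto
      with elim show ?thesis by blast
    qed (rule g_off)
  qed
qed

lemma q_zero: "AE z in lborel. q z = 0"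
  using g_zero by eventually_elim (simp add: g_def)

lemma convol_g_zero: "convol g k z = 0" for k :: "_ \<Rightarrow> 'c::{banach,second_countable_topology}"
proof -
  have "AE y in lborel. g y *\<^sub>R k (z - y) = 0" using g_zero by eventually_elim simp
  then show ?thesis unfolding convol_def by (rule integral_eq_zero_AE)
qed

text \<open>Mollifications of \<Gamma> are spatial gradients of mollifications of \<open>g\<close>,
  and these vanish; letting the radius shrink gives \<Gamma> = 0.\<close>

lemma G_zero: "AE z in lborel. G z = 0"
proof -
  have "AE z in lborel. \<Gamma> z \<bullet> i = 0" if i: "i \<in> Basis" for i
  proof (rule AE_zero_of_square_integral[OF \<Gamma>_comp_square[OF i], where K = 1])
    fix \<mu> :: real assume \<mu>: "0 < \<mu>"
    obtain d where d: "0 < d" and D: "\<And>\<eta>. (\<And>x. 0 \<le> \<eta> x) \<Longrightarrow> (\<And>x. x \<notin> ball 0 d \<Longrightarrow> \<eta> x = 0) \<Longrightarrow> integrable lborel \<eta> \<Longrightarrow>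
      (LINT x|lborel. \<eta> x) = 1 \<Longrightarrow>
      integrable lborel (\<lambda>x. (convol (\<lambda>z. \<Gamma> z \<bullet> i) \<eta> x - \<Gamma> x \<bullet> i)\<^sup>2) \<and>
      (LINT x|lborel. (convol (\<lambda>z. \<Gamma> z \<bullet> i) \<eta> x - \<Gamma> x \<bullet> i)\<^sup>2) \<le> \<mu>"
      by (rule L2_mollify[OF \<Gamma>_comp_meas \<Gamma>_comp_square[OF i] \<mu>]) blast
    obtain \<eta> :: "'a \<times> real \<Rightarrow> real" where \<eta>: "smooth_on UNIV \<eta>" "\<And>x. 0 \<le> \<eta> x"
      "\<And>x. x \<notin> ball 0 d \<Longrightarrow> \<eta> x = 0" "integrable lborel \<eta>" "(LINT x|lborel. \<eta> x) = 1"
      by (rule smooth_mollifier[OF d]) blast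
    have "fst (convol g (space_time_grad \<eta>) z) \<bullet> i = convol (\<lambda>z. \<Gamma> z \<bullet> i) \<eta> z" for z
      by (rule grad_convol[OF \<eta>(1) _ i], rule \<eta>(3), assumption)
    then have "convol (\<lambda>z. \<Gamma> z \<bullet> i) \<eta> z = 0" for z
      unfolding convol_g_zero by simp
    then show "(LINT z|lborel. (\<Gamma> z \<bullet> i)\<^sup>2) \<le> \<mu> * 1" using D[OF \<eta>(2-5)] by simp
  qed
  then have "AE z in lborel. \<forall>i\<in>Basis. \<Gamma> z \<bullet> i = 0" by (subst AE_ball_countable) (auto intro: countable_finite)
  then show ?thesis
    by eventually_elim (simp add: \<Gamma>_def euclidean_all_zero_iff)
qed

text \<open>With \<open>G\<close> zero almost everywhere, the right-hand side of the test equation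
  disappears. The integral of \<open>w z * S z\<close> is then bounded by the scheme error alone,
  which is arbitrarily small for a fixed source.\<close>

lemma w_zero: "AE z in lborel. w z = 0"
proof (rule AE_zero_of_square_integral[OF w_square, where K = 1])
  fix \<mu> :: real assume \<mu>: "0 < \<mu>"
  define W where "W = (LINT z|lborel. \<bar>w z\<bar>)"
  have W: "0 \<le> W" unfolding W_def by (rule integral_nonneg_AE) simp
  have fin: "finite {w}" by simp
  have mem: "u \<in> borel_measurable borel \<and> integrable lborel (\<lambda>x. (u x)\<^sup>2)" if "u \<in> {w}" for u
    using that meas(1) w_square by simp
  obtain \<rho> \<eta> where \<rho>: "0 < \<rho>" "\<rho> \<le> 1" and \<eta>1: "smooth_on UNIV \<eta>" "\<forall>z. z \<notin> ball (0, - 2 * \<rho>) \<rho> \<longrightarrow> \<eta> z = 0"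
    and app': "\<forall>u\<in>{w}.
      integrable lborel (\<lambda>x. (convol u \<eta> x - u x)\<^sup>2) \<and> (LINT x|lborel. (convol u \<eta> x - u x)\<^sup>2) \<le> \<mu>"
    by (rule delayed_kernel[OF fin mem \<mu>], assumption, rule that, assumption+)
  note \<eta> = \<eta>1(1) \<eta>1(2)[rule_format]
  note app = app'[rule_format, THEN conjunct1] app'[rule_format, THEN conjunct2]
  define S where "S = convol w \<eta>"
  define DS where "DS = convol w (space_time_grad \<eta>)"
  have woff: "w z = 0" if "z \<notin> cyl T" for z using off_cyl[OF that] by blast
  have wfar: "w z = 0" if "R0 < norm (fst z)" for z using far[OF that] by blast
  have Sw: "integrable lborel (\<lambda>z. (S z - w z)\<^sup>2)" "(LINT z|lborel. (S z - w z)\<^sup>2) \<le> \<mu>"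
    unfolding S_def using app[of w] by simp_all
  show "(LINT z|lborel. (w z)\<^sup>2) \<le> \<mu> * 1"
  proof (rule mollified_data[OF w_integrable woff wfar \<eta> \<rho>, folded S_def DS_def])
    fix s
    assume S: "\<And>z. GDERIV S z :> DS z" "\<And>z. \<bar>S z\<bar> \<le> s" "\<And>z. norm (DS z) \<le> s"
      "\<And>z z'. norm (DS z - DS z') \<le> s * norm (z - z')"
      "\<And>z. T - \<rho> \<le> snd z \<Longrightarrow> S z = 0 \<and> DS z = 0" "\<And>z. R0 + 1 < norm (fst z) \<Longrightarrow> S z = 0 \<and> DS z = 0"
    have "continuous_on UNIV S"
      using S(1) by (auto simp: gderiv_def intro!: continuous_at_imp_continuous_on has_derivative_continuous)
    then have Sm: "S \<in> borel_measurable borel" by (rule borel_measurable_continuous_onI)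
    have R1: "0 \<le> R0 + 1" using bounds(2) by simp
    have Swm: "(\<lambda>z. S z - w z) \<in> borel_measurable borel" using Sm meas(1) by (rule borel_measurable_diff)
    note i = L2_Young(1)[OF meas(1) Swm w_square Sw(1)]
    have eq: "w z * S z = (w z)\<^sup>2 + w z * (S z - w z)" for z by (simp add: power2_eq_square algebra_simps)
    have wS: "integrable lborel (\<lambda>z. w z * S z)"
      unfolding eq using w_square i by (rule Bochner_Integration.integrable_add)
    have split: "(LINT z|lborel. w z * S z) = (LINT z|lborel. (w z)\<^sup>2) + (LINT z|lborel. w z * (S z - w z))"
      unfolding eq using w_square i by (rule Bochner_Integration.integral_add)
    \<comment> \<open>The tolerance \<open>e\<close> is free while the source stays fixed. The
      weak-test data of \<open>dual_test\<close> are instantiated trivially, by the zero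
      function.\<close>
    have small: "(LINT z|lborel. w z * S z) \<le> e * W" if e: "0 < e" for e
    proof (rule dual_test[OF R1 \<rho>(1) e S, where \<omega> = "\<lambda>_. 0" and L = 0 and ?t0.0 = 1 and r = 0])
      fix \<Phi> D K' Y
      assume test: "\<And>z. GDERIV \<Phi> z :> D z" "continuous_on UNIV D" "compact K'" "K' \<subseteq> UNIV \<times> {..<T}"
        "\<And>z. z \<notin> K' \<Longrightarrow> \<Phi> z = 0"
        and err: "\<And>z. z \<in> cyl T \<Longrightarrow> \<bar>snd (D z) - b z \<bullet> fst (D z) + f z * \<Phi> z + S z\<bar> \<le> e"
      define A where "A z = snd (D z) - bX z \<bullet> fst (D z) + fX z * \<Phi> z" for z
      note eqn = C1_test_equation[OF test, folded A_def]
      have "AE z in lborel. mX z * (G z \<bullet> fst (D z)) = 0" using G_zero by eventually_elim simp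
      then have "(LINT z|lborel. mX z * (G z \<bullet> fst (D z))) = 0" by (rule integral_eq_zero_AE)
      then have A0: "(LINT z|lborel. w z * A z) = 0" using eqn(3) by (rule trans[rotated])
      have "w z * S z \<le> e * \<bar>w z\<bar> - w z * A z" for z
      proof (cases "z \<in> cyl T")
        case True
        then have "A z = snd (D z) - b z \<bullet> fst (D z) + f z * \<Phi> z" by (simp add: A_def bX_def fX_def)
        then have "\<bar>A z + S z\<bar> \<le> e" using err[OF True] by simp
        then have "\<bar>w z * (A z + S z)\<bar> \<le> \<bar>w z\<bar> * e" unfolding abs_mult by (rule mult_left_mono) simp
        then show ?thesis by (simp add: algebra_simps)
      qed (simp add: woff)
      then have "(LINT z|lborel. w z * S z) \<le> (LINT z|lborel. e * \<bar>w z\<bar> - w z * A z)"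
        by (intro integral_mono eqn(1) Bochner_Integration.integrable_diff wS) (use w_integrable in auto)
      also have "\<dots> = e * W"
        using w_integrable eqn(1) A0 by (simp add: W_def)
      finally show ?thesis .
    qed auto
    have "(LINT z|lborel. w z * S z) \<le> 0"
    proof (rule field_le_epsilon)
      fix e :: real assume e: "0 < e"
      have "0 < e / (W + 1)" using e W by simp
      from small[OF this] have "(LINT z|lborel. w z * S z) \<le> e * (W / (W + 1))" by simp
      also have "\<dots> \<le> e * 1" using e W by (intro mult_left_mono) auto
      finally show "(LINT z|lborel. w z * S z) \<le> 0 + e" by simp
    qed
    then have "(LINT z|lborel. (w z)\<^sup>2) \<le> \<bar>LINT z|lborel. w z * (S z - w z)\<bar>" unfolding split by linarith
    \<comment> \<open>Young with parameter 1 returns half of the square integral, which is absorbed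
      on the left and leaves \<mu>.\<close>
    also have "\<dots> \<le> (1 * (LINT z|lborel. (w z)\<^sup>2) + (LINT z|lborel. (S z - w z)\<^sup>2) / 1) / 2"
      by (rule L2_Young(2)[OF meas(1) Swm w_square Sw(1)]) simp
    finally show "(LINT z|lborel. (w z)\<^sup>2) \<le> \<mu> * 1" using Sw(2) by simp
  qed
qed

end

section \<open>Constants from the smoothness assumptions, and conclusion\<close>

lemma smooth_bounded_regularity_real:
  fixes g :: "'e::euclidean_space \<Rightarrow> real"
  assumes g: "smooth_bounded_on X g" and X: "convex X"
  shows "\<exists>C D. 0 \<le> C \<and> (\<forall>z\<in>X. GDERIV g z :> D z \<and> \<bar>g z\<bar> \<le> C \<and> norm (D z) \<le> C) \<and>
    (\<forall>z\<in>X. \<forall>z'\<in>X. norm (D z - D z') \<le> C * norm (z - z'))"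
proof (rule smooth_bounded_regularity[OF g X])
  fix C and D :: "real \<Rightarrow> 'e \<Rightarrow> 'e"
  assume C: "0 \<le> C" "\<And>z i. z \<in> X \<Longrightarrow> i \<in> Basis \<Longrightarrow> GDERIV (\<lambda>z. g z \<bullet> i) z :> D i z"
    "\<And>z. z \<in> X \<Longrightarrow> norm (g z) \<le> C" "\<And>z i. z \<in> X \<Longrightarrow> i \<in> Basis \<Longrightarrow> norm (D i z) \<le> C"
    "\<And>z z' i. z \<in> X \<Longrightarrow> z' \<in> X \<Longrightarrow> i \<in> Basis \<Longrightarrow> norm (D i z - D i z') \<le> C * norm (z - z')"
  show ?thesis
    using C(1) C(2)[where i = 1] C(3) C(4)[where i = 1] C(5)[where i = 1]
    by (intro exI[of _ C] exI[of _ "D 1"]) simp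
qed

lemma hs_data_exists:
  fixes b :: "'a::euclidean_space \<times> real \<Rightarrow> 'a" and f m :: "'a \<times> real \<Rightarrow> real"
  assumes T: "0 < T" and m: "smooth_bounded_on (cyl T) m" and f: "smooth_bounded_on (cyl T) f"
    and b: "smooth_bounded_on (cyl T) b" and \<delta>: "0 < \<delta>" "\<forall>z\<in>cyl T. \<delta> \<le> m z"
  shows "\<exists>B Db Df Dm Mm. hs_data T B b f Db Df m Dm \<delta> Mm"
proof -
  obtain Mm Dm where Mm: "0 \<le> Mm" "\<forall>z\<in>cyl T. GDERIV m z :> Dm z \<and> \<bar>m z\<bar> \<le> Mm \<and> norm (Dm z) \<le> Mm"
    "\<forall>z\<in>cyl T. \<forall>z'\<in>cyl T. norm (Dm z - Dm z') \<le> Mm * norm (z - z')"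
    using smooth_bounded_regularity_real[OF m convex_cyl] by (elim exE conjE)
  obtain Cf Df where Cf: "0 \<le> Cf" "\<forall>z\<in>cyl T. GDERIV f z :> Df z \<and> \<bar>f z\<bar> \<le> Cf \<and> norm (Df z) \<le> Cf"
    "\<forall>z\<in>cyl T. \<forall>z'\<in>cyl T. norm (Df z - Df z') \<le> Cf * norm (z - z')"
    using smooth_bounded_regularity_real[OF f convex_cyl] by (elim exE conjE)
  show ?thesis
  proof (rule smooth_bounded_regularity[OF b convex_cyl])
    fix C Db
    assume C: "0 \<le> C" "\<And>z i. z \<in> cyl T \<Longrightarrow> i \<in> Basis \<Longrightarrow> GDERIV (\<lambda>z. b z \<bullet> i) z :> Db i z"
      "\<And>z. z \<in> cyl T \<Longrightarrow> norm (b z) \<le> C" "\<And>z i. z \<in> cyl T \<Longrightarrow> i \<in> Basis \<Longrightarrow> norm (Db i z) \<le> C"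
      "\<And>z z' i. z \<in> cyl T \<Longrightarrow> z' \<in> cyl T \<Longrightarrow> i \<in> Basis \<Longrightarrow> norm (Db i z - Db i z') \<le> C * norm (z - z')"
    define B where "B = 1 + C + Cf"
    have B: "1 \<le> B" "C \<le> B" "Cf \<le> B" using C(1) Cf(1) by (auto simp: B_def)
    have "hs_data T B b f Db Df m Dm \<delta> Mm"
    proof
      show "0 < T" "1 \<le> B" "0 < \<delta>" by fact+
    next
      fix z :: "'a \<times> real" assume z: "z \<in> cyl T"
      show "GDERIV f z :> Df z" "\<bar>f z\<bar> \<le> B" "norm (Df z) \<le> B" using Cf(2) z B(3) by (auto intro: order_trans)
      show "\<delta> \<le> m z \<and> m z \<le> Mm" using \<delta>(2) Mm(2) z by (auto dest!: bspec)
      show "GDERIV m z :> Dm z" using Mm(2) z by blast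
      fix z' :: "'a \<times> real" assume z': "z' \<in> cyl T"
      have "Cf * norm (z - z') \<le> B * norm (z - z')" using B(3) by (rule mult_right_mono) simp
      then show "norm (Df z - Df z') \<le> B * norm (z - z')" using Cf(3) z z' by (auto intro: order_trans)
      show "\<bar>m z - m z'\<bar> \<le> Mm * norm (z - z')"
        by (rule GDERIV_Lipschitz[OF convex_cyl _ _ z z', where D = Dm]) (use Mm(2) in auto)
    next
      fix i :: 'a and z :: "'a \<times> real" assume i: "i \<in> Basis" and z: "z \<in> cyl T"
      show "GDERIV (\<lambda>z. b z \<bullet> i) z :> Db i z" by (rule C(2)[OF z i])
      show "\<bar>b z \<bullet> i\<bar> \<le> B" by (rule order_trans[OF Basis_le_norm[OF i] order_trans[OF C(3)[OF z] B(2)]])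
      show "norm (Db i z) \<le> B" by (rule order_trans[OF C(4)[OF z i] B(2)])
      fix z' :: "'a \<times> real" assume z': "z' \<in> cyl T"
      have "C * norm (z - z') \<le> B * norm (z - z')" using B(2) by (rule mult_right_mono) simp
      then show "norm (Db i z - Db i z') \<le> B * norm (z - z')" by (rule order_trans[OF C(5)[OF z z' i]])
    next
      have "Mm-lipschitz_on (cyl T) Dm"
        by (rule lipschitz_onI) (use Mm in \<open>auto simp: dist_norm\<close>)
      then show "continuous_on (cyl T) Dm" by (rule lipschitz_on_continuous_on)
    qed
    then show ?thesis by blast
  qed
qed

theorem theorem4p2:
  fixes T \<delta> :: real
    and m f :: "(real ^ 'n) \<times> real \<Rightarrow> real"
    and b :: "(real ^ 'n) \<times> real \<Rightarrow> real ^ 'n"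
    and \<rho>0 :: "real ^ 'n \<Rightarrow> real"
    and \<rho>1 p1 \<rho>2 p2 :: "(real ^ 'n) \<times> real \<Rightarrow> real"
  assumes "T > 0"
    and "smooth_bounded_on (cyl T) m"
    and "smooth_bounded_on (cyl T) f"
    and "smooth_bounded_on (cyl T) b"
    and "\<delta> > 0" and "\<forall>z \<in> cyl T. m z \<ge> \<delta>"
    and "hele_shaw_weak_solution T m b f \<rho>0 \<rho>1 p1"
    and "\<rho>1 \<in> Linf_L1_Linf T" and "p1 \<in> L2_H1_Linf T"
    and "compactly_supported_in_space T \<rho>1" and "compactly_supported_in_space T p1"
    and "hele_shaw_weak_solution T m b f \<rho>0 \<rho>2 p2"
    and "\<rho>2 \<in> Linf_L1_Linf T" and "p2 \<in> L2_H1_Linf T"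
    and "compactly_supported_in_space T \<rho>2" and "compactly_supported_in_space T p2"
  shows "AE z in lebesgue_on (cyl T). \<rho>1 z = \<rho>2 z \<and> p1 z = p2 z"
proof -
  obtain B Db Df Dm Mm where hs: "hs_data T B b f Db Df m Dm \<delta> Mm"
    using hs_data_exists[OF assms(1-6)] by (elim exE)
  interpret hs_data T B b f Db Df m Dm \<delta> Mm by (rule hs)
  obtain r1 u1 G1 M1 R1 where 1: "reduction \<rho>0 \<rho>1 p1 r1 u1 G1 M1 R1"
    using reduction_exists[OF assms(7-11)] by (elim exE)
  obtain r2 u2 G2 M2 R2 where 2: "reduction \<rho>0 \<rho>2 p2 r2 u2 G2 M2 R2"
    using reduction_exists[OF assms(12-16)] by (elim exE)
  have diff: "hs_difference T B b f Db Df m Dm \<delta> Mm (\<lambda>z. r1 z - r2 z) (\<lambda>z. u1 z - u2 z) (\<lambda>z. G1 z - G2 z)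
      (M1 + M2) (max R1 R2)"
    by (intro hs_difference.intro hs hs_difference_axioms.intro difference_exists[OF 1 2])
  have "AE z in lborel. z \<in> cyl T \<longrightarrow> \<rho>1 z = r1 z \<and> p1 z = u1 z" using 1 unfolding reduction_def by blast
  moreover have "AE z in lborel. z \<in> cyl T \<longrightarrow> \<rho>2 z = r2 z \<and> p2 z = u2 z" using 2 unfolding reduction_def by blast
  moreover note hs_difference.w_zero[OF diff] hs_difference.q_zero[OF diff]
  ultimately have "AE z in lborel. z \<in> cyl T \<longrightarrow> \<rho>1 z = \<rho>2 z \<and> p1 z = p2 z"
    by eventually_elim auto
  then show ?thesis unfolding AE_lebesgue_on[OF cyl_lebesgue] .
qed
end
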